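(* Let $\mathbb{K}$ be a commutative ring. The commutative operad $\mathcal{C}$ over $\mathbb{K}$, with its canonical weight grading, is Koszul. In particular, the comparison morphisms $$\bar{K}(\mathcal{C})\to\bar{B}(\mathcal{C})\to\bar{N}(\mathcal{C})$$ (the inclusion of the Koszul construction in the reduced bar construction, followed by the levelization morphism to the normalized reduced simplicial bar construction) are all quasi-isomorphisms.
   Context: A $\Sigma_*$-module $M$ is a sequence $M(r)$, $r\in\mathbb{N}$, of $\mathbb{K}[\Sigma_r]$-modules (possibly differential graded, with the Koszul sign rule), extended to finite sets and bijections $J\mapsto M(J)$. The composition product is $(M\circ N)(n)=\bigoplus_r(M(r)\otimes N^{\otimes r}(n))_{\Sigma_r}$, where $(M\otimes N)(n)=\bigoplus_{J\amalg J'=\{1,\dots,n\}}M(J)\otimes N(J')$; its unit is $I$ ($I(1)=\mathbb{K}$, $I(r)=0$ for $r\ne1$). Operads are monoids for $\circ$; $p\circ_iq=p(1,\dots,q,\dots,1)$. Commutative operad: $\mathcal{C}(0)=0$ and $\mathcal{C}(r)=\mathbb{K}$ is the trivial representation for $r\geq1$ (spanned by the monomial $x_1\cdots x_r$); its algebras are the commutative associative algebras without unit. Canonical weight grading of an operad $P$ with $P(0)=0$, $P(1)=\mathbb{K}1$: $P_{(s)}(r)=P(r)$ if $s=r-1$ and $0$ otherwise. Trees: an $n$-tree $\tau$ is an abstract tree oriented towards a root edge, with $n$ external input edges indexed by $1,\dots,n$; $V(\tau)$ is its set of vertices, $I_v$ the set of sources of edges ending at $v$; an internal edge $e$ goes from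 a vertex $s(e)$ to a vertex $t(e)$. $\tau(M)=\bigotimes_{v}M(I_v)$ and $F^c(M)(n)=\operatorname{colim}_\tau\tau(M)$ over $n$-trees and isomorphisms; $F^c_{(d)}(M)$ is spanned by trees with $d$ vertices. For an operad $P$ with $P(0)=0$, $P(1)=\mathbb{K}1$, let $\tilde P(r)=P(r)$ for $r\geq2$ and $0$ for $r=0,1$. The reduced bar construction is $\bar{B}(P)=F^c(\Sigma\tilde P)$ ($\Sigma$ = suspension), $\bar{B}_d(P)=F^c_{(d)}(\Sigma\tilde P)$, with differential $\beta$: $\beta(\bigotimes_v\Sigma p_v)$ is the sum over internal edges $e$ of the labelled tree with $e$ contracted, the merged vertex labelled by $-\Sigma(p_u\circ_vp_v)$, $u=t(e)$, $v=s(e)$ (Koszul signs). The weight of a labelled tree is the sum of the weights of its labels. The Koszul construction is $\bar{K}(P)_{(s)}=\ker(\beta:\bar{B}_s(P)_{(s)}\to\bar{B}_{s-1}(P)_{(s)})$, a subcomplex of $\bar{B}(P)$. $P$ is Koszul if $\bar{K}(P)\hookrightarrow\bar{B}(P)$ is a quasi-isomorphism and, if $\mathbb{K}$ is not a field, $P$ and $\bar{K}(P)$ are moreover projective as $\mathbb{K}$-modules. Reduced simplicial bar construction: $\bar{C}_d(P)=P^{\circ d}$; $d_i$ for $0<i<d$ multiplies the $i$-th and $(i+1)$-th factors, $d_0$ and $d_d$ apply the augmentation $P\to I$ to the first and last factors, degeneracies insert operad units. $\bar{N}(P)$ is its normalized chain complex. Elements of $P^{\circ d}$ are represented by labelled trees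 with $d$ levels. The levelization morphism $\bar{B}(P)\to\bar{N}(P)$ sends a labelled tree $\tau$ with $d$ vertices to the sum, over all bijections $l:V(\tau)\to\{1,\dots,d\}$ with $l(t(e))<l(s(e))$ for every internal edge $e$, of the $d$-level tree with the vertex $v$ (label $p_v$) on level $l(v)$ and all other vertices of the level tree being unit vertices labelled by $1$; tensors are ordered by level and the $d$ suspension symbols are removed to the left with the Koszul sign. *)

theory Defs
  imports Complex_Main "HOL-Library.Poly_Mapping" "HOL-Combinatorics.Permutations"
begin

section \<open>Modules over a commutative ring\<close>

text \<open>
  The ground ring is a type \<open>'k\<close> of class \<open>comm_ring_1\<close>. The free module on a type \<open>'b\<close> is
  \<open>'b \<Rightarrow>\<^sub>0 'k\<close>. A module given by generators and relations is represented
  by a pair of submodules \<open>R \<subseteq> M\<close> of an ambient module, standing for \<open>M / R\<close>.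
\<close>

definition fscale :: "'k::comm_ring_1 \<Rightarrow> ('b \<Rightarrow>\<^sub>0 'k) \<Rightarrow> ('b \<Rightarrow>\<^sub>0 'k)" where
  "fscale c x = Poly_Mapping.map ((*) c) x"

lemma lookup_fscale: "Poly_Mapping.lookup (fscale c x) b = c * Poly_Mapping.lookup x b"
  unfolding fscale_def by (simp add: Poly_Mapping.map.rep_eq when_def)

lemma module_fscale: "module (fscale :: 'k::comm_ring_1 \<Rightarrow> ('b \<Rightarrow>\<^sub>0 'k) \<Rightarrow> _)"
  by unfold_locales
    (auto intro!: poly_mapping_eqI simp: lookup_fscale Poly_Mapping.lookup_add algebra_simps)

abbreviation gen :: "'b \<Rightarrow> ('b \<Rightarrow>\<^sub>0 'k::comm_ring_1)" where
  "gen b \<equiv> Poly_Mapping.single b 1"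

abbreviation fspan :: "('b \<Rightarrow>\<^sub>0 'k::comm_ring_1) set \<Rightarrow> ('b \<Rightarrow>\<^sub>0 'k) set" where
  "fspan \<equiv> module.span fscale"

definition lin_ext :: "('b \<Rightarrow> ('c \<Rightarrow>\<^sub>0 'k)) \<Rightarrow> ('b \<Rightarrow>\<^sub>0 'k::comm_ring_1) \<Rightarrow> ('c \<Rightarrow>\<^sub>0 'k)" where
  "lin_ext f x = (\<Sum>b \<in> Poly_Mapping.keys x. fscale (Poly_Mapping.lookup x b) (f b))"

definition linear_on ::
  "('k \<Rightarrow> 'a \<Rightarrow> 'a) \<Rightarrow> ('k \<Rightarrow> 'b \<Rightarrow> 'b) \<Rightarrow> 'a::ab_group_add set \<Rightarrow> ('a \<Rightarrow> 'b::ab_group_add) \<Rightarrow> bool" where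
  "linear_on s1 s2 M f \<longleftrightarrow>
     (\<forall>x\<in>M. \<forall>y\<in>M. f (x + y) = f x + f y) \<and> (\<forall>c. \<forall>x\<in>M. f (s1 c x) = s2 c (f x))"

text \<open>
  \<open>M / R\<close> is projective when it is a retract of a free module. Since \<open>M / R\<close> is generated by
  elements of \<open>M :: 'a set\<close>, a free module on a basis of type \<open>'a\<close> suffices; and a linear map from a
  free module to \<open>M / R\<close> is always represented by a linear map to \<open>M\<close>.
\<close>

definition projective_quotient ::
  "('k::comm_ring_1 \<Rightarrow> 'a \<Rightarrow> 'a::ab_group_add) \<Rightarrow> 'a set \<Rightarrow> 'a set \<Rightarrow> bool" where
  "projective_quotient s M R \<longleftrightarrow>
     (\<exists>(i :: 'a \<Rightarrow> ('a \<Rightarrow>\<^sub>0 'k)) (p :: ('a \<Rightarrow>\<^sub>0 'k) \<Rightarrow> 'a).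
        linear_on s fscale M i \<and> (\<forall>x\<in>R. i x = 0) \<and>
        linear_on fscale s UNIV p \<and> (\<forall>y. p y \<in> M) \<and>
        (\<forall>x\<in>M. p (i x) - x \<in> R))"


section \<open>Chain complexes and quasi-isomorphisms\<close>

text \<open>
  The module in degree \<open>d\<close> is \<open>chains C d / zeros C d\<close>; \<open>bdry C d\<close> represents the differential
  from degree \<open>d + 1\<close> to degree \<open>d\<close>.
\<close>

record 'x quotient_complex =
  chains :: "nat \<Rightarrow> 'x set"
  zeros :: "nat \<Rightarrow> 'x set"
  bdry :: "nat \<Rightarrow> 'x \<Rightarrow> 'x"

type_synonym ('b, 'k) fcomplex = "('b \<Rightarrow>\<^sub>0 'k) quotient_complex"

definition chain_complex :: "('b, 'k::comm_ring_1) fcomplex \<Rightarrow> bool" where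
  "chain_complex C \<longleftrightarrow> (\<forall>d.
     module.subspace fscale (chains C d) \<and> module.subspace fscale (zeros C d) \<and>
     zeros C d \<subseteq> chains C d \<and>
     linear_on fscale fscale (chains C (Suc d)) (bdry C d) \<and>
     bdry C d ` chains C (Suc d) \<subseteq> chains C d \<and>
     bdry C d ` zeros C (Suc d) \<subseteq> zeros C d \<and>
     (\<forall>x \<in> chains C (Suc (Suc d)). bdry C d (bdry C (Suc d) x) \<in> zeros C d))"

definition chain_map ::
  "('b, 'k::comm_ring_1) fcomplex \<Rightarrow> ('c, 'k) fcomplex \<Rightarrow> (nat \<Rightarrow> ('b \<Rightarrow>\<^sub>0 'k) \<Rightarrow> ('c \<Rightarrow>\<^sub>0 'k)) \<Rightarrow> bool" where
  "chain_map C D f \<longleftrightarrow> (\<forall>d.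
     linear_on fscale fscale (chains C d) (f d) \<and>
     f d ` chains C d \<subseteq> chains D d \<and> f d ` zeros C d \<subseteq> zeros D d \<and>
     (\<forall>x \<in> chains C (Suc d). f d (bdry C d x) - bdry D d (f (Suc d) x) \<in> zeros D d))"

fun cycles :: "('b, 'k::comm_ring_1) fcomplex \<Rightarrow> nat \<Rightarrow> ('b \<Rightarrow>\<^sub>0 'k) set" where
  "cycles C 0 = chains C 0"
| "cycles C (Suc d) = {x \<in> chains C (Suc d). bdry C d x \<in> zeros C d}"

definition boundaries :: "('b, 'k::comm_ring_1) fcomplex \<Rightarrow> nat \<Rightarrow> ('b \<Rightarrow>\<^sub>0 'k) set" where
  "boundaries C d = {bdry C d y + z | y z. y \<in> chains C (Suc d) \<and> z \<in> zeros C d}"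

definition coset :: "'a::ab_group_add set \<Rightarrow> 'a \<Rightarrow> 'a set" where
  "coset B x = (+) x ` B"

definition homology :: "('b, 'k::comm_ring_1) fcomplex \<Rightarrow> nat \<Rightarrow> ('b \<Rightarrow>\<^sub>0 'k) set set" where
  "homology C d = coset (boundaries C d) ` cycles C d"

definition homology_map ::
  "('c, 'k::comm_ring_1) fcomplex \<Rightarrow> nat \<Rightarrow> (('b \<Rightarrow>\<^sub>0 'k) \<Rightarrow> ('c \<Rightarrow>\<^sub>0 'k)) \<Rightarrow> ('b \<Rightarrow>\<^sub>0 'k) set \<Rightarrow> ('c \<Rightarrow>\<^sub>0 'k) set" where
  "homology_map D d f X = (\<Union>x\<in>X. coset (boundaries D d) (f x))"

definition quasi_iso ::
  "('b, 'k::comm_ring_1) fcomplex \<Rightarrow> ('c, 'k) fcomplex \<Rightarrow> (nat \<Rightarrow> ('b \<Rightarrow>\<^sub>0 'k) \<Rightarrow> ('c \<Rightarrow>\<^sub>0 'k)) \<Rightarrow> bool" where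
  "quasi_iso C D f \<longleftrightarrow> chain_complex C \<and> chain_complex D \<and> chain_map C D f \<and>
     (\<forall>d. bij_betw (homology_map D d (f d)) (homology C d) (homology D d))"


section \<open>Operads\<close>

text \<open>
  Operads in (ungraded) modules. \<open>ops P r\<close> is the module \<open>P(r)\<close>, a submodule of \<open>'m\<close>. Variables are
  numbered from \<open>0\<close>. A permutation \<open>\<sigma>\<close> of \<open>{..<r}\<close> acts on \<open>P(r)\<close> from the left by renaming the
  variable \<open>i\<close> to \<open>\<sigma> i\<close>: \<open>(\<sigma> p)(x\<^sub>0, \<dots>) = p(x\<^bsub>\<sigma> 0\<^esub>, \<dots>)\<close>. The monoid structure \<open>P \<circ> P \<rightarrow> P\<close> is given
  by the operations \<open>op_comp P p [(n\<^sub>1, q\<^sub>1), \<dots>, (n\<^sub>r, q\<^sub>r)] = p(q\<^sub>1, \<dots>, q\<^sub>r)\<close>, where \<open>q\<^sub>i\<close> is in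
  \<open>P(n\<^sub>i)\<close>; the arities \<open>n\<^sub>i\<close> are passed along because the submodules \<open>P(n)\<close> may overlap.
\<close>

record ('m, 'k) operad =
  smul :: "'k \<Rightarrow> 'm \<Rightarrow> 'm"
  ops :: "nat \<Rightarrow> 'm set"
  act :: "nat \<Rightarrow> (nat \<Rightarrow> nat) \<Rightarrow> 'm \<Rightarrow> 'm"
  unit_op :: 'm
  op_comp :: "'m \<Rightarrow> (nat \<times> 'm) list \<Rightarrow> 'm"

text \<open>
  \<open>blocks [n\<^sub>1, \<dots>, n\<^sub>r]\<close> cuts \<open>[0..<n\<^sub>1 + \<dots> + n\<^sub>r]\<close> into consecutive blocks of these lengths;
  \<open>block_perm ns \<sigma>\<close> is the induced permutation of the blocks and \<open>sum_perm ns [\<tau>\<^sub>1, \<dots>, \<tau>\<^sub>r]\<close> is the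
  direct sum of permutations \<open>\<tau>\<^sub>i\<close> of \<open>{..<n\<^sub>i}\<close>.
\<close>

definition blocks :: "nat list \<Rightarrow> nat list list" where
  "blocks ns = map (\<lambda>j. [sum_list (take j ns)..<sum_list (take (Suc j) ns)]) [0..<length ns]"

definition perm_of_list :: "nat list \<Rightarrow> nat \<Rightarrow> nat" where
  "perm_of_list xs k = (if k < length xs then xs ! k else k)"

definition block_perm :: "nat list \<Rightarrow> (nat \<Rightarrow> nat) \<Rightarrow> nat \<Rightarrow> nat" where
  "block_perm ns \<sigma> = perm_of_list (concat (permute_list \<sigma> (blocks ns)))"

definition sum_perm :: "nat list \<Rightarrow> (nat \<Rightarrow> nat) list \<Rightarrow> nat \<Rightarrow> nat" where
  "sum_perm ns \<tau>s = perm_of_list (concat (map2 permute_list \<tau>s (blocks ns)))"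

definition inputs :: "('m, 'k) operad \<Rightarrow> (nat \<times> 'm) list \<Rightarrow> bool" where
  "inputs P qs \<longleftrightarrow> (\<forall>(n, q) \<in> set qs. q \<in> ops P n)"

abbreviation total_arity :: "(nat \<times> 'm) list \<Rightarrow> nat" where
  "total_arity qs \<equiv> sum_list (map fst qs)"

locale operad =
  fixes P :: "('m::ab_group_add, 'k::comm_ring_1) operad"
  assumes smul_module: "module (smul P)"
    and ops_subspace: "module.subspace (smul P) (ops P r)"
    and act_closed: "\<lbrakk>\<sigma> permutes {..<r}; p \<in> ops P r\<rbrakk> \<Longrightarrow> act P r \<sigma> p \<in> ops P r"
    and act_linear: "\<sigma> permutes {..<r} \<Longrightarrow> linear_on (smul P) (smul P) (ops P r) (act P r \<sigma>)"
    and act_id: "p \<in> ops P r \<Longrightarrow> act P r id p = p"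
    and act_comp: "\<lbrakk>\<sigma> permutes {..<r}; \<tau> permutes {..<r}; p \<in> ops P r\<rbrakk>
      \<Longrightarrow> act P r (\<sigma> \<circ> \<tau>) p = act P r \<sigma> (act P r \<tau> p)"
    and unit_closed: "unit_op P \<in> ops P 1"
    and comp_closed: "\<lbrakk>p \<in> ops P (length qs); inputs P qs\<rbrakk> \<Longrightarrow> op_comp P p qs \<in> ops P (total_arity qs)"
    and comp_linear_left: "inputs P qs
      \<Longrightarrow> linear_on (smul P) (smul P) (ops P (length qs)) (\<lambda>p. op_comp P p qs)"
    and comp_linear_right: "\<lbrakk>p \<in> ops P (length us + 1 + length vs); inputs P us; inputs P vs\<rbrakk>
      \<Longrightarrow> linear_on (smul P) (smul P) (ops P n) (\<lambda>q. op_comp P p (us @ (n, q) # vs))"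
    and unit_left: "q \<in> ops P n \<Longrightarrow> op_comp P (unit_op P) [(n, q)] = q"
    and unit_right: "p \<in> ops P r \<Longrightarrow> op_comp P p (replicate r (1, unit_op P)) = p"
    and assoc: "\<lbrakk>p \<in> ops P (length qs); inputs P qs; map length rss = map fst qs;
        \<forall>rs \<in> set rss. inputs P rs\<rbrakk>
      \<Longrightarrow> op_comp P (op_comp P p qs) (concat rss) =
          op_comp P p (map2 (\<lambda>(n, q) rs. (total_arity rs, op_comp P q rs)) qs rss)"
    and equivariant_outer: "\<lbrakk>p \<in> ops P (length qs); inputs P qs; \<sigma> permutes {..<length qs}\<rbrakk>
      \<Longrightarrow> op_comp P (act P (length qs) \<sigma> p) qs =
          act P (total_arity qs) (block_perm (map fst qs) \<sigma>) (op_comp P p (permute_list \<sigma> qs))"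
    and equivariant_inner: "\<lbrakk>p \<in> ops P (length qs); inputs P qs;
        list_all2 (\<lambda>\<tau> (n, q). \<tau> permutes {..<n}) \<tau>s qs\<rbrakk>
      \<Longrightarrow> op_comp P p (map2 (\<lambda>\<tau> (n, q). (n, act P n \<tau> q)) \<tau>s qs) =
          act P (total_arity qs) (sum_perm (map fst qs) \<tau>s) (op_comp P p qs)"

locale connected_operad = operad +
  assumes ops_0: "ops P 0 = {0}"
    and ops_1: "bij_betw (\<lambda>a. smul P a (unit_op P)) UNIV (ops P 1)"

text \<open>The augmentation \<open>P \<rightarrow> I\<close> in arity \<open>r\<close>, when \<open>P(1)\<close> is free on the unit.\<close>

definition augm :: "('m, 'k::comm_ring_1) operad \<Rightarrow> nat \<Rightarrow> 'm \<Rightarrow> 'k" where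
  "augm P r p = (if r = 1 then (THE a. p = smul P a (unit_op P)) else 0)"

text \<open>\<open>P\<^sub>(\<^sub>s\<^sub>)(r) = P(r)\<close> for \<open>s = r - 1\<close>.\<close>

definition canonical_weight :: "nat \<Rightarrow> nat" where
  "canonical_weight r = r - 1"

text \<open>The scalar \<open>a\<close> in arity \<open>r \<ge> 1\<close> is \<open>a \<cdot> x\<^sub>1 \<cdots> x\<^sub>r\<close>.\<close>

definition commutative_operad :: "('k, 'k::comm_ring_1) operad" where
  "commutative_operad =
     \<lparr>smul = (*), ops = (\<lambda>r. if r = 0 then {0} else UNIV), act = (\<lambda>r \<sigma> p. p), unit_op = 1,
      op_comp = (\<lambda>p qs. p * prod_list (map snd qs))\<rparr>"

lemma connected_commutative_operad:
  "connected_operad (commutative_operad :: ('k, 'k::comm_ring_1) operad)"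
proof -
  let ?C = "commutative_operad :: ('k, 'k) operad"
  have [simp]: "module ((*) :: 'k \<Rightarrow> 'k \<Rightarrow> 'k)"
    by unfold_locales (simp_all add: algebra_simps)
  have null: "prod_list (map snd qs) = 0" if null: "inputs ?C qs" "total_arity qs = 0" "qs \<noteq> []" for qs
  proof -
    obtain n q qs' where qs: "qs = (n, q) # qs'"
      using null(3) by (metis list.exhaust surj_pair)
    then show ?thesis using null by (auto simp: inputs_def commutative_operad_def)
  qed
  have closed: "op_comp ?C p qs \<in> ops ?C (total_arity qs)"
    if "p \<in> ops ?C (length qs)" "inputs ?C qs" for p qs
    using null[OF that(2)] that(1) by (cases "qs = []") (auto simp: commutative_operad_def)
  have assoc: "prod_list (map snd qs) * prod_list (map snd (concat rss)) =
      prod_list (map snd (map2 (\<lambda>(n, q) rs. (total_arity rs, op_comp ?C q rs)) qs rss))"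
    if "map length rss = map fst qs" for qs :: "(nat \<times> 'k) list" and rss
    using that
  proof (induction qs arbitrary: rss)
    case (Cons a qs)
    then obtain rs rss' where "rss = rs # rss'" by (cases rss) auto
    with Cons show ?case by (cases a) (auto simp: commutative_operad_def algebra_simps)
  qed simp
  have perm: "prod_list (map snd (permute_list \<sigma> qs)) = prod_list (map snd qs)"
    if "\<sigma> permutes {..<length qs}" for \<sigma> and qs :: "(nat \<times> 'k) list"
    by (metis mset_map mset_permute_list prod_mset_prod_list that)
  have inner: "map snd (map2 (\<lambda>\<tau> (n, q). (n, act ?C n \<tau> q)) \<tau>s qs) = map snd qs"
    if "list_all2 (\<lambda>\<tau> (n, q). \<tau> permutes {..<n}) \<tau>s qs" for \<tau>s and qs :: "(nat \<times> 'k) list"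
    using that by (induction rule: list_all2_induct) (auto simp: commutative_operad_def)
  have "operad ?C"
  proof (rule operad.intro, goal_cases)
    case (8 p qs) then show ?case by (rule closed)
  next
    case (13 p qs rss) then show ?case
      using assoc[of rss qs] by (simp add: commutative_operad_def mult.assoc)
  next
    case (14 p qs \<sigma>) then show ?case using perm[of \<sigma> qs] by (simp add: commutative_operad_def)
  next
    case (15 p qs \<tau>s) then show ?case using inner[of \<tau>s qs] by (simp add: commutative_operad_def)
  qed (auto simp: commutative_operad_def linear_on_def module.subspace_def algebra_simps)
  then show ?thesis
    by (simp add: connected_operad_def connected_operad_axioms_def)
      (simp add: commutative_operad_def bij_betw_def)
qed


section \<open>Labelled trees\<close>

text \<open>
  Planar trees; a vertex carries an extra decoration of type \<open>'i\<close> and an operation, a leaf carries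
  the index of an input edge. The ordering of the inputs \<open>I\<^sub>v\<close> of a vertex \<open>v\<close> identifies \<open>M(I\<^sub>v)\<close>
  with \<open>M(r)\<close>; forgetting it is the equivariance relation in \<open>tensor_rels\<close> below, so
  that trees modulo these relations are abstract trees labelled by \<open>\<Otimes>\<^sub>v M(I\<^sub>v)\<close>, up to isomorphism.
\<close>

datatype ('i, 'm) tree =
  Leaf nat
| Node (deco: 'i) (label: 'm) (children: "('i, 'm) tree list")
where "children (Leaf i) = []"

fun leaves :: "('i, 'm) tree \<Rightarrow> nat list" where
  "leaves (Leaf i) = [i]"
| "leaves (Node a p ts) = concat (map leaves ts)"

fun vertices :: "('i, 'm) tree \<Rightarrow> 'i list" where
  "vertices (Leaf i) = []"
| "vertices (Node a p ts) = a # concat (map vertices ts)"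

fun labelled_in :: "(nat \<Rightarrow> 'm set) \<Rightarrow> ('i, 'm) tree \<Rightarrow> bool" where
  "labelled_in M (Leaf i) \<longleftrightarrow> True"
| "labelled_in M (Node a p ts) \<longleftrightarrow> p \<in> M (length ts) \<and> (\<forall>t \<in> set ts. labelled_in M t)"

definition n_tree :: "nat \<Rightarrow> ('i, 'm) tree \<Rightarrow> bool" where
  "n_tree n T \<longleftrightarrow> distinct (leaves T) \<and> set (leaves T) = {1..n}"

inductive_set tree_contexts :: "(('i, 'm) tree \<Rightarrow> ('i, 'm) tree) set" where
  hole: "(\<lambda>t. t) \<in> tree_contexts"
| below: "C \<in> tree_contexts \<Longrightarrow> (\<lambda>t. Node a p (us @ C t # vs)) \<in> tree_contexts"

text \<open>Multilinearity in the labels and equivariance, among the labelled trees in \<open>G\<close>.\<close>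

definition tensor_rels ::
  "('m::ab_group_add, 'k::comm_ring_1) operad \<Rightarrow> ('i, 'm) tree set \<Rightarrow> (('i, 'm) tree \<Rightarrow>\<^sub>0 'k) set" where
  "tensor_rels P G =
     {gen (C (Node a (p + q) ts)) - gen (C (Node a p ts)) - gen (C (Node a q ts)) | C a p q ts.
        C \<in> tree_contexts \<and> {C (Node a (p + q) ts), C (Node a p ts), C (Node a q ts)} \<subseteq> G}
   \<union> {gen (C (Node a (smul P c p) ts)) - fscale c (gen (C (Node a p ts))) | C a c p ts.
        C \<in> tree_contexts \<and> {C (Node a (smul P c p) ts), C (Node a p ts)} \<subseteq> G}
   \<union> {gen (C (Node a (act P (length ts) \<sigma> p) ts)) - gen (C (Node a p (permute_list \<sigma> ts))) | C a \<sigma> p ts.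
        C \<in> tree_contexts \<and> \<sigma> permutes {..<length ts} \<and>
        {C (Node a (act P (length ts) \<sigma> p) ts), C (Node a p (permute_list \<sigma> ts))} \<subseteq> G}"


section \<open>The reduced bar construction\<close>

definition reduced_ops :: "('m::ab_group_add, 'k) operad \<Rightarrow> nat \<Rightarrow> 'm set" where
  "reduced_ops P r = (if r \<ge> 2 then ops P r else {0})"

text \<open>
  The decoration of a vertex \<open>v\<close> is the position, in \<open>{..<d}\<close>, of its label in the tensor
  \<open>\<Sigma>p\<^sub>0 \<otimes> \<cdots> \<otimes> \<Sigma>p\<^bsub>d-1\<^esub>\<close>. The labels \<open>\<Sigma>p\<close> have degree \<open>1\<close>, so that permuting the
  positions produces the sign of the permutation.
\<close>

definition bar_trees :: "('m::ab_group_add, 'k) operad \<Rightarrow> nat \<Rightarrow> nat \<Rightarrow> (nat, 'm) tree set" where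
  "bar_trees P n d = {T. n_tree n T \<and> labelled_in (reduced_ops P) T \<and>
     distinct (vertices T) \<and> set (vertices T) = {..<d}}"

definition bar_rels ::
  "('m::ab_group_add, 'k::comm_ring_1) operad \<Rightarrow> nat \<Rightarrow> nat \<Rightarrow> ((nat, 'm) tree \<Rightarrow>\<^sub>0 'k) set" where
  "bar_rels P n d = tensor_rels P (bar_trees P n d) \<union>
     {gen (map_tree \<pi> id T) - fscale (of_int (sign \<pi>)) (gen T) | \<pi> T.
        \<pi> permutes {..<d} \<and> T \<in> bar_trees P n d}"

text \<open>Internal edges \<open>e\<close>, as pairs \<open>(s(e), t(e))\<close>.\<close>

fun edges :: "(nat, 'm) tree \<Rightarrow> (nat \<times> nat) set" where
  "edges (Leaf i) = {}"
| "edges (Node k p ts) = {(j, k) | j q us. Node j q us \<in> set ts} \<union> (\<Union>t \<in> set ts. edges t)"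

text \<open>Contraction of the edge with source \<open>v\<close>; the merged vertex keeps the position of the target.\<close>

definition is_vertex :: "nat \<Rightarrow> (nat, 'm) tree \<Rightarrow> bool" where
  "is_vertex v t \<longleftrightarrow> (\<exists>q us. t = Node v q us)"

definition partial_comp :: "('m, 'k) operad \<Rightarrow> 'm \<Rightarrow> nat \<Rightarrow> nat \<Rightarrow> 'm \<Rightarrow> nat \<Rightarrow> 'm" where
  "partial_comp P p i n q j =
     op_comp P p (replicate i (1, unit_op P) @ (n, q) # replicate j (1, unit_op P))"

fun contract :: "('m, 'k) operad \<Rightarrow> nat \<Rightarrow> (nat, 'm) tree \<Rightarrow> (nat, 'm) tree" where
  "contract P v (Leaf i) = Leaf i"
| "contract P v (Node k p ts) =
    (case List.extract (is_vertex v) ts of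
       None \<Rightarrow> Node k p (map (contract P v) ts)
     | Some (us, t, ws) \<Rightarrow>
         Node k (partial_comp P p (length us) (length (children t)) (label t) (length ws))
           (us @ children t @ ws))"

text \<open>
  The sign: let \<open>a\<close> and \<open>b\<close> be the positions of \<open>u = t(e)\<close> and \<open>v = s(e)\<close>. Bring \<open>\<Sigma>p\<^sub>v\<close> to the
  immediate right of \<open>\<Sigma>p\<^sub>u\<close>, move the operator of degree \<open>-1\<close> past the factors to the left of
  \<open>\<Sigma>p\<^sub>u\<close>, and replace \<open>\<Sigma>p\<^sub>u \<otimes> \<Sigma>p\<^sub>v\<close> by \<open>-\<Sigma>(p\<^sub>u \<circ>\<^sub>v p\<^sub>v)\<close>. With positions numbered from \<open>0\<close> the
  exponent is \<open>(b - a - 1) + a + 1\<close> if \<open>a < b\<close> and \<open>(a - b) + (a - 1) + 1\<close> if \<open>b < a\<close>; in both cases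
  the sign is \<open>(-1)\<^sup>b\<close>, and the positions after \<open>b\<close> are shifted down by one.
\<close>

definition bar_diff ::
  "('m, 'k::comm_ring_1) operad \<Rightarrow> (nat, 'm) tree \<Rightarrow> ((nat, 'm) tree \<Rightarrow>\<^sub>0 'k)" where
  "bar_diff P T = (\<Sum>(v, u) \<in> edges T. fscale ((-1) ^ v)
     (gen (map_tree (\<lambda>k. if k > v then k - 1 else k) id (contract P v T))))"

definition bar_complex ::
  "('m::ab_group_add, 'k::comm_ring_1) operad \<Rightarrow> nat \<Rightarrow> ((nat, 'm) tree, 'k) fcomplex" where
  "bar_complex P n =
     \<lparr>chains = (\<lambda>d. fspan (gen ` bar_trees P n d)), zeros = (\<lambda>d. fspan (bar_rels P n d)),
      bdry = (\<lambda>d. lin_ext (bar_diff P))\<rparr>"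


section \<open>The Koszul construction\<close>

fun tree_weight :: "('i, 'm) tree \<Rightarrow> nat" where
  "tree_weight (Leaf i) = 0"
| "tree_weight (Node a p ts) = canonical_weight (length ts) + sum_list (map tree_weight ts)"

text \<open>
  As a subcomplex of the bar construction, \<open>koszul_complex P n\<close> inherits differential and zeros;
  its component of degree \<open>s\<close> consists of the classes of the elements of the kernel of the
  differential that are combinations of trees with \<open>s\<close> vertices and weight \<open>s\<close>.
\<close>

definition koszul_complex ::
  "('m::ab_group_add, 'k::comm_ring_1) operad \<Rightarrow> nat \<Rightarrow> ((nat, 'm) tree, 'k) fcomplex" where
  "koszul_complex P n =
     \<lparr>chains = (\<lambda>s. {x + z | x z.
         x \<in> fspan (gen ` {T \<in> bar_trees P n s. tree_weight T = s}) \<and>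
         x \<in> cycles (bar_complex P n) s \<and> z \<in> zeros (bar_complex P n) s}),
      zeros = zeros (bar_complex P n), bdry = bdry (bar_complex P n)\<rparr>"

abbreviation koszul_inclusion ::
  "nat \<Rightarrow> ((nat, 'm) tree \<Rightarrow>\<^sub>0 'k::comm_ring_1) \<Rightarrow> ((nat, 'm) tree \<Rightarrow>\<^sub>0 'k)" where
  "koszul_inclusion \<equiv> \<lambda>s x. x"

definition koszul :: "('m::ab_group_add, 'k::comm_ring_1) operad \<Rightarrow> bool" where
  "koszul P \<longleftrightarrow> connected_operad P \<and>
     (\<forall>n. quasi_iso (koszul_complex P n) (bar_complex P n) koszul_inclusion) \<and>
     (\<not> (\<forall>a :: 'k. a \<noteq> 0 \<longrightarrow> (\<exists>b. a * b = 1)) \<longrightarrow>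
        (\<forall>r. projective_quotient (smul P) (ops P r) {0}) \<and>
        (\<forall>n s. projective_quotient fscale
           (chains (koszul_complex P n) s) (zeros (koszul_complex P n) s)))"


section \<open>The reduced simplicial bar construction\<close>

text \<open>
  The elements of \<open>P\<^bsup>\<circ>d\<^esup>(n)\<close> are represented by labelled trees with \<open>d\<close> levels: each leaf has
  exactly \<open>d\<close> vertices below it. Level \<open>1\<close> (the first factor) is the root vertex.
\<close>

type_synonym 'm level_tree = "(unit, 'm) tree"

fun has_levels :: "nat \<Rightarrow> 'm level_tree \<Rightarrow> bool" where
  "has_levels d (Leaf i) \<longleftrightarrow> d = 0"
| "has_levels d (Node a p ts) \<longleftrightarrow> d > 0 \<and> (\<forall>t \<in> set ts. has_levels (d - 1) t)"

definition level_trees :: "('m, 'k) operad \<Rightarrow> nat \<Rightarrow> nat \<Rightarrow> 'm level_tree set" where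
  "level_trees P n d = {T. n_tree n T \<and> labelled_in (ops P) T \<and> has_levels d T}"

text \<open>Multiply the levels \<open>i\<close> and \<open>i + 1\<close>, for \<open>i \<ge> 1\<close>.\<close>

fun merge_levels :: "('m, 'k) operad \<Rightarrow> nat \<Rightarrow> 'm level_tree \<Rightarrow> 'm level_tree" where
  "merge_levels P i (Leaf j) = Leaf j"
| "merge_levels P i (Node a p ts) =
    (if i \<le> 1 then Node a (op_comp P p (map (\<lambda>t. (length (children t), label t)) ts))
                   (concat (map children ts))
     else Node a p (map (merge_levels P (i - 1)) ts))"

text \<open>
  Apply the augmentation to all vertices of level \<open>d\<close>, the last level: \<open>top_coeff\<close> is the product
  of the scalars obtained, and \<open>cut_top\<close> removes the vertices (all of arity \<open>1\<close> if the scalar is nonzero).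
\<close>

fun top_coeff :: "('m, 'k::comm_ring_1) operad \<Rightarrow> nat \<Rightarrow> 'm level_tree \<Rightarrow> 'k" where
  "top_coeff P d (Leaf j) = 1"
| "top_coeff P d (Node a p ts) =
    (if d \<le> 1 then augm P (length ts) p else prod_list (map (top_coeff P (d - 1)) ts))"

fun cut_top :: "nat \<Rightarrow> 'm level_tree \<Rightarrow> 'm level_tree" where
  "cut_top d (Leaf j) = Leaf j"
| "cut_top d (Node a p ts) = (if d \<le> 1 then hd ts else Node a p (map (cut_top (d - 1)) ts))"

definition face :: "('m, 'k::comm_ring_1) operad \<Rightarrow> nat \<Rightarrow> nat \<Rightarrow> 'm level_tree \<Rightarrow> ('m level_tree \<Rightarrow>\<^sub>0 'k)" where
  "face P d i T =
    (if i = 0 then fscale (augm P (length (children T)) (label T)) (gen (hd (children T)))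
     else if i < d then gen (merge_levels P i T)
     else fscale (top_coeff P d T) (gen (cut_top d T)))"

text \<open>\<open>degeneracy P j\<close> inserts a level of units after the level \<open>j\<close>.\<close>

abbreviation unit_vertex :: "('m, 'k) operad \<Rightarrow> 'm level_tree \<Rightarrow> 'm level_tree" where
  "unit_vertex P t \<equiv> Node () (unit_op P) [t]"

fun degeneracy :: "('m, 'k) operad \<Rightarrow> nat \<Rightarrow> 'm level_tree \<Rightarrow> 'm level_tree" where
  "degeneracy P 0 T = unit_vertex P T"
| "degeneracy P (Suc j) (Leaf i) = Leaf i"
| "degeneracy P (Suc j) (Node a p ts) = Node a p (map (degeneracy P j) ts)"

definition normalized_rels ::
  "('m::ab_group_add, 'k::comm_ring_1) operad \<Rightarrow> nat \<Rightarrow> nat \<Rightarrow> ('m level_tree \<Rightarrow>\<^sub>0 'k) set" where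
  "normalized_rels P n d = tensor_rels P (level_trees P n d) \<union>
     {gen (degeneracy P j T) | j T. j < d \<and> T \<in> level_trees P n (d - 1)}"

definition normalized_bar_complex ::
  "('m::ab_group_add, 'k::comm_ring_1) operad \<Rightarrow> nat \<Rightarrow> ('m level_tree, 'k) fcomplex" where
  "normalized_bar_complex P n =
     \<lparr>chains = (\<lambda>d. fspan (gen ` level_trees P n d)), zeros = (\<lambda>d. fspan (normalized_rels P n d)),
      bdry = (\<lambda>d. lin_ext (\<lambda>T. \<Sum>i\<le>Suc d. fscale ((-1) ^ i) (face P (Suc d) i T)))\<rparr>"


section \<open>The levelization morphism\<close>

text \<open>
  Vertices are referred to by their positions and levels are numbered from \<open>0\<close>, so that \<open>l\<close> is a
  permutation of \<open>{..<d}\<close>. \<open>place_levels P l d m T\<close> places a subtree \<open>T\<close>, whose root edge leaves from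
  level \<open>m\<close>, on the levels \<open>m, \<dots>, d - 1\<close>.
\<close>

fun place_levels :: "('m, 'k) operad \<Rightarrow> (nat \<Rightarrow> nat) \<Rightarrow> nat \<Rightarrow> nat \<Rightarrow> (nat, 'm) tree \<Rightarrow> 'm level_tree" where
  "place_levels P l d m (Leaf i) = (unit_vertex P ^^ (d - m)) (Leaf i)"
| "place_levels P l d m (Node k p ts) =
    (unit_vertex P ^^ (l k - m)) (Node () p (map (place_levels P l d (Suc (l k))) ts))"

text \<open>
  Reordering \<open>\<Sigma>p\<^sub>0 \<otimes> \<cdots> \<otimes> \<Sigma>p\<^bsub>d-1\<^esub>\<close> by level gives the sign of \<open>l\<close>; removing the suspensions to the
  left gives no further sign, since the \<open>p\<^sub>i\<close> have degree \<open>0\<close>.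
\<close>

definition levelization ::
  "('m, 'k::comm_ring_1) operad \<Rightarrow> nat \<Rightarrow> ((nat, 'm) tree \<Rightarrow>\<^sub>0 'k) \<Rightarrow> ('m level_tree \<Rightarrow>\<^sub>0 'k)" where
  "levelization P d = lin_ext (\<lambda>T.
     \<Sum>l \<in> {l. l permutes {..<d} \<and> (\<forall>(v, u) \<in> edges T. l u < l v)}.
       fscale (of_int (sign l)) (gen (place_levels P l d 0 T)))"

end

theory Submission
  imports Defs "HOL-Library.Disjoint_Sets"
begin

text \<open>
  Multilinearity lets one collect all labels of a tree into a single coefficient. A tree with a vertex
  of arity at most \<open>1\<close> then vanishes in the bar construction, and the other trees correspond up to
  sign to their nested sets: the sets of inputs lying above the vertices. Likewise a nondegenerate
  level tree corresponds to the chain of partitions of \<open>{1..n}\<close> cut out at its heights. Contracting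
  an edge deletes a cluster other than the whole set \<open>A = {1..n}\<close>, and a face of a level tree deletes
  a partition other than the finest one \<open>\<rho>\<close> and the coarsest one \<open>{A}\<close>, so that both complexes are
  free with alternating sums of deletions as differential. Levelization becomes the map sending a
  nested set to the signed sum of the chains obtained by ordering its clusters.

  Both nested sets and chains of partitions make sense for a partition \<open>\<rho>\<close> of \<open>A\<close>, whose blocks
  are the inputs. Fix a block \<open>p\<close>. Nested sets containing a cluster \<open>p \<union> q\<close> with \<open>q\<close> another
  block, with this cluster removed, are the nested sets of the partition obtained by merging \<open>p\<close>
  and \<open>q\<close>, and similarly for chains; no nested set contains two such clusters. The nested sets
  without such clusters form an acyclic complex, by toggling one cluster, and so do the corresponding
  chains. Induction on the number of blocks shows that the complex of nested sets is exact except
  in the top degree \<open>n - 1\<close>, and that the cone of the map to chains is acyclic. Since the weight of a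
  reduced tree is \<open>n - 1\<close>, the Koszul construction is concentrated in the top degree,
  where it consists of the cycles of the bar construction.
\<close>


section \<open>Free modules\<close>

text \<open>A statement about the singletons of \<open>{1..n}\<close> alone could not be proved by
  induction, since merging two inputs leaves that class; this is why the inputs are the blocks of an
  arbitrary partition \<rho>. A nested set contains at most one cluster \<open>p \<union> q\<close>
  because two of them share \<open>p\<close> while neither contains the other. The toggled element
  varies with the generator, so inserting it is a contracting homotopy only up to an error; the
  error raises a bounded rank, and finitely many corrections remove it. Over a general ring neither
  ranks nor Euler characteristics can replace such explicit preimages, and the module of top cycles
  has to be split off by hand to be projective. Generators are unordered sets whose orientation
  comes from one global total order; the positions of the vertices and the numbering of the levels
  are both compared with it, which reduces all signs to those of an exterior algebra. Degrees do not
  enter the induction: generators of all cardinalities are treated together, and homogeneous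
  components are taken at the end.\<close>

interpretation fs: module fscale
  by (rule module_fscale)

text \<open>Linearity on the whole ambient free module, which is more than \<open>linear_on\<close>
  asks for. The maps below are built from \<open>lin_ext\<close>, so an identity between them on a
  span can be checked on generators.\<close>

abbreviation lin :: "(('b \<Rightarrow>\<^sub>0 'k::comm_ring_1) \<Rightarrow> ('c \<Rightarrow>\<^sub>0 'k)) \<Rightarrow> bool" where
  "lin \<equiv> module_hom fscale fscale"

definition free_on :: "'b set \<Rightarrow> ('b \<Rightarrow>\<^sub>0 'k::comm_ring_1) set" where
  "free_on S = {x. Poly_Mapping.keys x \<subseteq> S}"

lemma linI:
  assumes "\<And>x y. f (x + y) = f x + f y" "\<And>c x. f (fscale c x) = fscale c (f x)"
  shows "lin f"
  by (intro module_hom.intro module_fscale module_hom_axioms.intro assms)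

lemma lin_add: "lin f \<Longrightarrow> f (x + y) = f x + f y"
  and lin_scale: "lin f \<Longrightarrow> f (fscale c x) = fscale c (f x)"
  and lin_zero: "lin f \<Longrightarrow> f 0 = 0"
  and lin_neg: "lin f \<Longrightarrow> f (- x) = - f x"
  and lin_diff: "lin f \<Longrightarrow> f (x - y) = f x - f y"
  and lin_sum: "lin f \<Longrightarrow> f (sum g A) = (\<Sum>a\<in>A. f (g a))"
  by (simp_all add: module_hom.add module_hom.scale module_hom.zero module_hom.neg module_hom.diff module_hom.sum)

lemma lin_linear_on: "lin f \<Longrightarrow> linear_on fscale fscale S f"
  by (simp add: linear_on_def lin_add lin_scale)

lemma lin_comp: "lin f \<Longrightarrow> lin g \<Longrightarrow> lin (\<lambda>x. f (g x))"
  by (intro linI) (simp_all add: lin_add lin_scale)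

lemma lin_plus: "lin f \<Longrightarrow> lin g \<Longrightarrow> lin (\<lambda>x. f x + g x)"
  by (intro linI) (simp_all add: lin_add lin_scale algebra_simps)

lemma lin_minus: "lin f \<Longrightarrow> lin g \<Longrightarrow> lin (\<lambda>x. f x - g x)"
  by (intro linI) (simp_all add: lin_add lin_scale algebra_simps)

lemma lin_uminus: "lin f \<Longrightarrow> lin (\<lambda>x. - f x)"
  by (intro linI) (simp_all add: lin_add lin_scale)

lemma lin_const_scale: "lin f \<Longrightarrow> lin (\<lambda>x. fscale c (f x))"
  by (intro linI) (simp_all add: lin_add lin_scale algebra_simps)

lemma lin_setsum: "(\<And>i. i \<in> I \<Longrightarrow> lin (f i)) \<Longrightarrow> lin (\<lambda>x. \<Sum>i\<in>I. f i x)"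
  by (intro linI) (simp_all add: lin_add lin_scale sum.distrib fs.scale_sum_right)

lemma lin_id: "lin (\<lambda>x. x)"
  by (intro linI) simp_all

lemma lin_0: "lin (\<lambda>x. 0)"
  by (intro linI) simp_all

lemma keys_fscale: "Poly_Mapping.keys (fscale c x) \<subseteq> Poly_Mapping.keys x"
  by (auto simp: in_keys_iff lookup_fscale)

lemma keys_diff_subset: "Poly_Mapping.keys (x - y :: 'b \<Rightarrow>\<^sub>0 'k::comm_ring_1) \<subseteq> Poly_Mapping.keys x \<union> Poly_Mapping.keys y"
  by (auto simp: in_keys_iff lookup_minus)

lemma lin_ext_superset:
  assumes "finite S" "Poly_Mapping.keys x \<subseteq> S"
  shows "lin_ext f x = (\<Sum>b\<in>S. fscale (Poly_Mapping.lookup x b) (f b))"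
  unfolding lin_ext_def by (rule sum.mono_neutral_left[OF assms]) (simp add: in_keys_iff)

lemma lin_lin_ext:
  fixes f :: "'b \<Rightarrow> ('c \<Rightarrow>\<^sub>0 'k::comm_ring_1)"
  shows "lin (lin_ext f)"
proof (rule linI)
  fix x y :: "'b \<Rightarrow>\<^sub>0 'k"
  let ?S = "Poly_Mapping.keys x \<union> Poly_Mapping.keys y"
  have "lin_ext f z = (\<Sum>b\<in>?S. fscale (Poly_Mapping.lookup z b) (f b))" if "z \<in> {x, y, x + y}" for z
    using that keys_add[of x y] by (intro lin_ext_superset) auto
  then show "lin_ext f (x + y) = lin_ext f x + lin_ext f y"
    by (simp add: lookup_add fs.scale_left_distrib sum.distrib)
next
  fix c and x :: "'b \<Rightarrow>\<^sub>0 'k"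
  have "lin_ext f (fscale c x) =
      (\<Sum>b\<in>Poly_Mapping.keys x. fscale (Poly_Mapping.lookup (fscale c x) b) (f b))"
    using keys_fscale[of c x] by (intro lin_ext_superset) auto
  then show "lin_ext f (fscale c x) = fscale c (lin_ext f x)"
    by (simp add: lin_ext_def lookup_fscale fs.scale_sum_right)
qed

lemma lin_ext_gen [simp]: "lin_ext f (gen b) = f b"
  by (simp add: lin_ext_def)

lemma fscale_gen: "fscale c (gen b) = Poly_Mapping.single b c"
  by (rule poly_mapping_eqI) (simp add: lookup_fscale lookup_single when_def)

lemma sum_gen: "(\<Sum>b\<in>Poly_Mapping.keys x. fscale (Poly_Mapping.lookup x b) (gen b)) = x"
  by (rule poly_mapping_eqI)
    (simp add: lookup_sum lookup_fscale lookup_single when_def if_distrib in_keys_iff cong: if_cong)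

lemma gen_mem_free_on [simp]: "gen b \<in> free_on S \<longleftrightarrow> b \<in> S"
  by (simp add: free_on_def)

lemma zero_free_on [simp]: "0 \<in> free_on S"
  and add_free_on: "x \<in> free_on S \<Longrightarrow> y \<in> free_on S \<Longrightarrow> x + y \<in> free_on S"
  and scale_free_on: "x \<in> free_on S \<Longrightarrow> fscale c x \<in> free_on S"
  and diff_free_on: "x \<in> free_on S \<Longrightarrow> y \<in> free_on S \<Longrightarrow> x - y \<in> free_on S"
  using keys_add[of x y] keys_fscale[of c x] keys_diff_subset[of x y] by (auto simp: free_on_def)

lemma uminus_free_on: "x \<in> free_on S \<Longrightarrow> - x \<in> free_on S"
  using diff_free_on[of 0 S x] by simp

lemma sum_free_on: "(\<And>i. i \<in> I \<Longrightarrow> f i \<in> free_on S) \<Longrightarrow> sum f I \<in> free_on S"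
  by (induction I rule: infinite_finite_induct) (auto intro: add_free_on)

lemma free_on_mono: "x \<in> free_on S \<Longrightarrow> S \<subseteq> T \<Longrightarrow> x \<in> free_on T"
  by (auto simp: free_on_def)

lemma subspace_free_on: "fs.subspace (free_on S)"
  by (rule fs.subspaceI) (auto intro: add_free_on scale_free_on)

lemma span_gen: "fspan (gen ` S) = free_on S"
proof
  show "fspan (gen ` S) \<subseteq> (free_on S :: ('a \<Rightarrow>\<^sub>0 'b) set)"
    by (rule fs.span_minimal[OF _ subspace_free_on]) auto
  show "free_on S \<subseteq> fspan (gen ` S :: ('a \<Rightarrow>\<^sub>0 'b) set)"
  proof
    fix x :: "'a \<Rightarrow>\<^sub>0 'b" assume x: "x \<in> free_on S"
    have "(\<Sum>b\<in>Poly_Mapping.keys x. fscale (Poly_Mapping.lookup x b) (gen b)) \<in> fspan (gen ` S)"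
      using x by (intro fs.span_sum fs.span_scale fs.span_base) (auto simp: free_on_def)
    then show "x \<in> fspan (gen ` S)" by (simp add: sum_gen)
  qed
qed

lemma lin_ext_mem:
  assumes "x \<in> free_on S" "fs.subspace W" "\<And>b. b \<in> S \<Longrightarrow> f b \<in> W"
  shows "lin_ext f x \<in> W"
  unfolding lin_ext_def using assms
  by (intro fs.subspace_sum fs.subspace_scale) (auto simp: free_on_def)

lemma lin_free_on_mem:
  assumes "lin f" "x \<in> free_on S" "fs.subspace W" "\<And>b. b \<in> S \<Longrightarrow> f (gen b) \<in> W"
  shows "f x \<in> W"
proof -
  have "f (\<Sum>b\<in>Poly_Mapping.keys x. fscale (Poly_Mapping.lookup x b) (gen b)) \<in> W"
    using assms by (auto simp: lin_sum lin_scale free_on_def intro!: fs.subspace_sum fs.subspace_scale)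
  then show ?thesis by (simp add: sum_gen)
qed

lemma lin_eq_on_free:
  assumes "lin f" "lin g" "x \<in> free_on S" "\<And>b. b \<in> S \<Longrightarrow> f (gen b) = g (gen b)"
  shows "f x = g x"
  using lin_free_on_mem[OF lin_minus[OF assms(1,2)] assms(3) fs.subspace_single_0] assms(4) by simp

lemma lin_eq:
  assumes "lin f" "lin g" "\<And>b. f (gen b) = g (gen b)"
  shows "f x = g x"
  by (rule lin_eq_on_free[OF assms(1,2), of _ UNIV]) (auto simp: assms(3) free_on_def)

lemma lin_span_mem:
  assumes "lin f" "x \<in> fspan R" "fs.subspace W" "\<And>r. r \<in> R \<Longrightarrow> f r \<in> W"
  shows "f x \<in> W"
proof -
  have "fs.subspace {x. f x \<in> W}"
    using assms(1,3) by (intro fs.subspaceI) (auto simp: lin_add lin_scale lin_zero fs.subspace_0 fs.subspace_add fs.subspace_scale)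
  then have "fspan R \<subseteq> {x. f x \<in> W}" using assms(4) by (intro fs.span_minimal) auto
  then show ?thesis using assms(2) by auto
qed

text \<open>The projection onto a coordinate summand. It selects, for instance, the chains through a
  given partition or the generators of a given cardinality.\<close>

definition restrict :: "'b set \<Rightarrow> ('b \<Rightarrow>\<^sub>0 'k::comm_ring_1) \<Rightarrow> ('b \<Rightarrow>\<^sub>0 'k)" where
  "restrict S = lin_ext (\<lambda>b. if b \<in> S then gen b else 0)"

lemma lin_restrict: "lin (restrict S)"
  unfolding restrict_def by (rule lin_lin_ext)

lemma lookup_restrict: "Poly_Mapping.lookup (restrict S x) b = (if b \<in> S then Poly_Mapping.lookup x b else 0)"
  by (simp add: restrict_def lin_ext_def lookup_sum lookup_fscale if_distrib[where f="\<lambda>t. Poly_Mapping.lookup t b"]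
      lookup_single when_def in_keys_iff if_distrib[where f="(*) _"] sum.If_cases cong: if_cong)

lemma restrict_gen: "restrict S (gen b) = (if b \<in> S then gen b else 0)"
  by (simp add: restrict_def)

lemma restrict_free_on: "x \<in> free_on T \<Longrightarrow> restrict S x \<in> free_on (S \<inter> T)"
  by (auto simp: free_on_def in_keys_iff lookup_restrict split: if_splits)

lemma restrict_id: "x \<in> free_on S \<Longrightarrow> restrict S x = x"
  by (rule poly_mapping_eqI) (auto simp: lookup_restrict free_on_def in_keys_iff)


section \<open>Signed deletion and insertion\<close>

text \<open>Off the diagonal the terms cancel in pairs. On the diagonal antisymmetry gives only
  \<open>h x x + h x x = 0\<close>, which does not force \<open>h x x = 0\<close> in the presence of
  2-torsion; hence the separate condition.\<close>

lemma sum_antisymmetric: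
  fixes h :: "'i \<Rightarrow> 'i \<Rightarrow> 'a::ab_group_add"
  assumes "finite S" "\<And>x y. x \<in> S \<Longrightarrow> y \<in> S \<Longrightarrow> h x y = - h y x" "\<And>x. x \<in> S \<Longrightarrow> h x x = 0"
  shows "(\<Sum>x\<in>S. \<Sum>y\<in>S. h x y) = 0"
  using assms
proof (induction S)
  case (insert a S)
  have "h x a + h a x = 0" if "x \<in> S" for x
    using insert.prems(1)[of x a] that by simp
  then have *: "(\<Sum>x\<in>S. h x a) + (\<Sum>y\<in>S. h a y) = 0"
    by (simp flip: sum.distrib)
  have ih: "(\<Sum>x\<in>S. \<Sum>y\<in>S. h x y) = 0"
    by (rule insert.IH) (blast intro: insert.prems)+
  have a: "h a a = 0" by (rule insert.prems) simp
  have "(\<Sum>x\<in>insert a S. \<Sum>y\<in>insert a S. h x y) =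
      h a a + ((\<Sum>x\<in>S. h x a) + (\<Sum>y\<in>S. h a y)) + (\<Sum>x\<in>S. \<Sum>y\<in>S. h x y)"
    using insert.hyps by (simp add: sum.distrib ac_simps)
  then show ?case by (simp only: * ih a add_0_left)
qed simp

section \<open>Signs from a global total order\<close>

definition some_order :: "'a rel" where
  "some_order = (SOME r. well_order_on UNIV r)"

lemma some_order_total: "x \<noteq> y \<Longrightarrow> (x, y) \<in> some_order \<longleftrightarrow> (y, x) \<notin> some_order"
proof -
  have "well_order_on UNIV (some_order :: 'a rel)"
    unfolding some_order_def by (rule someI_ex) (rule well_order_on)
  then show "x \<noteq> y \<Longrightarrow> (x, y) \<in> some_order \<longleftrightarrow> (y, x) \<notin> some_order"
    by (auto simp: well_order_on_def linear_order_on_def partial_order_on_def total_on_def antisym_def)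
qed

text \<open>
  A total order in which a proper refinement of a partition of a finite set comes after it; on
  clusters any total order would do.
\<close>

definition prec :: "'w set \<Rightarrow> 'w set \<Rightarrow> bool" where
  "prec a b \<longleftrightarrow> card a < card b \<or> (card a = card b \<and> a \<noteq> b \<and> (a, b) \<in> some_order)"

lemma prec_irrefl [simp]: "\<not> prec a a"
  by (simp add: prec_def)

lemma prec_total: "a \<noteq> b \<Longrightarrow> prec a b \<longleftrightarrow> \<not> prec b a"
  using some_order_total[of a b] by (auto simp: prec_def)

text \<open>A finite set stands for the exterior product of its elements in increasing order, and
  this is the sign of moving D to the front. Then \<open>del D\<close> is the contraction by D,
  \<open>ins D\<close> the exterior multiplication by D, and the anticommutation relations proved
  below are the usual ones for these operators.\<close>

definition eps :: "'w set \<Rightarrow> 'w set set \<Rightarrow> 'k::comm_ring_1" where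
  "eps D F = (-1) ^ card {C \<in> F. prec C D}"

lemma eps_square [simp]: "eps D F * eps D F = (1 :: 'k::comm_ring_1)"
  by (simp add: eps_def minus_one_power_iff)

lemma eps_insert:
  assumes "finite F" "C \<notin> F"
  shows "eps D (insert C F) = (if prec C D then - eps D F else eps D F :: 'k::comm_ring_1)"
proof -
  have "{B \<in> insert C F. prec B D} = (if prec C D then insert C {B \<in> F. prec B D} else {B \<in> F. prec B D})"
    by auto
  then show ?thesis using assms by (simp add: eps_def)
qed

lemma eps_remove:
  assumes "finite F" "C \<in> F"
  shows "eps D (F - {C}) = (if prec C D then - eps D F else eps D F :: 'k::comm_ring_1)"
  using eps_insert[of "F - {C}" C D, where 'k='k] assms by (simp add: insert_absorb split: if_splits)

text \<open>Infinite sets carry no meaningful sign and are sent to 0, here and in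
  \<open>ins\<close>.\<close>

definition del :: "'w set \<Rightarrow> ('w set set \<Rightarrow>\<^sub>0 'k::comm_ring_1) \<Rightarrow> ('w set set \<Rightarrow>\<^sub>0 'k)" where
  "del D = lin_ext (\<lambda>F. if finite F \<and> D \<in> F then fscale (eps D F) (gen (F - {D})) else 0)"

definition ins :: "'w set \<Rightarrow> ('w set set \<Rightarrow>\<^sub>0 'k::comm_ring_1) \<Rightarrow> ('w set set \<Rightarrow>\<^sub>0 'k)" where
  "ins D = lin_ext (\<lambda>F. if finite F \<and> D \<notin> F then fscale (eps D F) (gen (insert D F)) else 0)"

text \<open>\<Omega> holds the vertices that may be removed: in the applications all except A, or
  all except \<rho> and \<open>{A}\<close>. Being a complement it may be infinite, so the sum runs
  over elements of F.\<close>

definition bd :: "'w set set \<Rightarrow> ('w set set \<Rightarrow>\<^sub>0 'k::comm_ring_1) \<Rightarrow> ('w set set \<Rightarrow>\<^sub>0 'k)" where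
  "bd \<Omega> = lin_ext (\<lambda>F. \<Sum>D\<in>F \<inter> \<Omega>. del D (gen F))"

lemma lin_del: "lin (del D)" and lin_ins: "lin (ins D)" and lin_bd: "lin (bd \<Omega>)"
  unfolding del_def ins_def bd_def by (rule lin_lin_ext)+

lemma del_gen: "del D (gen F) = (if finite F \<and> D \<in> F then fscale (eps D F) (gen (F - {D})) else 0)"
  and ins_gen: "ins D (gen F) = (if finite F \<and> D \<notin> F then fscale (eps D F) (gen (insert D F)) else 0)"
  and bd_gen: "bd \<Omega> (gen F) = (\<Sum>D\<in>F \<inter> \<Omega>. del D (gen F))"
  by (simp_all add: del_def ins_def bd_def)

lemmas lin_intros = lin_comp[OF lin_del] lin_comp[OF lin_ins] lin_comp[OF lin_bd]
  lin_plus lin_minus lin_uminus lin_setsum lin_const_scale lin_id lin_0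

lemmas lin_simps = lin_add lin_scale lin_zero lin_neg lin_diff lin_sum

text \<open>Exactly one of C and D precedes the other, so exactly one of the two deletions changes
  the sign of the other.\<close>

lemma del_del: "del C (del D x) = - del D (del C x)"
proof (rule lin_eq[where f="\<lambda>x. del C (del D x)" and g="\<lambda>x. - del D (del C x)"])
  fix F :: "'a set set"
  show "del C (del D (gen F)) = - del D (del C (gen F) :: 'a set set \<Rightarrow>\<^sub>0 'b)"
  proof (cases "finite F \<and> C \<in> F \<and> D \<in> F \<and> C \<noteq> D")
    case True
    then have CD: "prec D C \<longleftrightarrow> \<not> prec C D" "D \<noteq> C"
      using prec_total[of D C] by auto
    have "F - {C} - {D} = F - {C, D}" "F - {D} - {C} = F - {C, D}" by auto
    then show ?thesis using True CD
      by (cases "prec C D") (simp_all add: del_gen lin_scale[OF lin_del] eps_remove mult.commute)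
  qed (auto simp: del_gen lin_simps[OF lin_del])
qed (intro lin_intros)+

lemma del_del_same [simp]: "del D (del D x) = 0"
  by (rule lin_eq[where f="\<lambda>x. del D (del D x)" and g="\<lambda>x. 0"])
    (auto simp: del_gen lin_simps[OF lin_del] intro!: lin_intros)

lemma del_ins: 
  assumes "C \<noteq> D" 
  shows "del C (ins D x) = - ins D (del C x)"
proof (rule lin_eq[where f="\<lambda>x. del C (ins D x)" and g="\<lambda>x. - ins D (del C x)"])
  fix F :: "'a set set"
  show "del C (ins D (gen F)) = - ins D (del C (gen F) :: 'a set set \<Rightarrow>\<^sub>0 'b)"
  proof (cases "finite F \<and> C \<in> F \<and> D \<notin> F")
    case True
    have e: "insert D F - {C} = insert D (F - {C})" "prec D C \<longleftrightarrow> \<not> prec C D"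
      using assms prec_total[of D C] by auto
    show ?thesis using assms True e
      by (cases "prec C D")
        (simp_all add: del_gen ins_gen lin_scale[OF lin_del] lin_scale[OF lin_ins] eps_remove eps_insert mult.commute)
  qed (use assms in \<open>auto simp: del_gen ins_gen lin_simps[OF lin_del] lin_simps[OF lin_ins]\<close>)
qed (intro lin_intros)+

lemma del_ins_same:
  assumes "x \<in> free_on {F. finite F}"
  shows "del D (ins D x) + ins D (del D x) = x"
proof (rule lin_eq_on_free[where f="\<lambda>x. del D (ins D x) + ins D (del D x)" and g="\<lambda>x. x", OF _ _ assms])
  fix F :: "'a set set" assume "F \<in> {F. finite F}"
  then show "del D (ins D (gen F)) + ins D (del D (gen F)) = (gen F :: 'a set set \<Rightarrow>\<^sub>0 'b)"
    by (auto simp: del_gen ins_gen lin_simps[OF lin_del] lin_simps[OF lin_ins] eps_insert eps_remove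
        insert_absorb)
qed (intro lin_intros)+

lemma del_eq_0: "(\<And>F. F \<in> S \<Longrightarrow> D \<notin> F) \<Longrightarrow> x \<in> free_on S \<Longrightarrow> del D x = 0"
  by (rule lin_eq_on_free[OF lin_del lin_0]) (auto simp: del_gen)

lemma del_ins_id:
  assumes "x \<in> free_on S" "\<And>F. F \<in> S \<Longrightarrow> finite F \<and> D \<notin> F"
  shows "del D (ins D x) = x"
proof -
  have "x \<in> free_on {F. finite F}" by (rule free_on_mono[OF assms(1)]) (use assms(2) in auto)
  moreover have "del D x = 0" by (rule del_eq_0[OF _ assms(1)]) (use assms(2) in auto)
  ultimately show ?thesis using del_ins_same[of x D] by (simp add: lin_zero[OF lin_ins])
qed

lemma del_mem: "x \<in> free_on S \<Longrightarrow> (\<And>F. F \<in> S \<Longrightarrow> D \<in> F \<Longrightarrow> F - {D} \<in> T) \<Longrightarrow> del D x \<in> free_on T"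
  by (rule lin_free_on_mem[OF lin_del _ subspace_free_on]) (auto simp: del_gen intro: scale_free_on)

lemma ins_mem: "x \<in> free_on S \<Longrightarrow> (\<And>F. F \<in> S \<Longrightarrow> D \<notin> F \<Longrightarrow> insert D F \<in> T) \<Longrightarrow> ins D x \<in> free_on T"
  by (rule lin_free_on_mem[OF lin_ins _ subspace_free_on]) (auto simp: ins_gen intro: scale_free_on)

lemma bd_mem:
  "x \<in> free_on S \<Longrightarrow> (\<And>F D. F \<in> S \<Longrightarrow> D \<in> F \<Longrightarrow> D \<in> \<Omega> \<Longrightarrow> F - {D} \<in> T) \<Longrightarrow> bd \<Omega> x \<in> free_on T"
  by (rule lin_free_on_mem[OF lin_bd _ subspace_free_on])
    (auto simp: bd_gen del_gen intro!: sum_free_on scale_free_on)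

lemma lookup_del:
  assumes "finite F" "D \<in> F"
  shows "Poly_Mapping.lookup (del D x) (F - {D}) = eps D F * Poly_Mapping.lookup x F"
proof -
  have "F' - {D} = F - {D} \<Longrightarrow> D \<in> F' \<Longrightarrow> F' = F" for F' using assms by blast
  then have *: "Poly_Mapping.lookup (if finite F' \<and> D \<in> F' then fscale (eps D F') (gen (F' - {D})) else 0)
      (F - {D}) = (if F' = F then eps D F else 0)" for F'
    using assms by (auto simp: lookup_fscale lookup_single when_def)
  have "Poly_Mapping.lookup (del D x) (F - {D}) =
      (\<Sum>F'\<in>Poly_Mapping.keys x. Poly_Mapping.lookup x F' * (if F' = F then eps D F else 0))"
    by (simp only: del_def lin_ext_def lookup_sum lookup_fscale *)
  also have "\<dots> = eps D F * Poly_Mapping.lookup x F"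
    by (simp add: if_distrib[where f="(*) _"] sum.delta in_keys_iff mult.commute cong: if_cong)
  finally show ?thesis .
qed

text \<open>Distinct sets containing D stay distinct when D is removed, so nothing can cancel: the
  coefficients reappear up to signs, which are invertible in any ring.\<close>

lemma del_zero_imp:
  assumes "x \<in> free_on S" "del D x = 0" "\<And>F. F \<in> S \<Longrightarrow> finite F"
  shows "x \<in> free_on {F \<in> S. D \<notin> F}"
proof -
  have "D \<notin> F" if "F \<in> Poly_Mapping.keys x" for F
  proof
    assume D: "D \<in> F"
    have "eps D F * Poly_Mapping.lookup x F = 0"
      using lookup_del[of F D x] that assms D by (auto simp: free_on_def)
    then have "eps D F * (eps D F * Poly_Mapping.lookup x F) = 0" by simp
    then have "Poly_Mapping.lookup x F = 0" by (simp flip: mult.assoc)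
    then show False using that by (simp add: in_keys_iff)
  qed
  then show ?thesis using assms(1) by (auto simp: free_on_def)
qed

lemma bd_sum:
  assumes "x \<in> free_on (Pow U)" "finite U"
  shows "bd \<Omega> x = (\<Sum>D\<in>U \<inter> \<Omega>. del D x)"
proof (rule lin_eq_on_free[where f="bd \<Omega>" and g="\<lambda>x. \<Sum>D\<in>U \<inter> \<Omega>. del D x", OF _ _ assms(1)])
  fix F assume F: "F \<in> Pow U"
  show "bd \<Omega> (gen F) = (\<Sum>D\<in>U \<inter> \<Omega>. del D (gen F) :: 'a set set \<Rightarrow>\<^sub>0 'b)"
    unfolding bd_gen by (rule sum.mono_neutral_left) (use F assms(2) in \<open>auto simp: del_gen\<close>)
qed (intro lin_intros)+

lemma bd_del: "bd \<Omega> (del C x) = - del C (bd \<Omega> x)"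
proof (rule lin_eq[where f="\<lambda>x. bd \<Omega> (del C x)" and g="\<lambda>x. - del C (bd \<Omega> x)"])
  fix F :: "'a set set"
  show "bd \<Omega> (del C (gen F)) = - del C (bd \<Omega> (gen F) :: 'a set set \<Rightarrow>\<^sub>0 'b)"
  proof (cases "finite F")
    case True
    have "del C (gen F) \<in> (free_on (Pow F) :: ('a set set \<Rightarrow>\<^sub>0 'b) set)" by (rule del_mem[of _ "Pow F"]) auto
    then have "bd \<Omega> (del C (gen F)) = (\<Sum>D\<in>F \<inter> \<Omega>. del D (del C (gen F :: 'a set set \<Rightarrow>\<^sub>0 'b)))"
      by (rule bd_sum) fact
    also have "\<dots> = (\<Sum>D\<in>F \<inter> \<Omega>. - del C (del D (gen F)))" by (intro sum.cong refl del_del)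
    finally show ?thesis by (simp add: bd_gen lin_sum[OF lin_del] sum_negf)
  qed (simp add: bd_gen del_gen lin_simps[OF lin_del] lin_simps[OF lin_bd])
qed (intro lin_intros)+

lemma bd_bd [simp]: "bd \<Omega> (bd \<Omega> x) = 0"
proof (rule lin_eq[where f="\<lambda>x. bd \<Omega> (bd \<Omega> x)" and g="\<lambda>x. 0"])
  fix F :: "'a set set"
  show "bd \<Omega> (bd \<Omega> (gen F)) = (0 :: 'a set set \<Rightarrow>\<^sub>0 'b)"
  proof (cases "finite F")
    case True
    have "bd \<Omega> (bd \<Omega> (gen F)) = - (\<Sum>D\<in>F \<inter> \<Omega>. \<Sum>C\<in>F \<inter> \<Omega>. del D (del C (gen F)) :: 'a set set \<Rightarrow>\<^sub>0 'b)"
      by (simp add: bd_gen lin_sum[OF lin_bd] bd_del lin_sum[OF lin_del] sum_negf)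
    also have "\<dots> = 0"
      using True by (subst sum_antisymmetric) (auto intro: del_del)
    finally show ?thesis .
  qed (simp add: bd_gen del_gen lin_simps[OF lin_bd])
qed (intro lin_intros)+

text \<open>For a fixed C in \<Omega> this is the homotopy contracting a cone with apex C. It holds
  because \<open>ins C\<close> anticommutes with every deletion except that of C.\<close>

lemma bd_ins:
  assumes "x \<in> free_on {F. finite F}"
  shows "bd \<Omega> (ins C x) + ins C (bd \<Omega> x) = (if C \<in> \<Omega> then x else 0)"
proof (rule lin_eq_on_free[where f="\<lambda>x. bd \<Omega> (ins C x) + ins C (bd \<Omega> x)"
      and g="\<lambda>x. if C \<in> \<Omega> then x else 0", OF _ _ assms])
  fix F :: "'a set set" assume "F \<in> {F. finite F}"
  then have F: "finite (insert C F)" by simp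
  let ?g = "gen F :: 'a set set \<Rightarrow>\<^sub>0 'b"
  have "ins C ?g \<in> free_on (Pow (insert C F))" by (rule ins_mem[of _ "Pow F"]) auto
  then have "bd \<Omega> (ins C ?g) = (\<Sum>D\<in>insert C F \<inter> \<Omega>. del D (ins C ?g))" using F by (rule bd_sum)
  moreover have "bd \<Omega> ?g = (\<Sum>D\<in>insert C F \<inter> \<Omega>. del D ?g)" using F by (intro bd_sum) auto
  ultimately have "bd \<Omega> (ins C ?g) + ins C (bd \<Omega> ?g) =
      (\<Sum>D\<in>insert C F \<inter> \<Omega>. del D (ins C ?g) + ins C (del D ?g))"
    by (simp add: lin_sum[OF lin_ins] sum.distrib)
  also have "\<dots> = (\<Sum>D\<in>insert C F \<inter> \<Omega>. if D = C then ?g else 0)"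
    using F by (intro sum.cong refl) (auto simp: del_ins intro!: del_ins_same)
  also have "\<dots> = (if C \<in> \<Omega> then ?g else 0)" using F by (simp add: sum.delta')
  finally show "bd \<Omega> (ins C ?g) + ins C (bd \<Omega> ?g) = (if C \<in> \<Omega> then ?g else 0)" .
qed (intro lin_intros, cases "C \<in> \<Omega>", simp_all add: lin_id lin_0)

text \<open>
  With \<open>h\<close> the insertion of the vertex \<open>c (s F)\<close>, the operator \<open>bd \<circ> h + h \<circ> bd\<close> differs from the
  identity only by terms in which \<open>s F\<close> has been deleted.
\<close>

lemma toggle_acyclic:
  fixes K :: "'w set set set" and r :: "'w set \<Rightarrow> nat" and x :: "'w set set \<Rightarrow>\<^sub>0 'k::comm_ring_1"
  assumes fin: "\<And>F. F \<in> K \<Longrightarrow> finite F"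
    and down: "\<And>F D. F \<in> K \<Longrightarrow> D \<in> F \<Longrightarrow> D \<in> \<Omega> \<Longrightarrow> F - {D} \<in> K"
    and c: "\<And>F. F \<in> K \<Longrightarrow> c (s F) \<in> \<Omega> \<and> insert (c (s F)) F \<in> K \<and> s (insert (c (s F)) F) = s F"
    and keep: "\<And>F D. F \<in> K \<Longrightarrow> D \<in> F \<Longrightarrow> D \<in> \<Omega> \<Longrightarrow> D \<noteq> s F \<Longrightarrow> s (F - {D}) = s F"
    and raise: "\<And>F. F \<in> K \<Longrightarrow> s F \<in> F \<Longrightarrow> s F \<in> \<Omega> \<Longrightarrow> r (s F) < r (s (F - {s F}))"
    and bound: "\<And>F. F \<in> K \<Longrightarrow> r (s F) \<le> N"
    and neq: "\<And>F. F \<in> K \<Longrightarrow> c (s F) \<noteq> s F"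
    and x: "x \<in> free_on K" "bd \<Omega> x = 0"
  shows "\<exists>y\<in>free_on K. bd \<Omega> y = x"
proof -
  define h where "h = lin_ext (\<lambda>F. ins (c (s F)) (gen F) :: 'w set set \<Rightarrow>\<^sub>0 'k)"
  have lin_h: "lin h" unfolding h_def by (rule lin_lin_ext)
  have h_gen: "h (gen F) = ins (c (s F)) (gen F)" for F by (simp add: h_def)
  have h_mem: "h y \<in> free_on K" if "y \<in> free_on K" for y
  proof (rule lin_free_on_mem[OF lin_h that subspace_free_on])
    fix F assume "F \<in> K"
    then have "insert (c (s F)) F \<in> K" using c by blast
    then show "h (gen F) \<in> free_on K" by (simp add: h_gen ins_gen scale_free_on)
  qed
  \<comment> \<open>The error of the homotopy \<open>h\<close> lies one step deeper in the
    filtration by the rank of \<open>s F\<close>.\<close>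
  have step: "y - (bd \<Omega> (h y) + h (bd \<Omega> y)) \<in> free_on {F \<in> K. Suc k \<le> r (s F)}"
    if y: "y \<in> free_on {F \<in> K. k \<le> r (s F)}" for k y
  proof (rule lin_free_on_mem[where f="\<lambda>y. y - (bd \<Omega> (h y) + h (bd \<Omega> y))", OF _ y subspace_free_on])
    fix F assume "F \<in> {F \<in> K. k \<le> r (s F)}"
    then have F: "F \<in> K" "k \<le> r (s F)" "finite F" using fin by auto
    let ?C = "c (s F)" and ?g = "gen F :: 'w set set \<Rightarrow>\<^sub>0 'k"
    let ?C' = "c (s (F - {s F}))"
    have "h (bd \<Omega> ?g) - ins ?C (bd \<Omega> ?g) = (\<Sum>D\<in>F \<inter> \<Omega>. h (del D ?g) - ins ?C (del D ?g))"
      by (simp add: bd_gen lin_sum[OF lin_ins] lin_sum[OF lin_h] sum_subtractf)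
    \<comment> \<open>Deleting a D other than \<open>s F\<close> leaves \<open>s\<close>, and hence
      the element to be inserted, unchanged; only \<open>D = s F\<close> survives.\<close>
    also have "\<dots> = (\<Sum>D\<in>F \<inter> \<Omega>. if D = s F then ins ?C' (del D ?g) - ins ?C (del D ?g) else 0)"
      using F keep by (intro sum.cong refl)
        (auto simp: del_gen lin_scale[OF lin_h] lin_scale[OF lin_ins] h_gen)
    also have "\<dots> \<in> free_on {F \<in> K. Suc k \<le> r (s F)}"
    proof (intro sum_free_on)
      fix D assume D: "D \<in> F \<inter> \<Omega>"
      show "(if D = s F then ins ?C' (del D ?g) - ins ?C (del D ?g) else 0)
          \<in> free_on {F \<in> K. Suc k \<le> r (s F)}"
      proof (cases "D = s F")
        case True
        then have sF: "s F \<in> F" "s F \<in> \<Omega>" using D by auto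
        let ?F' = "F - {s F}"
        have F': "?F' \<in> K" "Suc k \<le> r (s ?F')"
          using down[OF F(1) sF] raise[OF F(1) sF] F(2) by auto
        have 1: "insert ?C' ?F' \<in> K" "Suc k \<le> r (s (insert ?C' ?F'))"
          using c[OF F'(1)] F'(2) by auto
        \<comment> \<open>This set arises from \<open>insert ?C F\<close> by deleting
          \<open>s F\<close>. As \<open>s\<close> has the same value on \<open>insert ?C F\<close>
          as on F, the rank rises here too.\<close>
        have e: "insert ?C ?F' = insert ?C F - {s F}" using neq[OF F(1)] by auto
        have 2: "insert ?C ?F' \<in> K" unfolding e using c[OF F(1)] sF by (intro down) auto
        have 3: "Suc k \<le> r (s (insert ?C ?F'))"
          using raise[of "insert ?C F"] c[OF F(1)] sF F(2) unfolding e by simp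
        have "del D ?g = fscale (eps D F) (gen ?F')" using True sF F(3) by (simp add: del_gen)
        moreover have "ins B (gen ?F') \<in> free_on {F \<in> K. Suc k \<le> r (s F)}"
          if "insert B ?F' \<in> K" "Suc k \<le> r (s (insert B ?F'))" for B
          using that by (simp add: ins_gen scale_free_on)
        ultimately show ?thesis using True 1 2 3
          by (auto simp: lin_scale[OF lin_ins] intro!: diff_free_on scale_free_on)
      qed simp
    qed
    finally have m: "h (bd \<Omega> ?g) - ins ?C (bd \<Omega> ?g) \<in> free_on {F \<in> K. Suc k \<le> r (s F)}" .
    have "bd \<Omega> (ins ?C ?g) + ins ?C (bd \<Omega> ?g) = ?g"
      using bd_ins[of ?g \<Omega> ?C] F c by simp
    then have e: "?g - (bd \<Omega> (h ?g) + h (bd \<Omega> ?g)) = - (h (bd \<Omega> ?g) - ins ?C (bd \<Omega> ?g))"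
      by (simp add: h_gen algebra_simps)
    show "?g - (bd \<Omega> (h ?g) + h (bd \<Omega> ?g)) \<in> free_on {F \<in> K. Suc k \<le> r (s F)}"
      unfolding e by (rule uminus_free_on[OF m])
  qed (intro lin_intros lin_comp[OF lin_h])+
  \<comment> \<open>Corrections are iterated with growing rank k; beyond N the filtered module is
    zero.\<close>
  have "\<exists>y\<in>free_on K. bd \<Omega> y = x" if "x \<in> free_on {F \<in> K. k \<le> r (s F)}" "bd \<Omega> x = 0"
    for k and x :: "'w set set \<Rightarrow>\<^sub>0 'k"
    using that
  proof (induction "Suc N - k" arbitrary: k x)
    case 0
    then have e: "{F \<in> K. k \<le> r (s F)} = {}" using bound by fastforce
    have "x = 0" using 0(2) unfolding e by (simp add: free_on_def)
    then show ?case by (intro bexI[of _ 0]) (simp_all add: lin_zero[OF lin_bd])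
  next
    case (Suc m)
    have "x - bd \<Omega> (h x) \<in> free_on {F \<in> K. Suc k \<le> r (s F)}"
      using step[OF Suc.prems(1)] by (simp add: Suc.prems(2) lin_zero[OF lin_h])
    moreover have "bd \<Omega> (x - bd \<Omega> (h x)) = 0" by (simp add: lin_diff[OF lin_bd] Suc.prems)
    moreover have "m = Suc N - Suc k" using Suc.hyps(2) by linarith
    ultimately obtain y where y: "y \<in> free_on K" "bd \<Omega> y = x - bd \<Omega> (h x)"
      using Suc.hyps(1) by blast
    have "x \<in> free_on K" by (rule free_on_mono[OF Suc.prems(1)]) auto
    then have "y + h x \<in> free_on K" using y h_mem add_free_on by blast
    moreover have "bd \<Omega> (y + h x) = x" using y by (simp add: lin_add[OF lin_bd])
    ultimately show ?case by blast
  qed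
  from this[of x 0] x show ?thesis by simp
qed


section \<open>Nested sets of clusters and chains of partitions\<close>

definition laminar :: "'a set set \<Rightarrow> bool" where
  "laminar F \<longleftrightarrow> (\<forall>C\<in>F. \<forall>D\<in>F. C \<subseteq> D \<or> D \<subseteq> C \<or> C \<inter> D = {})"

text \<open>Strict inclusion excludes single blocks: when \<rho> is a partition of A, the clusters
  are the unions of at least two blocks, matching vertices with at least two inputs.\<close>

definition cluster :: "'a set \<Rightarrow> 'a set set \<Rightarrow> 'a set \<Rightarrow> bool" where
  "cluster A \<rho> C \<longleftrightarrow> C \<noteq> {} \<and> C \<subseteq> A \<and> (\<forall>b\<in>\<rho>. b \<subset> C \<or> b \<inter> C = {})"

text \<open>
  The reduced trees whose inputs are the blocks of the partition \<open>\<rho>\<close> of \<open>A\<close>; a vertex is encoded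
  by the union of the inputs above it.
\<close>

definition nested :: "'a set \<Rightarrow> 'a set set \<Rightarrow> 'a set set set" where
  "nested A \<rho> = {F. A \<noteq> {} \<and> laminar F \<and> (\<forall>C\<in>F. cluster A \<rho> C) \<and> (A \<in> F \<or> \<rho> = {A})}"

text \<open>Chains in the interval from \<rho> to the coarsest partition. Both ends are kept as
  members, so d levels correspond to d + 1 partitions; the boundary never removes the ends because
  \<Omega> omits them. Empty A is excluded to match \<open>nested\<close>.\<close>

definition part_chains :: "'a set \<Rightarrow> 'a set set \<Rightarrow> 'a set set set set" where
  "part_chains A \<rho> = {G. A \<noteq> {} \<and> \<rho> \<in> G \<and> {A} \<in> G \<and> (\<forall>\<pi>\<in>G. refines A \<rho> \<pi>) \<and>
     (\<forall>\<pi>\<in>G. \<forall>\<pi>'\<in>G. refines A \<pi> \<pi>' \<or> refines A \<pi>' \<pi>)}"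

definition coarsen :: "'a set set \<Rightarrow> 'a set \<Rightarrow> 'a set set" where
  "coarsen \<rho> X = insert X {b \<in> \<rho>. \<not> b \<subseteq> X}"

text \<open>For the clusters of a tree these are the vertices all of whose inputs are external, the
  ones at which the tree can be pruned.\<close>

definition minimals :: "'a set set \<Rightarrow> 'a set set" where
  "minimals F = {X \<in> F. \<forall>Y\<in>F. \<not> Y \<subset> X}"

definition maximals :: "'a set set \<Rightarrow> 'a set set" where
  "maximals F = {X \<in> F. \<forall>Y\<in>F. \<not> X \<subset> Y}"

section \<open>Partitions and refinement\<close>

lemma partition_on_eqI: "partition_on A \<pi> \<Longrightarrow> b \<in> \<pi> \<Longrightarrow> c \<in> \<pi> \<Longrightarrow> b \<inter> c \<noteq> {} \<Longrightarrow> b = c"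
  by (auto simp: partition_on_def disjoint_def)

lemma partition_on_subset_eq: "partition_on A \<pi> \<Longrightarrow> b \<in> \<pi> \<Longrightarrow> c \<in> \<pi> \<Longrightarrow> b \<subseteq> c \<Longrightarrow> b = c"
  by (metis inf.absorb1 partition_onD3 partition_on_eqI)

lemma partition_on_block: "partition_on A \<pi> \<Longrightarrow> x \<in> A \<Longrightarrow> \<exists>b\<in>\<pi>. x \<in> b"
  by (auto simp: partition_on_def)

lemma partition_on_full: "partition_on A \<pi> \<Longrightarrow> A \<in> \<pi> \<Longrightarrow> \<pi> = {A}"
  using partition_on_subset_eq[of A \<pi> _ A] by (auto simp: partition_on_def)

text \<open>Inclusion maps the blocks of \<pi> onto the blocks of \<pi>'. If this map were
  injective, each block of \<pi>' would contain just one block of \<pi> and hence equal it.\<close>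

lemma refines_card_less:
  assumes "finite A" "refines A \<pi> \<pi>'" "\<pi> \<noteq> \<pi>'"
  shows "card \<pi>' < card \<pi>"
proof -
  have p: "partition_on A \<pi>" "partition_on A \<pi>'" using assms(2) by (auto simp: refines_def)
  obtain f where f: "\<And>b. b \<in> \<pi> \<Longrightarrow> f b \<in> \<pi>' \<and> b \<subseteq> f b"
    using assms(2) unfolding refines_def by metis
  have fin: "finite \<pi>" "finite \<pi>'" using p assms(1) finite_elements by blast+
  have f_eq: "f b = c" if "b \<in> \<pi>" "c \<in> \<pi>'" "x \<in> b" "x \<in> c" for b c x
    using f[OF that(1)] that p(2) by (intro partition_on_eqI[of A \<pi>']) auto
  have surj: "\<pi>' \<subseteq> f ` \<pi>"
  proof
    fix c assume c: "c \<in> \<pi>'"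
    then obtain x where x: "x \<in> c" using p(2) partition_onD3 by (metis all_not_in_conv)
    then have "x \<in> A" using c p(2) by (auto simp: partition_on_def)
    then obtain b where "b \<in> \<pi>" "x \<in> b" using p(1) partition_on_block by metis
    then show "c \<in> f ` \<pi>" using f_eq c x by blast
  qed
  have "\<not> inj_on f \<pi>"
  proof
    assume inj: "inj_on f \<pi>"
    have "f b = b" if b: "b \<in> \<pi>" for b
    proof
      show "f b \<subseteq> b"
      proof
        fix x assume x: "x \<in> f b"
        then have "x \<in> A" using f[OF b] p(2) by (auto simp: partition_on_def)
        then obtain b' where "b' \<in> \<pi>" "x \<in> b'" using p(1) partition_on_block by metis
        then have "f b' = f b" using f_eq f b x by blast
        then show "x \<in> b" using inj \<open>b' \<in> \<pi>\<close> b \<open>x \<in> b'\<close> by (auto dest: inj_onD)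
      qed
    qed (use f b in blast)
    then have "\<pi> = \<pi>'" using surj f by force
    then show False using assms(3) by simp
  qed
  then have "card (f ` \<pi>) < card \<pi>" using fin(1) card_image_le[of \<pi> f] eq_card_imp_inj_on[of \<pi> f] by force
  moreover have "card \<pi>' \<le> card (f ` \<pi>)" using surj fin(1) by (intro card_mono) auto
  ultimately show ?thesis by simp
qed

lemma nested_finite: "finite A \<Longrightarrow> F \<in> nested A \<rho> \<Longrightarrow> finite F"
  by (rule finite_subset[of _ "Pow A"]) (auto simp: nested_def cluster_def)

lemma part_chains_finite: "finite A \<Longrightarrow> G \<in> part_chains A \<rho> \<Longrightarrow> finite G"
  by (rule finite_subset[OF _ finitely_many_partition_on[of A]])
    (auto simp: part_chains_def refines_def)

lemma laminar_subset: "laminar F \<Longrightarrow> F' \<subseteq> F \<Longrightarrow> laminar F'"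
  unfolding laminar_def by blast

lemma nestedD:
  assumes "F \<in> nested A \<rho>"
  shows "A \<noteq> {}" "laminar F" "C \<in> F \<Longrightarrow> cluster A \<rho> C" "A \<in> F \<or> \<rho> = {A}"
  using assms unfolding nested_def by blast+

lemma laminarD: "laminar F \<Longrightarrow> C \<in> F \<Longrightarrow> D \<in> F \<Longrightarrow> C \<subseteq> D \<or> D \<subseteq> C \<or> C \<inter> D = {}"
  unfolding laminar_def by blast

lemma nested_delete: "F \<in> nested A \<rho> \<Longrightarrow> D \<noteq> A \<Longrightarrow> F - {D} \<in> nested A \<rho>"
  using laminar_subset[of F "F - {D}"] by (auto simp: nested_def)

lemma part_chains_delete: "G \<in> part_chains A \<rho> \<Longrightarrow> \<pi> \<noteq> \<rho> \<Longrightarrow> \<pi> \<noteq> {A} \<Longrightarrow> G - {\<pi>} \<in> part_chains A \<rho>"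
  by (auto simp: part_chains_def)

lemma nested_full: "F \<in> nested A {A} \<Longrightarrow> F = {}"
  by (auto simp: nested_def cluster_def)

section \<open>Merging the blocks inside a cluster\<close>

lemma coarsen_partition:
  assumes "partition_on A \<rho>" "cluster A \<rho> X"
  shows "partition_on A (coarsen \<rho> X)" "refines A \<rho> (coarsen \<rho> X)" "coarsen \<rho> X \<noteq> \<rho>"
proof -
  have X: "X \<noteq> {}" "X \<subseteq> A" "\<And>b. b \<in> \<rho> \<Longrightarrow> b \<subset> X \<or> b \<inter> X = {}"
    using assms(2) by (auto simp: cluster_def)
  have dis: "b \<inter> X = {}" if "b \<in> \<rho>" "\<not> b \<subseteq> X" for b using X(3) that by blast
  show p: "partition_on A (coarsen \<rho> X)"
  proof (rule partition_onI)
    show "\<Union> (coarsen \<rho> X) = A"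
      using assms(1) X(2) by (auto simp: coarsen_def partition_on_def)
    show "{} \<notin> coarsen \<rho> X" using X(1) by (auto simp: coarsen_def)
    fix b c assume "b \<in> coarsen \<rho> X" "c \<in> coarsen \<rho> X" "b \<noteq> c"
    then show "disjnt b c"
      using dis partition_on_eqI[OF assms(1), of b c] by (auto simp: coarsen_def disjnt_def)
  qed
  show "refines A \<rho> (coarsen \<rho> X)"
    using assms(1) p by (auto simp: refines_def coarsen_def)
  show "coarsen \<rho> X \<noteq> \<rho>"
    using X(3)[of X] X(1) by (auto simp: coarsen_def)
qed

lemma coarsen_eq_full:
  assumes "partition_on A \<rho>" "cluster A \<rho> X"
  shows "coarsen \<rho> X = {A} \<longleftrightarrow> X = A"
proof
  show "X = A" if "coarsen \<rho> X = {A}" using that by (auto simp: coarsen_def)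
  show "coarsen \<rho> X = {A}" if "X = A" using that assms(1) by (auto simp: coarsen_def partition_on_def)
qed

lemma coarsen_coarsen_subset: "X \<subseteq> Y \<Longrightarrow> coarsen (coarsen \<rho> X) Y = coarsen \<rho> Y"
  by (auto simp: coarsen_def)

lemma coarsen_commute:
  "\<not> X \<subseteq> Y \<Longrightarrow> \<not> Y \<subseteq> X \<Longrightarrow> coarsen (coarsen \<rho> X) Y = coarsen (coarsen \<rho> Y) X"
  by (auto simp: coarsen_def)

lemma minimals_subset: "minimals F \<subseteq> F"
  by (auto simp: minimals_def)

text \<open>Pruning: the vertex X, which has only external inputs, becomes a single input.
  Minimality excludes clusters inside X and laminarity those that cross it, so the remaining ones
  see X as a block.\<close>

lemma nested_remove:
  assumes "F \<in> nested A \<rho>" "X \<in> minimals F" "partition_on A \<rho>"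
  shows "F - {X} \<in> nested A (coarsen \<rho> X)"
proof -
  note F = nestedD[OF assms(1)]
  have X: "X \<in> F" "\<And>Y. Y \<in> F \<Longrightarrow> \<not> Y \<subset> X" using assms(2) by (auto simp: minimals_def)
  have "cluster A (coarsen \<rho> X) C" if C: "C \<in> F - {X}" for C
  proof -
    have "C \<subseteq> X \<or> X \<subseteq> C \<or> C \<inter> X = {}" using laminarD[OF F(2)] C X(1) by blast
    then have "X \<subset> C \<or> X \<inter> C = {}" using X(2)[of C] C by blast
    moreover have "cluster A \<rho> C" using F(3) C by blast
    ultimately show ?thesis by (simp add: cluster_def coarsen_def)
  qed
  moreover have "A \<in> F - {X} \<or> coarsen \<rho> X = {A}"
  proof (cases "X = A")
    case True
    then show ?thesis using coarsen_eq_full[OF assms(3) F(3)[OF X(1)]] by simp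
  next
    case False
    then show ?thesis using F(4) nested_full[of F A] assms(1) X(1) by blast
  qed
  moreover have "laminar (F - {X})" using F(2) laminar_subset by blast
  ultimately show ?thesis using F(1) unfolding nested_def by blast
qed

lemma nested_insert:
  assumes "F \<in> nested A (coarsen \<rho> X)" "cluster A \<rho> X"
  shows "insert X F \<in> nested A \<rho>" "X \<notin> F"
proof -
  have cl: "cluster A (coarsen \<rho> X) C" if "C \<in> F" for C
    using nestedD(3)[OF assms(1) that] .
  then have F: "X \<subset> C \<or> X \<inter> C = {}" if "C \<in> F" for C
    using that unfolding cluster_def coarsen_def by blast
  show "X \<notin> F" using F assms(2) unfolding cluster_def by blast
  have cl': "cluster A \<rho> C" if C: "C \<in> F" for C
    unfolding cluster_def
  proof (intro conjI ballI)
    fix b assume b: "b \<in> \<rho>"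
    show "b \<subset> C \<or> b \<inter> C = {}"
    proof (cases "b \<subseteq> X")
      case True
      then show ?thesis using F[OF C] by blast
    next
      case False
      then have "b \<in> coarsen \<rho> X" using b by (simp add: coarsen_def)
      then show ?thesis using cl[OF C] unfolding cluster_def by blast
    qed
  qed (use cl[OF C] in \<open>auto simp: cluster_def\<close>)
  have "A \<in> insert X F \<or> \<rho> = {A}"
    using nestedD(4)[OF assms(1)] unfolding coarsen_def by blast
  moreover have "laminar (insert X F)"
    using nestedD(2)[OF assms(1)] F unfolding laminar_def by blast
  moreover have "\<forall>C\<in>insert X F. cluster A \<rho> C" using cl' assms(2) by blast
  ultimately show "insert X F \<in> nested A \<rho>" using nestedD(1)[OF assms(1)] unfolding nested_def by blast
qed

section \<open>Extending a chain by a finer partition\<close>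

lemma part_chainsD:
  assumes "G \<in> part_chains A \<rho>"
  shows "A \<noteq> {}" "\<rho> \<in> G" "{A} \<in> G" "\<pi> \<in> G \<Longrightarrow> refines A \<rho> \<pi>"
    "\<pi> \<in> G \<Longrightarrow> \<pi>' \<in> G \<Longrightarrow> refines A \<pi> \<pi>' \<or> refines A \<pi>' \<pi>"
  using assms unfolding part_chains_def by blast+

lemma part_chains_insert:
  assumes "G \<in> part_chains A \<rho>'" "refines A \<rho> \<rho>'" "\<rho> \<noteq> \<rho>'"
  shows "insert \<rho> G \<in> part_chains A \<rho>" "\<rho> \<notin> G"
proof -
  note G = part_chainsD[OF assms(1)]
  have r: "refines A \<rho> \<pi>" if "\<pi> \<in> G" for \<pi>
    using refines_trans[OF assms(2) G(4)[OF that]] .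
  have "refines A \<rho> \<rho>" using assms(2) refines_refl unfolding refines_def by blast
  then show "insert \<rho> G \<in> part_chains A \<rho>"
    using G r unfolding part_chains_def by blast
  show "\<rho> \<notin> G" using refines_asym[OF assms(2)] G(4) assms(3) by blast
qed

text \<open>Every member of G is strictly coarser than \<rho>, hence has fewer blocks and precedes
  it. This is what the comparison of cardinalities in \<open>prec\<close> is for.\<close>

lemma eps_finest:
  assumes "finite A" "G \<in> part_chains A \<rho>'" "refines A \<rho> \<rho>'" "\<rho> \<noteq> \<rho>'"
  shows "eps \<rho> G = ((-1) ^ card G :: 'k::comm_ring_1)"
proof -
  have "prec \<pi> \<rho>" if "\<pi> \<in> G" for \<pi>
  proof -
    have "refines A \<rho> \<pi>" "\<pi> \<noteq> \<rho>" using part_chains_insert[OF assms(2-4)] part_chainsD(4) that by blast+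
    then show ?thesis using refines_card_less[OF assms(1)] by (auto simp: prec_def)
  qed
  then have "{C \<in> G. prec C \<rho>} = G" by auto
  then show ?thesis by (simp add: eps_def)
qed


section \<open>Subdivision\<close>

text \<open>Linear extensions listed from the root upwards: no cluster is preceded by a proper
  subset of itself, so the last entry is minimal.\<close>

definition orders :: "'a set set \<Rightarrow> 'a set list set" where
  "orders F = {xs. distinct xs \<and> set xs = F \<and> sorted_wrt (\<lambda>a b. \<not> a \<subset> b) xs}"

definition prec_sign :: "'a set \<Rightarrow> 'a set \<Rightarrow> 'k::comm_ring_1" where
  "prec_sign a b = (if prec a b then 1 else -1)"

text \<open>For distinct entries, the sign of the permutation that sorts the list by
  \<open>prec\<close>: each pair out of order contributes -1.\<close>

fun order_sign :: "'a set list \<Rightarrow> 'k::comm_ring_1" where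
  "order_sign [] = 1"
| "order_sign (x # xs) = (\<Prod>y\<leftarrow>xs. prec_sign x y) * order_sign xs"

text \<open>Cut the tree so that the first m vertices of the order lie below the cut. The edges
  through the cut carry the maximal sets among the remaining clusters and the blocks of \<rho>; for
  m = 0 this is the root edge.\<close>

definition flag :: "'a set set \<Rightarrow> 'a set list \<Rightarrow> 'a set set set" where
  "flag \<rho> xs = (\<lambda>m. maximals (\<rho> \<union> set (drop m xs))) ` {..length xs}"

definition subdivide :: "'a set set \<Rightarrow> ('a set set \<Rightarrow>\<^sub>0 'k::comm_ring_1) \<Rightarrow> ('a set set set \<Rightarrow>\<^sub>0 'k)" where
  "subdivide \<rho> = lin_ext (\<lambda>F. \<Sum>xs\<in>orders F. fscale (order_sign xs) (gen (flag \<rho> xs)))"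

lemma lin_subdivide: "lin (subdivide \<rho>)"
  unfolding subdivide_def by (rule lin_lin_ext)

lemma order_sign_append:
  "order_sign (xs @ ys) = order_sign xs * order_sign ys * (\<Prod>x\<leftarrow>xs. \<Prod>y\<leftarrow>ys. prec_sign x y)"
  by (induction xs) (simp_all add: ac_simps)

lemma order_sign_snoc:
  assumes "distinct (xs @ [X])"
  shows "order_sign (xs @ [X]) = (-1) ^ length xs * eps X (set xs) * (order_sign xs :: 'k::comm_ring_1)"
proof -
  have "(\<Prod>x\<leftarrow>xs. prec_sign x X :: 'k) = (-1) ^ length xs * eps X (set xs)"
    using assms
  proof (induction xs)
    case (Cons a xs)
    then show ?case by (simp add: eps_insert prec_sign_def)
  qed (simp add: eps_def)
  then show ?thesis by (simp add: order_sign_append mult.commute)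
qed

lemma maximals_partition: "partition_on A \<rho> \<Longrightarrow> maximals \<rho> = \<rho>"
  using partition_on_subset_eq[of A \<rho>] by (auto simp: maximals_def)

lemma maximals_dominate:
  assumes "finite H" "C \<in> H"
  shows "\<exists>D\<in>maximals H. C \<subseteq> D"
proof -
  obtain D where "D \<in> H" "C \<subseteq> D" "\<forall>B\<in>H. D \<subseteq> B \<longrightarrow> D = B"
    using finite_has_maximal2[OF assms] by metis
  then show ?thesis by (intro bexI[of _ D]) (auto simp: maximals_def)
qed

lemma maximals_coarsen:
  assumes "finite \<rho>" "finite H" "\<forall>b\<in>\<rho>. b \<noteq> X"
  shows "maximals (coarsen \<rho> X \<union> H) = maximals (insert X (\<rho> \<union> H))"
proof (intro subset_antisym subsetI)
  fix C assume C: "C \<in> maximals (coarsen \<rho> X \<union> H)"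
  have "\<not> C \<subset> D" if "D \<in> \<rho>" for D
  proof (cases "D \<subseteq> X")
    case True
    then show ?thesis using C by (auto simp: maximals_def coarsen_def)
  qed (use C that in \<open>auto simp: maximals_def coarsen_def\<close>)
  then show "C \<in> maximals (insert X (\<rho> \<union> H))" using C by (auto simp: maximals_def coarsen_def)
next
  fix C assume C: "C \<in> maximals (insert X (\<rho> \<union> H))"
  then have "\<not> C \<subset> X" by (auto simp: maximals_def)
  then show "C \<in> maximals (coarsen \<rho> X \<union> H)" using C assms(3) by (auto simp: maximals_def coarsen_def)
qed

lemma flag_Nil: "partition_on A \<rho> \<Longrightarrow> flag \<rho> [] = {\<rho>}"
  by (simp add: flag_def maximals_partition)

text \<open>At every cut but the last, X still lies above the cut and dominates the blocks inside
  it, so \<rho> may be replaced by the partition with X merged. Only the last cut sees \<rho>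
  itself.\<close>

lemma flag_snoc:
  assumes "finite A" "partition_on A \<rho>" "cluster A \<rho> X"
  shows "flag \<rho> (xs @ [X]) = insert \<rho> (flag (coarsen \<rho> X) xs)"
proof -
  have X: "\<forall>b\<in>\<rho>. b \<noteq> X" using assms(3) by (auto simp: cluster_def)
  have fin: "finite \<rho>" using assms finite_elements by blast
  let ?f = "\<lambda>m. maximals (\<rho> \<union> set (drop m (xs @ [X])))"
  have "{..length (xs @ [X])} = insert (Suc (length xs)) {..length xs}" by auto
  then have "flag \<rho> (xs @ [X]) = insert (?f (Suc (length xs))) (?f ` {..length xs})"
    unfolding flag_def by (simp only: image_insert)
  moreover have "?f (Suc (length xs)) = \<rho>" using maximals_partition[OF assms(2)] by simp
  moreover have "?f m = maximals (coarsen \<rho> X \<union> set (drop m xs))" if "m \<in> {..length xs}" for m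
    using that maximals_coarsen[OF fin _ X, of "set (drop m xs)"] by simp
  then have "?f ` {..length xs} = flag (coarsen \<rho> X) xs"
    unfolding flag_def by (intro image_cong refl) auto
  ultimately show ?thesis by simp
qed

lemma snoc_in_orders:
  "ys @ [X] \<in> orders F \<longleftrightarrow> X \<in> minimals F \<and> ys \<in> orders (F - {X})"
proof
  assume "ys @ [X] \<in> orders F"
  then have "distinct (ys @ [X])" "F = insert X (set ys)" "sorted_wrt (\<lambda>a b. \<not> a \<subset> b) ys" "\<forall>Y\<in>set ys. \<not> Y \<subset> X"
    by (simp_all add: orders_def sorted_wrt_append)
  then show "X \<in> minimals F \<and> ys \<in> orders (F - {X})"
    unfolding orders_def minimals_def by simp
next
  assume "X \<in> minimals F \<and> ys \<in> orders (F - {X})"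
  then have "distinct ys" "set ys = F - {X}" "sorted_wrt (\<lambda>a b. \<not> a \<subset> b) ys" "X \<in> F" "\<forall>Y\<in>F. \<not> Y \<subset> X"
    unfolding orders_def minimals_def by blast+
  then show "ys @ [X] \<in> orders F"
    by (simp add: orders_def sorted_wrt_append insert_absorb)
qed

lemma orders_snoc:
  assumes "F \<noteq> {}"
  shows "orders F = (\<Union>X\<in>minimals F. (\<lambda>ys. ys @ [X]) ` orders (F - {X}))"
proof -
  show ?thesis
  proof (rule set_eqI)
    fix xs
    show "xs \<in> orders F \<longleftrightarrow> xs \<in> (\<Union>X\<in>minimals F. (\<lambda>ys. ys @ [X]) ` orders (F - {X}))"
    proof (cases xs rule: rev_cases)
      case Nil
      then show ?thesis using assms by (simp add: orders_def image_iff)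
    next
      case (snoc ys X)
      then show ?thesis by (simp add: snoc_in_orders image_iff conj_commute)
    qed
  qed
qed

lemma finite_orders: "finite F \<Longrightarrow> finite (orders F)"
  by (rule finite_subset[OF _ finite_subset_distinct[of F]]) (auto simp: orders_def)

lemma flag_mem:
  assumes "finite A" "partition_on A \<rho>" "F \<in> nested A \<rho>" "xs \<in> orders F"
  shows "flag \<rho> xs \<in> part_chains A \<rho> \<and> card (flag \<rho> xs) = Suc (length xs)"
  using assms(2-)
proof (induction xs arbitrary: \<rho> F rule: rev_induct)
  case Nil
  then have "\<rho> = {A}" "A \<noteq> {}" by (auto simp: orders_def nested_def)
  then show ?case using Nil by (auto simp: flag_Nil part_chains_def intro: refines_refl)
next
  case (snoc X ys)
  have X: "X \<in> minimals F" "ys \<in> orders (F - {X})" "X \<in> F"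
    using snoc.prems(3) minimals_subset unfolding snoc_in_orders by blast+
  have cl: "cluster A \<rho> X" using X nestedD(3)[OF snoc.prems(2)] by blast
  note c = coarsen_partition[OF snoc.prems(1) cl]
  have "flag (coarsen \<rho> X) ys \<in> part_chains A (coarsen \<rho> X) \<and> card (flag (coarsen \<rho> X) ys) = Suc (length ys)"
    using snoc.IH[OF c(1) nested_remove[OF snoc.prems(2) X(1) snoc.prems(1)] X(2)] .
  then show ?case
    using part_chains_insert[OF _ c(2) c(3)[symmetric]] part_chains_finite[OF assms(1)]
    by (auto simp: flag_snoc[OF assms(1) snoc.prems(1) cl])
qed

lemma subdivide_mem:
  assumes "finite A" "partition_on A \<rho>" "x \<in> free_on (nested A \<rho>)"
  shows "subdivide \<rho> x \<in> free_on (part_chains A \<rho>)"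
  using flag_mem[OF assms(1,2)]
  by (intro lin_free_on_mem[OF lin_subdivide assms(3) subspace_free_on])
    (auto simp: subdivide_def intro!: sum_free_on scale_free_on)

lemma subdivide_empty: "partition_on A \<rho> \<Longrightarrow> subdivide \<rho> (gen {}) = gen {\<rho>}"
proof -
  have "orders {} = {[] :: 'a set list}" by (auto simp: orders_def)
  then show "partition_on A \<rho> \<Longrightarrow> subdivide \<rho> (gen {}) = gen {\<rho>}"
    by (simp add: subdivide_def flag_Nil)
qed

text \<open>The linear extensions are grouped by their last entry X; what precedes X orders the tree
  pruned at X. A sign -1 remains because \<open>ins \<rho>\<close> passes
  \<open>length ys + 1\<close> partitions whereas X passes only \<open>length ys\<close>
  clusters.\<close>

lemma subdivide_gen:
  assumes "finite A" "partition_on A \<rho>" "F \<in> nested A \<rho>" "F \<noteq> {}"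
  shows "subdivide \<rho> (gen F) =
    (\<Sum>X\<in>minimals F. - ins \<rho> (subdivide (coarsen \<rho> X) (del X (gen F :: _ \<Rightarrow>\<^sub>0 'k::comm_ring_1))))"
proof -
  have fin: "finite F" using nested_finite assms by blast
  have "subdivide \<rho> (gen F) = (\<Sum>xs\<in>orders F. fscale (order_sign xs) (gen (flag \<rho> xs)) :: _ \<Rightarrow>\<^sub>0 'k)"
    by (simp add: subdivide_def)
  also have "\<dots> = (\<Sum>X\<in>minimals F. \<Sum>xs\<in>(\<lambda>ys. ys @ [X]) ` orders (F - {X}). fscale (order_sign xs) (gen (flag \<rho> xs)))"
    unfolding orders_snoc[OF assms(4)]
    by (rule sum.UNION_disjoint) (use fin finite_orders finite_subset[OF minimals_subset] in auto)
  also have "\<dots> = (\<Sum>X\<in>minimals F. - ins \<rho> (subdivide (coarsen \<rho> X) (del X (gen F))))"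
  proof (rule sum.cong[OF refl])
    fix X assume X: "X \<in> minimals F"
    then have XF: "X \<in> F" by (auto simp: minimals_def)
    then have cl: "cluster A \<rho> X" using nestedD(3)[OF assms(3)] by blast
    note c = coarsen_partition[OF assms(2) cl]
    have "fscale (order_sign (ys @ [X])) (gen (flag \<rho> (ys @ [X]))) =
        - ins \<rho> (fscale (eps X F) (fscale (order_sign ys) (gen (flag (coarsen \<rho> X) ys) :: _ \<Rightarrow>\<^sub>0 'k)))"
      if ys: "ys \<in> orders (F - {X})" for ys
    proof -
      let ?G = "flag (coarsen \<rho> X) ys"
      have G: "?G \<in> part_chains A (coarsen \<rho> X)" "card ?G = Suc (length ys)"
        using flag_mem[OF assms(1) c(1) nested_remove[OF assms(3) X assms(2)] ys] by auto
      have set: "set ys = F - {X}" "distinct (ys @ [X])" using ys by (auto simp: orders_def)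
      have "order_sign (ys @ [X]) = (-1) ^ length ys * eps X F * (order_sign ys :: 'k)"
        using order_sign_snoc[OF set(2), where 'k='k] eps_remove[OF fin XF, of X, where 'k='k] set(1) by simp
      moreover have "ins \<rho> (gen ?G) = fscale (- ((-1) ^ length ys)) (gen (insert \<rho> ?G) :: _ \<Rightarrow>\<^sub>0 'k)"
        using part_chains_insert(2)[OF G(1) c(2) c(3)[symmetric]] part_chains_finite[OF assms(1) G(1)]
          eps_finest[OF assms(1) G(1) c(2) c(3)[symmetric], where 'k='k] G(2)
        by (simp add: ins_gen)
      ultimately show ?thesis
        by (simp add: flag_snoc[OF assms(1,2) cl] lin_scale[OF lin_ins] ac_simps)
    qed
    then have "(\<Sum>xs\<in>(\<lambda>ys. ys @ [X]) ` orders (F - {X}). fscale (order_sign xs) (gen (flag \<rho> xs))) =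
        (\<Sum>ys\<in>orders (F - {X}). - ins \<rho> (fscale (eps X F) (fscale (order_sign ys) (gen (flag (coarsen \<rho> X) ys) :: _ \<Rightarrow>\<^sub>0 'k))))"
      by (subst sum.reindex) (auto intro: inj_onI)
    also have "\<dots> = - ins \<rho> (subdivide (coarsen \<rho> X) (del X (gen F)))"
      using fin XF
      by (simp add: del_gen subdivide_def sum_negf lin_scale[OF lin_lin_ext] lin_scale[OF lin_ins]
          lin_sum[OF lin_ins] fs.scale_sum_right)
    finally show "(\<Sum>xs\<in>(\<lambda>ys. ys @ [X]) ` orders (F - {X}). fscale (order_sign xs) (gen (flag \<rho> xs))) =
      - ins \<rho> (subdivide (coarsen \<rho> X) (del X (gen F :: _ \<Rightarrow>\<^sub>0 'k)))" .
  qed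
  finally show ?thesis .
qed

lemma nested_free_finite: "finite A \<Longrightarrow> x \<in> free_on (nested A \<rho>) \<Longrightarrow> x \<in> free_on {F. finite F}"
  using nested_finite by (auto elim!: free_on_mono)

lemma part_chains_free_finite: "finite A \<Longrightarrow> y \<in> free_on (part_chains A \<rho>) \<Longrightarrow> y \<in> free_on {F. finite F}"
  using part_chains_finite by (auto elim!: free_on_mono)

section \<open>Subdivision as a chain map\<close>

lemma minimals_delete:
  assumes "D \<in> F" "X \<in> minimals (F - {D})" "X \<notin> minimals F"
  shows "D \<subset> X" "D \<in> minimals F"
proof -
  show "D \<subset> X" using assms unfolding minimals_def by blast
  then show "D \<in> minimals F" using assms unfolding minimals_def by blast
qed

lemma minimals_delete_subset: "minimals F - {D} \<subseteq> minimals (F - {D})"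
  unfolding minimals_def by blast

text \<open>On chains starting at \<rho>' the boundary belonging to \<rho> has one face more, the
  removal of \<rho>' itself, unless \<rho>' is also the coarsest partition.\<close>

lemma bd_coarser:
  assumes fin: "finite A" and v: "v \<in> free_on (part_chains A \<rho>')"
    and r: "refines A \<rho> \<rho>'" "\<rho> \<noteq> \<rho>'"
  shows "bd (- {\<rho>, {A}}) v = bd (- {\<rho>', {A}}) v + (if \<rho>' = {A} then 0 else del \<rho>' v)"
proof (rule lin_eq_on_free[OF lin_bd _ v])
  show "lin (\<lambda>v. bd (- {\<rho>', {A}}) v + (if \<rho>' = {A} then 0 else del \<rho>' v))"
    by (cases "\<rho>' = {A}"; simp; intro lin_plus lin_bd lin_del)
  fix G assume G: "G \<in> part_chains A \<rho>'"
  have "finite G" using part_chains_finite fin G by blast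
  have \<rho>: "\<rho> \<notin> G" using part_chains_insert(2)[OF G r] .
  have \<rho>': "\<rho>' \<in> G" using part_chainsD(2)[OF G] .
  show "bd (- {\<rho>, {A}}) (gen G) = bd (- {\<rho>', {A}}) (gen G) + (if \<rho>' = {A} then 0 else del \<rho>' (gen G))"
  proof (cases "\<rho>' = {A}")
    case True
    then have "G \<inter> - {\<rho>, {A}} = G \<inter> - {\<rho>', {A}}" using \<rho> by auto
    then show ?thesis using True by (simp add: bd_gen)
  next
    case False
    then have "G \<inter> - {\<rho>, {A}} = insert \<rho>' (G \<inter> - {\<rho>', {A}})" using \<rho> \<rho>' by auto
    then show ?thesis using False \<open>finite G\<close> by (simp add: bd_gen add.commute)
  qed
qed

text \<open>By induction through the recursion \<open>subdivide_gen\<close>. A face of a chain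
  removes one partition, and only the removal of the one next to \<rho> is not covered by the
  induction: it merges the last two clusters X and Y of an order. If these are incomparable,
  exchanging them gives the same face with opposite sign; if X lies inside Y, the face belongs to
  the tree with X contracted.\<close>

lemma subdivide_bd_gen:
  assumes "finite A" "partition_on A \<rho>" "F \<in> nested A \<rho>"
  shows "bd (- {\<rho>, {A}}) (subdivide \<rho> (gen F)) = subdivide \<rho> (bd (- {A}) (gen F) :: _ \<Rightarrow>\<^sub>0 'k::comm_ring_1)"
  using assms(2,3)
proof (induction "card F" arbitrary: F \<rho> rule: less_induct)
  case less
  note \<rho> = less.prems(1) and F = less.prems(2)
  have fin: "finite F" using nested_finite assms(1) F by blast
  show ?case
  proof (cases "F = {}")
    case True
    then have "\<rho> = {A}" using nestedD(4)[OF F] by blast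
    moreover have "subdivide \<rho> (gen {}) = (gen {\<rho>} :: _ \<Rightarrow>\<^sub>0 'k)" by (rule subdivide_empty[OF \<rho>])
    ultimately show ?thesis using True
      by (simp add: bd_gen lin_zero[OF lin_subdivide])
  next
    case False
    let ?g = "gen F :: _ \<Rightarrow>\<^sub>0 'k"
    define m where "m = minimals F"
    have m: "finite m" "m \<subseteq> F" using fin finite_subset[OF minimals_subset] minimals_subset by (auto simp: m_def)
    have cl: "cluster A \<rho> X" if "X \<in> F" for X using nestedD(3)[OF F that] .
    \<comment> \<open>\<open>T X D\<close>: contract D, then prune X. \<open>W X Y\<close>: prune X,
      then Y, and omit the partition between the two prunings.\<close>
    define T where "T = (\<lambda>X D. ins \<rho> (subdivide (coarsen \<rho> X) (del X (del D ?g))))"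
    define W where "W = (\<lambda>X Y. - ins \<rho> (subdivide (coarsen (coarsen \<rho> X) Y) (del Y (del X ?g))))"
    have A_min: "F = {A}" if "A \<in> m"
      using that nestedD(3)[OF F] unfolding m_def minimals_def cluster_def by blast
    have AF: "A \<in> F" using nestedD(4)[OF F] nested_full[of F A] F False by blast

    have X_part: "- bd (- {\<rho>, {A}}) (ins \<rho> (subdivide (coarsen \<rho> X) (del X ?g))) =
        (\<Sum>D\<in>F - {A}. - T X D) + (if X = A then 0 else \<Sum>Y\<in>minimals (F - {X}). W X Y)"
      if X: "X \<in> m" for X
    proof -
      let ?\<rho>' = "coarsen \<rho> X"
      have XF: "X \<in> F" using X m by blast
      note c = coarsen_partition[OF \<rho> cl[OF XF]]
      have FX: "F - {X} \<in> nested A ?\<rho>'" using nested_remove[OF F _ \<rho>] X by (simp add: m_def)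
      have delX: "del X ?g = fscale (eps X F) (gen (F - {X}))" using fin XF by (simp add: del_gen)
      define u where "u = subdivide ?\<rho>' (del X ?g)"
      have dm: "del X ?g \<in> free_on (nested A ?\<rho>')" unfolding delX using FX by (simp add: scale_free_on)
      have um: "u \<in> free_on (part_chains A ?\<rho>')"
        unfolding u_def by (rule subdivide_mem[OF assms(1) c(1) dm])
      have "bd (- {\<rho>, {A}}) (ins \<rho> u) + ins \<rho> (bd (- {\<rho>, {A}}) u) = 0"
        using bd_ins[OF part_chains_free_finite[OF assms(1) um], of "- {\<rho>, {A}}" \<rho>] by simp
      then have 1: "- bd (- {\<rho>, {A}}) (ins \<rho> u) = ins \<rho> (bd (- {\<rho>, {A}}) u)"
        by (simp add: neg_eq_iff_add_eq_0)
      have 2: "bd (- {\<rho>, {A}}) u = bd (- {?\<rho>', {A}}) u + (if ?\<rho>' = {A} then 0 else del ?\<rho>' u)"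
        by (rule bd_coarser[OF assms(1) um c(2) c(3)[symmetric]])
      have "card (F - {X}) < card F" using fin XF by (rule card_Diff1_less)
      then have "bd (- {?\<rho>', {A}}) (subdivide ?\<rho>' (gen (F - {X}))) =
          subdivide ?\<rho>' (bd (- {A}) (gen (F - {X}) :: _ \<Rightarrow>\<^sub>0 'k))"
        using less.hyps c(1) FX by blast
      then have "bd (- {?\<rho>', {A}}) u = subdivide ?\<rho>' (bd (- {A}) (del X ?g))"
        unfolding u_def delX by (simp add: lin_scale[OF lin_subdivide] lin_scale[OF lin_bd])
      also have "\<dots> = - subdivide ?\<rho>' (del X (bd (- {A}) ?g))"
        by (simp add: bd_del lin_neg[OF lin_subdivide])
      also have "\<dots> = (\<Sum>D\<in>F \<inter> - {A}. - subdivide ?\<rho>' (del X (del D ?g)))"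
        by (simp add: bd_gen lin_sum[OF lin_del] lin_sum[OF lin_subdivide] sum_negf)
      finally have 3: "ins \<rho> (bd (- {?\<rho>', {A}}) u) = (\<Sum>D\<in>F - {A}. - T X D)"
        by (simp add: T_def lin_sum[OF lin_ins] lin_neg[OF lin_ins] Diff_eq)
      \<comment> \<open>The face removing the partition next to \<rho>: \<open>u\<close> is expanded
        once more by the recursion, and \<open>del\<close> undoes the insertion of that
        partition.\<close>
      have 4: "ins \<rho> (del ?\<rho>' u) = (\<Sum>Y\<in>minimals (F - {X}). W X Y)" if "X \<noteq> A"
      proof -
        have ne: "F - {X} \<noteq> {}" using that AF by blast
        have "u = fscale (eps X F) (subdivide ?\<rho>' (gen (F - {X})))"
          unfolding u_def delX by (simp add: lin_scale[OF lin_subdivide])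
        also have "\<dots> = (\<Sum>Y\<in>minimals (F - {X}). - ins ?\<rho>' (subdivide (coarsen ?\<rho>' Y) (del Y (del X ?g))))"
          unfolding subdivide_gen[OF assms(1) c(1) FX ne] delX
          by (simp add: fs.scale_sum_right lin_scale[OF lin_del] lin_scale[OF lin_subdivide] lin_scale[OF lin_ins])
        finally have u: "u = \<dots>" .
        have "del ?\<rho>' (ins ?\<rho>' (subdivide (coarsen ?\<rho>' Y) (del Y (del X ?g)))) =
            subdivide (coarsen ?\<rho>' Y) (del Y (del X ?g))" if Y: "Y \<in> minimals (F - {X})" for Y
        proof (rule del_ins_id)
          have YF: "Y \<in> F - {X}" using Y minimals_subset by blast
          note c' = coarsen_partition[OF c(1) nestedD(3)[OF FX YF]]
          have "del Y (gen (F - {X})) \<in> (free_on (nested A (coarsen ?\<rho>' Y)) :: (_ \<Rightarrow>\<^sub>0 'k) set)"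
            using nested_remove[OF FX Y c(1)] by (simp add: del_gen scale_free_on)
          then have "del Y (del X ?g) \<in> free_on (nested A (coarsen ?\<rho>' Y))"
            unfolding delX by (simp add: lin_scale[OF lin_del] scale_free_on)
          then show "subdivide (coarsen ?\<rho>' Y) (del Y (del X ?g)) \<in> free_on (part_chains A (coarsen ?\<rho>' Y))"
            by (rule subdivide_mem[OF assms(1) c'(1)])
          show "\<And>G. G \<in> part_chains A (coarsen ?\<rho>' Y) \<Longrightarrow> finite G \<and> ?\<rho>' \<notin> G"
            using part_chains_finite[OF assms(1)] part_chains_insert(2)[OF _ c'(2) c'(3)[symmetric]] by blast
        qed
        then have "del ?\<rho>' u = (\<Sum>Y\<in>minimals (F - {X}). - subdivide (coarsen ?\<rho>' Y) (del Y (del X ?g)))"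
          unfolding u by (simp add: lin_sum[OF lin_del] lin_neg[OF lin_del])
        then show ?thesis by (simp add: W_def lin_sum[OF lin_ins] lin_neg[OF lin_ins])
      qed
      show ?thesis unfolding u_def[symmetric]
        using 1 2 3 4 coarsen_eq_full[OF \<rho> cl[OF XF]]
        by (cases "X = A") (simp_all add: lin_add[OF lin_ins] lin_zero[OF lin_ins])
    qed

    have "bd (- {\<rho>, {A}}) (subdivide \<rho> ?g) =
        (\<Sum>X\<in>m. - bd (- {\<rho>, {A}}) (ins \<rho> (subdivide (coarsen \<rho> X) (del X ?g))))"
      unfolding subdivide_gen[OF assms(1) \<rho> F False]
      by (simp add: m_def lin_sum[OF lin_bd] lin_neg[OF lin_bd])
    also have "\<dots> = (\<Sum>X\<in>m. (\<Sum>D\<in>F - {A}. - T X D) + (if X = A then 0 else \<Sum>Y\<in>minimals (F - {X}). W X Y))"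
      by (intro sum.cong refl X_part)
    also have "\<dots> = (\<Sum>X\<in>m. \<Sum>D\<in>F - {A}. - T X D) + (\<Sum>X\<in>m. if X = A then 0 else \<Sum>Y\<in>minimals (F - {X}). W X Y)"
      by (rule sum.distrib)
    also have "(\<Sum>X\<in>m. if X = A then 0 else \<Sum>Y\<in>minimals (F - {X}). W X Y) =
        (\<Sum>X\<in>m - {A}. \<Sum>Y\<in>minimals (F - {X}). W X Y)"
      using m(1) by (intro sum.mono_neutral_cong_right) auto
    \<comment> \<open>A cluster Y that is minimal once X is removed was either minimal before or
      contains X properly. In the second case pruning X and then Y merges the same blocks as pruning
      Y at once, so the term is one of the tree with X contracted.\<close>
    also have "(\<Sum>X\<in>m - {A}. \<Sum>Y\<in>minimals (F - {X}). W X Y) =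
        (\<Sum>X\<in>m - {A}. (\<Sum>Y\<in>m - {A}. W X Y) + (\<Sum>Y\<in>minimals (F - {X}) - m. - T Y X))"
    proof (intro sum.cong refl)
      fix X assume X: "X \<in> m - {A}"
      have XF: "X \<in> F" using X m by blast
      have fm: "finite (minimals (F - {X}))" using fin finite_subset[OF minimals_subset] by blast
      have sub: "m - {X} \<subseteq> minimals (F - {X})" unfolding m_def by (rule minimals_delete_subset)
      have "(\<Sum>Y\<in>minimals (F - {X}). W X Y) =
          (\<Sum>Y\<in>minimals (F - {X}) - (m - {X}). W X Y) + (\<Sum>Y\<in>m - {X}. W X Y)"
        by (rule sum.subset_diff[OF sub fm])
      also have "minimals (F - {X}) - (m - {X}) = minimals (F - {X}) - m"
        using minimals_subset by blast
      also have "(\<Sum>Y\<in>minimals (F - {X}) - m. W X Y) = (\<Sum>Y\<in>minimals (F - {X}) - m. - T Y X)"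
      proof (intro sum.cong refl)
        fix Y assume "Y \<in> minimals (F - {X}) - m"
        then have "X \<subset> Y" using minimals_delete(1)[OF XF] by (simp add: m_def)
        then show "W X Y = - T Y X" by (simp add: W_def T_def coarsen_coarsen_subset)
      qed
      also have "(\<Sum>Y\<in>m - {X}. W X Y) = (\<Sum>Y\<in>m - {A}. W X Y)"
      proof -
        have "A \<notin> m" using A_min X m by auto
        moreover have "W X X = 0" by (simp add: W_def lin_zero[OF lin_subdivide] lin_zero[OF lin_ins])
        ultimately show ?thesis using m(1) X by (simp add: sum.remove[of m X])
      qed
      finally show "(\<Sum>Y\<in>minimals (F - {X}). W X Y) =
          (\<Sum>Y\<in>m - {A}. W X Y) + (\<Sum>Y\<in>minimals (F - {X}) - m. - T Y X)"
        by (simp only: add.commute)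
    qed
    \<comment> \<open>Distinct minimal clusters are incomparable: pruning them in either order gives
      the same partition, while the deletions anticommute, so these terms cancel.\<close>
    also have "\<dots> = (\<Sum>X\<in>m - {A}. \<Sum>Y\<in>minimals (F - {X}) - m. - T Y X)"
    proof -
      have "(\<Sum>X\<in>m - {A}. \<Sum>Y\<in>m - {A}. W X Y) = 0"
      proof (rule sum_antisymmetric)
        show "W X X = 0" for X by (simp add: W_def lin_zero[OF lin_subdivide] lin_zero[OF lin_ins])
        fix X Y assume XY: "X \<in> m - {A}" "Y \<in> m - {A}"
        show "W X Y = - W Y X"
        proof (cases "X = Y")
          case False
          then have "\<not> X \<subseteq> Y" "\<not> Y \<subseteq> X" using XY unfolding m_def minimals_def by blast+
          then show ?thesis unfolding W_def using coarsen_commute[of X Y \<rho>] del_del[of X Y ?g]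
            by (simp add: lin_neg[OF lin_subdivide] lin_neg[OF lin_ins])
        qed (simp add: W_def lin_zero[OF lin_subdivide] lin_zero[OF lin_ins])
      qed (use m in simp)
      then show ?thesis by (simp add: sum.distrib)
    qed
    \<comment> \<open>X is renamed to D. Only the removal of a minimal D can make new clusters
      minimal, so letting D range over all of \<open>F - {A}\<close> adds nothing.\<close>
    also have "\<dots> = (\<Sum>D\<in>F - {A}. \<Sum>X\<in>minimals (F - {D}) - m. - T X D)"
    proof (rule sum.mono_neutral_left)
      show "\<forall>D\<in>F - {A} - (m - {A}). (\<Sum>X\<in>minimals (F - {D}) - m. - T X D) = 0"
      proof
        fix D assume D: "D \<in> F - {A} - (m - {A})"
        then have e: "minimals (F - {D}) - m = {}" using minimals_delete(2)[of D F] by (auto simp: m_def)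
        show "(\<Sum>X\<in>minimals (F - {D}) - m. - T X D) = 0" unfolding e by simp
      qed
    qed (use fin m in auto)
    also have "(\<Sum>X\<in>m. \<Sum>D\<in>F - {A}. - T X D) = (\<Sum>D\<in>F - {A}. \<Sum>X\<in>m. - T X D)"
      by (rule sum.swap)
    also have "(\<Sum>D\<in>F - {A}. \<Sum>X\<in>m. - T X D) + (\<Sum>D\<in>F - {A}. \<Sum>X\<in>minimals (F - {D}) - m. - T X D) =
        (\<Sum>D\<in>F - {A}. \<Sum>X\<in>minimals (F - {D}). - T X D)"
      unfolding sum.distrib[symmetric]
    proof (intro sum.cong refl)
      fix D assume D: "D \<in> F - {A}"
      have fm: "finite (minimals (F - {D}))" using fin finite_subset[OF minimals_subset] by blast
      have "(\<Sum>X\<in>m. - T X D) = (\<Sum>X\<in>m - {D}. - T X D)"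
        using m(1) by (intro sum.mono_neutral_right) (auto simp: T_def lin_zero[OF lin_subdivide] lin_zero[OF lin_ins])
      moreover have "minimals (F - {D}) - m = minimals (F - {D}) - (m - {D})"
        using minimals_subset by blast
      ultimately show "(\<Sum>X\<in>m. - T X D) + (\<Sum>X\<in>minimals (F - {D}) - m. - T X D) = (\<Sum>X\<in>minimals (F - {D}). - T X D)"
        using sum.subset_diff[OF minimals_delete_subset[of F D] fm, of "\<lambda>X. - T X D"]
        by (simp only: m_def add.commute)
    qed
    also have "\<dots> = (\<Sum>D\<in>F - {A}. subdivide \<rho> (del D ?g))"
    proof (intro sum.cong refl)
      fix D assume D: "D \<in> F - {A}"
      have FD: "F - {D} \<in> nested A \<rho>" "F - {D} \<noteq> {}" using nested_delete[OF F] D AF by blast+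
      have "del D ?g = fscale (eps D F) (gen (F - {D}))" using D fin by (simp add: del_gen)
      then show "(\<Sum>X\<in>minimals (F - {D}). - T X D) = subdivide \<rho> (del D ?g)"
        by (simp add: T_def lin_scale[OF lin_subdivide] subdivide_gen[OF assms(1) \<rho> FD] fs.scale_sum_right
            lin_scale[OF lin_del] lin_scale[OF lin_ins])
    qed
    also have "\<dots> = subdivide \<rho> (bd (- {A}) ?g)"
      by (simp add: bd_gen lin_sum[OF lin_subdivide] Diff_eq)
    finally show ?thesis .
  qed
qed

lemma subdivide_bd:
  assumes "finite A" "partition_on A \<rho>" "x \<in> free_on (nested A \<rho>)"
  shows "bd (- {\<rho>, {A}}) (subdivide \<rho> x) = subdivide \<rho> (bd (- {A}) x)"
  by (rule lin_eq_on_free[where f="\<lambda>x. bd (- {\<rho>, {A}}) (subdivide \<rho> x)", OF _ _ assms(3)])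
    (intro lin_comp[OF lin_bd lin_subdivide] lin_comp[OF lin_subdivide lin_bd] subdivide_bd_gen[OF assms(1,2)])+


section \<open>Acyclicity\<close>

text \<open>
  In a nested set without clusters that are unions of two blocks one of which is \<open>p\<close>, toggle
  \<open>S - p\<close>, where \<open>S\<close> is the smallest cluster containing \<open>p\<close>.
\<close>

lemma nested_toggle_acyclic:
  fixes x :: "'a set set \<Rightarrow>\<^sub>0 'k::comm_ring_1"
  assumes fin: "finite A" and \<rho>: "partition_on A \<rho>" "p \<in> \<rho>" "\<rho> \<noteq> {A}"
    and x: "x \<in> free_on {F \<in> nested A \<rho>. \<forall>q\<in>\<rho> - {p}. p \<union> q \<notin> F}" "bd (- {A}) x = 0"
  shows "\<exists>y\<in>free_on {F \<in> nested A \<rho>. \<forall>q\<in>\<rho> - {p}. p \<union> q \<notin> F}. bd (- {A}) y = x"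
proof -
  define K where "K = {F \<in> nested A \<rho>. \<forall>q\<in>\<rho> - {p}. p \<union> q \<notin> F}"
  define least where "least = (\<lambda>F S. S \<in> F \<and> p \<subseteq> S \<and> (\<forall>D\<in>F. p \<subseteq> D \<longrightarrow> S \<subseteq> D))"
  \<comment> \<open>The intersection is a total function and agrees with the least cluster
    containing p whenever there is one.\<close>
  define s where "s = (\<lambda>F. \<Inter>{S \<in> F. p \<subseteq> S})"
  have p: "p \<noteq> {}" "p \<subseteq> A" using \<rho>(1,2) by (auto simp: partition_on_def)
  have s_eq: "s F = S" if "least F S" for F S
    using that unfolding s_def least_def by blast
  have least_s: "least F (s F)" if F: "F \<in> K" for F
  proof -
    have FN: "F \<in> nested A \<rho>" using F by (simp add: K_def)
    have "A \<in> F" using nestedD(4)[OF FN] \<rho>(3) by blast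
    then have ne: "{S \<in> F. p \<subseteq> S} \<noteq> {}" using p(2) by blast
    have "finite {S \<in> F. p \<subseteq> S}" using nested_finite[OF fin FN] by simp
    from finite_has_minimal[OF this ne]
    obtain S where S: "S \<in> {S \<in> F. p \<subseteq> S}" "\<forall>D\<in>{S \<in> F. p \<subseteq> S}. D \<subseteq> S \<longrightarrow> S = D"
      by blast
    \<comment> \<open>Clusters containing the nonempty block p meet, so by laminarity they form a
      chain, and a minimal one is the least.\<close>
    have "S \<subseteq> D" if "D \<in> F" "p \<subseteq> D" for D
    proof -
      have "S \<subseteq> D \<or> D \<subseteq> S \<or> S \<inter> D = {}" using laminarD[OF nestedD(2)[OF FN]] S that by blast
      then show ?thesis using S that p(1) by blast
    qed
    then have "least F S" using S(1) by (simp add: least_def)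
    then show ?thesis using s_eq by simp
  qed
  have KD: "F \<in> nested A \<rho>" "\<And>q. q \<in> \<rho> - {p} \<Longrightarrow> p \<union> q \<notin> F" if "F \<in> K" for F
    using that by (auto simp: K_def)
  have p_cl: "p \<subset> C \<or> p \<inter> C = {}" if "F \<in> K" "C \<in> F" for F C
    using nestedD(3)[OF KD(1)[OF that(1)] that(2)] \<rho>(2) by (simp add: cluster_def)
  have "\<exists>y\<in>free_on K. bd (- {A}) y = x"
  proof (rule toggle_acyclic[where s=s and c="\<lambda>S. S - p" and r=card and N="card A"])
    fix F assume F: "F \<in> K"
    note FN = KD(1)[OF F] and FS = least_s[OF F]
    let ?S = "s F"
    have S: "?S \<in> F" "p \<subset> ?S" "\<And>D. D \<in> F \<Longrightarrow> p \<subseteq> D \<Longrightarrow> ?S \<subseteq> D"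
      using FS p_cl[OF F, of ?S] p(1) unfolding least_def by blast+
    have clS: "cluster A \<rho> ?S" using nestedD(3)[OF FN S(1)] .
    show "finite F" using nested_finite[OF fin FN] .
    show "card ?S \<le> card A" using clS fin by (intro card_mono) (auto simp: cluster_def)
    show "?S - p \<noteq> ?S" using S(2) p(1) by blast
    \<comment> \<open>Removing the block p leaves a union of blocks, and it is not a single block b,
      because then \<open>?S = p \<union> b\<close> would be an excluded cluster.\<close>
    have "cluster A \<rho> (?S - p)"
      unfolding cluster_def
    proof (intro conjI ballI)
      fix b assume b: "b \<in> \<rho>"
      show "b \<subset> ?S - p \<or> b \<inter> (?S - p) = {}"
      proof (cases "b = p")
        case False
        then have "b \<inter> p = {}" using partition_on_eqI[OF \<rho>(1) b \<rho>(2)] by blast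
        moreover have "b \<noteq> ?S - p"
        proof
          assume "b = ?S - p"
          then have "p \<union> b = ?S" using S(2) by blast
          moreover have "p \<union> b \<notin> F" using KD(2)[OF F, of b] b False by simp
          ultimately show False using S(1) by simp
        qed
        moreover have "b \<subset> ?S \<or> b \<inter> ?S = {}" using clS b by (simp add: cluster_def)
        ultimately show ?thesis by blast
      qed blast
    qed (use S(2) clS in \<open>auto simp: cluster_def\<close>)
    moreover have "laminar (insert (?S - p) F)"
    proof -
      have "D \<subseteq> ?S - p \<or> ?S - p \<subseteq> D \<or> D \<inter> (?S - p) = {}" if D: "D \<in> F" for D
      proof (cases "p \<subseteq> D")
        case False
        then have "p \<inter> D = {}" using p_cl[OF F D] by blast
        moreover have "D \<subseteq> ?S \<or> ?S \<subseteq> D \<or> D \<inter> ?S = {}" using laminarD[OF nestedD(2)[OF FN] D S(1)] .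
        ultimately show ?thesis using S(2) p(1) by blast
      qed (use S(3) D in blast)
      then show ?thesis using nestedD(2)[OF FN] unfolding laminar_def by blast
    qed
    ultimately have "insert (?S - p) F \<in> nested A \<rho>"
      using FN unfolding nested_def by blast
    moreover have "p \<union> q \<noteq> ?S - p" for q using p(1) by blast
    ultimately have "insert (?S - p) F \<in> K" using KD(2)[OF F] unfolding K_def by blast
    moreover have "least (insert (?S - p) F) ?S" using S p(1) unfolding least_def by blast
    moreover have "?S - p \<noteq> A" using p by blast
    ultimately show "?S - p \<in> - {A} \<and> insert (?S - p) F \<in> K \<and> s (insert (?S - p) F) = ?S"
      using s_eq by blast
    show down: "F - {D} \<in> K" if "D \<in> F" "D \<in> - {A}" for D
      using nested_delete[OF FN, of D] that KD(2)[OF F] unfolding K_def by blast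
    show "s (F - {D}) = ?S" if "D \<in> F" "D \<in> - {A}" "D \<noteq> ?S" for D
      by (rule s_eq) (use S that in \<open>unfold least_def, blast\<close>)
    \<comment> \<open>With \<open>?S\<close> gone, a larger cluster containing p becomes the least;
      there is one because A itself is not removed.\<close>
    show "card ?S < card (s (F - {?S}))" if "?S \<in> F" "?S \<in> - {A}"
    proof -
      have F': "F - {?S} \<in> K" by (rule down[OF that])
      then have S': "s (F - {?S}) \<in> F - {?S}" "p \<subseteq> s (F - {?S})"
        using least_s[OF F'] unfolding least_def by blast+
      then have "?S \<subset> s (F - {?S})" using S(3) by blast
      moreover have "s (F - {?S}) \<subseteq> A"
        using nestedD(3)[OF KD(1)[OF F'] S'(1)] by (simp add: cluster_def)
      ultimately show ?thesis using fin finite_subset psubset_card_mono by metis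
    qed
  qed (use x in \<open>unfold K_def\<close>)
  then show ?thesis unfolding K_def .
qed

section \<open>Merging two blocks\<close>

lemma cluster_pair:
  assumes "partition_on A \<rho>" "p \<in> \<rho>" "q \<in> \<rho>" "p \<noteq> q"
  shows "cluster A \<rho> (p \<union> q)"
proof -
  have "p \<noteq> {}" "q \<noteq> {}" "p \<inter> q = {}" "p \<subseteq> A" "q \<subseteq> A"
    using assms partition_on_eqI[OF assms(1-3)] by (auto simp: partition_on_def)
  moreover have "b \<inter> p = {}" if "b \<in> \<rho>" "b \<noteq> p" for b using partition_on_eqI[OF assms(1) that(1) assms(2)] that by blast
  moreover have "b \<inter> q = {}" if "b \<in> \<rho>" "b \<noteq> q" for b using partition_on_eqI[OF assms(1) that(1) assms(3)] that by blast
  ultimately show ?thesis unfolding cluster_def by blast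
qed

lemma cluster_subset_pair:
  assumes "partition_on A \<rho>" "p \<in> \<rho>" "q \<in> \<rho>" "cluster A \<rho> C" "C \<subseteq> p \<union> q"
  shows "C = p \<union> q"
proof -
  have "p \<subset> C \<or> p \<inter> C = {}" "q \<subset> C \<or> q \<inter> C = {}" "C \<noteq> {}"
    using assms(2-4) by (auto simp: cluster_def)
  then show ?thesis using assms(5) by blast
qed

lemma pair_minimal:
  assumes "partition_on A \<rho>" "p \<in> \<rho>" "q \<in> \<rho>" "F \<in> nested A \<rho>" "p \<union> q \<in> F"
  shows "p \<union> q \<in> minimals F"
  using cluster_subset_pair[OF assms(1-3) nestedD(3)[OF assms(4)]] assms(5)
  unfolding minimals_def by blast

text \<open>Merging two blocks is a covering relation of the partition lattice: a partition in
  between either has a block containing both p and q, or separates them and is then as fine as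
  \<rho>.\<close>

lemma refines_coarsen_pair:
  assumes "partition_on A \<rho>" "p \<in> \<rho>" "q \<in> \<rho>" "p \<noteq> q"
    and "refines A \<rho> \<pi>" "refines A \<pi> (coarsen \<rho> (p \<union> q))"
  shows "\<pi> = \<rho> \<or> \<pi> = coarsen \<rho> (p \<union> q)"
proof (cases "\<exists>B\<in>\<pi>. p \<union> q \<subseteq> B")
  case True
  have "partition_on A (coarsen \<rho> (p \<union> q))" "partition_on A \<pi>" "\<forall>b\<in>\<rho>. \<exists>B\<in>\<pi>. b \<subseteq> B"
    using assms(5,6) unfolding refines_def by blast+
  then have "refines A (coarsen \<rho> (p \<union> q)) \<pi>"
    using True unfolding refines_def coarsen_def by blast
  then show ?thesis using refines_asym[OF assms(6)] by blast
next
  case False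
  have \<pi>: "partition_on A \<pi>" "\<And>b. b \<in> \<rho> \<Longrightarrow> \<exists>B\<in>\<pi>. b \<subseteq> B"
    using assms(5) unfolding refines_def by blast+
  have block: "b \<subseteq> B \<or> b \<inter> B = {}" if b: "b \<in> \<rho>" and B: "B \<in> \<pi>" for b B
  proof -
    obtain B' where B': "B' \<in> \<pi>" "b \<subseteq> B'" using \<pi>(2)[OF b] by blast
    show ?thesis using partition_on_eqI[OF \<pi>(1) B'(1) B] B'(2) by blast
  qed
  have "\<exists>b\<in>\<rho>. B \<subseteq> b" if B: "B \<in> \<pi>" for B
  proof -
    obtain C where C: "C \<in> coarsen \<rho> (p \<union> q)" "B \<subseteq> C" using assms(6) B unfolding refines_def by blast
    show ?thesis
    proof (cases "C \<in> \<rho>")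
      case False
      then have "B \<subseteq> p \<union> q" using C unfolding coarsen_def by blast
      moreover have "p \<inter> B = {} \<or> q \<inter> B = {}"
        using block[OF assms(2) B] block[OF assms(3) B] \<open>\<not> (\<exists>B\<in>\<pi>. p \<union> q \<subseteq> B)\<close> B by blast
      ultimately show ?thesis using assms(2,3) by blast
    qed (use C in blast)
  qed
  then have "refines A \<pi> \<rho>" using assms(1) \<pi>(1) unfolding refines_def by blast
  then show ?thesis using refines_asym[OF assms(5)] by blast
qed

text \<open>If p lies properly inside a block of \<pi>, this splits it off from that block: the
  common refinement of \<pi> and \<open>{p, A - p}\<close>.\<close>

definition isolate :: "'a set \<Rightarrow> 'a set set \<Rightarrow> 'a set set" where
  "isolate p \<pi> = insert p ((\<lambda>b. b - p) ` \<pi>)"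

text \<open>Being the coarsest refinement of \<pi> that has p as a block is what lets it fit into a
  chain. It equals \<rho> only if \<pi> joins p to a single other block; chains through such a \<pi>
  are kept out of the toggling, since \<rho> itself cannot be toggled.\<close>

lemma isolate:
  assumes \<rho>: "partition_on A \<rho>" "p \<in> \<rho>" and \<pi>: "refines A \<rho> \<pi>" "p \<notin> \<pi>"
  shows "partition_on A (isolate p \<pi>)" "refines A (isolate p \<pi>) \<pi>"
    "\<And>\<pi>'. refines A \<pi>' \<pi> \<Longrightarrow> p \<in> \<pi>' \<Longrightarrow> refines A \<pi>' (isolate p \<pi>)"
    "isolate p \<pi> = \<rho> \<Longrightarrow> \<exists>q\<in>\<rho> - {p}. \<pi> = coarsen \<rho> (p \<union> q)"
proof -
  have p: "p \<noteq> {}" "p \<subseteq> A" using \<rho> by (auto simp: partition_on_def)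
  have \<pi>p: "partition_on A \<pi>" using \<pi>(1) by (simp add: refines_def)
  obtain b0 where b0: "b0 \<in> \<pi>" "p \<subseteq> b0" using \<pi>(1) \<rho>(2) unfolding refines_def by blast
  have other: "b \<inter> p = {}" if "b \<in> \<pi>" "b \<noteq> b0" for b
    using partition_on_eqI[OF \<pi>p that(1) b0(1)] that(2) b0(2) by blast
  have ne: "b - p \<noteq> {}" if "b \<in> \<pi>" for b
  proof (cases "b = b0")
    case True
    have "b0 \<noteq> p" using b0(1) \<pi>(2) by metis
    then show ?thesis using True b0(2) by blast
  next
    case False
    then have "b \<inter> p = {}" using other that by blast
    moreover have "b \<noteq> {}" using \<pi>p that by (auto simp: partition_on_def)
    ultimately show ?thesis by blast
  qed
  show iso: "partition_on A (isolate p \<pi>)"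
  proof (rule partition_onI)
    show "\<Union> (isolate p \<pi>) = A"
      using partition_onD1[OF \<pi>p] p(2) unfolding isolate_def by blast
    show "{} \<notin> isolate p \<pi>" using p(1) ne unfolding isolate_def by blast
    fix b c assume bc: "b \<in> isolate p \<pi>" "c \<in> isolate p \<pi>" "b \<noteq> c"
    have "disjnt (b' - p) (c' - p)" if "b' \<in> \<pi>" "c' \<in> \<pi>" "b' - p \<noteq> c' - p" for b' c'
      using partition_on_eqI[OF \<pi>p that(1,2)] that(3) unfolding disjnt_def by blast
    moreover have "disjnt p (b' - p)" for b' by (auto simp: disjnt_def)
    ultimately show "disjnt b c" using bc unfolding isolate_def by (auto simp: disjnt_sym)
  qed
  show "refines A (isolate p \<pi>) \<pi>"
    using iso \<pi>p b0 unfolding refines_def isolate_def by blast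
  show finer: "refines A \<pi>' (isolate p \<pi>)" if r: "refines A \<pi>' \<pi>" and p': "p \<in> \<pi>'" for \<pi>'
  proof -
    have \<pi>': "partition_on A \<pi>'" using r by (simp add: refines_def)
    have "\<exists>c\<in>isolate p \<pi>. b \<subseteq> c" if b: "b \<in> \<pi>'" for b
    proof (cases "b = p")
      case False
      then have "b \<inter> p = {}" using partition_on_eqI[OF \<pi>' b p'] by blast
      moreover obtain c where c: "c \<in> \<pi>" "b \<subseteq> c" using r b unfolding refines_def by blast
      ultimately have "b \<subseteq> c - p" by blast
      moreover have "c - p \<in> isolate p \<pi>" using c(1) by (simp add: isolate_def)
      ultimately show ?thesis by blast
    qed (simp add: isolate_def)
    then show ?thesis using \<pi>' iso unfolding refines_def by blast
  qed
  show "\<exists>q\<in>\<rho> - {p}. \<pi> = coarsen \<rho> (p \<union> q)" if e: "isolate p \<pi> = \<rho>"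
  proof
    let ?q = "b0 - p"
    have "?q \<in> isolate p \<pi>" using b0(1) by (simp add: isolate_def)
    then have "?q \<in> \<rho>" by (simp only: e)
    moreover have "?q \<noteq> p" using p(1) by blast
    ultimately show q: "?q \<in> \<rho> - {p}" by blast
    have pq: "p \<union> ?q = b0" using b0(2) by blast
    have cl: "cluster A \<rho> b0" using cluster_pair[OF \<rho>, of ?q] q pq by auto
    note c = coarsen_partition[OF \<rho>(1) cl]
    have rb: "refines A (coarsen \<rho> b0) \<pi>"
      using c(1) \<pi>p \<pi>(1) b0(1) unfolding refines_def coarsen_def by blast
    have "\<exists>c\<in>coarsen \<rho> b0. b \<subseteq> c" if b: "b \<in> \<pi>" for b
    proof (cases "b = b0")
      case False
      then have "b - p = b" using other[OF b] by blast
      moreover have "b - p \<in> isolate p \<pi>" using b by (simp add: isolate_def)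
      ultimately have "b \<in> \<rho>" by (simp add: e)
      then show ?thesis using c(2) unfolding refines_def by blast
    qed (simp add: coarsen_def)
    then have "refines A \<pi> (coarsen \<rho> b0)" using \<pi>p c(1) unfolding refines_def by blast
    then have "\<pi> = coarsen \<rho> b0" using rb by (rule refines_asym)
    then show "\<pi> = coarsen \<rho> (p \<union> ?q)" by (simp only: pq)
  qed
qed

text \<open>
  In a chain without partitions obtained from \<open>\<rho>\<close> by merging \<open>p\<close> with another block, toggle
  \<open>isolate p \<pi>\<close>, where \<open>\<pi>\<close> is the finest partition of the chain of which \<open>p\<close> is not a block.
\<close>

lemma part_chains_toggle_acyclic:
  fixes y :: "'a set set set \<Rightarrow>\<^sub>0 'k::comm_ring_1"
  assumes fin: "finite A" and \<rho>: "partition_on A \<rho>" "p \<in> \<rho>" "\<rho> \<noteq> {A}"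
    and y: "y \<in> free_on {G \<in> part_chains A \<rho>. \<forall>q\<in>\<rho> - {p}. coarsen \<rho> (p \<union> q) \<notin> G}" "bd (- {\<rho>, {A}}) y = 0"
  shows "\<exists>z\<in>free_on {G \<in> part_chains A \<rho>. \<forall>q\<in>\<rho> - {p}. coarsen \<rho> (p \<union> q) \<notin> G}. bd (- {\<rho>, {A}}) z = y"
proof -
  define K where "K = {G \<in> part_chains A \<rho>. \<forall>q\<in>\<rho> - {p}. coarsen \<rho> (p \<union> q) \<notin> G}"
  define least where "least = (\<lambda>G \<pi>. \<pi> \<in> G \<and> p \<notin> \<pi> \<and> (\<forall>\<pi>'\<in>G. p \<notin> \<pi>' \<longrightarrow> refines A \<pi> \<pi>'))"
  define s where "s = (\<lambda>G. THE \<pi>. least G \<pi>)"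
  have p: "p \<noteq> {}" "p \<subseteq> A" "p \<noteq> A"
    using \<rho> partition_on_full[OF \<rho>(1)] by (auto simp: partition_on_def)
  have s_eq: "s G = \<pi>" if "least G \<pi>" for G \<pi>
    unfolding s_def
  proof (rule the_equality)
    show "least G \<pi>" by fact
    fix \<pi>' assume "least G \<pi>'"
    then show "\<pi>' = \<pi>" using that by (intro refines_asym[of A]) (simp_all add: least_def)
  qed
  have least_s: "least G (s G)" if G: "G \<in> K" for G
  proof -
    have GP: "G \<in> part_chains A \<rho>" using G by (simp add: K_def)
    let ?H = "{\<pi> \<in> G. p \<notin> \<pi>}"
    \<comment> \<open>\<open>{A}\<close> does not have p as a block, so the set is nonempty; its
      finest member is found as the one with the most blocks.\<close>
    have "{A} \<in> ?H" using part_chainsD(3)[OF GP] p(3) by simp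
    moreover have fH: "finite (card ` ?H)" using part_chains_finite[OF fin GP] by simp
    ultimately have "Max (card ` ?H) \<in> card ` ?H" by (intro Max_in) blast+
    then obtain \<pi> where \<pi>0: "\<pi> \<in> ?H" "Max (card ` ?H) = card \<pi>" by (rule imageE)
    have \<pi>: "\<pi> \<in> ?H" "\<And>\<pi>'. \<pi>' \<in> ?H \<Longrightarrow> card \<pi>' \<le> card \<pi>"
      unfolding \<pi>0(2)[symmetric] using \<pi>0(1) fH by (blast, intro Max_ge imageI)
    have "refines A \<pi> \<pi>'" if "\<pi>' \<in> G" "p \<notin> \<pi>'" for \<pi>'
    proof (rule ccontr)
      assume n: "\<not> refines A \<pi> \<pi>'"
      then have r: "refines A \<pi>' \<pi>" using part_chainsD(5)[OF GP] \<pi>(1) that(1) by blast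
      moreover have "\<pi>' \<noteq> \<pi>" using n r by blast
      ultimately have "card \<pi> < card \<pi>'" by (rule refines_card_less[OF fin])
      then show False using \<pi>(2)[of \<pi>'] that by simp
    qed
    then have "least G \<pi>" using \<pi>(1) by (simp add: least_def)
    then show ?thesis using s_eq by simp
  qed
  have KD: "G \<in> part_chains A \<rho>" "\<And>q. q \<in> \<rho> - {p} \<Longrightarrow> coarsen \<rho> (p \<union> q) \<notin> G" if "G \<in> K" for G
    using that by (auto simp: K_def)
  have "\<exists>z\<in>free_on K. bd (- {\<rho>, {A}}) z = y"
  \<comment> \<open>The rank grows as \<open>s G\<close> gets coarser. The difference is not
    truncated, as no member of the chain has more blocks than \<rho>.\<close>
  proof (rule toggle_acyclic[where s=s and c="isolate p" and r="\<lambda>\<pi>. card \<rho> - card \<pi>" and N="card \<rho>"])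
    fix G assume G: "G \<in> K"
    note GP = KD(1)[OF G] and GS = least_s[OF G]
    let ?\<pi> = "s G" and ?\<pi>' = "isolate p (s G)"
    have S: "?\<pi> \<in> G" "p \<notin> ?\<pi>" "\<And>\<pi>'. \<pi>' \<in> G \<Longrightarrow> p \<notin> \<pi>' \<Longrightarrow> refines A ?\<pi> \<pi>'"
      using GS unfolding least_def by blast+
    have r: "refines A \<rho> ?\<pi>" using part_chainsD(4)[OF GP S(1)] .
    note iso = isolate[OF \<rho>(1,2) r S(2)]
    have pi': "p \<in> ?\<pi>'" by (simp add: isolate_def)
    show "finite G" using part_chains_finite[OF fin GP] .
    show "card \<rho> - card ?\<pi> \<le> card \<rho>" by simp
    show "?\<pi>' \<noteq> ?\<pi>" using pi' S(2) by blast
    have fine: "refines A \<pi> ?\<pi>'" if "\<pi> \<in> G" "p \<in> \<pi>" for \<pi>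
    proof (rule iso(3)[OF _ that(2)])
      obtain b where b: "b \<in> ?\<pi>" "p \<subseteq> b" using r \<rho>(2) unfolding refines_def by blast
      have "\<not> refines A ?\<pi> \<pi>"
      proof
        assume R: "refines A ?\<pi> \<pi>"
        then obtain c where c: "c \<in> \<pi>" "b \<subseteq> c" using b unfolding refines_def by blast
        have "p = c" using R b c p(1) by (intro partition_on_eqI[of A \<pi>, OF _ that(2) c(1)]) (auto simp: refines_def)
        then show False using b c S(2) by auto
      qed
      then show "refines A \<pi> ?\<pi>" using part_chainsD(5)[OF GP that(1) S(1)] by blast
    qed
    have coarse: "refines A ?\<pi>' \<pi>" if "\<pi> \<in> G" "p \<notin> \<pi>" for \<pi>
      using refines_trans[OF iso(2) S(3)[OF that]] .
    have "refines A \<rho> ?\<pi>'" using iso(3)[OF r \<rho>(2)] .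
    moreover have "refines A ?\<pi>' ?\<pi>'" using refines_refl[OF iso(1)] .
    moreover have "refines A ?\<pi>' \<pi> \<or> refines A \<pi> ?\<pi>'" if "\<pi> \<in> G" for \<pi>
      using fine[OF that] coarse[OF that] by blast
    ultimately have "insert ?\<pi>' G \<in> part_chains A \<rho>"
      using GP unfolding part_chains_def by blast
    moreover have "coarsen \<rho> (p \<union> q) \<noteq> ?\<pi>'" if "q \<in> \<rho> - {p}" for q
    proof -
      have "q \<noteq> {}" "q \<inter> p = {}" using that \<rho> partition_on_eqI[OF \<rho>(1), of q p] by (auto simp: partition_on_def)
      then have "p \<notin> coarsen \<rho> (p \<union> q)" unfolding coarsen_def by blast
      then show ?thesis using pi' by metis
    qed
    ultimately have "insert ?\<pi>' G \<in> K" using KD(2)[OF G] unfolding K_def by blast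
    moreover have "least (insert ?\<pi>' G) ?\<pi>" using S pi' unfolding least_def by blast
    moreover have "?\<pi>' \<noteq> {A}" using pi' p(3) by auto
    \<comment> \<open>Isolating p leads back to \<rho> only from a partition that K forbids in
      G.\<close>
    moreover have "?\<pi>' \<noteq> \<rho>" using iso(4) KD(2)[OF G] S(1) by metis
    ultimately show "?\<pi>' \<in> - {\<rho>, {A}} \<and> insert ?\<pi>' G \<in> K \<and> s (insert ?\<pi>' G) = ?\<pi>"
      using s_eq by blast
    show down: "G - {D} \<in> K" if "D \<in> G" "D \<in> - {\<rho>, {A}}" for D
      using part_chains_delete[OF GP, of D] that KD(2)[OF G] unfolding K_def by blast
    show "s (G - {D}) = ?\<pi>" if "D \<in> G" "D \<in> - {\<rho>, {A}}" "D \<noteq> ?\<pi>" for D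
      by (rule s_eq) (use S that in \<open>unfold least_def, blast\<close>)
    show "card \<rho> - card ?\<pi> < card \<rho> - card (s (G - {?\<pi>}))" if "?\<pi> \<in> G" "?\<pi> \<in> - {\<rho>, {A}}"
    proof -
      have G': "G - {?\<pi>} \<in> K" by (rule down[OF that])
      then have S': "s (G - {?\<pi>}) \<in> G - {?\<pi>}" "p \<notin> s (G - {?\<pi>})"
        using least_s[OF G'] unfolding least_def by blast+
      have "card (s (G - {?\<pi>})) < card ?\<pi>"
        using S(3)[of "s (G - {?\<pi>})"] S' by (intro refines_card_less[OF fin]) blast+
      moreover have "card ?\<pi> < card \<rho>" using that by (intro refines_card_less[OF fin r]) auto
      ultimately show ?thesis by linarith
    qed
  qed (use y in \<open>unfold K_def\<close>)
  then show ?thesis unfolding K_def .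
qed


section \<open>Induction on the number of blocks\<close>

text \<open>The counterpart for chains of \<open>del (p \<union> q)\<close> on nested sets: from the
  chains through \<rho>' it removes \<rho>, leaving chains that start at \<rho>' when \<rho>' covers
  \<rho>.\<close>

definition strip :: "'a set set \<Rightarrow> 'a set set \<Rightarrow> ('a set set set \<Rightarrow>\<^sub>0 'k::comm_ring_1) \<Rightarrow> ('a set set set \<Rightarrow>\<^sub>0 'k)" where
  "strip \<rho> \<rho>' y = del \<rho> (restrict {G. \<rho>' \<in> G} y)"

lemma lin_strip: "lin (strip \<rho> \<rho>')"
  unfolding strip_def[abs_def] by (rule lin_comp[OF lin_del lin_restrict])

lemma strip_gen: "strip \<rho> \<rho>' (gen G) = (if \<rho>' \<in> G then del \<rho> (gen G) else 0)"
  by (simp add: strip_def restrict_gen lin_zero[OF lin_del])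

context
  fixes A :: "'a set" and \<rho> p q
  assumes fin: "finite A" and part: "partition_on A \<rho>" and pq: "p \<in> \<rho>" "q \<in> \<rho>" "p \<noteq> q"
begin

lemma pair_coarsen:
  "cluster A \<rho> (p \<union> q)" "partition_on A (coarsen \<rho> (p \<union> q))" "refines A \<rho> (coarsen \<rho> (p \<union> q))"
  "\<rho> \<noteq> coarsen \<rho> (p \<union> q)"
proof -
  show cl: "cluster A \<rho> (p \<union> q)" using cluster_pair[OF part pq] .
  note c = coarsen_partition[OF part cl]
  show "partition_on A (coarsen \<rho> (p \<union> q))" "refines A \<rho> (coarsen \<rho> (p \<union> q))" by fact+
  show "\<rho> \<noteq> coarsen \<rho> (p \<union> q)" using c(3) by metis
qed

lemma card_coarsen_pair: "Suc (card (coarsen \<rho> (p \<union> q))) = card \<rho>"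
proof -
  have ne: "p \<noteq> {}" "q \<noteq> {}" "p \<inter> q = {}"
    using part pq partition_on_eqI[OF part pq(1,2)] by (auto simp: partition_on_def)
  have "b \<subseteq> p \<union> q \<longleftrightarrow> b = p \<or> b = q" if b: "b \<in> \<rho>" for b
  proof
    assume "b \<subseteq> p \<union> q"
    moreover have "b \<noteq> {}" using b part by (auto simp: partition_on_def)
    ultimately have "b \<inter> p \<noteq> {} \<or> b \<inter> q \<noteq> {}" by blast
    then show "b = p \<or> b = q" using partition_on_eqI[OF part b] pq by metis
  qed blast
  then have "coarsen \<rho> (p \<union> q) = insert (p \<union> q) (\<rho> - {p, q})"
    unfolding coarsen_def by blast
  moreover have "p \<union> q \<notin> \<rho>"
  proof
    assume "p \<union> q \<in> \<rho>"
    then have "p = p \<union> q" "q = p \<union> q" using partition_on_subset_eq[OF part] pq by blast+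
    then show False using pq(3) by metis
  qed
  moreover have "finite \<rho>" using finite_elements[OF fin part] .
  moreover have "card (\<rho> - {p, q}) = card \<rho> - 2" using pq by (simp add: card_Diff_subset)
  moreover have "card {p, q} \<le> card \<rho>" using pq \<open>finite \<rho>\<close> by (intro card_mono) auto
  ultimately show ?thesis using pq(3) by simp
qed

lemma nested_del_pair:
  "F \<in> nested A \<rho> \<Longrightarrow> p \<union> q \<in> F \<Longrightarrow> F - {p \<union> q} \<in> nested A (coarsen \<rho> (p \<union> q))"
  using nested_remove[OF _ pair_minimal[OF part pq(1,2)] part] by blast

lemma nested_ins_pair:
  "F \<in> nested A (coarsen \<rho> (p \<union> q)) \<Longrightarrow> insert (p \<union> q) F \<in> nested A \<rho> \<and> p \<union> q \<notin> F"
  using nested_insert[OF _ pair_coarsen(1)] by blast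

lemma del_pair_mem: "x \<in> free_on (nested A \<rho>) \<Longrightarrow> del (p \<union> q) x \<in> free_on (nested A (coarsen \<rho> (p \<union> q)))"
  by (rule del_mem) (use nested_del_pair in blast)+

lemma ins_pair_mem: "x \<in> free_on (nested A (coarsen \<rho> (p \<union> q))) \<Longrightarrow> ins (p \<union> q) x \<in> free_on (nested A \<rho>)"
  by (rule ins_mem) (use nested_ins_pair in blast)+

lemma del_ins_pair:
  assumes "x \<in> free_on (nested A (coarsen \<rho> (p \<union> q)))"
  shows "del (p \<union> q) (ins (p \<union> q) x) = x"
  by (rule del_ins_id[OF assms]) (use nested_finite[OF fin] nested_ins_pair in blast)

text \<open>The partition with p and q merged covers \<rho>, so no other member of the chain lies
  strictly between, and every member besides \<rho> is comparable with it from above.\<close>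

lemma part_chains_remove:
  assumes "G \<in> part_chains A \<rho>" "coarsen \<rho> (p \<union> q) \<in> G"
  shows "G - {\<rho>} \<in> part_chains A (coarsen \<rho> (p \<union> q))"
proof -
  let ?\<rho>' = "coarsen \<rho> (p \<union> q)"
  note G = part_chainsD[OF assms(1)]
  have "refines A ?\<rho>' \<pi>" if \<pi>: "\<pi> \<in> G - {\<rho>}" for \<pi>
  proof (rule ccontr)
    assume n: "\<not> refines A ?\<rho>' \<pi>"
    then have "refines A \<pi> ?\<rho>'" using G(5)[of \<pi> ?\<rho>'] \<pi> assms(2) by blast
    then have "\<pi> = ?\<rho>'" using refines_coarsen_pair[OF part pq _ ] G(4)[of \<pi>] \<pi> by blast
    then show False using n refines_refl[OF pair_coarsen(2)] by simp
  qed
  moreover have "{A} \<noteq> \<rho>"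
  proof
    assume "{A} = \<rho>"
    then show False using pq by auto
  qed
  ultimately show ?thesis using G assms(2) pair_coarsen(4) unfolding part_chains_def by blast
qed

lemma strip_mem: "y \<in> free_on (part_chains A \<rho>) \<Longrightarrow> strip \<rho> (coarsen \<rho> (p \<union> q)) y \<in> free_on (part_chains A (coarsen \<rho> (p \<union> q)))"
proof -
  assume y: "y \<in> free_on (part_chains A \<rho>)"
  show ?thesis unfolding strip_def
    by (rule del_mem[OF restrict_free_on[OF y]]) (use part_chains_remove in blast)
qed

lemma ins_finest_mem:
  "y \<in> free_on (part_chains A (coarsen \<rho> (p \<union> q))) \<Longrightarrow> ins \<rho> y \<in> free_on (part_chains A \<rho>)"
  by (rule ins_mem) (use part_chains_insert[OF _ pair_coarsen(3,4)] in blast)+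

lemma strip_ins_same:
  assumes y: "y \<in> free_on (part_chains A (coarsen \<rho> (p \<union> q)))"
  shows "strip \<rho> (coarsen \<rho> (p \<union> q)) (ins \<rho> y) = y"
proof -
  let ?\<rho>' = "coarsen \<rho> (p \<union> q)"
  have "ins \<rho> y \<in> free_on {G. ?\<rho>' \<in> G}"
    by (rule ins_mem[OF y]) (use part_chainsD(2) in blast)
  then have "restrict {G. ?\<rho>' \<in> G} (ins \<rho> y) = ins \<rho> y" by (rule restrict_id)
  then show ?thesis unfolding strip_def
    using del_ins_id[OF y, of \<rho>] part_chains_finite[OF fin] part_chains_insert(2)[OF _ pair_coarsen(3,4)] by simp
qed

text \<open>Chains that lose the merged partition are killed by \<open>strip\<close>, so its removal
  contributes nothing on the left; on the right it has become an end of the chain. The sign comes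
  from \<open>del \<rho>\<close> passing the other deletions.\<close>

lemma strip_bd:
  assumes y: "y \<in> free_on (part_chains A \<rho>)"
  shows "strip \<rho> (coarsen \<rho> (p \<union> q)) (bd (- {\<rho>, {A}}) y) =
    - bd (- {coarsen \<rho> (p \<union> q), {A}}) (strip \<rho> (coarsen \<rho> (p \<union> q)) y)"
    (is "strip \<rho> ?\<rho>' _ = _")
proof (rule lin_eq_on_free[where f="\<lambda>y. strip \<rho> ?\<rho>' (bd (- {\<rho>, {A}}) y)", OF _ _ y])
  show "lin (\<lambda>y. strip \<rho> ?\<rho>' (bd (- {\<rho>, {A}}) y :: 'a set set set \<Rightarrow>\<^sub>0 'b))"
    by (rule lin_comp[OF lin_strip lin_bd])
  show "lin (\<lambda>y. - bd (- {?\<rho>', {A}}) (strip \<rho> ?\<rho>' y :: 'a set set set \<Rightarrow>\<^sub>0 'b))"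
    by (intro lin_uminus lin_comp[OF lin_bd lin_strip])
  fix G assume G: "G \<in> part_chains A \<rho>"
  let ?g = "gen G :: 'a set set set \<Rightarrow>\<^sub>0 'b"
  have fG: "finite G" using part_chains_finite[OF fin G] .
  have d: "strip \<rho> ?\<rho>' (del D ?g) = (if ?\<rho>' \<in> G - {D} then del \<rho> (del D ?g) else 0)" if "D \<in> G" for D
    using that fG by (simp add: del_gen lin_scale[OF lin_strip] strip_gen lin_scale[OF lin_del])
  have "strip \<rho> ?\<rho>' (bd (- {\<rho>, {A}}) ?g) = (\<Sum>D\<in>G \<inter> - {\<rho>, {A}}. if ?\<rho>' \<in> G - {D} then del \<rho> (del D ?g) else 0)"
    by (simp add: bd_gen lin_sum[OF lin_strip] d)
  also have "\<dots> = - bd (- {?\<rho>', {A}}) (strip \<rho> ?\<rho>' ?g)"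
  proof (cases "?\<rho>' \<in> G")
    case True
    have "(\<Sum>D\<in>G \<inter> - {\<rho>, {A}}. if ?\<rho>' \<in> G - {D} then del \<rho> (del D ?g) else 0) =
        (\<Sum>D\<in>G \<inter> - {?\<rho>', {A}}. del \<rho> (del D ?g))"
      using fG True by (intro sum.mono_neutral_cong) auto
    also have "\<dots> = - bd (- {?\<rho>', {A}}) (del \<rho> ?g)"
      by (simp add: bd_del bd_gen lin_sum[OF lin_del])
    finally show ?thesis using True by (simp add: strip_gen)
  qed (simp add: strip_gen lin_zero[OF lin_bd])
  finally show "strip \<rho> ?\<rho>' (bd (- {\<rho>, {A}}) ?g) = - bd (- {?\<rho>', {A}}) (strip \<rho> ?\<rho>' ?g)" .
qed

text \<open>A linear extension with last cluster X gives a chain whose second finest member is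
  \<rho> with X merged. The chain runs through the partition merging p and q only if X lies in
  \<open>p \<union> q\<close>, hence equals it; and \<open>p \<union> q\<close> is always minimal,
  so it can be the last entry.\<close>

lemma strip_subdivide:
  assumes x: "x \<in> free_on (nested A \<rho>)"
  shows "strip \<rho> (coarsen \<rho> (p \<union> q)) (subdivide \<rho> x) = - subdivide (coarsen \<rho> (p \<union> q)) (del (p \<union> q) x)"
    (is "strip \<rho> ?\<rho>' _ = _")
proof (rule lin_eq_on_free[where f="\<lambda>x. strip \<rho> ?\<rho>' (subdivide \<rho> x)", OF _ _ x])
  show "lin (\<lambda>x. strip \<rho> ?\<rho>' (subdivide \<rho> x :: 'a set set set \<Rightarrow>\<^sub>0 'b))"
    by (rule lin_comp[OF lin_strip lin_subdivide])
  show "lin (\<lambda>x. - subdivide ?\<rho>' (del (p \<union> q) x :: 'a set set \<Rightarrow>\<^sub>0 'b))"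
    by (intro lin_uminus lin_comp[OF lin_subdivide lin_del])
  fix F assume F: "F \<in> nested A \<rho>"
  let ?g = "gen F :: 'a set set \<Rightarrow>\<^sub>0 'b" and ?X = "p \<union> q"
  have fF: "finite F" using nested_finite[OF fin F] .
  have "\<rho> \<noteq> {A}" using pq by auto
  then have ne: "F \<noteq> {}" using nestedD(4)[OF F] by blast
  define u where "u = (\<lambda>X. subdivide (coarsen \<rho> X) (del X ?g))"
  have u: "u X \<in> free_on (part_chains A (coarsen \<rho> X))" "cluster A \<rho> X" if X: "X \<in> minimals F" for X
  proof -
    have XF: "X \<in> F" using X minimals_subset by blast
    show cl: "cluster A \<rho> X" using nestedD(3)[OF F XF] .
    have "del X ?g \<in> free_on (nested A (coarsen \<rho> X))"
      using fF XF nested_remove[OF F X part] by (simp add: del_gen scale_free_on)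
    then show "u X \<in> free_on (part_chains A (coarsen \<rho> X))"
      unfolding u_def by (rule subdivide_mem[OF fin coarsen_partition(1)[OF part cl]])
  qed
  have zero: "strip \<rho> ?\<rho>' (ins \<rho> (u X)) = 0" if X: "X \<in> minimals F" "X \<noteq> ?X" for X
  proof -
    have no: "?\<rho>' \<notin> G" if G: "G \<in> part_chains A (coarsen \<rho> X)" for G
    proof
      assume "?\<rho>' \<in> G"
      then have "refines A (coarsen \<rho> X) ?\<rho>'" using part_chainsD(4)[OF G] by blast
      then obtain C where C: "C \<in> ?\<rho>'" "X \<subseteq> C" unfolding refines_def coarsen_def by blast
      have cl: "cluster A \<rho> X" using u(2)[OF X(1)] .
      have "C \<notin> \<rho>"
      proof
        assume "C \<in> \<rho>"
        then have "C \<subset> X \<or> C \<inter> X = {}" "X \<noteq> {}" using cl by (auto simp: cluster_def)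
        then show False using C(2) by blast
      qed
      then have "C = ?X" using C(1) by (auto simp: coarsen_def)
      then show False using cluster_subset_pair[OF part pq(1,2) cl] C(2) X(2) by simp
    qed
    have "ins \<rho> (u X) \<in> free_on {G. ?\<rho>' \<notin> G}"
      by (rule ins_mem[OF u(1)[OF X(1)]]) (use no pair_coarsen(4) in auto)
    then have "restrict {G. ?\<rho>' \<in> G} (ins \<rho> (u X)) = 0"
      using restrict_free_on[of "ins \<rho> (u X)" "{G. ?\<rho>' \<notin> G}" "{G. ?\<rho>' \<in> G}"] by (simp add: free_on_def Int_def)
    then show ?thesis by (simp add: strip_def lin_zero[OF lin_del])
  qed
  have "strip \<rho> ?\<rho>' (subdivide \<rho> ?g) = (\<Sum>X\<in>minimals F. - strip \<rho> ?\<rho>' (ins \<rho> (u X)))"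
    unfolding subdivide_gen[OF fin part F ne] u_def by (simp add: lin_sum[OF lin_strip] lin_neg[OF lin_strip])
  also have "\<dots> = (\<Sum>X\<in>minimals F. if X = ?X then - u ?X else 0)"
    using u(1) strip_ins_same zero by (intro sum.cong refl) auto
  also have "\<dots> = (if ?X \<in> minimals F then - u ?X else 0)"
    using finite_subset[OF minimals_subset fF] by simp
  also have "\<dots> = - u ?X"
  proof (cases "?X \<in> F")
    case True
    then show ?thesis using pair_minimal[OF part pq(1,2) F] by simp
  next
    case False
    then show ?thesis by (simp add: u_def del_gen lin_zero[OF lin_subdivide])
  qed
  finally show "strip \<rho> ?\<rho>' (subdivide \<rho> ?g) = - subdivide ?\<rho>' (del ?X ?g)" by (simp add: u_def)
qed

end

lemma pair_inj:
  assumes "partition_on A \<rho>" "p \<in> \<rho>" "q \<in> \<rho> - {p}" "q' \<in> \<rho> - {p}" "p \<union> q = p \<union> q'"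
  shows "q = q'"
proof -
  have q: "q \<in> \<rho>" "q' \<in> \<rho>" "q \<noteq> p" "q' \<noteq> p" using assms(3,4) by auto
  have "q \<inter> p = {}" using partition_on_eqI[OF assms(1) q(1) assms(2)] q(3) by metis
  moreover have "q' \<inter> p = {}" using partition_on_eqI[OF assms(1) q(2) assms(2)] q(4) by metis
  ultimately show ?thesis using assms(5) by blast
qed

text \<open>Each \<open>z q\<close> is lifted by inserting \<open>p \<union> q\<close>, and the
  lifts are added. Deleting \<open>p \<union> q\<close> kills the summands of the other blocks q',
  since no nested set contains both \<open>p \<union> q\<close> and
  \<open>p \<union> q'\<close>.\<close>

lemma nested_lift:
  assumes fin: "finite A" and part: "partition_on A \<rho>" and p: "p \<in> \<rho>"
    and z: "\<And>q. q \<in> \<rho> - {p} \<Longrightarrow> z q \<in> free_on (nested A (coarsen \<rho> (p \<union> q)))"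
  shows "\<exists>x\<in>free_on (nested A \<rho>). \<forall>q\<in>\<rho> - {p}. del (p \<union> q) x = z q"
proof (intro bexI[of _ "\<Sum>q\<in>\<rho> - {p}. ins (p \<union> q) (z q)"] ballI sum_free_on)
  have finr: "finite \<rho>" using finite_elements[OF fin part] .
  fix q assume q: "q \<in> \<rho> - {p}"
  show "ins (p \<union> q) (z q) \<in> free_on (nested A \<rho>)"
    using ins_pair_mem[OF fin part p] q z[OF q] by auto
  have "del (p \<union> q) (ins (p \<union> q') (z q')) = (if q' = q then z q else 0)" if q': "q' \<in> \<rho> - {p}" for q'
  proof (cases "q' = q")
    case True
    then show ?thesis using del_ins_pair[OF fin part p _ _ z[OF q]] q by auto
  next
    case False
    then have ne: "p \<union> q \<noteq> p \<union> q'" using pair_inj[OF part p q q'] by metis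
    have q'p: "q' \<in> \<rho>" "p \<noteq> q'" using q' by auto
    have "p \<union> q \<notin> F" if F: "F \<in> nested A (coarsen \<rho> (p \<union> q'))" for F
    proof
      assume pqF: "p \<union> q \<in> F"
      have F': "insert (p \<union> q') F \<in> nested A \<rho>" using nested_ins_pair[OF fin part p q'p F] by blast
      have "p \<union> q' \<in> minimals (insert (p \<union> q') F)" using pair_minimal[OF part p q'p(1) F'] by simp
      moreover have "p \<union> q \<in> minimals (insert (p \<union> q') F)"
        using pair_minimal[OF part p _ F', of q] q pqF by simp
      moreover have "p \<union> q \<subseteq> p \<union> q' \<or> p \<union> q' \<subseteq> p \<union> q \<or> (p \<union> q) \<inter> (p \<union> q') = {}"
        by (rule laminarD[OF nestedD(2)[OF F']]) (use pqF in auto)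
      moreover have "p \<noteq> {}" using p part by (auto simp: partition_on_def)
      ultimately show False using ne unfolding minimals_def by blast
    qed
    then have "del (p \<union> q) (z q') = 0" by (intro del_eq_0[OF _ z[OF q']])
    then show ?thesis using False ne by (simp add: del_ins lin_zero[OF lin_ins])
  qed
  then have "del (p \<union> q) (\<Sum>q'\<in>\<rho> - {p}. ins (p \<union> q') (z q')) = (\<Sum>q'\<in>\<rho> - {p}. if q' = q then z q else 0)"
    by (simp add: lin_sum[OF lin_del])
  then show "del (p \<union> q) (\<Sum>q'\<in>\<rho> - {p}. ins (p \<union> q') (z q')) = z q" using finr q by simp
qed

lemma part_chains_lift:
  assumes fin: "finite A" and part: "partition_on A \<rho>" and p: "p \<in> \<rho>"
    and z: "\<And>q. q \<in> \<rho> - {p} \<Longrightarrow> z q \<in> free_on (part_chains A (coarsen \<rho> (p \<union> q)))"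
  shows "\<exists>y\<in>free_on (part_chains A \<rho>). \<forall>q\<in>\<rho> - {p}. strip \<rho> (coarsen \<rho> (p \<union> q)) y = z q"
proof (intro bexI[of _ "\<Sum>q\<in>\<rho> - {p}. ins \<rho> (z q)"] ballI sum_free_on)
  have finr: "finite \<rho>" using finite_elements[OF fin part] .
  fix q assume q: "q \<in> \<rho> - {p}"
  then have qp: "q \<in> \<rho>" "p \<noteq> q" by auto
  show "ins \<rho> (z q) \<in> free_on (part_chains A \<rho>)"
    by (rule ins_finest_mem[OF fin part p qp z[OF q]])
  have "strip \<rho> (coarsen \<rho> (p \<union> q)) (ins \<rho> (z q')) = (if q' = q then z q else 0)" if q': "q' \<in> \<rho> - {p}" for q'
  proof (cases "q' = q")
    case True
    then show ?thesis using strip_ins_same[OF fin part p qp z[OF q]] by simp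
  next
    case False
    then have ne: "p \<union> q \<noteq> p \<union> q'" using pair_inj[OF part p q q'] by metis
    have q'p: "q' \<in> \<rho>" "p \<noteq> q'" using q' by auto
    let ?R = "coarsen \<rho> (p \<union> q)" and ?R' = "coarsen \<rho> (p \<union> q')"
    note R = pair_coarsen[OF fin part p qp] and R' = pair_coarsen[OF fin part p q'p]
    \<comment> \<open>Both partitions cover \<rho>, so one refines the other only if they are equal;
      but then the distinct blocks \<open>p \<union> q\<close> and \<open>p \<union> q'\<close>
      would overlap.\<close>
    have no: "?R \<notin> G" if G: "G \<in> part_chains A ?R'" for G
    proof
      assume "?R \<in> G"
      then have "refines A ?R' ?R" using part_chainsD(4)[OF G] by blast
      then have "?R' = \<rho> \<or> ?R' = ?R" by (rule refines_coarsen_pair[OF part p qp R'(3)])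
      then have e: "?R' = ?R" using R'(4) by metis
      have a: "p \<union> q \<in> ?R" by (simp add: coarsen_def)
      have "p \<union> q' \<in> ?R'" by (simp add: coarsen_def)
      then have b: "p \<union> q' \<in> ?R" by (simp only: e)
      have "p \<noteq> {}" using p part by (auto simp: partition_on_def)
      then have "(p \<union> q) \<inter> (p \<union> q') \<noteq> {}" by blast
      then show False using partition_on_eqI[OF R(2) a b] ne by metis
    qed
    have "ins \<rho> (z q') \<in> free_on {G. ?R \<notin> G}"
      by (rule ins_mem[OF z[OF q']]) (use no R(4) in auto)
    then have "restrict {G. ?R \<in> G} (ins \<rho> (z q')) = 0"
      using restrict_free_on[of "ins \<rho> (z q')" "{G. ?R \<notin> G}" "{G. ?R \<in> G}"] by (simp add: free_on_def Int_def)
    then show ?thesis using False by (simp add: strip_def lin_zero[OF lin_del])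
  qed
  then have "strip \<rho> (coarsen \<rho> (p \<union> q)) (\<Sum>q'\<in>\<rho> - {p}. ins \<rho> (z q')) = (\<Sum>q'\<in>\<rho> - {p}. if q' = q then z q else 0)"
    by (simp add: lin_sum[OF lin_strip])
  then show "strip \<rho> (coarsen \<rho> (p \<union> q)) (\<Sum>q'\<in>\<rho> - {p}. ins \<rho> (z q')) = z q" using finr q by simp
qed

lemma nested_del_pairs_zero:
  assumes fin: "finite A" and part: "partition_on A \<rho>" and x: "x \<in> free_on (nested A \<rho>)"
    and z: "\<And>q. q \<in> \<rho> - {p} \<Longrightarrow> del (p \<union> q) x = 0"
  shows "x \<in> free_on {F \<in> nested A \<rho>. \<forall>q\<in>\<rho> - {p}. p \<union> q \<notin> F}"
proof -
  have "x \<in> free_on {F \<in> nested A \<rho>. p \<union> q \<notin> F}" if "q \<in> \<rho> - {p}" for q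
    by (rule del_zero_imp[OF x z[OF that] nested_finite[OF fin]])
  then show ?thesis using x by (auto simp: free_on_def)
qed

text \<open>Every chain contains \<rho>, so \<open>del \<rho>\<close> loses none of the chains
  through the merged partition: a vanishing \<open>strip\<close> means that there are none.\<close>

lemma part_chains_strips_zero:
  assumes fin: "finite A" and part: "partition_on A \<rho>" and y: "y \<in> free_on (part_chains A \<rho>)"
    and z: "\<And>q. q \<in> \<rho> - {p} \<Longrightarrow> strip \<rho> (coarsen \<rho> (p \<union> q)) y = 0"
  shows "y \<in> free_on {G \<in> part_chains A \<rho>. \<forall>q\<in>\<rho> - {p}. coarsen \<rho> (p \<union> q) \<notin> G}"
proof -
  have "coarsen \<rho> (p \<union> q) \<notin> G" if q: "q \<in> \<rho> - {p}" and G: "G \<in> Poly_Mapping.keys y" for q G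
  proof
    let ?S = "{G. coarsen \<rho> (p \<union> q) \<in> G}"
    assume "coarsen \<rho> (p \<union> q) \<in> G"
    then have "G \<in> Poly_Mapping.keys (restrict ?S y)" using G by (simp add: in_keys_iff lookup_restrict)
    moreover have "restrict ?S y \<in> free_on (?S \<inter> part_chains A \<rho>)" by (rule restrict_free_on[OF y])
    then have "restrict ?S y \<in> free_on {G \<in> ?S \<inter> part_chains A \<rho>. \<rho> \<notin> G}"
      by (rule del_zero_imp) (use z[OF q] part_chains_finite[OF fin] in \<open>auto simp: strip_def\<close>)
    ultimately show False using part_chainsD(2) by (auto simp: free_on_def)
  qed
  then show ?thesis using y by (auto simp: free_on_def)
qed

text \<open>Modulo the nested sets without any \<open>p \<union> q\<close>, the maps
  \<open>del (p \<union> q)\<close> identify the complex with a direct sum of complexes for one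
  block less. There x is a boundary by induction, and subtracting the boundary of a lift leaves a
  cycle to which toggling applies. Deleting a pair lowers both \<open>card F\<close> and
  \<open>card \<rho>\<close> by one, so the bound on the degree is inherited.\<close>

theorem nested_acyclic:
  fixes x :: "'a set set \<Rightarrow>\<^sub>0 'k::comm_ring_1"
  assumes "finite A" "partition_on A \<rho>"
    and "x \<in> free_on {F \<in> nested A \<rho>. Suc (card F) < card \<rho>}" "bd (- {A}) x = 0"
  shows "\<exists>y\<in>free_on (nested A \<rho>). bd (- {A}) y = x"
  using assms(2-)
proof (induction "card \<rho>" arbitrary: \<rho> x rule: less_induct)
  case less
  note fin = assms(1) and part = less.prems(1) and x = less.prems(2)
  have xN: "x \<in> free_on (nested A \<rho>)" by (rule free_on_mono[OF x]) auto
  show ?case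
  proof (cases "A = {} \<or> \<rho> = {A}")
    case True
    \<comment> \<open>With a single block the only generator is the empty nested set, in the top
      degree, which the bound on the cardinality excludes.\<close>
    then have e: "{F \<in> nested A \<rho>. Suc (card F) < card \<rho>} = {}" by (auto simp: nested_def)
    have "x = 0" using x unfolding e by (simp add: free_on_def)
    then show ?thesis by (intro bexI[of _ 0]) (simp_all add: lin_zero[OF lin_bd])
  next
    case False
    then obtain p where p: "p \<in> \<rho>" using part by (auto simp: partition_on_def)
    \<comment> \<open>The minus sign compensates for the anticommutation of \<open>bd\<close> and
      \<open>del\<close>, so that the boundary of the lift has the components of x.\<close>
    have "\<exists>y\<in>free_on (nested A (coarsen \<rho> (p \<union> q))). bd (- {A}) y = - del (p \<union> q) x"
      if q: "q \<in> \<rho> - {p}" for q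
    proof (rule less.hyps)
      have qp: "q \<in> \<rho>" "p \<noteq> q" using q by auto
      have card: "Suc (card (coarsen \<rho> (p \<union> q))) = card \<rho>"
        by (rule card_coarsen_pair[OF fin part p qp])
      then show "card (coarsen \<rho> (p \<union> q)) < card \<rho>" by simp
      show "partition_on A (coarsen \<rho> (p \<union> q))" using pair_coarsen(2)[OF fin part p qp] .
      have "del (p \<union> q) x \<in> free_on {F \<in> nested A (coarsen \<rho> (p \<union> q)). Suc (card F) < card (coarsen \<rho> (p \<union> q))}"
      proof (rule del_mem[OF x])
        fix F assume F: "F \<in> {F \<in> nested A \<rho>. Suc (card F) < card \<rho>}" "p \<union> q \<in> F"
        then have FN: "F \<in> nested A \<rho>" by simp
        have "Suc (card (F - {p \<union> q})) = card F" using nested_finite[OF fin FN] F(2) by (rule card_Suc_Diff1)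
        then show "F - {p \<union> q} \<in> {F \<in> nested A (coarsen \<rho> (p \<union> q)). Suc (card F) < card (coarsen \<rho> (p \<union> q))}"
          using nested_del_pair[OF fin part p qp FN F(2)] F(1) card by simp
      qed
      then show "- del (p \<union> q) x \<in> free_on {F \<in> nested A (coarsen \<rho> (p \<union> q)). Suc (card F) < card (coarsen \<rho> (p \<union> q))}"
        by (rule uminus_free_on)
      show "bd (- {A}) (- del (p \<union> q) x) = 0"
        by (simp add: lin_neg[OF lin_bd] bd_del less.prems(3) lin_zero[OF lin_del])
    qed
    then obtain z where z: "\<And>q. q \<in> \<rho> - {p} \<Longrightarrow> z q \<in> free_on (nested A (coarsen \<rho> (p \<union> q)))"
        "\<And>q. q \<in> \<rho> - {p} \<Longrightarrow> bd (- {A}) (z q) = - del (p \<union> q) x" by metis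
    from nested_lift[OF fin part p, of z, OF z(1)]
    obtain x1 where x1: "x1 \<in> free_on (nested A \<rho>)" "\<forall>q\<in>\<rho> - {p}. del (p \<union> q) x1 = z q" by blast
    have bd_x1: "bd (- {A}) x1 \<in> free_on (nested A \<rho>)"
      by (rule bd_mem[OF x1(1)]) (simp add: nested_delete)
    have "del (p \<union> q) (x - bd (- {A}) x1) = 0" if "q \<in> \<rho> - {p}" for q
    proof -
      have "del (p \<union> q) (bd (- {A}) x1) = - bd (- {A}) (del (p \<union> q) x1)" by (simp add: bd_del)
      then show ?thesis using x1(2) z(2) that by (simp add: lin_diff[OF lin_del])
    qed
    then have "x - bd (- {A}) x1 \<in> free_on {F \<in> nested A \<rho>. \<forall>q\<in>\<rho> - {p}. p \<union> q \<notin> F}"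
      by (intro nested_del_pairs_zero[OF fin part diff_free_on[OF xN bd_x1]])
    moreover have "bd (- {A}) (x - bd (- {A}) x1) = 0" by (simp add: lin_diff[OF lin_bd] less.prems(3))
    moreover have "\<rho> \<noteq> {A}" using False by simp
    ultimately obtain x2 where x2: "x2 \<in> free_on {F \<in> nested A \<rho>. \<forall>q\<in>\<rho> - {p}. p \<union> q \<notin> F}"
        "bd (- {A}) x2 = x - bd (- {A}) x1"
      using nested_toggle_acyclic[OF fin part p] by blast
    have "x2 \<in> free_on (nested A \<rho>)" by (rule free_on_mono[OF x2(1)]) auto
    then have "x1 + x2 \<in> free_on (nested A \<rho>)" using x1(1) by (rule add_free_on[rotated])
    moreover have "bd (- {A}) (x1 + x2) = x" by (simp add: lin_add[OF lin_bd] x2(2))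
    ultimately show ?thesis by blast
  qed
qed

lemma free_on_singleton: "x \<in> free_on {b} \<Longrightarrow> x = fscale (Poly_Mapping.lookup x b) (gen b)"
  unfolding fscale_gen by (rule poly_mapping_eqI) (auto simp: free_on_def lookup_single when_def in_keys_iff)

text \<open>A pair (x, y) with these equations is a cycle of the mapping cone of
  \<open>subdivide\<close>, and the conclusion says that it bounds. The case x = 0 is surjectivity
  on homology, the general case contains injectivity; the cone packages both in one inductive
  statement.\<close>

theorem subdivide_cone_acyclic:
  fixes x :: "'a set set \<Rightarrow>\<^sub>0 'k::comm_ring_1"
  assumes "finite A" "partition_on A \<rho>"
    and "x \<in> free_on (nested A \<rho>)" "y \<in> free_on (part_chains A \<rho>)"
    and "bd (- {A}) x = 0" "subdivide \<rho> x = bd (- {\<rho>, {A}}) y"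
  shows "\<exists>x'\<in>free_on (nested A \<rho>). \<exists>y'\<in>free_on (part_chains A \<rho>).
    x = bd (- {A}) x' \<and> y = subdivide \<rho> x' + bd (- {\<rho>, {A}}) y'"
  using assms(2-)
proof (induction "card \<rho>" arbitrary: \<rho> x y rule: less_induct)
  case less
  note fin = assms(1) and part = less.prems(1) and x = less.prems(2) and y = less.prems(3)
  note cyc = less.prems(4) and eq = less.prems(5)
  consider "A = {}" | "A \<noteq> {}" "\<rho> = {A}" | "A \<noteq> {}" "\<rho> \<noteq> {A}" by blast
  then show ?case
  proof cases
    case 1
    then have "nested A \<rho> = {}" "part_chains A \<rho> = {}" by (simp_all add: nested_def part_chains_def)
    then have "x = 0" "y = 0" using x y by (simp_all add: free_on_def)
    then show ?thesis
      by (intro bexI[of _ 0]) (simp_all add: lin_zero[OF lin_bd] lin_zero[OF lin_subdivide])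
  next
    case 2
    \<comment> \<open>One block: each complex has a single generator and \<open>subdivide\<close>
      sends one to the other, so x vanishes and y is an image.\<close>
    have "{} \<in> nested A \<rho>" using 2 by (simp add: nested_def laminar_def)
    moreover have "F = {}" if "F \<in> nested A \<rho>" for F using nested_full[of F A] that 2(2) by simp
    ultimately have N: "nested A \<rho> = {{}}" by blast
    have "\<pi> = {A}" if "refines A {A} \<pi>" for \<pi>
    proof -
      have "refines A \<pi> {A}" using that partition_onD1[of A \<pi>] unfolding refines_def by blast
      then show ?thesis using that by (rule refines_asym)
    qed
    then have "part_chains A \<rho> \<subseteq> {{{A}}}" using 2 unfolding part_chains_def by blast
    moreover have "{{A}} \<in> part_chains A \<rho>" using 2 refines_refl[OF part] by (simp add: part_chains_def)
    ultimately have C: "part_chains A \<rho> = {{{A}}}" by blast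
    define a b where "a = Poly_Mapping.lookup x {}" and "b = Poly_Mapping.lookup y {{A}}"
    have xa: "x = fscale a (gen {})" unfolding a_def by (rule free_on_singleton) (use x N in simp)
    have yb: "y = fscale b (gen {{A}})" unfolding b_def by (rule free_on_singleton) (use y C in simp)
    have sub: "subdivide \<rho> (gen {}) = (gen {{A}} :: _ \<Rightarrow>\<^sub>0 'k)" using subdivide_empty[OF part] 2 by simp
    have "subdivide \<rho> x = 0" unfolding eq yb using 2 by (simp add: lin_scale[OF lin_bd] bd_gen)
    then have "fscale a (gen {{A}} :: _ \<Rightarrow>\<^sub>0 'k) = 0" by (simp add: xa lin_scale[OF lin_subdivide] sub)
    then have "Poly_Mapping.single {{A}} a = 0" by (simp only: fscale_gen)
    then have "a = 0" by (metis lookup_single_eq lookup_zero)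
    then have "x = 0" by (simp add: xa)
    show ?thesis
    proof (intro bexI conjI)
      show "x = bd (- {A}) (fscale b (gen {}))" by (simp add: \<open>x = 0\<close> lin_scale[OF lin_bd] bd_gen)
      show "y = subdivide \<rho> (fscale b (gen {})) + bd (- {\<rho>, {A}}) 0"
        by (simp add: yb lin_scale[OF lin_subdivide] sub lin_zero[OF lin_bd])
    qed (simp_all add: N scale_free_on)
  next
    case 3
    then obtain p where p: "p \<in> \<rho>" using part by (auto simp: partition_on_def)
    let ?R = "\<lambda>q. coarsen \<rho> (p \<union> q)"
    have "\<exists>x'\<in>free_on (nested A (?R q)). \<exists>y'\<in>free_on (part_chains A (?R q)).
      del (p \<union> q) x = bd (- {A}) x' \<and> strip \<rho> (?R q) y = subdivide (?R q) x' + bd (- {?R q, {A}}) y'"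
      if q: "q \<in> \<rho> - {p}" for q
    proof (rule less.hyps)
      have qp: "q \<in> \<rho>" "p \<noteq> q" using q by auto
      show "card (?R q) < card \<rho>" using card_coarsen_pair[OF fin part p qp] by simp
      show "partition_on A (?R q)" using pair_coarsen(2)[OF fin part p qp] .
      show "del (p \<union> q) x \<in> free_on (nested A (?R q))" by (rule del_pair_mem[OF fin part p qp x])
      show "strip \<rho> (?R q) y \<in> free_on (part_chains A (?R q))" by (rule strip_mem[OF fin part p qp y])
      show "bd (- {A}) (del (p \<union> q) x) = 0" by (simp add: bd_del cyc lin_zero[OF lin_del])
      have "- subdivide (?R q) (del (p \<union> q) x) = - bd (- {?R q, {A}}) (strip \<rho> (?R q) y)"
        using strip_subdivide[OF fin part p qp x] strip_bd[OF fin part p qp y] eq by simp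
      then show "subdivide (?R q) (del (p \<union> q) x) = bd (- {?R q, {A}}) (strip \<rho> (?R q) y)" by simp
    qed
    then obtain u v where u: "\<And>q. q \<in> \<rho> - {p} \<Longrightarrow> u q \<in> free_on (nested A (?R q))"
      and v: "\<And>q. q \<in> \<rho> - {p} \<Longrightarrow> v q \<in> free_on (part_chains A (?R q))"
      and uv: "\<And>q. q \<in> \<rho> - {p} \<Longrightarrow> del (p \<union> q) x = bd (- {A}) (u q)"
        "\<And>q. q \<in> \<rho> - {p} \<Longrightarrow> strip \<rho> (?R q) y = subdivide (?R q) (u q) + bd (- {?R q, {A}}) (v q)"
      by metis
    from nested_lift[OF fin part p, of "\<lambda>q. - u q"] u
    obtain x1 where x1: "x1 \<in> free_on (nested A \<rho>)" "\<forall>q\<in>\<rho> - {p}. del (p \<union> q) x1 = - u q"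
      using uminus_free_on by blast
    from part_chains_lift[OF fin part p, of "\<lambda>q. - v q"] v
    obtain y1 where y1: "y1 \<in> free_on (part_chains A \<rho>)" "\<forall>q\<in>\<rho> - {p}. strip \<rho> (?R q) y1 = - v q"
      using uminus_free_on by blast
    \<comment> \<open>Subtracting the boundary of (x1, y1) in the cone kills all components at the
      merged partitions.\<close>
    define x2 where "x2 = x - bd (- {A}) x1"
    define y2 where "y2 = y - subdivide \<rho> x1 - bd (- {\<rho>, {A}}) y1"
    have bd_N: "bd (- {A}) w \<in> free_on (nested A \<rho>)" if "w \<in> free_on (nested A \<rho>)" for w :: "'a set set \<Rightarrow>\<^sub>0 'k"
      by (rule bd_mem[OF that]) (simp add: nested_delete)
    have bd_C: "bd (- {\<rho>, {A}}) w \<in> free_on (part_chains A \<rho>)" if "w \<in> free_on (part_chains A \<rho>)" for w :: "'a set set set \<Rightarrow>\<^sub>0 'k"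
      by (rule bd_mem[OF that]) (simp add: part_chains_delete)
    have x2: "x2 \<in> free_on (nested A \<rho>)" unfolding x2_def by (intro diff_free_on x bd_N x1(1))
    have y2: "y2 \<in> free_on (part_chains A \<rho>)"
      unfolding y2_def by (intro diff_free_on y bd_C y1(1) subdivide_mem[OF fin part x1(1)])
    have x2c: "bd (- {A}) x2 = 0" by (simp add: x2_def lin_diff[OF lin_bd] cyc)
    have xy2: "subdivide \<rho> x2 = bd (- {\<rho>, {A}}) y2"
      by (simp add: x2_def y2_def lin_diff[OF lin_bd] lin_diff[OF lin_subdivide] eq subdivide_bd[OF fin part x1(1)])
    have "del (p \<union> q) x2 = 0" if q: "q \<in> \<rho> - {p}" for q
    proof -
      have "del (p \<union> q) (bd (- {A}) x1) = - bd (- {A}) (del (p \<union> q) x1)" by (simp add: bd_del)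
      also have "\<dots> = bd (- {A}) (u q)" using x1(2) q by (simp add: lin_neg[OF lin_bd])
      finally show ?thesis using uv(1)[OF q] by (simp add: x2_def lin_diff[OF lin_del])
    qed
    then have "x2 \<in> free_on {F \<in> nested A \<rho>. \<forall>q\<in>\<rho> - {p}. p \<union> q \<notin> F}"
      by (rule nested_del_pairs_zero[OF fin part x2])
    then obtain x3 where x3: "x3 \<in> free_on {F \<in> nested A \<rho>. \<forall>q\<in>\<rho> - {p}. p \<union> q \<notin> F}"
        "bd (- {A}) x3 = x2"
      using nested_toggle_acyclic[OF fin part p 3(2) _ x2c] by blast
    have x3N: "x3 \<in> free_on (nested A \<rho>)" by (rule free_on_mono[OF x3(1)]) auto
    \<comment> \<open>The preimage of x2 changes y2 without bringing those components back: x3 has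
      no pairs, so every \<open>strip\<close> of its subdivision is zero.\<close>
    define y3 where "y3 = y2 - subdivide \<rho> x3"
    have y3: "y3 \<in> free_on (part_chains A \<rho>)"
      unfolding y3_def by (intro diff_free_on y2 subdivide_mem[OF fin part x3N])
    have y3c: "bd (- {\<rho>, {A}}) y3 = 0"
      by (simp add: y3_def lin_diff[OF lin_bd] subdivide_bd[OF fin part x3N] x3(2) xy2)
    have "strip \<rho> (?R q) y3 = 0" if q: "q \<in> \<rho> - {p}" for q
    proof -
      have qp: "q \<in> \<rho>" "p \<noteq> q" using q by auto
      have "del (p \<union> q) x3 = 0" by (rule del_eq_0[OF _ x3(1)]) (use q in auto)
      then have "strip \<rho> (?R q) (subdivide \<rho> x3) = 0"
        using strip_subdivide[OF fin part p qp x3N] by (simp add: lin_zero[OF lin_subdivide])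
      moreover have "strip \<rho> (?R q) (subdivide \<rho> x1) = subdivide (?R q) (u q)"
        using strip_subdivide[OF fin part p qp x1(1)] x1(2) q by (simp add: lin_neg[OF lin_subdivide])
      moreover have "strip \<rho> (?R q) (bd (- {\<rho>, {A}}) y1) = bd (- {?R q, {A}}) (v q)"
        using strip_bd[OF fin part p qp y1(1)] y1(2) q by (simp add: lin_neg[OF lin_bd])
      ultimately show ?thesis
        by (simp add: y3_def y2_def lin_diff[OF lin_strip] uv(2)[OF q])
    qed
    then have "y3 \<in> free_on {G \<in> part_chains A \<rho>. \<forall>q\<in>\<rho> - {p}. ?R q \<notin> G}"
      by (rule part_chains_strips_zero[OF fin part y3])
    then obtain y4 where y4: "y4 \<in> free_on {G \<in> part_chains A \<rho>. \<forall>q\<in>\<rho> - {p}. ?R q \<notin> G}"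
        "bd (- {\<rho>, {A}}) y4 = y3"
      using part_chains_toggle_acyclic[OF fin part p 3(2) _ y3c] by blast
    have y4C: "y4 \<in> free_on (part_chains A \<rho>)" by (rule free_on_mono[OF y4(1)]) auto
    show ?thesis
    proof (intro bexI conjI)
      show "x = bd (- {A}) (x1 + x3)" by (simp add: lin_add[OF lin_bd] x3(2) x2_def)
      show "y = subdivide \<rho> (x1 + x3) + bd (- {\<rho>, {A}}) (y1 + y4)"
        by (simp add: lin_add[OF lin_bd] lin_add[OF lin_subdivide] y4(2) y3_def y2_def)
    qed (intro add_free_on x1(1) x3N y1(1) y4C)+
  qed
qed


section \<open>Trees labelled by the commutative operad\<close>

abbreviation (input) Com :: "('k, 'k::comm_ring_1) operad" where
  "Com \<equiv> commutative_operad"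

lemma commutative_operad_simps [simp]:
  "smul commutative_operad = (*)" "act commutative_operad r \<sigma> a = a" "unit_op commutative_operad = 1"
  "ops commutative_operad r = (if r = 0 then {0} else UNIV)"
  "op_comp commutative_operad a qs = a * prod_list (map snd qs)"
  by (simp_all add: commutative_operad_def)

abbreviation lset :: "('i, 'm) tree \<Rightarrow> nat set" where
  "lset T \<equiv> set (leaves T)"

fun coef :: "('i, 'k) tree \<Rightarrow> 'k::comm_ring_1" where
  "coef (Leaf i) = 1"
| "coef (Node a c ts) = c * prod_list (map coef ts)"

fun arity_ge :: "nat \<Rightarrow> ('i, 'm) tree \<Rightarrow> bool" where
  "arity_ge k (Leaf i) \<longleftrightarrow> True"
| "arity_ge k (Node a p ts) \<longleftrightarrow> k \<le> length ts \<and> (\<forall>t\<in>set ts. arity_ge k t)"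

text \<open>Clusters are recorded together with the decorations, because the positions of the
  vertices determine the sign of a bar tree.\<close>

fun vcs :: "('i, 'm) tree \<Rightarrow> ('i \<times> nat set) set" where
  "vcs (Leaf i) = {}"
| "vcs (Node a p ts) = insert (a, \<Union>t\<in>set ts. lset t) (\<Union>t\<in>set ts. vcs t)"

text \<open>The partition of the inputs defined by the edges at height \<open>m\<close>.\<close>

fun lev :: "nat \<Rightarrow> ('i, 'm) tree \<Rightarrow> nat set set" where
  "lev 0 T = {lset T}"
| "lev (Suc m) (Leaf i) = {{i}}"
| "lev (Suc m) (Node a p ts) = (\<Union>t\<in>set ts. lev m t)"

text \<open>Isomorphism of abstract trees: labels and the order of the inputs of a vertex are
  forgotten, decorations and leaf indices are kept.\<close>

inductive iso :: "('i, 'm) tree \<Rightarrow> ('i, 'm) tree \<Rightarrow> bool" where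
  iso_Leaf: "iso (Leaf i) (Leaf i)"
| iso_Node: "mset ts' = mset ts \<Longrightarrow> list_all2 iso ts' us \<Longrightarrow> iso (Node a p ts) (Node a q us)"
monos list_all2_mono

abbreviation ones :: "('i, 'k::one) tree \<Rightarrow> bool" where
  "ones \<equiv> labelled_in (\<lambda>r. {1})"

section \<open>Isomorphism of labelled trees\<close>

lemma iso_refl: "iso T T"
proof (induction T)
  case (Node a p ts)
  then show ?case by (intro iso_Node[OF refl] list.rel_refl_strong) auto
qed (rule iso_Leaf)

lemma iso_relabel: "iso (Node a p ts) (Node a q ts)"
  by (intro iso_Node[OF refl] list.rel_refl_strong iso_refl)

lemma iso_permute: "mset us = mset ts \<Longrightarrow> iso (Node a p ts) (Node a q us)"
  by (intro iso_Node[of us] list.rel_refl_strong iso_refl)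

lemma iso_child: "iso t u \<Longrightarrow> iso (Node a p (us @ t # vs)) (Node a p (us @ u # vs))"
  by (intro iso_Node[OF refl] list_all2_appendI list.rel_refl_strong iso_refl) (auto intro: list.rel_refl_strong iso_refl)

lemma iso_context: "C \<in> tree_contexts \<Longrightarrow> iso t u \<Longrightarrow> iso (C t) (C u)"
  by (induction rule: tree_contexts.induct) (auto intro: iso_child)

lemma iso_induct_strong [consumes 1, case_names Leaf Node]:
  assumes "iso T T'"
    and "\<And>i. P (Leaf i) (Leaf i)"
    and "\<And>ts' ts us a p q. mset ts' = mset ts \<Longrightarrow> list_all2 iso ts' us \<Longrightarrow> list_all2 P ts' us \<Longrightarrow> P (Node a p ts) (Node a q us)"
  shows "P T T'"
  using assms(1)
proof (induction rule: iso.induct)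
  case (iso_Node ts' ts us a p q)
  from iso_Node(2) have "list_all2 iso ts' us" "list_all2 P ts' us"
    by (auto elim!: list_all2_mono)
  then show ?case using assms(3) iso_Node(1) by blast
qed (rule assms(2))

lemma iso_mset:
  assumes "iso T T'"
  shows "mset (leaves T') = mset (leaves T) \<and> mset (vertices T') = mset (vertices T)"
  using assms
proof (induction rule: iso_induct_strong)
  case (Node ts' ts us a p q)
  have c: "mset (concat xss) = sum_mset (image_mset mset (mset xss))" for xss :: "'c list list"
    by (induction xss) auto
  have "map mset (map leaves ts') = map mset (map leaves us)" "map mset (map vertices ts') = map mset (map vertices us)"
    using Node(3) by (auto simp: list_all2_conv_all_nth intro!: nth_equalityI)
  then have "image_mset mset (mset (map leaves us)) = image_mset mset (mset (map leaves ts'))"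
      "image_mset mset (mset (map vertices us)) = image_mset mset (mset (map vertices ts'))"
    by (metis mset_map)+
  moreover have "mset (map leaves ts') = mset (map leaves ts)" "mset (map vertices ts') = mset (map vertices ts)"
    using Node(1) by simp_all
  ultimately show ?case by (simp add: c)
qed simp

lemma list_all2_set_imp: "list_all2 P xs ys \<Longrightarrow> y \<in> set ys \<Longrightarrow> \<exists>x\<in>set xs. P x y"
  by (metis list_all2_conv_all_nth in_set_conv_nth)

lemma iso_arity_ge: "iso T T' \<Longrightarrow> arity_ge k T \<Longrightarrow> arity_ge k T'"
proof (induction rule: iso_induct_strong)
  case (Node ts' ts us a p q)
  have "set ts' = set ts" using Node(1) by (rule mset_eq_setD)
  moreover have "length us = length ts" using mset_eq_length[OF Node(1)] list_all2_lengthD[OF Node(2)] by simp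
  moreover have "\<exists>t\<in>set ts'. arity_ge k t \<longrightarrow> arity_ge k u" if "u \<in> set us" for u
    using list_all2_set_imp[OF Node(3) that] .
  ultimately show ?case using Node(4) by auto
qed simp

lemma iso_has_levels: "iso T T' \<Longrightarrow> has_levels d T \<Longrightarrow> has_levels d T'"
proof (induction arbitrary: d rule: iso_induct_strong)
  case (Node ts' ts us a p q)
  have "set ts' = set ts" using Node(1) by (rule mset_eq_setD)
  moreover have "\<exists>t\<in>set ts'. \<forall>d. has_levels d t \<longrightarrow> has_levels d u" if "u \<in> set us" for u
    using list_all2_set_imp[OF Node(3) that] .
  ultimately show ?case using Node(4) by auto
qed simp

section \<open>Contexts and the tensor relations\<close>

lemma tree_context_comp: "C \<in> tree_contexts \<Longrightarrow> (\<lambda>t. C (Node a p (us @ t # vs))) \<in> tree_contexts"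
proof (induction rule: tree_contexts.induct)
  case hole
  then show ?case using tree_contexts.below[OF tree_contexts.hole] .
next
  case (below C b q us' vs')
  from tree_contexts.below[OF below.IH] show ?case .
qed

lemma context_coef:
  assumes "C \<in> tree_contexts"
  shows "\<exists>c. \<forall>t. coef (C t) = c * coef t"
  using assms
proof (induction rule: tree_contexts.induct)
  case hole
  then show ?case by (intro exI[of _ 1]) simp
next
  case (below C a p us vs)
  then obtain c where "\<And>t. coef (C t) = c * coef t" by blast
  then show ?case
    by (intro exI[of _ "p * prod_list (map coef us) * c * prod_list (map coef vs)"]) (simp add: ac_simps)
qed

lemma context_lset: "C \<in> tree_contexts \<Longrightarrow> lset t = lset u \<Longrightarrow> lset (C t) = lset (C u)"
  by (induction rule: tree_contexts.induct) auto

lemma context_vcs: "C \<in> tree_contexts \<Longrightarrow> lset t = lset u \<Longrightarrow> vcs t = vcs u \<Longrightarrow> vcs (C t) = vcs (C u)"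
proof (induction rule: tree_contexts.induct)
  case (below C a p us vs)
  have "lset (C t) = lset (C u)" "vcs (C t) = vcs (C u)" using below context_lset by blast+
  then show ?case by simp
qed

lemma context_lev:
  assumes "C \<in> tree_contexts" "\<And>m. lev m t = lev m u"
  shows "lev m (C t) = lev m (C u)"
  using assms(1)
proof (induction arbitrary: m rule: tree_contexts.induct)
  case hole
  then show ?case by (rule assms(2))
next
  case (below C a p us vs)
  have "lset (C t) = lset (C u)" using below.IH[of 0] by simp
  then show ?case using below.IH by (cases m) auto
qed

text \<open>A vertex with fewer than k inputs can only carry the label 0. Exhibiting it inside a
  context is the form in which the tensor relations apply.\<close>

lemma label_zero_context:
  assumes "labelled_in M T" "\<not> arity_ge k T" "\<And>r. r < k \<Longrightarrow> M r \<subseteq> {0}"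
  obtains C a ts where "C \<in> tree_contexts" "T = C (Node a 0 ts)"
proof -
  have "\<exists>C a ts. C \<in> tree_contexts \<and> T = C (Node a 0 ts)"
    using assms(1,2)
  proof (induction T)
    case (Node a p ts)
    show ?case
    proof (cases "k \<le> length ts")
      case True
      then obtain t where t: "t \<in> set ts" "\<not> arity_ge k t" using Node.prems by auto
      moreover have "labelled_in M t" using Node.prems(1) t(1) by simp
      ultimately obtain C b us where C: "C \<in> tree_contexts" "t = C (Node b 0 us)" using Node.IH[OF t(1)] by blast
      obtain xs ys where "ts = xs @ t # ys" using t(1) by (meson split_list)
      then show ?thesis using C
        by (intro exI[of _ "\<lambda>t. Node a p (xs @ C t # ys)"] exI[of _ b] exI[of _ us])
          (simp add: tree_contexts.below)
    next
      case False
      then have "p = 0" using Node.prems(1) assms(3)[of "length ts"] by auto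
      then show ?thesis
        by (intro exI[of _ "\<lambda>t. t"] exI[of _ a] exI[of _ ts]) (simp add: tree_contexts.hole)
    qed
  qed simp
  then show thesis using that by (elim exE conjE)
qed

lemma label_zero_coef:
  assumes "C \<in> tree_contexts"
  shows "coef (C (Node a 0 ts)) = 0"
proof -
  obtain c where "\<forall>t. coef (C t) = c * coef t" using context_coef[OF assms] by (elim exE)
  then show ?thesis by simp
qed

text \<open>Homogeneity for the scalar 0 relates the tree to 0 times itself, since
  \<open>0 * 0\<close> is again the label 0.\<close>

lemma label_zero_rels:
  fixes G :: "('i, 'k::comm_ring_1) tree set"
  assumes "C \<in> tree_contexts" "C (Node a 0 ts) \<in> G"
  shows "gen (C (Node a 0 ts)) \<in> fspan (tensor_rels commutative_operad G)"
proof (rule fs.span_base)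
  let ?P = "commutative_operad :: ('k, 'k) operad"
  have "gen (C (Node a 0 ts)) = gen (C (Node a (smul ?P 0 0) ts)) - fscale 0 (gen (C (Node a 0 ts)))"
    by simp
  moreover have "{C (Node a (smul ?P 0 0) ts), C (Node a 0 ts)} \<subseteq> G" using assms(2) by simp
  ultimately have "gen (C (Node a 0 ts)) \<in> {gen (C (Node a (smul ?P c p) ts)) - fscale c (gen (C (Node a p ts))) | C a c p ts.
        C \<in> tree_contexts \<and> {C (Node a (smul ?P c p) ts), C (Node a p ts)} \<subseteq> G}"
    by (intro CollectI exI[of _ C] exI[of _ a] exI[of _ 0] exI[of _ ts] conjI assms(1))
  then show "gen (C (Node a 0 ts)) \<in> tensor_rels ?P G"
    unfolding tensor_rels_def by (rule UnI1[OF UnI2])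
qed

lemma low_arity_coef:
  assumes "labelled_in M T" "\<not> arity_ge k T" "\<And>r. r < k \<Longrightarrow> M r \<subseteq> {0}"
  shows "coef T = 0"
  by (rule label_zero_context[OF assms]) (simp_all add: label_zero_coef)

lemma low_arity_rels:
  assumes "labelled_in M T" "\<not> arity_ge k T" "\<And>r. r < k \<Longrightarrow> M r \<subseteq> {0}" "T \<in> G"
  shows "gen T \<in> fspan (tensor_rels commutative_operad G)"
proof (rule label_zero_context[OF assms(1-3)])
  fix C a ts assume "C \<in> tree_contexts" "T = C (Node a 0 ts)"
  then show ?thesis using label_zero_rels[of C a ts G] assms(4) by simp
qed

lemma tensor_rels_mono: "G \<subseteq> G' \<Longrightarrow> fspan (tensor_rels P G) \<subseteq> fspan (tensor_rels P G')"
  by (rule fs.span_mono, unfold tensor_rels_def, intro Un_mono Collect_mono impI;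
      elim exE conjE; intro exI conjI; (assumption | erule order_trans)+)

text \<open>The label of a vertex is pulled out as a scalar, its children are permuted by
  equivariance and then replaced by induction, always inside the context C. The relations concern
  only trees in G, and all intermediate trees are isomorphic to the given one; hence the closure
  condition on G.\<close>

lemma iso_rels:
  fixes G :: "('i, 'k::comm_ring_1) tree set"
  assumes closed: "\<And>S S'. S \<in> G \<Longrightarrow> iso S S' \<Longrightarrow> S' \<in> G"
    and "iso T T'" "ones T'" "C \<in> tree_contexts" "C T \<in> G"
  shows "gen (C T) - fscale (coef T) (gen (C T')) \<in> fspan (tensor_rels commutative_operad G)"
  using assms(2-)
proof (induction arbitrary: C rule: iso_induct_strong)
  case (Leaf i)
  then show ?case by (simp add: fs.span_zero)
next
  case (Node ts' ts us a p q)
  let ?P = "commutative_operad :: ('k, 'k) operad"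
  let ?R = "tensor_rels ?P G"
  note C = Node(5) and CG = Node(6)
  have q: "q = 1" using Node(4) by simp
  have G1: "C (Node a 1 ts) \<in> G" using closed[OF CG iso_context[OF C iso_relabel]] .
  have G2: "C (Node a 1 ts') \<in> G" using closed[OF CG iso_context[OF C iso_permute[OF Node(1)]]] .
  have "gen (C (Node a (smul ?P p 1) ts)) - fscale p (gen (C (Node a 1 ts))) \<in> ?R"
  proof -
    have "{C (Node a (smul ?P p 1) ts), C (Node a 1 ts)} \<subseteq> G" using CG G1 by simp
    then have "gen (C (Node a (smul ?P p 1) ts)) - fscale p (gen (C (Node a 1 ts))) \<in>
        {gen (C (Node a (smul ?P c p) ts)) - fscale c (gen (C (Node a p ts))) | C a c p ts.
        C \<in> tree_contexts \<and> {C (Node a (smul ?P c p) ts), C (Node a p ts)} \<subseteq> G}"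
      by (intro CollectI exI[of _ C] exI[of _ a] exI[of _ p] exI[of _ 1] exI[of _ ts] conjI C refl)
    then show ?thesis unfolding tensor_rels_def by (rule UnI1[OF UnI2])
  qed
  then have s1: "gen (C (Node a p ts)) - fscale p (gen (C (Node a 1 ts))) \<in> fspan ?R"
    using fs.span_base[of _ ?R] by simp
  obtain \<sigma> where \<sigma>: "\<sigma> permutes {..<length ts}" "permute_list \<sigma> ts = ts'"
    using mset_eq_permutation[OF Node(1)] by blast
  have "gen (C (Node a (act ?P (length ts) \<sigma> 1) ts)) - gen (C (Node a 1 (permute_list \<sigma> ts))) \<in> ?R"
  proof -
    have "{C (Node a (act ?P (length ts) \<sigma> 1) ts), C (Node a 1 (permute_list \<sigma> ts))} \<subseteq> G"
      using G1 G2 \<sigma>(2) by simp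
    then have "gen (C (Node a (act ?P (length ts) \<sigma> 1) ts)) - gen (C (Node a 1 (permute_list \<sigma> ts))) \<in>
        {gen (C (Node a (act ?P (length ts) \<sigma> p) ts)) - gen (C (Node a p (permute_list \<sigma> ts))) | C a \<sigma> p ts.
        C \<in> tree_contexts \<and> \<sigma> permutes {..<length ts} \<and>
        {C (Node a (act ?P (length ts) \<sigma> p) ts), C (Node a p (permute_list \<sigma> ts))} \<subseteq> G}"
      by (intro CollectI exI[of _ C] exI[of _ a] exI[of _ \<sigma>] exI[of _ 1] exI[of _ ts] conjI C \<sigma>(1) refl)
    then show ?thesis unfolding tensor_rels_def by (rule UnI2)
  qed
  then have s2: "gen (C (Node a 1 ts)) - gen (C (Node a 1 ts')) \<in> fspan ?R"
    using fs.span_base[of _ ?R] \<sigma>(2) by simp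
  \<comment> \<open>The children are replaced one at a time from left to right; \<open>zs\<close>
    are those already done.\<close>
  have s3: "gen (C (Node a 1 (zs @ ts'))) - fscale (prod_list (map coef ts')) (gen (C (Node a 1 (zs @ us)))) \<in> fspan ?R"
    if "C (Node a 1 (zs @ ts')) \<in> G" "\<forall>u\<in>set us. ones u" for zs
    using Node(3) Node(2) that
  proof (induction arbitrary: zs rule: list_all2_induct)
    case Nil
    then show ?case by (simp add: fs.span_zero)
  next
    case (Cons t ts' u us)
    have iso: "iso t u" using Cons.prems(1) by simp
    have IHt: "gen (D t) - fscale (coef t) (gen (D u)) \<in> fspan ?R" if "D \<in> tree_contexts" "D t \<in> G" for D
      using Cons.hyps(1) Cons.prems(3) that by simp
    have "C (Node a 1 (zs @ u # ts')) \<in> G"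
      by (rule closed[OF Cons.prems(2) iso_context[OF C iso_child[OF iso]]])
    then have "gen (C (Node a 1 ((zs @ [u]) @ ts'))) - fscale (prod_list (map coef ts')) (gen (C (Node a 1 ((zs @ [u]) @ us)))) \<in> fspan ?R"
      using Cons.prems by (intro Cons.IH) simp_all
    from fs.span_add[OF IHt[OF tree_context_comp[OF C], of a 1 zs ts'] fs.span_scale[OF this, of "coef t"]] Cons.prems(2)
    show ?case by (simp add: fs.scale_right_diff_distrib)
  qed
  have "gen (C (Node a 1 ([] @ ts'))) - fscale (prod_list (map coef ts')) (gen (C (Node a 1 ([] @ us)))) \<in> fspan ?R"
    using Node(4) G2 by (intro s3) auto
  moreover have "prod_list (map coef ts') = prod_list (map coef ts)"
    using Node(1) by (metis mset_map prod_mset_prod_list)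
  ultimately have s3: "gen (C (Node a 1 ts')) - fscale (prod_list (map coef ts)) (gen (C (Node a 1 us))) \<in> fspan ?R"
    by simp
  from fs.span_add[OF s1 fs.span_scale[OF fs.span_add[OF s2 s3], of p]]
  show ?case using q by (simp add: fs.scale_right_diff_distrib)
qed

text \<open>\<open>coef\<close> is multilinear in the labels and invariant under permutations, so it
  is enough that \<open>g\<close> ignores the label and the order of the inputs at each
  vertex.\<close>

lemma kill_tensor_rels:
  fixes g :: "('i, 'k::comm_ring_1) tree \<Rightarrow> ('c \<Rightarrow>\<^sub>0 'k)"
  assumes g: "\<And>C a p q ts us. C \<in> tree_contexts \<Longrightarrow> mset us = mset ts \<Longrightarrow> g (C (Node a p ts)) = g (C (Node a q us))"
    and "r \<in> tensor_rels commutative_operad G"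
  shows "lin_ext (\<lambda>T. fscale (coef T) (g T)) r = 0"
  using assms(2) unfolding tensor_rels_def
proof (elim UnE)
  assume "r \<in> {gen (C (Node a (p + q) ts)) - gen (C (Node a p ts)) - gen (C (Node a q ts)) | C a p q ts.
        C \<in> tree_contexts \<and> {C (Node a (p + q) ts), C (Node a p ts), C (Node a q ts)} \<subseteq> G}"
  then obtain C a p q ts where r: "r = gen (C (Node a (p + q) ts)) - gen (C (Node a p ts)) - gen (C (Node a q ts))"
    and C: "C \<in> tree_contexts" by (elim CollectE exE conjE)
  obtain c where c: "\<And>t. coef (C t) = c * coef t" using context_coef[OF C] by (elim exE) simp
  have e: "g (C (Node a (p + q) ts)) = g (C (Node a p ts))" "g (C (Node a q ts)) = g (C (Node a p ts))"
    by (rule g[OF C refl])+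
  have "coef (C (Node a (p + q) ts)) - coef (C (Node a p ts)) - coef (C (Node a q ts)) = 0"
    by (simp add: c algebra_simps)
  then show ?thesis
    by (simp only: r lin_diff[OF lin_lin_ext] lin_ext_gen e fs.scale_left_diff_distrib[symmetric] fs.scale_zero_left)
next
  assume "r \<in> {gen (C (Node a (smul commutative_operad c p) ts)) - fscale c (gen (C (Node a p ts))) | C a c p ts.
        C \<in> tree_contexts \<and> {C (Node a (smul commutative_operad c p) ts), C (Node a p ts)} \<subseteq> G}"
  then obtain C a b p ts where r: "r = gen (C (Node a (b * p) ts)) - fscale b (gen (C (Node a p ts)))"
    and C: "C \<in> tree_contexts" by (elim CollectE exE conjE) simp
  obtain c where c: "\<And>t. coef (C t) = c * coef t" using context_coef[OF C] by (elim exE) simp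
  have e: "g (C (Node a (b * p) ts)) = g (C (Node a p ts))" using g[OF C refl] .
  show ?thesis by (simp add: r lin_diff[OF lin_lin_ext] lin_scale[OF lin_lin_ext] c e ac_simps)
next
  assume "r \<in> {gen (C (Node a (act commutative_operad (length ts) \<sigma> p) ts)) - gen (C (Node a p (permute_list \<sigma> ts))) | C a \<sigma> p ts.
        C \<in> tree_contexts \<and> \<sigma> permutes {..<length ts} \<and>
        {C (Node a (act commutative_operad (length ts) \<sigma> p) ts), C (Node a p (permute_list \<sigma> ts))} \<subseteq> G}"
  then obtain C a \<sigma> p ts where r: "r = gen (C (Node a p ts)) - gen (C (Node a p (permute_list \<sigma> ts)))"
    and C: "C \<in> tree_contexts" and \<sigma>: "\<sigma> permutes {..<length ts}" by (elim CollectE exE conjE) simp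
  obtain c where c: "\<And>t. coef (C t) = c * coef t" using context_coef[OF C] by (elim exE) simp
  have m: "mset (permute_list \<sigma> ts) = mset ts" using \<sigma> by simp
  have e: "g (C (Node a p (permute_list \<sigma> ts))) = g (C (Node a p ts))" by (rule g[OF C m, symmetric])
  have "prod_list (map coef (permute_list \<sigma> ts)) = prod_list (map coef ts)"
    using m by (metis mset_map prod_mset_prod_list)
  then show ?thesis by (simp add: r lin_diff[OF lin_lin_ext] c e)
qed

text \<open>The invariant \<open>f\<close> matches the children of the two trees bijectively; in the
  applications it is the set of leaves.\<close>

lemma iso_children:
  assumes "distinct (map f ts)" "distinct (map f us)" "f ` set ts = f ` set us"
    and "\<And>t u. t \<in> set ts \<Longrightarrow> u \<in> set us \<Longrightarrow> f t = f u \<Longrightarrow> iso t u"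
  shows "iso (Node a p ts) (Node a q us)"
proof -
  have "mset (map f us) = mset (map f ts)"
    using assms(1-3) set_eq_iff_mset_eq_distinct[OF assms(2,1)] by simp
  then obtain \<sigma> where \<sigma>: "\<sigma> permutes {..<length ts}" "permute_list \<sigma> (map f ts) = map f us"
    using mset_eq_permutation[of "map f us" "map f ts"] by (metis length_map)
  then have m: "map f (permute_list \<sigma> ts) = map f us" by (simp add: permute_list_map)
  have "list_all2 iso (permute_list \<sigma> ts) us"
  proof (rule list_all2_all_nthI)
    show "length (permute_list \<sigma> ts) = length us" using m by (metis length_map)
    fix i assume i: "i < length (permute_list \<sigma> ts)"
    then have "i < length us" using m by (metis length_map)
    then have "us ! i \<in> set us" "f (permute_list \<sigma> ts ! i) = f (us ! i)"
      using m i by (auto dest: arg_cong[where f="\<lambda>xs. xs ! i"])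
    moreover have "permute_list \<sigma> ts ! i \<in> set ts"
      using i \<sigma>(1) by (metis nth_mem set_permute_list)
    ultimately show "iso (permute_list \<sigma> ts ! i) (us ! i)" using assms(4) by blast
  qed
  moreover have "mset (permute_list \<sigma> ts) = mset ts" using \<sigma>(1) by simp
  ultimately show ?thesis by (rule iso_Node[rotated])
qed

lemma leaves_nonempty: "arity_ge (Suc 0) T \<Longrightarrow> lset T \<noteq> {}"
proof (induction T)
  case (Node a p ts)
  then obtain t where "t \<in> set ts" by (cases ts) auto
  then show ?case using Node by auto
qed simp

lemma arity_ge_mono: "arity_ge k T \<Longrightarrow> j \<le> k \<Longrightarrow> arity_ge j T"
  by (induction T) auto

lemma distinct_concat_disjoint:
  assumes "distinct (concat (map f ts))" "t \<in> set ts" "u \<in> set ts" "set (f t) \<inter> set (f u) \<noteq> {}"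
  shows "t = u"
  using assms
proof (induction ts)
  case (Cons a ts)
  have "set (f a) \<inter> set (f v) = {}" if "v \<in> set ts" for v using Cons.prems(1) that by auto
  then show ?case using Cons by auto
qed simp

lemma distinct_map_sets:
  assumes "distinct (concat (map f ts))" "\<And>t. t \<in> set ts \<Longrightarrow> f t \<noteq> []"
  shows "distinct (map (\<lambda>t. set (f t)) ts)"
  using assms
proof (induction ts)
  case (Cons a ts)
  have "set (f a) \<noteq> set (f v)" if v: "v \<in> set ts" for v
  proof
    assume "set (f a) = set (f v)"
    moreover have "set (f a) \<inter> set (f v) = {}" using Cons.prems(1) v by auto
    moreover have "f a \<noteq> []" using Cons.prems(2) by simp
    ultimately show False by simp
  qed
  then show ?case using Cons by auto
qed simp

lemma distinct_children: "distinct (concat (map f ts)) \<Longrightarrow> t \<in> set ts \<Longrightarrow> distinct (f t)"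
  by (induction ts) auto


section \<open>Signs of orderings\<close>

lemma prec_sign_swap: "a \<noteq> b \<Longrightarrow> prec_sign b a = - (prec_sign a b :: 'k::comm_ring_1)"
  using prec_total[of a b] by (auto simp: prec_sign_def)

lemma prod_list_prec_sign_swap:
  assumes "a \<notin> set xs"
  shows "(\<Prod>x\<leftarrow>xs. prec_sign x a) = (-1) ^ length xs * (\<Prod>x\<leftarrow>xs. prec_sign a x :: 'k::comm_ring_1)"
  using assms
proof (induction xs)
  case (Cons x xs)
  then have "prec_sign x a = - (prec_sign a x :: 'k)" by (intro prec_sign_swap) auto
  then show ?case using Cons by simp
qed simp

lemma prod_list_mult:
  "(\<Prod>x\<leftarrow>xs. f x * g x) = (\<Prod>x\<leftarrow>xs. f x) * (\<Prod>x\<leftarrow>xs. g x :: 'k::comm_ring_1)"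
  by (induction xs) (simp_all add: ac_simps)

lemma prod_list_mset: "mset xs = mset ys \<Longrightarrow> (\<Prod>x\<leftarrow>xs. f x) = (\<Prod>x\<leftarrow>ys. f x :: 'k::comm_ring_1)"
  by (metis mset_map prod_mset_prod_list)

text \<open>Each entry of \<open>ws\<close> changes sides with both x and y, which gives an even
  number of sign changes; the pair x, y itself gives one more.\<close>

lemma order_sign_swap:
  assumes "distinct (us @ x # ws @ y # vs)"
  shows "order_sign (us @ y # ws @ x # vs) = - (order_sign (us @ x # ws @ y # vs) :: 'k::comm_ring_1)"
proof -
  define S where "S = (\<lambda>a (xs :: 'a set list). (\<Prod>w\<leftarrow>xs. prec_sign a w :: 'k))"
  have e: "order_sign (x # ws @ y # vs) = S x ws * prec_sign x y * S x vs * order_sign ws * S y vs * order_sign vs *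
      (\<Prod>w\<leftarrow>ws. prec_sign w y) * (\<Prod>w\<leftarrow>ws. S w vs)" for x y
    by (simp add: order_sign_append S_def prod_list_mult ac_simps)
  have "(\<Prod>w\<leftarrow>ws. prec_sign w y) = (-1) ^ length ws * S y ws" "(\<Prod>w\<leftarrow>ws. prec_sign w x) = (-1) ^ length ws * S x ws"
    "prec_sign y x = - (prec_sign x y :: 'k)"
    unfolding S_def using assms by (auto intro!: prod_list_prec_sign_swap prec_sign_swap)
  then have "order_sign (y # ws @ x # vs) = - (order_sign (x # ws @ y # vs) :: 'k)"
    unfolding e by (simp add: ac_simps)
  moreover have "(\<Prod>u\<leftarrow>us. \<Prod>w\<leftarrow>y # ws @ x # vs. prec_sign u w) = (\<Prod>u\<leftarrow>us. \<Prod>w\<leftarrow>x # ws @ y # vs. prec_sign u w :: 'k)"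
    by (intro arg_cong[where f=prod_list] map_cong refl prod_list_mset) simp
  ultimately show ?thesis unfolding order_sign_append[of us] by simp
qed

lemma order_sign_permute:
  assumes "distinct xs" "\<pi> permutes {..<length xs}"
  shows "order_sign (permute_list \<pi> xs) = of_int (sign \<pi>) * (order_sign xs :: 'k::comm_ring_1)"
  using finite_lessThan assms(2)
proof (induction rule: permutes_rev_induct)
  case id
  then show ?case by simp
next
  case (swap a b p)
  define ys where "ys = permute_list p xs"
  have ys: "distinct ys" "length ys = length xs"
    using assms(1) \<open>p permutes {..<length xs}\<close> by (simp_all add: ys_def)
  have swap_sign: "order_sign (permute_list (Transposition.transpose a b) ys) = - (order_sign ys :: 'k)"
    if ab: "a < b" "b < length ys" for a b
  proof -
    define us ws vs where "us = take a ys" and "ws = take (b - Suc a) (drop (Suc a) ys)" and "vs = drop (Suc b) ys"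
    have "drop (Suc a) ys = ws @ drop (b - Suc a) (drop (Suc a) ys)"
      unfolding ws_def by (rule append_take_drop_id[symmetric])
    also have "drop (b - Suc a) (drop (Suc a) ys) = ys ! b # vs"
      using ab by (simp add: vs_def Cons_nth_drop_Suc)
    finally have d: "ys = us @ ys ! a # ws @ ys ! b # vs"
      using ab by (metis id_take_nth_drop less_trans us_def)
    have len: "length us = a" "length ws = b - Suc a" using ab by (simp_all add: us_def ws_def)
    have "permute_list (Transposition.transpose a b) ys = ys[a := ys ! b, b := ys ! a]"
      using ab by (intro nth_equalityI) (auto simp: permute_list_def nth_list_update Transposition.transpose_def)
    also have "\<dots> = us @ ys ! b # ws @ ys ! a # vs"
    proof -
      have "(us @ x # ws @ y # vs)[a := y, b := x] = us @ y # ws @ x # vs" for x y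
      proof -
        have "a = length us" "b = length us + Suc (length ws)" using len ab by simp_all
        then show ?thesis by (simp add: list_update_append)
      qed
      then show ?thesis using d by metis
    qed
    finally show ?thesis using order_sign_swap[of us "ys ! a" ws "ys ! b" vs, where 'k='k] d ys(1) by metis
  qed
  have ab: "a < length ys" "b < length ys" "a \<noteq> b" using swap ys by auto
  have "order_sign (permute_list (Transposition.transpose a b) ys) = - (order_sign ys :: 'k)"
    using swap_sign[of a b] swap_sign[of b a] ab by (cases "a < b") (auto simp: transpose_commute)
  moreover have "permute_list (p \<circ> Transposition.transpose a b) xs = permute_list (Transposition.transpose a b) ys"
    unfolding ys_def using swap by (intro permute_list_compose permutes_swap_id) auto
  moreover have "sign (p \<circ> Transposition.transpose a b) = - sign p"
    using swap by (simp add: sign_compose sign_swap_id permutation_swap_id permutes_imp_permutation[OF finite_lessThan])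
  ultimately show ?case using swap.IH unfolding ys_def[symmetric]
    by (simp only: of_int_minus mult_minus_left)
qed

lemma eps_prod_list:
  assumes "distinct xs" "c \<notin> set xs"
  shows "eps c (set xs) = (\<Prod>x\<leftarrow>xs. prec_sign c x :: 'k::comm_ring_1)"
  using assms
proof (induction xs)
  case (Cons x xs)
  then have "prec x c \<longleftrightarrow> \<not> prec c x" by (intro prec_total) auto
  then show ?case using Cons by (simp add: eps_insert prec_sign_def)
qed (simp add: eps_def)

lemma eps_self: "eps c (insert c F) = eps c F"
proof -
  have "{C \<in> insert c F. prec C c} = {C \<in> F. prec C c}" by auto
  then show ?thesis by (simp add: eps_def)
qed

text \<open>Moving c to the front costs \<open>(-1) ^ length us\<close> in the list and
  \<open>eps\<close> in the sorted order; the two differ by the ratio of the sorting signs with and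
  without c.\<close>

lemma order_sign_remove:
  assumes "distinct (us @ c # vs)"
  shows "(-1) ^ length us * order_sign (us @ vs) = eps c (set (us @ c # vs)) * (order_sign (us @ c # vs) :: 'k::comm_ring_1)"
proof -
  let ?S = "\<lambda>xs. (\<Prod>x\<leftarrow>xs. prec_sign c x :: 'k)"
  have "eps c (set (us @ c # vs)) = (eps c (set (us @ vs)) :: 'k)" using eps_self[of c "set us \<union> set vs"] by simp
  also have "\<dots> = ?S us * ?S vs" using assms eps_prod_list[of "us @ vs" c, where 'k='k] by simp
  finally have e: "eps c (set (us @ c # vs)) = ?S us * ?S vs" .
  have "(\<Prod>u\<leftarrow>us. prec_sign u c :: 'k) = (-1) ^ length us * ?S us"
    by (rule prod_list_prec_sign_swap) (use assms in auto)
  then have o: "order_sign (us @ c # vs) = (-1) ^ length us * (?S us * ?S vs) * order_sign (us @ vs)"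
    by (simp add: order_sign_append prod_list_mult ac_simps)
  have "(?S us * ?S vs) * (?S us * ?S vs) = 1" using e eps_square[of c "set (us @ c # vs)", where 'k='k] by simp
  moreover have "(?S us * ?S vs) * ((-1) ^ length us * (?S us * ?S vs) * order_sign (us @ vs)) =
      ((?S us * ?S vs) * (?S us * ?S vs)) * ((-1) ^ length us * order_sign (us @ vs))"
    by (simp only: ac_simps)
  ultimately show ?thesis unfolding e o by simp
qed


section \<open>Bar trees and nested sets\<close>

definition singles :: "'a set \<Rightarrow> 'a set set" where
  "singles A = (\<lambda>x. {x}) ` A"

lemma partition_on_singles: "partition_on A (singles A)"
  unfolding singles_def by (rule partition_on_singletons)

section \<open>Clusters of a reduced tree\<close>

lemma vcs_fst: "fst ` vcs T = set (vertices T)"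
  by (induction T) (simp_all add: image_UN)

lemma vcs_subset: "(k, c) \<in> vcs T \<Longrightarrow> c \<subseteq> lset T"
proof (induction T)
  case (Node a p ts)
  then consider "c = (\<Union>t\<in>set ts. lset t)" | t where "t \<in> set ts" "(k, c) \<in> vcs t" by auto
  then show ?case
  proof cases
    case (2 t)
    then show ?thesis using Node.IH[OF 2] by auto
  qed simp
qed simp

lemma vcs_functional:
  assumes "distinct (vertices T)" "(k, c) \<in> vcs T" "(k, c') \<in> vcs T"
  shows "c = c'"
  using assms
proof (induction T)
  case (Node a p ts)
  have v: "x \<in> set (vertices t)" if "(x, d) \<in> vcs t" for x d and t :: "('a, 'b) tree"
    using that vcs_fst[of t] by force
  have a: "(a, d) \<notin> vcs t" if "t \<in> set ts" for d t
    using v[of a d t] that Node.prems(1) by auto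
  have dis: "distinct (concat (map vertices ts))" using Node.prems(1) by simp
  show ?case
  proof (cases "k = a")
    case True
    then show ?thesis using Node.prems(2,3) a by auto
  next
    case False
    then obtain t u where tu: "t \<in> set ts" "(k, c) \<in> vcs t" "u \<in> set ts" "(k, c') \<in> vcs u"
      using Node.prems(2,3) by auto
    have "set (vertices t) \<inter> set (vertices u) \<noteq> {}" using v tu by blast
    then have "t = u" using distinct_concat_disjoint[OF dis tu(1,3)] by simp
    then show ?thesis using Node.IH[OF tu(1)] tu distinct_children[OF dis tu(1)] by simp
  qed
qed simp

definition cl :: "('i \<times> nat set) set \<Rightarrow> 'i \<Rightarrow> nat set" where
  "cl V k = (THE c. (k, c) \<in> V)"

lemma cl_eq: "distinct (vertices T) \<Longrightarrow> (k, c) \<in> vcs T \<Longrightarrow> cl (vcs T) k = c"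
  unfolding cl_def by (rule the_equality) (simp_all add: vcs_functional)

lemma cl_mem:
  assumes "distinct (vertices T)" "k \<in> set (vertices T)"
  shows "(k, cl (vcs T) k) \<in> vcs T"
proof -
  obtain c where "(k, c) \<in> vcs T" using assms(2) unfolding vcs_fst[symmetric] by force
  then show ?thesis using cl_eq[OF assms(1)] by simp
qed

definition reduced :: "('i, 'm) tree \<Rightarrow> bool" where
  "reduced T \<longleftrightarrow> arity_ge 2 T \<and> distinct (leaves T)"

lemma reduced_child: "reduced (Node a p ts) \<Longrightarrow> t \<in> set ts \<Longrightarrow> reduced t"
  unfolding reduced_def using distinct_children by auto

lemma reduced_lset_nonempty: "reduced T \<Longrightarrow> lset T \<noteq> {}"
  unfolding reduced_def using arity_ge_mono[of 2 T 1] leaves_nonempty by auto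

lemma reduced_children_disjoint:
  assumes "reduced (Node a p ts)" "t \<in> set ts" "u \<in> set ts" "lset t \<inter> lset u \<noteq> {}"
  shows "t = u"
  using assms distinct_concat_disjoint[of leaves ts t u] by (simp add: reduced_def)

lemma distinct_lset_children:
  assumes "distinct (leaves (Node a p ts))" "\<And>t. t \<in> set ts \<Longrightarrow> lset t \<noteq> {}"
  shows "distinct (map (\<lambda>t. lset t) ts)"
  using assms distinct_map_sets[of leaves ts] by force

lemma reduced_distinct_lset: "reduced (Node a p ts) \<Longrightarrow> distinct (map (\<lambda>t. lset t) ts)"
  using reduced_child reduced_lset_nonempty distinct_lset_children unfolding reduced_def by metis

lemma child_psubset:
  assumes "reduced (Node a p ts)" "t \<in> set ts"
  shows "lset t \<subset> (\<Union>t\<in>set ts. lset t)"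
proof -
  have "distinct ts" using reduced_distinct_lset[OF assms(1)] by (simp add: distinct_map)
  then have "2 \<le> card (set ts)" using assms(1) by (simp add: reduced_def distinct_card)
  then have "\<not> set ts \<subseteq> {t}" using card_mono[of "{t}" "set ts"] by auto
  then obtain u where u: "u \<in> set ts" "u \<noteq> t" by blast
  then have dis: "lset t \<inter> lset u = {}" using reduced_children_disjoint[OF assms(1) assms(2) u(1)] by blast
  have "lset u \<noteq> {}" using reduced_child[OF assms(1) u(1)] by (rule reduced_lset_nonempty)
  then have "\<exists>x. x \<in> lset u" by (simp only: ex_in_conv not_False_eq_True)
  then obtain x where x: "x \<in> lset u" by (elim exE)
  then have "x \<notin> lset t" using dis by (metis IntI empty_iff)
  moreover have "x \<in> (\<Union>t\<in>set ts. lset t)" using u(1) x by (rule UN_I)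
  moreover have "lset t \<subseteq> (\<Union>t\<in>set ts. lset t)" by (rule UN_upper[OF assms(2)])
  ultimately show ?thesis by (intro psubsetI) metis+
qed

lemma reduced_cluster:
  assumes "reduced T" "(k, c) \<in> vcs T"
  shows "c \<noteq> {} \<and> (\<forall>i. c \<noteq> {i})"
  using assms
proof (induction T)
  case (Node a p ts)
  consider "c = (\<Union>t\<in>set ts. lset t)" | t where "t \<in> set ts" "(k, c) \<in> vcs t" using Node.prems(2) by auto
  then show ?case
  proof cases
    case 1
    obtain t where t: "t \<in> set ts" using Node.prems(1) by (cases ts) (auto simp: reduced_def)
    have "lset t \<subset> c" unfolding 1 using child_psubset[OF Node.prems(1) t] .
    moreover have "lset t \<noteq> {}" using reduced_child[OF Node.prems(1) t] by (rule reduced_lset_nonempty)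
    ultimately show ?thesis by (metis psubset_imp_subset subset_empty subset_singletonD psubset_eq)
  next
    case (2 t)
    then show ?thesis using Node.IH[OF 2(1) reduced_child[OF Node.prems(1) 2(1)] 2(2)] by simp
  qed
qed simp

text \<open>With at least two inputs at every vertex, the cluster of a child is a proper subset of
  that of its parent. Unary vertices would share clusters.\<close>

lemma vcs_inj:
  assumes "reduced T" "(k, c) \<in> vcs T" "(k', c) \<in> vcs T"
  shows "k = k'"
  using assms
proof (induction T)
  case (Node a p ts)
  have below: "c \<subset> (\<Union>t\<in>set ts. lset t)" if "t \<in> set ts" "(x, c) \<in> vcs t" for x t
    using vcs_subset[OF that(2)] child_psubset[OF Node.prems(1) that(1)] by blast
  have ne: "c \<noteq> {}" using reduced_cluster[OF Node.prems(1,2)] by simp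
  show ?case
  proof (cases "c = (\<Union>t\<in>set ts. lset t)")
    case True
    then show ?thesis using Node.prems(2,3) below by auto
  next
    case False
    then obtain t u where tu: "t \<in> set ts" "(k, c) \<in> vcs t" "u \<in> set ts" "(k', c) \<in> vcs u"
      using Node.prems(2,3) by auto
    have "lset t \<inter> lset u \<noteq> {}" using vcs_subset[OF tu(2)] vcs_subset[OF tu(4)] ne by blast
    then have "t = u" using reduced_children_disjoint[OF Node.prems(1) tu(1,3)] by simp
    then show ?thesis using Node.IH[OF tu(1) reduced_child[OF Node.prems(1) tu(1)]] tu by simp
  qed
qed simp

lemma vcs_laminar:
  assumes "reduced T" "(k, c) \<in> vcs T" "(k', c') \<in> vcs T"
  shows "c \<subseteq> c' \<or> c' \<subseteq> c \<or> c \<inter> c' = {}"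
  using assms
proof (induction T)
  case (Node a p ts)
  show ?case
  proof (cases "c = (\<Union>t\<in>set ts. lset t) \<or> c' = (\<Union>t\<in>set ts. lset t)")
    case True
    then show ?thesis using vcs_subset[OF Node.prems(2)] vcs_subset[OF Node.prems(3)] by auto
  next
    case False
    then obtain t u where tu: "t \<in> set ts" "(k, c) \<in> vcs t" "u \<in> set ts" "(k', c') \<in> vcs u"
      using Node.prems(2,3) by auto
    show ?thesis
    proof (cases "t = u")
      case True
      then show ?thesis using Node.IH[OF tu(1) reduced_child[OF Node.prems(1) tu(1)]] tu by simp
    next
      case False
      then have "lset t \<inter> lset u = {}" using reduced_children_disjoint[OF Node.prems(1) tu(1,3)] by blast
      then show ?thesis using vcs_subset[OF tu(2)] vcs_subset[OF tu(4)] by blast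
    qed
  qed
qed simp

lemma vcs_nested:
  assumes "reduced T"
  shows "snd ` vcs T \<in> nested (lset T) (singles (lset T))"
proof -
  have "laminar (snd ` vcs T)" unfolding laminar_def using vcs_laminar[OF assms] by fastforce
  moreover have "cluster (lset T) (singles (lset T)) c" if c: "c \<in> snd ` vcs T" for c
  proof -
    obtain k where k: "(k, c) \<in> vcs T" using c by force
    have "c \<noteq> {}" "c \<noteq> {i}" "c \<subseteq> lset T" for i
      using reduced_cluster[OF assms k] vcs_subset[OF k] by auto
    then show ?thesis unfolding cluster_def singles_def by blast
  qed
  moreover have "lset T \<in> snd ` vcs T \<or> singles (lset T) = {lset T}"
    by (cases T) (simp_all add: singles_def)
  moreover have "lset T \<noteq> {}" using assms by (rule reduced_lset_nonempty)
  ultimately show ?thesis unfolding nested_def by blast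
qed

lemma reduced_positions:
  assumes "reduced T" "distinct (vertices T)" "set (vertices T) = {..<d}"
  shows "distinct (map (cl (vcs T)) [0..<d])" "set (map (cl (vcs T)) [0..<d]) = snd ` vcs T"
    "card (snd ` vcs T) = d"
proof -
  have mem: "(k, cl (vcs T) k) \<in> vcs T" if "k < d" for k
    using cl_mem[OF assms(2)] assms(3) that by blast
  then have "inj_on (cl (vcs T)) {..<d}"
    by (intro inj_onI) (metis assms(1) lessThan_iff vcs_inj)
  then show dis: "distinct (map (cl (vcs T)) [0..<d])" by (simp add: distinct_map atLeast0LessThan)
  moreover have "c \<in> cl (vcs T) ` {..<d}" if "(k, c) \<in> vcs T" for k c
  proof -
    have "k \<in> {..<d}" using that vcs_fst[of T] assms(3) by force
    then show ?thesis using cl_eq[OF assms(2) that] by blast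
  qed
  moreover have "cl (vcs T) k \<in> snd ` vcs T" if "k < d" for k using imageI[OF mem[OF that], of snd] by simp
  ultimately have "snd ` vcs T = cl (vcs T) ` {..<d}" by auto
  then show s: "set (map (cl (vcs T)) [0..<d]) = snd ` vcs T" by (simp add: atLeast0LessThan)
  show "card (snd ` vcs T) = d" unfolding s[symmetric] using distinct_card[OF dis] by simp
qed

text \<open>The sign relating the order of the tensor factors, given by the positions, to the order
  of the clusters by \<open>prec\<close>.\<close>

definition orient :: "nat \<Rightarrow> (nat \<times> nat set) set \<Rightarrow> 'k::comm_ring_1" where
  "orient d V = order_sign (map (cl V) [0..<d])"

definition bar_basis :: "nat \<Rightarrow> nat \<Rightarrow> nat set set set" where
  "bar_basis n d = {F \<in> nested {1..n} (singles {1..n}). card F = d}"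

definition bar_class :: "nat \<Rightarrow> (nat, 'k) tree \<Rightarrow> (nat set set \<Rightarrow>\<^sub>0 'k::comm_ring_1)" where
  "bar_class d T = fscale (coef T) (fscale (orient d (vcs T)) (gen (snd ` vcs T)))"

lemma orient_square:
  assumes "reduced T" "distinct (vertices T)" "set (vertices T) = {..<d}"
  shows "orient d (vcs T) * orient d (vcs T) = (1 :: 'k::comm_ring_1)"
proof -
  have p: "(\<Prod>y\<leftarrow>xs. prec_sign x y) * (\<Prod>y\<leftarrow>xs. prec_sign x y) = (1 :: 'k)" for x and xs :: "nat set list"
    by (induction xs) (simp_all add: prec_sign_def)
  have "order_sign xs * order_sign xs = (1 :: 'k)" for xs :: "nat set list"
  proof (induction xs)
    case (Cons x xs)
    have "order_sign (x # xs) * order_sign (x # xs) =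
        ((\<Prod>y\<leftarrow>xs. prec_sign x y) * (\<Prod>y\<leftarrow>xs. prec_sign x y)) * (order_sign xs * order_sign xs :: 'k)"
      by (simp add: ac_simps)
    then show ?case using p[of x xs] Cons.IH by simp
  qed simp
  then show ?thesis by (simp add: orient_def)
qed

section \<open>Classes of bar trees\<close>

lemma coef_zero_or_reduced:
  assumes "T \<in> bar_trees (commutative_operad :: ('k, 'k::comm_ring_1) operad) n d"
  shows "reduced T \<or> coef T = 0 \<and> gen T \<in> fspan (tensor_rels Com (bar_trees commutative_operad n d))"
proof (cases "arity_ge 2 T")
  case True
  then show ?thesis using assms by (simp add: bar_trees_def n_tree_def reduced_def)
next
  case False
  have l: "labelled_in (reduced_ops Com) T"
    using assms by (simp add: bar_trees_def)
  have z: "reduced_ops Com r \<subseteq> {0}" if "r < 2" for r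
    using that by (simp add: reduced_ops_def)
  show ?thesis using low_arity_coef[OF l False z] low_arity_rels[OF l False z assms] by simp
qed

lemma labelled_reduced:
  "arity_ge 2 T \<Longrightarrow> labelled_in (reduced_ops (commutative_operad :: ('k, 'k::comm_ring_1) operad)) T"
  by (induction T) (auto simp: reduced_ops_def)

lemma bar_treesD:
  assumes "T \<in> bar_trees P n d"
  shows "distinct (leaves T)" "lset T = {1..n}" "distinct (vertices T)" "set (vertices T) = {..<d}"
    "labelled_in (reduced_ops P) T"
  using assms by (simp_all add: bar_trees_def n_tree_def)

lemma bar_class_mem:
  assumes "T \<in> bar_trees (commutative_operad :: ('k, 'k::comm_ring_1) operad) n d"
  shows "bar_class d T \<in> free_on (bar_basis n d)"
  using coef_zero_or_reduced[OF assms]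
proof
  assume r: "reduced T"
  note T = bar_treesD[OF assms]
  have "snd ` vcs T \<in> bar_basis n d"
    using vcs_nested[OF r] reduced_positions(3)[OF r T(3,4)] T(2) by (simp add: bar_basis_def)
  then show ?thesis by (simp add: bar_class_def scale_free_on)
qed (simp add: bar_class_def)

lemma map_tree_simps:
  "leaves (map_tree f id T) = leaves T" "vertices (map_tree f id T) = map f (vertices T)"
  "arity_ge k (map_tree f id T) = arity_ge k T"
  "labelled_in M (map_tree f id T) = labelled_in M T"
  by (induction T) (auto simp: map_concat comp_def intro!: arg_cong[where f=concat])

lemma coef_map_tree: "coef (map_tree f id T) = coef T"
  by (induction T) (auto intro!: arg_cong[where f="\<lambda>x. _ * x"] arg_cong[where f=prod_list])

lemma vcs_map_tree: "vcs (map_tree f id T) = (\<lambda>(k, c). (f k, c)) ` vcs T"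
  by (induction T) (simp_all add: map_tree_simps[unfolded id_def] image_UN id_def)

lemma reduced_map_tree: "reduced (map_tree f id T) = reduced T"
  by (simp add: reduced_def map_tree_simps)

lemma bar_class_permute:
  assumes T: "T \<in> bar_trees (commutative_operad :: ('k, 'k::comm_ring_1) operad) n d" and \<pi>: "\<pi> permutes {..<d}"
  shows "map_tree \<pi> id T \<in> bar_trees (commutative_operad :: ('k, 'k::comm_ring_1) operad) n d"
    "bar_class d (map_tree \<pi> id T) = fscale (of_int (sign \<pi>)) (bar_class d T)"
proof -
  note TD = bar_treesD[OF T]
  have inj: "inj \<pi>" using \<pi> by (rule permutes_inj)
  show T': "map_tree \<pi> id T \<in> bar_trees Com n d"
    using T inj permutes_image[OF \<pi>]
    by (simp add: bar_trees_def n_tree_def map_tree_simps distinct_map inj_on_subset[of \<pi> UNIV])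
  show "bar_class d (map_tree \<pi> id T) = fscale (of_int (sign \<pi>)) (bar_class d T)"
    using coef_zero_or_reduced[OF T]
  proof
    assume r: "reduced T"
    let ?xs = "map (cl (vcs T)) [0..<d]"
    have \<pi>i: "inv \<pi> permutes {..<d}" using \<pi> by (rule permutes_inv)
    \<comment> \<open>The vertex that ends up in position k was in position
      \<open>inv \<pi> k\<close>; the inverse has the same sign.\<close>
    have "cl (vcs (map_tree \<pi> id T)) k = cl (vcs T) (inv \<pi> k)" if k: "k < d" for k
    proof (rule cl_eq)
      show "distinct (vertices (map_tree \<pi> id T))" by (rule bar_treesD[OF T'])
      have "inv \<pi> k \<in> set (vertices T)" using permutes_in_image[OF \<pi>i, of k] k TD(4) by simp
      then have "(inv \<pi> k, cl (vcs T) (inv \<pi> k)) \<in> vcs T" by (rule cl_mem[OF TD(3)])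
      then have "(\<pi> (inv \<pi> k), cl (vcs T) (inv \<pi> k)) \<in> vcs (map_tree \<pi> id T)"
        unfolding vcs_map_tree by force
      then show "(k, cl (vcs T) (inv \<pi> k)) \<in> vcs (map_tree \<pi> id T)" by (simp add: permutes_inverses(1)[OF \<pi>])
    qed
    then have "map (cl (vcs (map_tree \<pi> id T))) [0..<d] = permute_list (inv \<pi>) ?xs"
      using permutes_in_image[OF \<pi>i] by (auto simp: permute_list_def)
    then have "orient d (vcs (map_tree \<pi> id T)) = of_int (sign (inv \<pi>)) * (orient d (vcs T) :: 'k)"
      unfolding orient_def using order_sign_permute[OF reduced_positions(1)[OF r TD(3,4)], of "inv \<pi>", where 'k='k] \<pi>i by simp
    moreover have "sign (inv \<pi>) = sign \<pi>"
      using \<pi> by (intro sign_inverse permutes_imp_permutation[OF finite_lessThan])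
    moreover have "snd ` vcs (map_tree \<pi> id T) = snd ` vcs T" by (auto simp: vcs_map_tree image_image case_prod_unfold)
    ultimately show ?thesis by (simp add: bar_class_def coef_map_tree ac_simps)
  qed (simp add: bar_class_def coef_map_tree)
qed

lemma bar_class_rels:
  assumes "r \<in> bar_rels (commutative_operad :: ('k, 'k::comm_ring_1) operad) n d"
  shows "lin_ext (bar_class d) r = 0"
  using assms unfolding bar_rels_def
proof
  assume "r \<in> tensor_rels Com (bar_trees commutative_operad n d)"
  then show ?thesis unfolding bar_class_def[abs_def]
  proof (rule kill_tensor_rels[rotated])
    fix C :: "(nat, 'k) tree \<Rightarrow> (nat, 'k) tree" and a and p q :: 'k and ts us :: "(nat, 'k) tree list"
    assume C: "C \<in> tree_contexts" and m: "mset us = mset ts"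
    have "set us = set ts" using m by (rule mset_eq_setD)
    then have "vcs (C (Node a p ts)) = vcs (C (Node a q us))" by (intro context_vcs[OF C]) simp_all
    then show "fscale (orient d (vcs (C (Node a p ts)))) (gen (snd ` vcs (C (Node a p ts)))) =
        fscale (orient d (vcs (C (Node a q us)))) (gen (snd ` vcs (C (Node a q us))) :: _ \<Rightarrow>\<^sub>0 'k)" by simp
  qed
next
  assume "r \<in> {gen (map_tree \<pi> id T) - fscale (of_int (sign \<pi>)) (gen T) | \<pi> T.
        \<pi> permutes {..<d} \<and> T \<in> bar_trees Com n d}"
  then obtain \<pi> T where "r = gen (map_tree \<pi> id T) - fscale (of_int (sign \<pi>)) (gen T)"
    "\<pi> permutes {..<d}" "T \<in> bar_trees Com n d" by blast
  then show ?thesis using bar_class_permute(2)[of T n d \<pi>]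
    by (simp add: lin_diff[OF lin_lin_ext] lin_scale[OF lin_lin_ext])
qed

section \<open>Reconstruction of reduced trees\<close>

lemma reduced_child_below:
  assumes "(\<Union>t\<in>set ts. vcs t) \<subseteq> (\<Union>u\<in>set us. vcs u)" "(\<Union>t\<in>set ts. lset t) \<subseteq> (\<Union>u\<in>set us. lset u)" "t \<in> set ts"
  shows "\<exists>u\<in>set us. lset t \<subseteq> lset u"
proof (cases t)
  case (Leaf i)
  then have "i \<in> (\<Union>u\<in>set us. lset u)" using assms(2,3) by force
  then show ?thesis using Leaf by auto
next
  case (Node b q vs)
  then have "(b, lset t) \<in> vcs t" by simp
  then have "(b, lset t) \<in> (\<Union>u\<in>set us. vcs u)" using assms(1,3) by blast
  then obtain u where "u \<in> set us" "(b, lset t) \<in> vcs u" by (rule UN_E)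
  then show ?thesis using vcs_subset by metis
qed

lemma vcs_child:
  assumes "reduced (Node a p ts)" "t \<in> set ts"
  shows "vcs t = {(k, c) \<in> (\<Union>t\<in>set ts. vcs t). c \<subseteq> lset t}"
proof -
  have "(k, c) \<in> vcs t" if u: "u \<in> set ts" "(k, c) \<in> vcs u" "c \<subseteq> lset t" for k c u
  proof -
    have "c \<noteq> {}" using reduced_cluster[OF reduced_child[OF assms(1) u(1)] u(2)] by simp
    then have "lset u \<inter> lset t \<noteq> {}" using vcs_subset[OF u(2)] u(3) by blast
    then show ?thesis using reduced_children_disjoint[OF assms(1) u(1) assms(2)] u(2) by simp
  qed
  then show ?thesis using vcs_subset assms(2) by fast
qed

lemma vcs_not_root:
  assumes "reduced (Node a p ts)"
  shows "(k, \<Union>t\<in>set ts. lset t) \<notin> (\<Union>t\<in>set ts. vcs t)"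
proof
  assume "(k, \<Union>t\<in>set ts. lset t) \<in> (\<Union>t\<in>set ts. vcs t)"
  then obtain t where t: "t \<in> set ts" "(k, \<Union>t\<in>set ts. lset t) \<in> vcs t" by (rule UN_E)
  show False using vcs_subset[OF t(2)] child_psubset[OF assms t(1)] by blast
qed

text \<open>The leaf set of a child of the root is a cluster or a singleton, so it lies in that of
  some child of the other tree; going forth and back returns to the same child, since children are
  disjoint. The clusters inside a child are then the data of that child.\<close>

lemma vcs_eq_iso:
  assumes "reduced T" "reduced T'" "lset T = lset T'" "vcs T = vcs T'"
  shows "iso T T'"
  using assms
proof (induction T arbitrary: T')
  case (Leaf i)
  then show ?case by (cases T') (auto intro: iso_Leaf)
next
  case (Node a p ts)
  obtain b q us where T': "T' = Node b q us" using Node.prems(4) by (cases T') auto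
  note r = Node.prems(1) and r' = Node.prems(2)[unfolded T']
  let ?L = "\<Union>t\<in>set ts. lset t"
  have L: "(\<Union>u\<in>set us. lset u) = ?L" using Node.prems(3) T' by simp
  have "(b, ?L) \<in> vcs (Node a p ts)" using Node.prems(4) T' L by simp
  then have ab: "a = b" using vcs_inj[OF r, of a ?L b] by simp
  have V: "(\<Union>t\<in>set ts. vcs t) = (\<Union>u\<in>set us. vcs u)"
    using Node.prems(4) vcs_not_root[OF r, of a] vcs_not_root[OF r', of a] unfolding T' ab L vcs.simps
    by (metis insert_ident)
  have up: "\<exists>u\<in>set us. lset t \<subseteq> lset u" if "t \<in> set ts" for t
    using reduced_child_below[of ts us t] V L that by simp
  have down: "\<exists>t\<in>set ts. lset u \<subseteq> lset t" if "u \<in> set us" for u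
    using reduced_child_below[of us ts u] V L that by simp
  have up_eq: "\<exists>u\<in>set us. lset t = lset u" if t: "t \<in> set ts" for t
  proof -
    obtain u where u: "u \<in> set us" "lset t \<subseteq> lset u" using up[OF t] by blast
    obtain t' where t': "t' \<in> set ts" "lset u \<subseteq> lset t'" using down[OF u(1)] by blast
    have "lset t \<noteq> {}" using reduced_lset_nonempty[OF reduced_child[OF r t]] .
    then have "lset t \<inter> lset t' \<noteq> {}" using order_trans[OF u(2) t'(2)] by (simp add: inf.absorb1)
    then have "t = t'" using reduced_children_disjoint[OF r t t'(1)] by simp
    then show ?thesis using u t'(2) by (intro bexI[of _ u]) simp_all
  qed
  have down_eq: "\<exists>t\<in>set ts. lset t = lset u" if u: "u \<in> set us" for u
  proof -
    obtain t where t: "t \<in> set ts" "lset u \<subseteq> lset t" using down[OF u] by blast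
    obtain u' where u': "u' \<in> set us" "lset t \<subseteq> lset u'" using up[OF t(1)] by blast
    have "lset u \<noteq> {}" using reduced_lset_nonempty[OF reduced_child[OF r' u]] .
    then have "lset u \<inter> lset u' \<noteq> {}" using order_trans[OF t(2) u'(2)] by (simp add: inf.absorb1)
    then have "u = u'" using reduced_children_disjoint[OF r' u u'(1)] by simp
    then show ?thesis using t u'(2) by (intro bexI[of _ t]) simp_all
  qed
  show ?case unfolding T' ab
  proof (rule iso_children[where f="\<lambda>t. lset t"])
    show "distinct (map (\<lambda>t. lset t) ts)" "distinct (map (\<lambda>t. lset t) us)"
      using reduced_distinct_lset[OF r] reduced_distinct_lset[OF r'] by simp_all
    show "(\<lambda>t. lset t) ` set ts = (\<lambda>t. lset t) ` set us" using up_eq down_eq by (auto simp: image_iff) metis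
    fix t u assume tu: "t \<in> set ts" "u \<in> set us" "lset t = lset u"
    have "vcs t = vcs u" using vcs_child[OF r tu(1)] vcs_child[OF r' tu(2)] V tu(3) by simp
    then show "iso t u"
      using Node.IH[OF tu(1) reduced_child[OF r tu(1)] reduced_child[OF r' tu(2)] tu(3)] by blast
  qed
qed

lemma distinct_concat_mapI:
  assumes "distinct cs" "\<And>c. c \<in> set cs \<Longrightarrow> distinct (g c)"
    and "\<And>c c'. c \<in> set cs \<Longrightarrow> c' \<in> set cs \<Longrightarrow> c \<noteq> c' \<Longrightarrow> set (g c) \<inter> set (g c') = {}"
  shows "distinct (concat (map g cs))"
  using assms
proof (induction cs)
  case (Cons c cs)
  have "set (g c) \<inter> set (g c') = {}" if "c' \<in> set cs" for c'
    using Cons.prems(1) that by (intro Cons.prems(3)) auto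
  moreover have "distinct (concat (map g cs))" using Cons.prems by (intro Cons.IH) auto
  moreover have "distinct (g c)" by (rule Cons.prems) simp
  ultimately show ?case by auto
qed simp

text \<open>The children of the root belong to the maximal sets among the singletons and the proper
  clusters. Vertices are decorated by their own clusters, which keeps them distinct; positions are
  substituted afterwards.\<close>

lemma nested_tree_exists:
  assumes "finite A" "F \<in> nested A (singles A)"
  shows "\<exists>T :: (nat set, 'k::comm_ring_1) tree. reduced T \<and> ones T \<and> lset T = A \<and>
    distinct (vertices T) \<and> vcs T = (\<lambda>c. (c, c)) ` F"
  using assms
proof (induction "card A" arbitrary: A F rule: less_induct)
  case less
  note finA = less.prems(1) and F = less.prems(2)
  show ?case
  proof (cases "singles A = {A}")
    case True
    then have "F = {}" using nested_full F by metis
    moreover have "A \<in> singles A" using True by simp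
    then obtain x where "A = {x}" unfolding singles_def by blast
    ultimately show ?thesis by (intro exI[of _ "Leaf x"]) (simp add: reduced_def)
  next
    case False
    have AF: "A \<in> F" using nestedD(4)[OF F] False by blast
    have finF: "finite F" using nested_finite[OF finA F] .
    let ?K = "singles A \<union> (F - {A})"
    define H where "H = maximals ?K"
    have finK: "finite ?K" using finA finF by (simp add: singles_def)
    have HK: "H \<subseteq> ?K" by (auto simp: H_def maximals_def)
    have finH: "finite H" using finK HK finite_subset by blast
    have K: "c \<noteq> {}" "c \<subset> A" if "c \<in> ?K" for c
    proof -
      have "{x} \<noteq> A" for x using False by (auto simp: singles_def)
      then show "c \<noteq> {}" "c \<subset> A"
        using that nestedD(3)[OF F, of c] by (auto simp: singles_def cluster_def)
    qed
    have lam: "c \<subseteq> c' \<or> c' \<subseteq> c \<or> c \<inter> c' = {}" if "c \<in> ?K" "c' \<in> ?K" for c c'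
      using that laminarD[OF nestedD(2)[OF F], of c c'] by (auto simp: singles_def)
    have disj: "c = c'" if "c \<in> H" "c' \<in> H" "c \<inter> c' \<noteq> {}" for c c'
    proof -
      have "c \<subseteq> c' \<or> c' \<subseteq> c" using lam[of c c'] that HK by blast
      moreover have "\<not> c \<subset> c'" "\<not> c' \<subset> c" using that(1,2) by (auto simp: H_def maximals_def)
      ultimately show ?thesis by blast
    qed
    have dominate: "\<exists>c\<in>H. D \<subseteq> c" if "D \<in> ?K" for D
      unfolding H_def by (rule maximals_dominate[OF finK that])
    have cover: "\<exists>c\<in>H. x \<in> c" if "x \<in> A" for x
      using dominate[of "{x}"] that by (auto simp: singles_def)
    define Fc where "Fc = (\<lambda>c. {D \<in> F - {A}. D \<subseteq> c})"
    have "\<exists>T :: (nat set, 'k) tree. reduced T \<and> ones T \<and> lset T = c \<and> distinct (vertices T) \<and> vcs T = (\<lambda>c. (c, c)) ` Fc c"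
      if c: "c \<in> H" for c
    proof (rule less.hyps)
      have cK: "c \<noteq> {}" "c \<subset> A" using K HK c by blast+
      show "card c < card A" using cK(2) finA by (rule psubset_card_mono[rotated])
      show "finite c" using cK(2) finA finite_subset by blast
      have "laminar (Fc c)" using nestedD(2)[OF F] by (rule laminar_subset) (auto simp: Fc_def)
      moreover have "cluster c (singles c) D" if D: "D \<in> Fc c" for D
      proof -
        have "cluster A (singles A) D" "D \<subseteq> c" using nestedD(3)[OF F, of D] D by (auto simp: Fc_def)
        then show ?thesis using cK(2) by (auto simp: cluster_def singles_def)
      qed
      moreover have "c \<in> Fc c \<or> singles c = {c}" using c HK by (auto simp: Fc_def singles_def)
      ultimately show "Fc c \<in> nested c (singles c)" using cK(1) unfolding nested_def by blast
    qed
    then have "\<forall>c\<in>H. \<exists>T :: (nat set, 'k) tree. reduced T \<and> ones T \<and> lset T = c \<and> distinct (vertices T) \<and> vcs T = (\<lambda>c. (c, c)) ` Fc c"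
      by (rule ballI)
    from bchoice[OF this] obtain f :: "nat set \<Rightarrow> (nat set, 'k) tree" where
      f0: "\<forall>c\<in>H. reduced (f c) \<and> ones (f c) \<and> lset (f c) = c \<and> distinct (vertices (f c)) \<and> vcs (f c) = (\<lambda>c. (c, c)) ` Fc c"
      by (elim exE)
    have f: "reduced (f c)" "ones (f c)" "lset (f c) = c" "distinct (vertices (f c))" "vcs (f c) = (\<lambda>c. (c, c)) ` Fc c"
      if "c \<in> H" for c using f0 that by simp_all
    obtain cs where cs: "set cs = H" "distinct cs" using finite_distinct_list[OF finH] by blast
    define T where "T = Node A 1 (map f cs)"
    have fv: "set (vertices (f c)) = Fc c" if "c \<in> H" for c
      unfolding vcs_fst[symmetric] f(5)[OF that] by (simp add: image_image)
    have UH: "(\<Union>c\<in>H. c) = A"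
    proof
      show "(\<Union>c\<in>H. c) \<subseteq> A" using K HK by blast
      show "A \<subseteq> (\<Union>c\<in>H. c)" using cover by blast
    qed
    \<comment> \<open>A single maximal set would have to cover A while being a proper subset of
      it.\<close>
    have "2 \<le> card H"
    proof (rule ccontr)
      assume "\<not> 2 \<le> card H"
      then have one: "\<forall>c\<in>H. \<forall>c'\<in>H. c = c'" using card_le_Suc0_iff_eq[OF finH] by simp
      obtain x where "x \<in> A" using nestedD(1)[OF F] by blast
      then obtain c where c: "c \<in> H" using cover by blast
      then have "c \<subset> A" using K HK by blast
      then obtain y where "y \<in> A" "y \<notin> c" by blast
      then show False using cover[of y] one c by blast
    qed
    then have len: "2 \<le> length cs" using distinct_card[OF cs(2)] cs(1) by simp
    have "distinct (concat (map (\<lambda>c. leaves (f c)) cs))"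
    proof (rule distinct_concat_mapI[OF cs(2)])
      show "distinct (leaves (f c))" if "c \<in> set cs" for c using f(1) that cs(1) by (simp add: reduced_def)
      show "lset (f c) \<inter> lset (f c') = {}" if "c \<in> set cs" "c' \<in> set cs" "c \<noteq> c'" for c c'
        using disj[of c c'] f(3) that cs(1) by auto
    qed
    then have "reduced T" using f(1) cs(1) len by (simp add: T_def reduced_def comp_def)
    moreover have "ones T" using f(2) cs(1) by (simp add: T_def)
    moreover have "lset T = A" using f(3) cs(1) UH by (simp add: T_def)
    moreover have "distinct (vertices T)"
    proof -
      have "distinct (concat (map (\<lambda>c. vertices (f c)) cs))"
      proof (rule distinct_concat_mapI[OF cs(2)])
        show "distinct (vertices (f c))" if "c \<in> set cs" for c using f(4) that cs(1) by simp
        show "set (vertices (f c)) \<inter> set (vertices (f c')) = {}" if c: "c \<in> set cs" "c' \<in> set cs" "c \<noteq> c'" for c c'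
        proof -
          have "D \<notin> Fc c'" if D: "D \<in> Fc c" for D
          proof
            assume D': "D \<in> Fc c'"
            have "D \<noteq> {}" using K(1)[of D] D by (auto simp: Fc_def)
            then have "c \<inter> c' \<noteq> {}" using D D' by (auto simp: Fc_def)
            then show False using disj[of c c'] c cs(1) by blast
          qed
          then show ?thesis using fv c cs(1) by blast
        qed
      qed
      moreover have "A \<notin> set (vertices (f c))" if "c \<in> H" for c using fv[OF that] by (simp add: Fc_def)
      ultimately show ?thesis using cs(1) by (simp add: T_def comp_def)
    qed
    moreover have "vcs T = (\<lambda>c. (c, c)) ` F"
    proof -
      have "(\<Union>c\<in>H. Fc c) = F - {A}" using dominate by (auto simp: Fc_def)
      then have "(\<Union>c\<in>H. (\<lambda>c. (c, c)) ` Fc c) = (\<lambda>c. (c, c)) ` (F - {A})" by (simp flip: image_UN)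
      moreover have "(\<Union>c\<in>H. vcs (f c)) = (\<Union>c\<in>H. (\<lambda>c. (c, c)) ` Fc c)" using f(5) by (intro SUP_cong refl)
      moreover have "(\<Union>c\<in>H. lset (f c)) = A" using f(3) UH by simp
      ultimately have "vcs T = insert (A, A) ((\<lambda>c. (c, c)) ` (F - {A}))" by (simp add: T_def cs(1))
      also have "\<dots> = (\<lambda>c. (c, c)) ` F" using AF by blast
      finally show ?thesis .
    qed
    ultimately show ?thesis by blast
  qed
qed

lemma bar_representative:
  assumes "F \<in> bar_basis n d"
  shows "\<exists>T\<in>bar_trees (commutative_operad :: ('k, 'k::comm_ring_1) operad) n d. reduced T \<and> ones T \<and> snd ` vcs T = F"
proof -
  have F: "F \<in> nested {1..n} (singles {1..n})" "card F = d" using assms by (auto simp: bar_basis_def)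
  obtain T :: "(nat set, 'k) tree" where T: "reduced T" "ones T" "lset T = {1..n}" "distinct (vertices T)"
    "vcs T = (\<lambda>c. (c, c)) ` F" using nested_tree_exists[OF _ F(1)] by blast
  obtain h where h: "bij_betw h F {0..<d}"
    using ex_bij_betw_finite_nat[OF nested_finite[OF _ F(1)]] F(2) by auto
  have v: "set (vertices T) = F" unfolding vcs_fst[symmetric] T(5) by (simp add: image_image)
  have r: "reduced (map_tree h id T)" using T(1) by (simp add: reduced_map_tree)
  moreover have "map_tree h id T \<in> bar_trees Com n d"
    using T h labelled_reduced[of "map_tree h id T"] r v
    by (simp add: bar_trees_def n_tree_def map_tree_simps reduced_def distinct_map bij_betw_def atLeast0LessThan)
  moreover have "ones (map_tree h id T)" using T(2) by (simp add: map_tree_simps)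
  moreover have "snd ` vcs (map_tree h id T) = F" by (simp add: vcs_map_tree T(5) image_image)
  ultimately show ?thesis by blast
qed

text \<open>
  \<open>\<Phi>\<close> induces an isomorphism from \<open>chains C d / zeros C d\<close> to the free module on \<open>S\<close>.
\<close>

definition presents :: "('b, 'k::comm_ring_1) fcomplex \<Rightarrow> nat \<Rightarrow> (('b \<Rightarrow>\<^sub>0 'k) \<Rightarrow> ('c \<Rightarrow>\<^sub>0 'k)) \<Rightarrow> 'c set \<Rightarrow> bool" where
  "presents C d \<Phi> S \<longleftrightarrow> fs.subspace (chains C d) \<and> fs.subspace (zeros C d) \<and> zeros C d \<subseteq> chains C d \<and> lin \<Phi> \<and>
     (\<forall>x\<in>chains C d. \<Phi> x \<in> free_on S \<and> (\<Phi> x = 0 \<longleftrightarrow> x \<in> zeros C d)) \<and>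
     (\<forall>b\<in>S. \<exists>x\<in>chains C d. \<Phi> x = gen b)"

text \<open>\<open>s\<close> picks a representative of each basis element, and \<open>norm\<close>
  reduces every generator to representatives modulo the relations. If the image of x vanishes, this
  reduction exhibits x as a combination of relations.\<close>

lemma presentsI:
  fixes C :: "('b, 'k::comm_ring_1) fcomplex"
  assumes C: "chains C d = fspan (gen ` G)" "zeros C d = fspan R" "R \<subseteq> fspan (gen ` G)"
    and R: "\<And>r. r \<in> R \<Longrightarrow> lin_ext \<phi> r = 0"
    and mem: "\<And>T. T \<in> G \<Longrightarrow> \<phi> T \<in> free_on S"
    and s: "\<And>b. b \<in> S \<Longrightarrow> s b \<in> fspan (gen ` G) \<and> lin_ext \<phi> (s b) = gen b"
    and norm: "\<And>T. T \<in> G \<Longrightarrow> gen T - lin_ext s (\<phi> T) \<in> fspan R"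
  shows "presents C d (lin_ext \<phi>) S"
  unfolding presents_def
proof (intro conjI ballI)
  show "fs.subspace (chains C d)" "fs.subspace (zeros C d)" unfolding C by simp_all
  show "zeros C d \<subseteq> chains C d" unfolding C(1,2) by (rule fs.span_minimal[OF C(3)]) simp
  show "lin (lin_ext \<phi>)" by (rule lin_lin_ext)
  show "\<exists>x\<in>chains C d. lin_ext \<phi> x = gen b" if "b \<in> S" for b using s[OF that] unfolding C by blast
  fix x assume "x \<in> chains C d"
  then have x: "x \<in> free_on G" unfolding C span_gen .
  show "lin_ext \<phi> x \<in> free_on S" by (rule lin_ext_mem[OF x subspace_free_on mem])
  show "lin_ext \<phi> x = 0 \<longleftrightarrow> x \<in> zeros C d"
  proof
    assume z: "lin_ext \<phi> x = 0"
    have "x - lin_ext s (lin_ext \<phi> x) \<in> fspan R"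
      by (rule lin_free_on_mem[where f="\<lambda>x. x - lin_ext s (lin_ext \<phi> x)", OF _ x])
        (auto intro!: lin_minus lin_id lin_comp[OF lin_lin_ext lin_lin_ext] norm)
    then show "x \<in> zeros C d" using z by (simp add: C lin_zero[OF lin_lin_ext])
  next
    assume "x \<in> zeros C d"
    then show "lin_ext \<phi> x = 0"
      unfolding C using lin_span_mem[OF lin_lin_ext _ fs.subspace_single_0, of x R \<phi>] R by simp
  qed
qed

lemma tensor_rels_subset: "tensor_rels P G \<subseteq> fspan (gen ` G)"
proof -
  show ?thesis
    unfolding tensor_rels_def
    by (intro Un_least subsetI; elim CollectE exE conjE; simp only: insert_subset)
      (intro fs.span_diff fs.span_scale fs.span_base imageI; simp)+
qed

lemma same_clusters_permute:
  fixes T S :: "(nat, 'm) tree"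
  assumes T: "reduced T" "distinct (vertices T)" "set (vertices T) = {..<d}"
    and S: "reduced S" "distinct (vertices S)" "set (vertices S) = {..<d}"
    and eq: "snd ` vcs T = snd ` vcs S"
  shows "\<exists>\<pi>. \<pi> permutes {..<d} \<and> vcs (map_tree \<pi> id T) = vcs S"
proof -
  let ?xs = "map (cl (vcs T)) [0..<d]" and ?ys = "map (cl (vcs S)) [0..<d]"
  have "mset ?xs = mset ?ys"
    using reduced_positions(1,2)[OF T] reduced_positions(1,2)[OF S] eq
    by (metis set_eq_iff_mset_eq_distinct)
  then obtain \<pi> where "\<pi> permutes {..<length ?ys}" and p: "permute_list \<pi> ?ys = ?xs"
    by (rule mset_eq_permutation)
  then have \<pi>: "\<pi> permutes {..<d}" by simp
  have e: "cl (vcs T) i = cl (vcs S) (\<pi> i)" if i: "i < d" for i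
  proof -
    have "\<pi> i < d" using permutes_in_image[OF \<pi>] i by simp
    then show ?thesis using arg_cong[OF p, where f="\<lambda>xs. xs ! i"] i \<pi> by (simp add: permute_list_nth)
  qed
  have "(k, c) \<in> vcs (map_tree \<pi> id T) \<longleftrightarrow> (k, c) \<in> vcs S" for k c
  proof
    assume "(k, c) \<in> vcs (map_tree \<pi> id T)"
    then obtain i where i: "k = \<pi> i" "(i, c) \<in> vcs T" by (auto simp: vcs_map_tree)
    then have "i < d" using vcs_fst[of T] T(3) by force
    then have "\<pi> i \<in> set (vertices S)" "c = cl (vcs S) (\<pi> i)"
      using permutes_in_image[OF \<pi>, of i] S(3) e[of i] cl_eq[OF T(2) i(2)] by auto
    then show "(k, c) \<in> vcs S" using cl_mem[OF S(2)] i(1) by simp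
  next
    assume k: "(k, c) \<in> vcs S"
    then have "k < d" using vcs_fst[of S] S(3) by force
    define i where "i = inv \<pi> k"
    have i: "\<pi> i = k" "i < d" using permutes_inverses(1)[OF \<pi>] permutes_in_image[OF permutes_inv[OF \<pi>], of k] \<open>k < d\<close>
      by (auto simp: i_def)
    then have "c = cl (vcs T) i" using e[of i] cl_eq[OF S(2) k] by simp
    then have "(i, c) \<in> vcs T" using cl_mem[OF T(2)] i(2) T(3) by simp
    then show "(k, c) \<in> vcs (map_tree \<pi> id T)" using i(1) by (force simp: vcs_map_tree)
  qed
  then have "vcs (map_tree \<pi> id T) = vcs S" by auto
  then show ?thesis using \<pi> by blast
qed

lemma presents_bar:
  "presents (bar_complex (commutative_operad :: ('k, 'k::comm_ring_1) operad) n) d (lin_ext (bar_class d)) (bar_basis n d)"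
proof -
  let ?P = "commutative_operad :: ('k, 'k) operad"
  let ?G = "bar_trees ?P n d" and ?R = "bar_rels ?P n d"
  define rep where "rep = (\<lambda>F. SOME T :: (nat, 'k) tree. T \<in> ?G \<and> reduced T \<and> ones T \<and> snd ` vcs T = F)"
  have rep: "rep F \<in> ?G" "reduced (rep F)" "ones (rep F)" "snd ` vcs (rep F) = F" if "F \<in> bar_basis n d" for F
  proof -
    have "\<exists>T. T \<in> ?G \<and> reduced T \<and> ones T \<and> snd ` vcs T = F" using bar_representative[OF that, where 'k='k] by blast
    from someI_ex[OF this] show "rep F \<in> ?G" "reduced (rep F)" "ones (rep F)" "snd ` vcs (rep F) = F"
      unfolding rep_def by blast+
  qed
  define s where "s = (\<lambda>F. fscale (orient d (vcs (rep F))) (gen (rep F)) :: (nat, 'k) tree \<Rightarrow>\<^sub>0 'k)"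
  have coef1: "coef T = 1" if "ones T" for T :: "(nat, 'k) tree"
    using that
  proof (induction T)
    case (Node a p ts)
    have "prod_list (map coef us) = 1" if "\<And>u. u \<in> set us \<Longrightarrow> coef u = 1" for us :: "(nat, 'k) tree list"
      using that by (induction us) auto
    then show ?case using Node by simp
  qed simp
  show ?thesis
  proof (rule presentsI[where G="?G" and R="?R" and s=s])
    show "?R \<subseteq> fspan (gen ` ?G)"
    proof
      fix r assume "r \<in> ?R"
      then consider "r \<in> tensor_rels ?P ?G" | \<pi> T where "\<pi> permutes {..<d}" "T \<in> ?G"
        "r = gen (map_tree \<pi> id T) - fscale (of_int (sign \<pi>)) (gen T)" unfolding bar_rels_def by blast
      then show "r \<in> fspan (gen ` ?G)"
      proof cases
        case 1
        then show ?thesis using tensor_rels_subset by blast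
      next
        case 2
        then show ?thesis unfolding 2(3) using bar_class_permute(1)[of T n d \<pi>]
          by (intro fs.span_diff fs.span_scale fs.span_base imageI)
      qed
    qed
    show "lin_ext (bar_class d) r = 0" if "r \<in> ?R" for r using bar_class_rels[OF that] .
    show "bar_class d T \<in> free_on (bar_basis n d)" if "T \<in> ?G" for T :: "(nat, 'k) tree" using bar_class_mem[OF that] .
    show "s F \<in> fspan (gen ` ?G) \<and> lin_ext (bar_class d) (s F) = gen F" if F: "F \<in> bar_basis n d" for F
    proof
      show "s F \<in> fspan (gen ` ?G)" unfolding s_def using rep(1)[OF F] by (intro fs.span_scale fs.span_base imageI)
      have "orient d (vcs (rep F)) * orient d (vcs (rep F)) = (1 :: 'k)"
        using orient_square[OF rep(2)[OF F] bar_treesD(3,4)[OF rep(1)[OF F]]] .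
      then show "lin_ext (bar_class d) (s F) = gen F"
        by (simp add: s_def lin_scale[OF lin_lin_ext] bar_class_def rep(4)[OF F] coef1[OF rep(3)[OF F]])
    qed
    fix T :: "(nat, 'k) tree" assume T: "T \<in> ?G"
    show "gen T - lin_ext s (bar_class d T) \<in> fspan ?R"
      using coef_zero_or_reduced[OF T]
    proof
      assume z: "coef T = 0 \<and> gen T \<in> fspan (tensor_rels ?P ?G)"
      then have "bar_class d T = 0" by (simp add: bar_class_def)
      moreover have "fspan (tensor_rels ?P ?G) \<subseteq> fspan ?R" unfolding bar_rels_def by (rule fs.span_mono) simp
      ultimately show ?thesis using z by (auto simp: lin_zero[OF lin_lin_ext])
    next
      assume r: "reduced T"
      note TD = bar_treesD[OF T]
      define F where "F = snd ` vcs T"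
      have F: "F \<in> bar_basis n d"
        using vcs_nested[OF r] reduced_positions(3)[OF r TD(3,4)] TD(2) by (simp add: bar_basis_def F_def)
      note S = rep[OF F] and SD = bar_treesD[OF rep(1)[OF F]]
      obtain \<pi> where \<pi>: "\<pi> permutes {..<d}" "vcs (map_tree \<pi> id T) = vcs (rep F)"
        using same_clusters_permute[OF r TD(3,4) S(2) SD(3,4)] S(4) by (auto simp: F_def)
      let ?T = "map_tree \<pi> id T" and ?s = "of_int (sign \<pi>) :: 'k"
      have ss: "?s * ?s = 1" by (simp flip: of_int_mult)
      have T1: "?T \<in> ?G" "bar_class d ?T = fscale ?s (bar_class d T)" using bar_class_permute[OF T \<pi>(1)] .
      have r1: "reduced ?T" using r by (simp add: reduced_map_tree)
      have "iso ?T (rep F)"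
        using vcs_eq_iso[OF r1 S(2) _ \<pi>(2)] SD(2) TD(2) by (simp add: map_tree_simps)
      \<comment> \<open>Normalizing replaces labels by 1, which is allowed only at vertices with at
        least two inputs; so the relations are applied among reduced trees.\<close>
      define G0 where "G0 = {T \<in> ?G. arity_ge 2 T}"
      have "gen ((\<lambda>t. t) ?T) - fscale (coef ?T) (gen ((\<lambda>t. t) (rep F))) \<in> fspan (tensor_rels ?P G0)"
      proof (rule iso_rels[OF _ \<open>iso ?T (rep F)\<close> S(3) tree_contexts.hole])
        show "?T \<in> G0" using T1(1) r1 by (simp add: G0_def reduced_def)
        fix U V :: "(nat, 'k) tree" assume U: "U \<in> G0" and i: "iso U V"
        have "arity_ge 2 V" using iso_arity_ge[OF i] U by (simp add: G0_def)
        moreover have "distinct (leaves V) = distinct (leaves U)" "distinct (vertices V) = distinct (vertices U)"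
          "lset V = lset U" "set (vertices V) = set (vertices U)"
          using iso_mset[OF i] by (auto dest: mset_eq_imp_distinct_iff mset_eq_setD)
        ultimately show "V \<in> G0" using U labelled_reduced[of V]
          by (simp add: G0_def bar_trees_def n_tree_def)
      qed
      moreover have "fspan (tensor_rels ?P G0) \<subseteq> fspan ?R"
        using tensor_rels_mono[of G0 ?G ?P] fs.span_mono[of "tensor_rels ?P ?G" ?R]
        by (auto simp: G0_def bar_rels_def)
      ultimately have e1: "gen ?T - fscale (coef T) (gen (rep F)) \<in> fspan ?R" by (auto simp: coef_map_tree)
      have "gen ?T - fscale ?s (gen T) \<in> ?R" using \<pi>(1) T by (auto simp: bar_rels_def)
      then have e2: "gen ?T - fscale ?s (gen T) \<in> fspan ?R" by (rule fs.span_base)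
      have "bar_class d ?T = fscale (coef T) (fscale (orient d (vcs (rep F))) (gen F))"
        by (simp add: bar_class_def \<pi>(2) coef_map_tree S(4))
      then have "fscale ?s (fscale ?s (bar_class d T)) = fscale (?s * coef T * orient d (vcs (rep F))) (gen F)"
        unfolding T1(2) by (simp add: ac_simps)
      then have b: "bar_class d T = fscale (?s * coef T * orient d (vcs (rep F))) (gen F)" using ss by simp
      have "orient d (vcs (rep F)) * orient d (vcs (rep F)) = (1 :: 'k)" by (rule orient_square[OF S(2) SD(3,4)])
      then have "lin_ext s (bar_class d T) = fscale (?s * coef T) (gen (rep F))"
        unfolding b s_def by (simp add: lin_scale[OF lin_lin_ext] mult.assoc)
      moreover have "fscale ?s (gen ?T - fscale (coef T) (gen (rep F))) - fscale ?s (gen ?T - fscale ?s (gen T)) =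
          gen T - fscale (?s * coef T) (gen (rep F))"
        using ss by (simp add: fs.scale_right_diff_distrib)
      ultimately show ?thesis using fs.span_diff[OF fs.span_scale[OF e1, of ?s] fs.span_scale[OF e2, of ?s]] by simp
    qed
  qed (simp_all add: bar_complex_def)
qed


section \<open>The differential of the bar construction\<close>

lemma leaves_contract: "leaves (contract P v T) = leaves T"
proof (induction T)
  case (Node a p ts)
  show ?case
  proof (cases "List.extract (is_vertex v) ts")
    case None
    have "map (\<lambda>t. leaves (contract P v t)) ts = map leaves ts" using Node.IH by simp
    then show ?thesis using None by (simp add: comp_def cong: map_cong)
  next
    case (Some x)
    then obtain us t ws where x: "x = (us, t, ws)" by (cases x)
    then have "ts = us @ t # ws" "is_vertex v t" using Some by (simp_all add: extract_Some_iff)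
    then show ?thesis using Some x by (auto simp: is_vertex_def)
  qed
qed simp

lemma vertices_contract:
  assumes "distinct (vertices T)" "\<not> is_vertex v T"
  shows "vertices (contract P v T) = removeAll v (vertices T)"
  using assms
proof (induction T)
  case (Node a p ts)
  have av: "a \<noteq> v" using Node.prems(2) by (auto simp: is_vertex_def)
  have dis: "distinct (concat (map vertices ts))" using Node.prems(1) by simp
  have rc: "removeAll v (concat xss) = concat (map (removeAll v) xss)" for xss :: "nat list list"
    by (induction xss) simp_all
  show ?case
  proof (cases "List.extract (is_vertex v) ts")
    case None
    then have "\<not> is_vertex v t" if "t \<in> set ts" for t using that by (simp add: extract_None_iff)
    then have "map (\<lambda>t. vertices (contract P v t)) ts = map (\<lambda>t. removeAll v (vertices t)) ts"
      using Node.IH distinct_children[OF dis] by simp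
    then show ?thesis using None av by (simp add: comp_def rc cong: map_cong)
  next
    case (Some x)
    obtain us t ws where x: "x = (us, t, ws)" by (cases x)
    have ts: "ts = us @ t # ws" and t: "is_vertex v t" using Some x by (simp_all add: extract_Some_iff)
    obtain q xs where t': "t = Node v q xs" using t by (auto simp: is_vertex_def)
    have d: "distinct (concat (map vertices us) @ (v # concat (map vertices xs)) @ concat (map vertices ws))"
      using dis unfolding ts t' by simp
    have n: "removeAll v l = l" if "v \<notin> set l" for l using that by (rule removeAll_id)
    have "v \<notin> set (concat (map vertices us))" "v \<notin> set (concat (map vertices xs))" "v \<notin> set (concat (map vertices ws))"
      using d by auto
    then show ?thesis using Some av unfolding x ts t' by (simp add: n del: set_concat)
  qed
qed simp

lemma vcs_contract:
  assumes "distinct (vertices T)" "\<not> is_vertex v T"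
  shows "vcs (contract P v T) = {(k, c) \<in> vcs T. k \<noteq> v}"
  using assms
proof (induction T)
  case (Node a p ts)
  have av: "a \<noteq> v" using Node.prems(2) by (auto simp: is_vertex_def)
  have dis: "distinct (concat (map vertices ts))" using Node.prems(1) by simp
  show ?case
  proof (cases "List.extract (is_vertex v) ts")
    case None
    then have "\<not> is_vertex v t" if "t \<in> set ts" for t using that by (simp add: extract_None_iff)
    then have "vcs (contract P v t) = {(k, c) \<in> vcs t. k \<noteq> v}" if "t \<in> set ts" for t
      using Node.IH[OF that distinct_children[OF dis that]] that by simp
    then have "(\<Union>t\<in>set ts. vcs (contract P v t)) = (\<Union>t\<in>set ts. {(k, c) \<in> vcs t. k \<noteq> v})" by simp
    also have "\<dots> = {(k, c) \<in> (\<Union>t\<in>set ts. vcs t). k \<noteq> v}" by auto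
    finally show ?thesis using None av by (auto simp: leaves_contract)
  next
    case (Some x)
    obtain us t ws where x: "x = (us, t, ws)" by (cases x)
    have ts: "ts = us @ t # ws" and t: "is_vertex v t" using Some x by (simp_all add: extract_Some_iff)
    obtain q xs where t': "t = Node v q xs" using t by (auto simp: is_vertex_def)
    have d: "distinct (concat (map vertices us) @ (v # concat (map vertices xs)) @ concat (map vertices ws))"
      using dis unfolding ts t' by simp
    have v: "(v, c) \<notin> vcs u" if "u \<in> set us \<union> set xs \<union> set ws" for u c
    proof
      assume "(v, c) \<in> vcs u"
      then have "v \<in> set (vertices u)" using vcs_fst[of u] by force
      then show False using d that by auto
    qed
    have U: "{(k, c) \<in> (\<Union>u\<in>W. vcs u). k \<noteq> v} = (\<Union>u\<in>W. vcs u)" if "W \<subseteq> set us \<union> set xs \<union> set ws" for W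
      using v that by auto
    let ?L = "(\<Union>u\<in>set us. lset u) \<union> ((\<Union>u\<in>set xs. lset u) \<union> (\<Union>u\<in>set ws. lset u))"
    let ?V = "(\<Union>u\<in>set us. vcs u) \<union> ((\<Union>u\<in>set xs. vcs u) \<union> (\<Union>u\<in>set ws. vcs u))"
    have "vcs (contract P v (Node a p ts)) = insert (a, ?L) ?V"
      using Some by (simp add: x t')
    also have "\<dots> = {(k, c) \<in> insert (a, ?L) (insert (v, \<Union>u\<in>set xs. lset u) ?V). k \<noteq> v}"
      using av v by auto
    also have "insert (a, ?L) (insert (v, \<Union>u\<in>set xs. lset u) ?V) = vcs (Node a p ts)"
      unfolding ts t' by auto
    finally show ?thesis .
  qed
qed simp

lemma partial_comp_commutative:
  "partial_comp (commutative_operad :: ('k, 'k::comm_ring_1) operad) p i n q j = p * q"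
proof -
  have "prod_list (replicate m (1 :: 'k)) = 1" for m by (induction m) simp_all
  then show ?thesis by (simp add: partial_comp_def)
qed

lemma coef_contract: "coef (contract (commutative_operad :: ('k, 'k::comm_ring_1) operad) v T) = coef T"
proof (induction T)
  case (Node a p ts)
  show ?case
  proof (cases "List.extract (is_vertex v) ts")
    case None
    have "map (\<lambda>t. coef (contract Com v t)) ts = map coef ts" using Node.IH by simp
    then show ?thesis using None by (simp add: comp_def cong: map_cong)
  next
    case (Some x)
    obtain us t ws where x: "x = (us, t, ws)" by (cases x)
    have "ts = us @ t # ws" "is_vertex v t" using Some x by (simp_all add: extract_Some_iff)
    then show ?thesis using Some x by (auto simp: is_vertex_def partial_comp_commutative ac_simps)
  qed
qed simp

lemma labelled_contract:
  fixes T :: "(nat, 'k::comm_ring_1) tree"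
  assumes "labelled_in (reduced_ops Com) T"
  shows "labelled_in (reduced_ops Com) (contract Com v T)"
  using assms
proof (induction T)
  case (Node a p ts)
  show ?case
  proof (cases "List.extract (is_vertex v) ts")
    case None
    then show ?thesis using Node by simp
  next
    case (Some x)
    obtain us t ws where x: "x = (us, t, ws)" by (cases x)
    have ts: "ts = us @ t # ws" and "is_vertex v t" using Some x by (simp_all add: extract_Some_iff)
    then obtain q xs where t: "t = Node v q xs" by (auto simp: is_vertex_def)
    have "p = 0" if "length ts < 2" using Node.prems that by (auto simp: reduced_ops_def)
    moreover have "q = 0" if "length xs < 2" using Node.prems that unfolding ts t by (auto simp: reduced_ops_def)
    \<comment> \<open>If the merged vertex has fewer than two inputs, so has its source, whose label
      q is then zero.\<close>
    ultimately have "p * q \<in> reduced_ops Com (length us + (length xs + length ws))"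
      unfolding ts by (cases "length xs < 2"; cases "length us = 0 \<and> length ws = 0") (auto simp: reduced_ops_def)
    then show ?thesis using Some Node.prems unfolding x ts t by (auto simp: partial_comp_commutative)
  qed
qed simp

lemma fst_edges: "fst ` edges (Node k p ts) = (\<Union>t\<in>set ts. set (vertices t))"
proof -
  have "fst ` edges T = (\<Union>t\<in>set (children T). set (vertices t))" for T :: "(nat, 'a) tree"
  proof (induction T)
    case (Node k p ts)
    have "fst ` {(j, k) | j q us. Node j q us \<in> set ts} = {j. \<exists>q us. Node j q us \<in> set ts}" by force
    moreover have "set (vertices t) = {j. \<exists>q us. t = Node j q us} \<union> fst ` edges t" if "t \<in> set ts" for t
      using Node.IH[OF that] by (cases t) auto
    then have "(\<Union>t\<in>set ts. set (vertices t)) = {j. \<exists>q us. Node j q us \<in> set ts} \<union> (\<Union>t\<in>set ts. fst ` edges t)"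
      by (auto 0 3)
    ultimately show ?case by (simp add: image_Un image_UN)
  qed simp
  from this[of "Node k p ts"] show ?thesis by simp
qed

lemma edges_functional:
  assumes "distinct (vertices T)" "(v, u) \<in> edges T" "(v, u') \<in> edges T"
  shows "u = u'"
  using assms
proof (induction T)
  case (Node k p ts)
  have dis: "distinct (concat (map vertices ts))" using Node.prems(1) by simp
  have mem: "v \<in> set (vertices t)" if "(v, w) \<in> edges t" for t w
  proof (cases t)
    case (Node b q us)
    have "v \<in> fst ` edges t" using that by force
    then show ?thesis unfolding Node fst_edges by simp
  qed (use that in simp)
  have root: "w = k" if t: "t \<in> set ts" "t = Node v q us" and w: "(v, w) \<in> edges (Node k p ts)" for t q us w
  proof (rule ccontr)
    assume "w \<noteq> k"
    then obtain t' where t': "t' \<in> set ts" "(v, w) \<in> edges t'" using w by auto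
    have "set (vertices t) \<inter> set (vertices t') \<noteq> {}" using mem[OF t'(2)] t(2) by auto
    then have "t' = t" using distinct_concat_disjoint[OF dis t(1) t'(1)] by simp
    then have "v \<in> fst ` edges t" using t'(2) by force
    then have "v \<in> set (concat (map vertices us))" unfolding t(2) fst_edges by simp
    then show False using distinct_children[OF dis t(1)] unfolding t(2) by simp
  qed
  show ?case
  proof (cases "\<exists>t q us. t \<in> set ts \<and> t = Node v q us")
    case True
    then obtain t q us where t: "t \<in> set ts" "t = Node v q us" by (elim exE conjE)
    show ?thesis using root[OF t Node.prems(2)] root[OF t Node.prems(3)] by simp
  next
    case False
    then obtain t t' where t: "t \<in> set ts" "(v, u) \<in> edges t" "t' \<in> set ts" "(v, u') \<in> edges t'"
      using Node.prems(2,3) by auto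
    have "set (vertices t) \<inter> set (vertices t') \<noteq> {}" using mem[OF t(2)] mem[OF t(4)] by auto
    then have "t = t'" using distinct_concat_disjoint[OF dis t(1,3)] by simp
    then show ?thesis using Node.IH[OF t(1) distinct_children[OF dis t(1)]] t by simp
  qed
qed simp

text \<open>Every vertex except the root is the source of exactly one internal edge.\<close>

lemma sum_edges:
  assumes "distinct (vertices (Node k p ts))"
  shows "(\<Sum>(v, u)\<in>edges (Node k p ts). f v) = (\<Sum>v\<in>set (vertices (Node k p ts)) - {k}. f v)"
proof -
  have "inj_on fst (edges (Node k p ts))"
    using edges_functional[OF assms] by (intro inj_onI) (metis prod.collapse)
  then have "(\<Sum>v\<in>fst ` edges (Node k p ts). f v) = (\<Sum>e\<in>edges (Node k p ts). f (fst e))"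
    by (simp add: sum.reindex)
  moreover have "fst ` edges (Node k p ts) = set (vertices (Node k p ts)) - {k}"
    unfolding fst_edges using assms by auto
  ultimately show ?thesis by (simp add: case_prod_unfold)
qed

text \<open>Closes the gap left by the position v, as in \<open>bar_diff\<close>.\<close>

definition squeeze :: "nat \<Rightarrow> nat \<Rightarrow> nat" where
  "squeeze v k = (if k > v then k - 1 else k)"

lemma squeeze_skip: "squeeze v (if k < v then k else Suc k) = k"
  by (simp add: squeeze_def)

lemma inj_on_squeeze: "inj_on (squeeze v) (- {v})"
  by (rule inj_onI) (auto simp: squeeze_def split: if_splits)

lemma image_squeeze: "v < Suc d \<Longrightarrow> squeeze v ` ({..<Suc d} - {v}) = {..<d}"
proof (intro subset_antisym subsetI)
  fix k assume v: "v < Suc d" and k: "k \<in> {..<d}"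
  have "(if k < v then k else Suc k) \<in> {..<Suc d} - {v}" using v k by auto
  then show "k \<in> squeeze v ` ({..<Suc d} - {v})" using squeeze_skip[of v k] by (metis imageI)
qed (auto simp: squeeze_def)

text \<open>Contracting the edge with source v deletes the cluster of v and keeps all others. The
  sign \<open>(-1) ^ v\<close> is that of moving factor v to the front of the tensor, and
  \<open>order_sign_remove\<close> turns it into the sign of the deletion in the global order. For
  trees with a vertex of low arity both sides vanish with the coefficient.\<close>

lemma bar_diff_commutative:
  fixes T :: "(nat, 'k::comm_ring_1) tree"
  assumes T: "T \<in> bar_trees Com n (Suc d)"
  shows "bar_diff commutative_operad T \<in> fspan (gen ` bar_trees Com n d)"
    and "lin_ext (bar_class d) (bar_diff commutative_operad T) = bd (- {{1..n}}) (bar_class (Suc d) T)"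
proof -
  let ?P = "commutative_operad :: ('k, 'k) operad"
  note TD = bar_treesD[OF T]
  obtain r p ts where T': "T = Node r p ts" using TD(4) by (cases T) auto
  define D where "D = (\<lambda>v. map_tree (squeeze v) id (contract ?P v T))"
  have r: "r < Suc d" using TD(4) unfolding T' by auto
  have nv: "\<not> is_vertex v T" if "v \<noteq> r" for v using that by (auto simp: T' is_vertex_def)
  have D: "D v \<in> bar_trees ?P n d" if v: "v \<in> {..<Suc d} - {r}" for v
  proof -
    have vr: "v \<noteq> r" "v < Suc d" using v by auto
    have vs: "vertices (D v) = map (squeeze v) (removeAll v (vertices T))"
      using vertices_contract[OF TD(3) nv[OF vr(1)], of ?P] by (simp add: D_def map_tree_simps)
    have "inj_on (squeeze v) (set (removeAll v (vertices T)))"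
      by (rule inj_on_subset[OF inj_on_squeeze]) auto
    then have "distinct (vertices (D v))" unfolding vs using TD(3) by (simp add: distinct_map distinct_removeAll)
    moreover have "set (vertices (D v)) = {..<d}" unfolding vs using image_squeeze[OF vr(2)] TD(4) by simp
    ultimately show ?thesis
      using TD labelled_contract[OF TD(5), of v]
      by (simp add: bar_trees_def n_tree_def D_def map_tree_simps leaves_contract)
  qed
  have diff: "bar_diff ?P T = (\<Sum>v\<in>{..<Suc d} - {r}. fscale ((-1) ^ v) (gen (D v)))"
  proof -
    have "bar_diff ?P T = (\<Sum>(v, u)\<in>edges (Node r p ts). fscale ((-1) ^ v) (gen (D v)))"
      by (simp add: bar_diff_def D_def T' squeeze_def[abs_def])
    also have "\<dots> = (\<Sum>v\<in>set (vertices (Node r p ts)) - {r}. fscale ((-1) ^ v) (gen (D v)))"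
      using TD(3) unfolding T' by (rule sum_edges)
    finally show ?thesis unfolding TD(4)[unfolded T'] .
  qed
  show "bar_diff commutative_operad T \<in> fspan (gen ` bar_trees ?P n d)"
    unfolding diff using D by (intro fs.span_sum fs.span_scale fs.span_base imageI)
  have coefD: "coef (D v) = coef T" for v by (simp add: D_def coef_map_tree coef_contract)
  show "lin_ext (bar_class d) (bar_diff commutative_operad T) = bd (- {{1..n}}) (bar_class (Suc d) T)"
    using coef_zero_or_reduced[OF T]
  proof
    assume "coef T = 0 \<and> gen T \<in> fspan (tensor_rels ?P (bar_trees ?P n (Suc d)))"
    then show ?thesis
      unfolding diff by (simp add: lin_sum[OF lin_lin_ext] lin_scale[OF lin_lin_ext] bar_class_def coefD lin_zero[OF lin_bd])
  next
    assume red: "reduced T"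
    define c where "c = cl (vcs T)"
    define F where "F = snd ` vcs T"
    have mem: "(k, c k) \<in> vcs T" if "k < Suc d" for k
      unfolding c_def using cl_mem[OF TD(3)] TD(4) that by simp
    have P: "distinct (map c [0..<Suc d])" "set (map c [0..<Suc d]) = F"
      unfolding c_def F_def by (rule reduced_positions[OF red TD(3,4)])+
    have injc: "inj_on c {..<Suc d}" using P(1) by (simp add: distinct_map atLeast0LessThan del: upt_Suc)
    have F: "F = c ` {..<Suc d}" using P(2) by (simp add: atLeast0LessThan del: upt_Suc)
    have cr: "c r = {1..n}" unfolding c_def by (rule cl_eq[OF TD(3)]) (use TD(2) T' in simp)
    have step: "bar_class d (D v) = fscale (coef T) (fscale (orient d (vcs (D v))) (gen (F - {c v})))"
      and sgn: "(-1) ^ v * orient d (vcs (D v)) = eps (c v) F * (orient (Suc d) (vcs T) :: 'k)"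
      if v: "v \<in> {..<Suc d} - {r}" for v
    proof -
      have vr: "v \<noteq> r" "v < Suc d" using v by auto
      have V: "vcs (D v) = (\<lambda>(k, c). (squeeze v k, c)) ` {(k, c) \<in> vcs T. k \<noteq> v}"
        using vcs_contract[OF TD(3) nv[OF vr(1)], of ?P] by (simp add: D_def vcs_map_tree)
      have "snd ` vcs (D v) = snd ` {(k, c) \<in> vcs T. k \<noteq> v}" unfolding V by (simp add: image_image case_prod_unfold)
      also have "\<dots> = F - {c v}"
      proof (intro subset_antisym subsetI)
        fix C assume "C \<in> snd ` {(k, c) \<in> vcs T. k \<noteq> v}"
        then obtain k where k: "(k, C) \<in> vcs T" "k \<noteq> v" by auto
        have "C \<noteq> c v" using vcs_inj[OF red k(1), of v] mem[OF vr(2)] k(2) by metis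
        then show "C \<in> F - {c v}" using k(1) by (force simp: F_def)
      next
        fix C assume C: "C \<in> F - {c v}"
        then obtain k where k: "k < Suc d" "C = c k" unfolding F by auto
        then have "(k, C) \<in> {(k, c) \<in> vcs T. k \<noteq> v}" using mem[OF k(1)] C by auto
        then show "C \<in> snd ` {(k, c) \<in> vcs T. k \<noteq> v}" by force
      qed
      finally show "bar_class d (D v) = fscale (coef T) (fscale (orient d (vcs (D v))) (gen (F - {c v})))"
        by (simp add: bar_class_def coefD)
      have "cl (vcs (D v)) k = c (if k < v then k else Suc k)" if "k < d" for k
      proof (rule cl_eq)
        let ?k = "if k < v then k else Suc k"
        show "distinct (vertices (D v))" using bar_treesD(3)[OF D[OF v]] .
        have "(?k, c ?k) \<in> {(k, c) \<in> vcs T. k \<noteq> v}" using mem[of ?k] \<open>k < d\<close> by auto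
        then have "(squeeze v ?k, c ?k) \<in> vcs (D v)" unfolding V by force
        then show "(k, c ?k) \<in> vcs (D v)" by (simp only: squeeze_skip)
      qed
      then have "map (cl (vcs (D v))) [0..<d] = map (\<lambda>k. c (if k < v then k else Suc k)) [0..<d]" by simp
      also have "\<dots> = map c [0..<v] @ map c [Suc v..<Suc d]"
        using vr(2) by (intro nth_equalityI) (auto simp: nth_append simp del: upt_Suc)
      finally have l1: "map (cl (vcs (D v))) [0..<d] = map c [0..<v] @ map c [Suc v..<Suc d]" .
      have l2: "map c [0..<Suc d] = map c [0..<v] @ c v # map c [Suc v..<Suc d]"
        using vr(2) by (intro nth_equalityI) (auto simp: nth_append nth_Cons' simp del: upt_Suc)
      show "(-1) ^ v * orient d (vcs (D v)) = eps (c v) F * (orient (Suc d) (vcs T) :: 'k)"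
        using order_sign_remove[of "map c [0..<v]" "c v" "map c [Suc v..<Suc d]", where 'k='k] P
        unfolding orient_def l1 c_def[symmetric] l2 by (simp del: upt_Suc)
    qed
    have "lin_ext (bar_class d) (bar_diff ?P T) = (\<Sum>v\<in>{..<Suc d} - {r}. fscale ((-1) ^ v) (bar_class d (D v)))"
      unfolding diff by (simp add: lin_sum[OF lin_lin_ext] lin_scale[OF lin_lin_ext])
    also have "\<dots> = (\<Sum>v\<in>{..<Suc d} - {r}. fscale (coef T * orient (Suc d) (vcs T)) (del (c v) (gen F)))"
    proof (intro sum.cong refl)
      fix v assume v: "v \<in> {..<Suc d} - {r}"
      have "del (c v) (gen F) = fscale (eps (c v) F) (gen (F - {c v}) :: _ \<Rightarrow>\<^sub>0 'k)"
        using v F by (simp add: del_gen)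
      moreover have "(-1) ^ v * (coef T * orient d (vcs (D v))) = coef T * orient (Suc d) (vcs T) * eps (c v) F"
        using sgn[OF v] by (simp add: ac_simps)
      ultimately show "fscale ((-1) ^ v) (bar_class d (D v)) = fscale (coef T * orient (Suc d) (vcs T)) (del (c v) (gen F))"
        unfolding step[OF v] by simp
    qed
    also have "\<dots> = (\<Sum>C\<in>F \<inter> - {{1..n}}. fscale (coef T * orient (Suc d) (vcs T)) (del C (gen F)))"
    proof (rule sum.reindex_cong[symmetric, OF _ _ refl])
      show "inj_on c ({..<Suc d} - {r})" using injc by (rule inj_on_subset) auto
      have "c ` ({..<Suc d} - {r}) = F - {c r}" unfolding F using injc r by (subst inj_on_image_set_diff[of c "{..<Suc d}"]) auto
      then show "F \<inter> - {{1..n}} = c ` ({..<Suc d} - {r})" unfolding cr by auto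
    qed
    also have "\<dots> = bd (- {{1..n}}) (bar_class (Suc d) T)"
      unfolding bar_class_def F_def[symmetric] by (simp add: lin_scale[OF lin_bd] bd_gen fs.scale_sum_right)
    finally show ?thesis .
  qed
qed


section \<open>Level trees and chains of partitions\<close>

definition full :: "('i, 'm) tree \<Rightarrow> bool" where
  "full T \<longleftrightarrow> arity_ge 1 T \<and> distinct (leaves T)"

lemma full_child: "full (Node a p ts) \<Longrightarrow> t \<in> set ts \<Longrightarrow> full t"
  unfolding full_def using distinct_children by auto

lemma full_lset_nonempty: "full T \<Longrightarrow> lset T \<noteq> {}"
  unfolding full_def using leaves_nonempty[of T] by simp

lemma full_children_disjoint:
  assumes "full (Node a p ts)" "t \<in> set ts" "u \<in> set ts" "lset t \<inter> lset u \<noteq> {}"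
  shows "t = u"
  using assms distinct_concat_disjoint[of leaves ts t u] by (simp add: full_def)

lemma full_distinct_lset: "full (Node a p ts) \<Longrightarrow> distinct (map (\<lambda>t. lset t) ts)"
  using full_child full_lset_nonempty distinct_lset_children unfolding full_def by metis

lemma lev_partition: "full T \<Longrightarrow> partition_on (lset T) (lev m T)"
proof (induction T arbitrary: m)
  case (Leaf i)
  then show ?case by (cases m) (simp_all add: partition_on_space)
next
  case (Node a p ts)
  show ?case
  proof (cases m)
    case 0
    then show ?thesis using partition_on_space[OF full_lset_nonempty[OF Node.prems]] by (simp only: lev.simps)
  next
    case (Suc k)
    have P: "partition_on (lset t) (lev k t)" if "t \<in> set ts" for t
      using Node.IH[OF that full_child[OF Node.prems that]] .
    show ?thesis
    proof (rule partition_onI)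
      show "\<Union> (lev m (Node a p ts)) = lset (Node a p ts)"
        using partition_onD1[OF P] by (auto simp: Suc)
      show "{} \<notin> lev m (Node a p ts)" using partition_onD3[OF P] by (auto simp: Suc)
      fix b c assume "b \<in> lev m (Node a p ts)" "c \<in> lev m (Node a p ts)" and bc: "b \<noteq> c"
      then obtain t u where tu: "t \<in> set ts" "b \<in> lev k t" "u \<in> set ts" "c \<in> lev k u" by (auto simp: Suc)
      show "disjnt b c"
      proof (cases "t = u")
        case True
        then show ?thesis using partition_on_eqI[OF P[OF tu(1)] tu(2), of c] tu(4) bc by (auto simp: disjnt_def)
      next
        case False
        then have "lset t \<inter> lset u = {}" using full_children_disjoint[OF Node.prems tu(1,3)] by metis
        moreover have "b \<subseteq> lset t" "c \<subseteq> lset u"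
          using partition_onD1[OF P[OF tu(1)]] partition_onD1[OF P[OF tu(3)]] tu(2,4) by auto
        ultimately show ?thesis unfolding disjnt_def by (metis Int_mono subset_empty)
      qed
    qed
  qed
qed

lemma lev_subset: "full T \<Longrightarrow> c \<in> lev m T \<Longrightarrow> c \<subseteq> lset T"
  using partition_onD1[OF lev_partition] by blast

lemma lev_Suc_below: "full T \<Longrightarrow> b \<in> lev (Suc m) T \<Longrightarrow> \<exists>c\<in>lev m T. b \<subseteq> c"
proof (induction T arbitrary: m)
  case (Leaf i)
  then show ?case by (cases m) simp_all
next
  case (Node a p ts)
  then obtain t where t: "t \<in> set ts" "b \<in> lev m t" by auto
  show ?case
  proof (cases m)
    case 0
    then show ?thesis using t by auto
  next
    case (Suc k)
    then obtain c where "c \<in> lev k t" "b \<subseteq> c" using Node.IH[OF t(1) full_child[OF Node.prems(1) t(1)]] t(2) by blast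
    then show ?thesis using t(1) Suc by auto
  qed
qed

lemma lev_refines_Suc: "full T \<Longrightarrow> refines (lset T) (lev (Suc m) T) (lev m T)"
  using lev_partition lev_Suc_below unfolding refines_def by blast

lemma lev_refines:
  assumes "full T" "m \<le> m'"
  shows "refines (lset T) (lev m' T) (lev m T)"
  using assms(2)
proof (induction rule: dec_induct)
  case base
  show ?case using refines_refl[OF lev_partition[OF assms(1)]] .
next
  case (step k)
  show ?case using refines_trans[OF lev_refines_Suc[OF assms(1)] step.IH] .
qed

lemma lev_top: "has_levels d T \<Longrightarrow> lev d T = singles (lset T)"
proof (induction d arbitrary: T)
  case 0
  then show ?case by (cases T) (simp_all add: singles_def)
next
  case (Suc d)
  then show ?case by (cases T) (auto simp: singles_def)
qed

definition levset :: "nat \<Rightarrow> ('i, 'm) tree \<Rightarrow> nat set set set" where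
  "levset d T = (\<lambda>m. lev m T) ` {..d}"

definition norm_basis :: "nat \<Rightarrow> nat \<Rightarrow> nat set set set set" where
  "norm_basis n d = {G \<in> part_chains {1..n} (singles {1..n}). card G = Suc d}"

text \<open>A level tree in which a partition is repeated has fewer than d + 1 members in its
  \<open>levset\<close>; it is degenerate and is therefore sent to 0.\<close>

definition norm_gen :: "nat \<Rightarrow> nat set set set \<Rightarrow> (nat set set set \<Rightarrow>\<^sub>0 'k::comm_ring_1)" where
  "norm_gen d G = (if card G = Suc d then gen G else 0)"

definition norm_class :: "nat \<Rightarrow> ('i, 'k) tree \<Rightarrow> (nat set set set \<Rightarrow>\<^sub>0 'k::comm_ring_1)" where
  "norm_class d T = fscale (coef T) (norm_gen d (levset d T))"

lemma levset_part_chain: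
  assumes "full T" "has_levels d T"
  shows "levset d T \<in> part_chains (lset T) (singles (lset T))"
proof -
  have "lev d T \<in> levset d T" "lev 0 T \<in> levset d T" unfolding levset_def by (rule imageI, simp)+
  then have "singles (lset T) \<in> levset d T" "{lset T} \<in> levset d T" using lev_top[OF assms(2)] by simp_all
  moreover have "refines (lset T) (singles (lset T)) \<pi>" if "\<pi> \<in> levset d T" for \<pi>
    using that lev_refines[OF assms(1)] unfolding levset_def lev_top[OF assms(2), symmetric] by auto
  moreover have "refines (lset T) \<pi> \<pi>' \<or> refines (lset T) \<pi>' \<pi>" if \<pi>: "\<pi> \<in> levset d T" "\<pi>' \<in> levset d T" for \<pi> \<pi>'
  proof -
    obtain m m' where "\<pi> = lev m T" "\<pi>' = lev m' T" using \<pi> unfolding levset_def by (elim imageE)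
    then show ?thesis using lev_refines[OF assms(1)] nat_le_linear[of m m'] by blast
  qed
  ultimately show ?thesis using full_lset_nonempty[OF assms(1)] unfolding part_chains_def by blast
qed

lemma level_treesD:
  assumes "T \<in> level_trees P n d"
  shows "distinct (leaves T)" "lset T = {1..n}" "labelled_in (ops P) T" "has_levels d T"
  using assms by (simp_all add: level_trees_def n_tree_def)

lemma coef_zero_or_full:
  assumes "T \<in> level_trees (commutative_operad :: ('k, 'k::comm_ring_1) operad) n d"
  shows "full T \<or> coef T = 0 \<and> gen T \<in> fspan (tensor_rels Com (level_trees commutative_operad n d))"
proof (cases "arity_ge 1 T")
  case True
  then show ?thesis using level_treesD(1)[OF assms] by (simp add: full_def)
next
  case False
  have z: "ops Com r \<subseteq> {0}" if "r < 1" for r using that by simp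
  show ?thesis using low_arity_coef[OF level_treesD(3)[OF assms] False z] low_arity_rels[OF level_treesD(3)[OF assms] False z assms] by simp
qed

lemma norm_class_mem:
  assumes "T \<in> level_trees (commutative_operad :: ('k, 'k::comm_ring_1) operad) n d"
  shows "norm_class d T \<in> free_on (norm_basis n d)"
  using coef_zero_or_full[OF assms]
proof
  assume "full T"
  then show ?thesis using levset_part_chain[of T d] level_treesD[OF assms]
    by (simp add: norm_class_def norm_gen_def norm_basis_def scale_free_on)
qed (simp add: norm_class_def)

lemma labelled_full:
  "arity_ge 1 T \<Longrightarrow> labelled_in (ops (commutative_operad :: ('k, 'k::comm_ring_1) operad)) T"
  by (induction T) (auto simp: Suc_le_eq)

lemma lev_child:
  assumes "full (Node a p ts)" "t \<in> set ts"
  shows "lev m t = {c \<in> lev (Suc m) (Node a p ts). c \<subseteq> lset t}"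
proof -
  have "c \<in> lev m t" if u: "u \<in> set ts" "c \<in> lev m u" "c \<subseteq> lset t" for c u
  proof -
    have fu: "full u" using full_child[OF assms(1) u(1)] .
    have "c \<noteq> {}" using partition_onD3[OF lev_partition[OF fu]] u(2) by metis
    then have "lset u \<inter> lset t \<noteq> {}" using lev_subset[OF fu u(2)] u(3) by blast
    then show ?thesis using full_children_disjoint[OF assms(1) u(1) assms(2)] u(2) by simp
  qed
  moreover have "c \<subseteq> lset t" "c \<in> lev (Suc m) (Node a p ts)" if "c \<in> lev m t" for c
    using lev_subset[OF full_child[OF assms] that] that assms(2) by auto
  ultimately show ?thesis by auto
qed

lemma lev_eq_iso:
  assumes "full T" "full T'" "has_levels d T" "has_levels d T'" "\<And>m. m \<le> d \<Longrightarrow> lev m T = lev m T'"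
  shows "iso T (T' :: (unit, 'm) tree)"
  using assms
proof (induction d arbitrary: T T')
  case 0
  then obtain i j where "T = Leaf i" "T' = Leaf j" by (cases T; cases T') auto
  then show ?case using 0(5)[of 0] by (auto intro: iso_Leaf)
next
  case (Suc d)
  obtain p q ts us where T: "T = Node () p ts" and T': "T' = Node () q us"
    using Suc.prems(3,4) by (cases T; cases T') auto
  note f = Suc.prems(1)[unfolded T] and f' = Suc.prems(2)[unfolded T']
  show ?case unfolding T T'
  proof (rule iso_children[where f="\<lambda>t. lset t"])
    show "distinct (map (\<lambda>t. lset t) ts)" "distinct (map (\<lambda>t. lset t) us)"
      using full_distinct_lset[OF f] full_distinct_lset[OF f'] by simp_all
    have "lev (Suc 0) T = lev (Suc 0) T'" by (rule Suc.prems(5)) simp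
    moreover have "lev (Suc 0) (Node () r xs) = (\<lambda>t. lset t) ` set xs" for r and xs :: "(unit, 'm) tree list" by auto
    ultimately show "(\<lambda>t. lset t) ` set ts = (\<lambda>t. lset t) ` set us" unfolding T T' by simp
    fix t u assume tu: "t \<in> set ts" "u \<in> set us" "lset t = lset u"
    show "iso t u"
    proof (rule Suc.IH)
      show "full t" "full u" using full_child[OF f tu(1)] full_child[OF f' tu(2)] .
      show "has_levels d t" "has_levels d u" using Suc.prems(3,4) tu unfolding T T' by auto
      fix m assume "m \<le> d"
      then have "lev (Suc m) T = lev (Suc m) T'" by (intro Suc.prems(5)) simp
      then show "lev m t = lev m u"
        unfolding lev_child[OF f tu(1), of m] lev_child[OF f' tu(2), of m] T T' by (simp only: tu(3))
    qed
  qed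
qed

lemma levset_strict:
  assumes "full T" "card (levset d T) = Suc d" "m < m'" "m' \<le> d"
  shows "card (lev m T) < card (lev m' T)"
proof (rule refines_card_less[of "lset T"])
  have "inj_on (\<lambda>m. lev m T) {..d}" using assms(2) unfolding levset_def by (intro eq_card_imp_inj_on) simp_all
  then show "lev m' T \<noteq> lev m T" using assms(3,4) by (auto dest!: inj_onD[of _ _ m' m])
qed (use lev_refines[OF assms(1)] assms(3) in simp_all)

text \<open>Without repetitions the height of a partition is the number of members with fewer
  blocks, so the unordered set determines the whole sequence.\<close>

lemma levset_rank:
  assumes "full T" "card (levset d T) = Suc d" "m \<le> d"
  shows "card {\<pi> \<in> levset d T. card \<pi> < card (lev m T)} = m"
proof -
  note lt = levset_strict[OF assms(1,2)]
  have inj: "inj_on (\<lambda>m. lev m T) {..d}" using assms(2) unfolding levset_def by (intro eq_card_imp_inj_on) simp_all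
  have "card (lev j T) < card (lev m T) \<longleftrightarrow> j < m" if "j \<le> d" for j
    using lt[of j m] lt[of m j] that assms(3) by (metis less_asym less_irrefl linorder_neqE_nat)
  then have "{\<pi> \<in> levset d T. card \<pi> < card (lev m T)} = (\<lambda>m. lev m T) ` {..<m}"
    unfolding levset_def using assms(3) by auto
  moreover have "inj_on (\<lambda>m. lev m T) {..<m}" using inj by (rule inj_on_subset) (use assms(3) in auto)
  ultimately show ?thesis by (simp add: card_image)
qed

lemma levset_eq_lev:
  assumes "full T" "full T'" "card (levset d T) = Suc d" "levset d T = levset d T'" "m \<le> d"
  shows "lev m T = lev m T'"
proof -
  have c': "card (levset d T') = Suc d" using assms(3,4) by simp
  have "lev m T \<in> levset d T" unfolding levset_def using assms(5) by (intro imageI) simp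
  then have "lev m T \<in> levset d T'" by (simp only: assms(4))
  then obtain m' where m': "m' \<le> d" "lev m T = lev m' T'" unfolding levset_def by auto
  have "m = m'"
    using levset_rank[OF assms(1,3,5)] levset_rank[OF assms(2) c' m'(1)] unfolding assms(4) m'(2) by simp
  then show ?thesis using m'(2) by simp
qed

text \<open>Built from the leaves downwards: the subtree over a block b of the j-th partition has as
  children the subtrees over those blocks of the next partition that lie in b.\<close>

lemma level_tree_exists:
  fixes \<pi> :: "nat \<Rightarrow> nat set set"
  assumes fin: "finite A" and \<pi>: "\<And>m. m < d \<Longrightarrow> refines A (\<pi> (Suc m)) (\<pi> m)" "\<And>m. m \<le> d \<Longrightarrow> partition_on A (\<pi> m)" "\<pi> d = singles A"
    and "j \<le> d" "b \<in> \<pi> j"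
  shows "\<exists>T :: (unit, 'k::comm_ring_1) tree. full T \<and> ones T \<and> has_levels (d - j) T \<and> lset T = b \<and>
    (\<forall>m\<le>d - j. lev m T = {c \<in> \<pi> (j + m). c \<subseteq> b})"
  using assms(5,6)
proof (induction j arbitrary: b rule: inc_induct)
  case base
  then obtain x where x: "b = {x}" using \<pi>(3) by (auto simp: singles_def)
  have "{c \<in> \<pi> d. c \<subseteq> b} = {b}" using base \<pi>(3) x by (auto simp: singles_def)
  then show ?case by (intro exI[of _ "Leaf x"]) (simp add: full_def x)
next
  case (step j)
  let ?H = "{c \<in> \<pi> (Suc j). c \<subseteq> b}"
  note P = \<pi>(2)[of "Suc j"] and Pj = \<pi>(2)[of j]
  have pS: "partition_on A (\<pi> (Suc j))" and pj: "partition_on A (\<pi> j)" using P Pj step.hyps by simp_all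
  have r: "refines A (\<pi> (Suc j)) (\<pi> j)" using \<pi>(1) step.hyps by simp
  have finH: "finite ?H" using finite_elements[OF fin pS] by simp
  have within: "c \<subseteq> b" if "c \<in> \<pi> (Suc j)" "c \<inter> b \<noteq> {}" for c
  proof -
    obtain b' where b': "b' \<in> \<pi> j" "c \<subseteq> b'" using r \<open>c \<in> \<pi> (Suc j)\<close> unfolding refines_def by blast
    have "b' \<inter> b \<noteq> {}" using b'(2) that(2) by blast
    then have "b' = b" by (rule partition_on_eqI[OF pj b'(1) step.prems])
    then show ?thesis using b'(2) by simp
  qed
  have UH: "\<Union> ?H = b"
  proof
    show "b \<subseteq> \<Union> ?H"
    proof
      fix x assume x: "x \<in> b"
      then have "x \<in> A" using partition_onD1[OF pj] step.prems by blast
      then obtain c where "c \<in> \<pi> (Suc j)" "x \<in> c" using partition_on_block[OF pS] by blast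
      then show "x \<in> \<Union> ?H" using within[of c] x by blast
    qed
  qed blast
  have b_ne: "b \<noteq> {}" using partition_onD3[OF pj] step.prems by metis
  have "\<forall>c\<in>?H. \<exists>T :: (unit, 'k) tree. full T \<and> ones T \<and> has_levels (d - Suc j) T \<and> lset T = c \<and>
    (\<forall>m\<le>d - Suc j. lev m T = {e \<in> \<pi> (Suc j + m). e \<subseteq> c})"
    using step.IH by blast
  from bchoice[OF this] obtain f :: "nat set \<Rightarrow> (unit, 'k) tree" where
    f0: "\<forall>c\<in>?H. full (f c) \<and> ones (f c) \<and> has_levels (d - Suc j) (f c) \<and> lset (f c) = c \<and>
    (\<forall>m\<le>d - Suc j. lev m (f c) = {e \<in> \<pi> (Suc j + m). e \<subseteq> c})" by (elim exE)
  have f: "full (f c)" "ones (f c)" "has_levels (d - Suc j) (f c)" "lset (f c) = c"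
      "\<And>m. m \<le> d - Suc j \<Longrightarrow> lev m (f c) = {e \<in> \<pi> (Suc j + m). e \<subseteq> c}" if "c \<in> ?H" for c
    using f0 that by simp_all
  obtain cs where cs: "set cs = ?H" "distinct cs" using finite_distinct_list[OF finH] by blast
  define T where "T = Node () 1 (map f cs)"
  have "distinct (concat (map (\<lambda>c. leaves (f c)) cs))"
  proof (rule distinct_concat_mapI[OF cs(2)])
    show "distinct (leaves (f c))" if "c \<in> set cs" for c using f(1) that cs(1) by (simp add: full_def)
    show "lset (f c) \<inter> lset (f c') = {}" if "c \<in> set cs" "c' \<in> set cs" "c \<noteq> c'" for c c'
      using partition_on_eqI[OF pS, of c c'] f(4) that cs(1) by auto
  qed
  moreover have "cs \<noteq> []" using UH b_ne cs(1) by auto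
  ultimately have "full T" using f(1) cs(1) by (simp add: T_def full_def comp_def Suc_le_eq)
  moreover have "ones T" using f(2) cs(1) by (simp add: T_def)
  moreover have dj: "d - j = Suc (d - Suc j)" using step.hyps by simp
  then have "has_levels (d - j) T" using f(3) cs(1) by (simp add: T_def)
  moreover have lT: "lset T = b" using f(4) cs(1) UH by (simp add: T_def)
  moreover have "lev m T = {c \<in> \<pi> (j + m). c \<subseteq> b}" if m: "m \<le> d - j" for m
  proof (cases m)
    case 0
    have "{c \<in> \<pi> j. c \<subseteq> b} = {b}" using partition_on_subset_eq[OF pj _ step.prems] step.prems by blast
    then show ?thesis using 0 lT by simp
  next
    case (Suc k)
    have k: "k \<le> d - Suc j" using m Suc dj by simp
    have rk: "refines A (\<pi> (Suc j + k)) (\<pi> (Suc j))"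
      using k
    proof (induction k)
      case 0
      then show ?case using refines_refl pS by simp
    next
      case (Suc k)
      have "refines A (\<pi> (Suc (Suc j + k))) (\<pi> (Suc j + k))" using Suc.prems by (intro \<pi>(1)) simp
      moreover have "refines A (\<pi> (Suc j + k)) (\<pi> (Suc j))" using Suc by simp
      ultimately have "refines A (\<pi> (Suc (Suc j + k))) (\<pi> (Suc j))" by (rule refines_trans)
      then show ?case by simp
    qed
    have "lev m T = (\<Union>c\<in>?H. {e \<in> \<pi> (Suc j + k). e \<subseteq> c})"
      using f(5)[OF _ k] by (simp add: T_def Suc cs(1) del: add_Suc)
    also have "\<dots> = {e \<in> \<pi> (Suc j + k). e \<subseteq> b}"
    proof (intro subset_antisym subsetI)
      fix e assume e: "e \<in> {e \<in> \<pi> (Suc j + k). e \<subseteq> b}"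
      then obtain c where c: "c \<in> \<pi> (Suc j)" "e \<subseteq> c" using rk unfolding refines_def by blast
      have "partition_on A (\<pi> (Suc j + k))" using rk by (simp add: refines_def)
      then have "e \<noteq> {}" using e partition_onD3 by blast
      then have "c \<inter> b \<noteq> {}" using c(2) e by blast
      then have "c \<in> ?H" using within c(1) by blast
      then show "e \<in> (\<Union>c\<in>?H. {e \<in> \<pi> (Suc j + k). e \<subseteq> c})" using e c(2) by blast
    qed blast
    finally show ?thesis using Suc by simp
  qed
  ultimately show ?case by blast
qed

text \<open>Comparable partitions with equally many blocks coincide, so sorting the chain by the
  number of blocks gives the sequence of partitions by height.\<close>

lemma norm_representative:
  assumes G: "G \<in> norm_basis n d"
  shows "\<exists>T\<in>level_trees (commutative_operad :: ('k, 'k::comm_ring_1) operad) n d. full T \<and> ones T \<and> levset d T = G"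
proof -
  let ?A = "{1..n}"
  have GP: "G \<in> part_chains ?A (singles ?A)" and card: "card G = Suc d" using G by (auto simp: norm_basis_def)
  note GD = part_chainsD[OF GP]
  have finG: "finite G" using part_chains_finite[OF _ GP] by simp
  have cmp: "refines ?A \<pi>' \<pi>" if "\<pi> \<in> G" "\<pi>' \<in> G" "card \<pi> \<le> card \<pi>'" for \<pi> \<pi>'
  proof (rule ccontr)
    assume n: "\<not> refines ?A \<pi>' \<pi>"
    then have r: "refines ?A \<pi> \<pi>'" using GD(5)[OF that(1,2)] by blast
    have "\<pi> \<noteq> \<pi>'" using n r by metis
    then have "card \<pi>' < card \<pi>" using refines_card_less[OF _ r] by simp
    then show False using that(3) by simp
  qed
  have inj: "inj_on card G"
    by (rule inj_onI) (metis cmp order_refl refines_asym)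
  define cs where "cs = sorted_list_of_set (card ` G)"
  have cs: "set cs = card ` G" "length cs = Suc d" "sorted cs" "distinct cs"
    using finG card_image[OF inj] card by (simp_all add: cs_def)
  define \<pi> where "\<pi> = (\<lambda>m. the_inv_into G card (cs ! m))"
  have nth: "cs ! m \<in> card ` G" if "m \<le> d" for m using that cs(1,2) nth_mem[of m cs] by simp
  have \<pi>G: "\<pi> m \<in> G" "card (\<pi> m) = cs ! m" if "m \<le> d" for m
    using the_inv_into_into[OF inj nth[OF that] order_refl] f_the_inv_into_f[OF inj nth[OF that]] by (simp_all add: \<pi>_def)
  have ref: "refines ?A (\<pi> m') (\<pi> m)" if "m \<le> m'" "m' \<le> d" for m m'
    using that \<pi>G cs(2,3) by (intro cmp) (auto intro: sorted_nth_mono)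
  have part: "partition_on ?A (\<pi> m)" if "m \<le> d" for m
    using GD(4)[OF \<pi>G(1)[OF that]] by (simp add: refines_def)
  have GE: "\<exists>m\<le>d. \<sigma> = \<pi> m" if "\<sigma> \<in> G" for \<sigma>
  proof -
    have "card \<sigma> \<in> set cs" using cs(1) that by simp
    then obtain m where m: "m < length cs" "cs ! m = card \<sigma>" by (metis in_set_conv_nth)
    then have "\<sigma> = \<pi> m" using inj_onD[OF inj, of \<sigma> "\<pi> m"] \<pi>G[of m] that cs(2) by simp
    moreover have "m \<le> d" using m(1) cs(2) by simp
    ultimately show ?thesis by blast
  qed
  have \<pi>d: "\<pi> d = singles ?A"
  proof -
    obtain m where m: "m \<le> d" "singles ?A = \<pi> m" using GE[OF GD(2)] by blast
    have "refines ?A (singles ?A) (\<pi> d)" using GD(4) \<pi>G(1)[of d] by simp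
    moreover have "refines ?A (\<pi> d) (singles ?A)" using ref[OF m(1) order_refl] m(2) by simp
    ultimately show ?thesis using refines_asym by metis
  qed
  have \<pi>0: "\<pi> 0 = {?A}"
  proof -
    obtain m where m: "m \<le> d" "{?A} = \<pi> m" using GE[OF GD(3)] by blast
    have "refines ?A {?A} (\<pi> 0)" using ref[of 0 m] m by simp
    moreover have "refines ?A (\<pi> 0) {?A}"
      using part[of 0] partition_on_space[OF GD(1)] partition_onD1[OF part[of 0]] unfolding refines_def by auto
    ultimately show ?thesis using refines_asym by metis
  qed
  have "\<exists>T :: (unit, 'k) tree. full T \<and> ones T \<and> has_levels (d - 0) T \<and> lset T = ?A \<and>
    (\<forall>m\<le>d - 0. lev m T = {c \<in> \<pi> (0 + m). c \<subseteq> ?A})"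
    by (rule level_tree_exists[where A="?A" and \<pi>=\<pi> and d=d and j=0]) (use ref \<pi>0 part \<pi>d in auto)
  then obtain T :: "(unit, 'k) tree" where T: "full T" "ones T" "has_levels d T" "lset T = ?A"
    "\<And>m. m \<le> d \<Longrightarrow> lev m T = {c \<in> \<pi> m. c \<subseteq> ?A}" by auto
  have "lev m T = \<pi> m" if "m \<le> d" for m
    using T(5)[OF that] partition_onD1[OF part[OF that]] by auto
  then have "levset d T = \<pi> ` {..d}" unfolding levset_def by (intro image_cong) auto
  also have "\<dots> = G" using GE \<pi>G(1) by auto
  finally have "levset d T = G" .
  moreover have "T \<in> level_trees Com n d"
    using T labelled_full[of T] by (simp add: level_trees_def n_tree_def full_def)
  ultimately show ?thesis using T by blast
qed

section \<open>Degenerate level trees\<close>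

lemma leaves_degeneracy: "leaves (degeneracy P j T) = leaves T"
  by (induction P j T rule: degeneracy.induct) (auto intro!: arg_cong[where f=concat])

lemma has_levels_degeneracy: "has_levels e T \<Longrightarrow> j \<le> e \<Longrightarrow> has_levels (Suc e) (degeneracy P j T)"
proof (induction P j T arbitrary: e rule: degeneracy.induct)
  case (3 P j a p ts)
  then obtain e' where "e = Suc e'" by (cases e) auto
  then show ?case using 3 by simp
qed auto

lemma lev_degeneracy: "has_levels e T \<Longrightarrow> j \<le> e \<Longrightarrow> lev (Suc j) (degeneracy P j T) = lev j (degeneracy P j T)"
proof (induction P j T arbitrary: e rule: degeneracy.induct)
  case (3 P j a p ts)
  then obtain e' where "e = Suc e'" by (cases e) auto
  then have "lev (Suc j) (degeneracy P j t) = lev j (degeneracy P j t)" if "t \<in> set ts" for t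
    using "3.IH"[OF that, of e'] "3.prems" that by simp
  then show ?case by simp
qed auto

lemma labelled_degeneracy:
  "labelled_in (ops (commutative_operad :: ('k, 'k::comm_ring_1) operad)) T \<Longrightarrow>
   labelled_in (ops Com) (degeneracy Com j T)"
  by (induction "commutative_operad :: ('k, 'k) operad" j T rule: degeneracy.induct) auto

lemma degenerate_card:
  assumes "lev (Suc j) T = lev j T" "j < d"
  shows "card (levset d T) \<noteq> Suc d"
proof
  assume "card (levset d T) = Suc d"
  then have "inj_on (\<lambda>m. lev m T) {..d}" unfolding levset_def by (intro eq_card_imp_inj_on) simp_all
  then show False using assms by (auto dest!: inj_onD[of _ _ "Suc j" j])
qed

lemma one_child:
  assumes "full (Node a p ts)" "lev (Suc 0) (Node a p ts) = lev 0 (Node a p ts)"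
  obtains t where "ts = [t]"
proof -
  let ?f = "\<lambda>t. lset t"
  have "set (map ?f ts) = {lset (Node a p ts)}" using assms(2) by (simp add: UNION_singleton_eq_range)
  then have "card (set (map ?f ts)) = card {lset (Node a p ts)}" by (rule arg_cong)
  then have "length ts = 1"
    using distinct_card[OF full_distinct_lset[OF assms(1)]] by simp
  then show thesis using that by (cases ts) auto
qed

text \<open>If the partitions at heights j and j + 1 agree, every vertex between them has one input.
  Its label is 1, so it is a unit vertex, and the whole level comes from a degeneracy.\<close>

lemma remove_degeneracy:
  fixes U :: "'k::comm_ring_1 level_tree"
  assumes "full U" "ones U" "has_levels (Suc e) U" "j \<le> e" "lev (Suc j) U = lev j U"
  shows "\<exists>T. U = degeneracy Com j T \<and> has_levels e T \<and> leaves T = leaves U \<and> arity_ge 1 T"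
  using assms
proof (induction j arbitrary: e U)
  case 0
  then obtain ts where U: "U = Node () 1 ts" by (cases U) auto
  obtain t where "ts = [t]" using one_child[of "()" 1 ts] 0(1,5) unfolding U by auto
  then show ?case using 0 U by (intro exI[of _ t]) (simp add: full_def)
next
  case (Suc j)
  then obtain ts where U: "U = Node () 1 ts" by (cases U) auto
  obtain e' where e: "e = Suc e'" using Suc.prems(4) by (cases e) auto
  note f = Suc.prems(1)[unfolded U]
  have "\<exists>t'. t = degeneracy Com j t' \<and> has_levels e' t' \<and> leaves t' = leaves t \<and> arity_ge 1 t'"
    if t: "t \<in> set ts" for t
  proof (rule Suc.IH)
    show "full t" using full_child[OF f t] .
    show "ones t" "has_levels (Suc e') t" "j \<le> e'" using Suc.prems t U e by auto
    have "lev (Suc (Suc j)) (Node () 1 ts) = lev (Suc j) (Node () 1 ts)" using Suc.prems(5) unfolding U .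
    then show "lev (Suc j) t = lev j t"
      unfolding lev_child[OF f t, of "Suc j"] lev_child[OF f t, of j] by (simp only:)
  qed
  then have "\<forall>t\<in>set ts. \<exists>t'. t = degeneracy Com j t' \<and> has_levels e' t' \<and> leaves t' = leaves t \<and> arity_ge 1 t'"
    by (rule ballI)
  from bchoice[OF this] obtain g where
    g: "\<forall>t\<in>set ts. t = degeneracy Com j (g t) \<and> has_levels e' (g t) \<and> leaves (g t) = leaves t \<and> arity_ge 1 (g t)"
    by (elim exE)
  have "map (\<lambda>t. degeneracy Com j (g t)) ts = ts"
    by (rule map_idI) (use g in simp)
  then have "U = degeneracy Com (Suc j) (Node () 1 (map g ts))"
    by (simp add: U comp_def)
  moreover have "map (\<lambda>t. leaves (g t)) ts = map leaves ts" using g by simp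
  then have "leaves (Node () (1 :: 'k) (map g ts)) = leaves U" by (simp add: U comp_def cong: map_cong)
  moreover have "has_levels e (Node () (1 :: 'k) (map g ts))" using g by (simp add: e)
  moreover have "arity_ge 1 (Node () (1 :: 'k) (map g ts))" using g f by (simp add: full_def)
  ultimately show ?case by blast
qed

abbreviation relabel :: "('i, 'm) tree \<Rightarrow> ('i, 'k::one) tree" where
  "relabel \<equiv> map_tree id (\<lambda>_. 1)"

lemma relabel_simps:
  "leaves (relabel T) = leaves T" "arity_ge k (relabel T) = arity_ge k T" "ones (relabel T)"
  by (induction T) (auto intro!: arg_cong[where f=concat])

lemma has_levels_relabel: "has_levels d (relabel T) = has_levels d T"
  by (induction T arbitrary: d) auto

lemma lev_relabel: "lev m (relabel T) = lev m T"
proof (induction T arbitrary: m)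
  case (Node a p ts)
  then show ?case by (cases m) (simp_all add: relabel_simps[unfolded id_def] relabel_simps)
next
  case (Leaf i)
  show ?case by (cases m) simp_all
qed

lemma iso_relabelled: "iso T (relabel T :: ('i, 'k::one) tree)"
  by (induction T) (auto intro!: iso_Leaf iso_Node[OF refl] simp: list_all2_conv_all_nth)

lemma level_trees_iso_closed:
  assumes "U \<in> {T \<in> level_trees (commutative_operad :: ('k, 'k::comm_ring_1) operad) n d. arity_ge 1 T}" "iso U V"
  shows "V \<in> {T \<in> level_trees Com n d. arity_ge 1 T}"
proof -
  have "arity_ge 1 V" using iso_arity_ge[OF assms(2)] assms(1) by simp
  moreover have "distinct (leaves V) = distinct (leaves U)" "lset V = lset U"
    using iso_mset[OF assms(2)] by (auto dest: mset_eq_imp_distinct_iff mset_eq_setD)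
  moreover have "has_levels d V" using iso_has_levels[OF assms(2)] assms(1) by (simp add: level_trees_def)
  ultimately show ?thesis using assms(1) labelled_full[of V]
    by (simp add: level_trees_def n_tree_def)
qed

text \<open>The relations are applied among trees without vertices of arity 0: such a vertex admits
  only the label 0 and could not be relabelled by 1.\<close>

lemma level_trees_iso_rels:
  assumes "T \<in> level_trees (commutative_operad :: ('k, 'k::comm_ring_1) operad) n d" "full T" "iso T T'" "ones T'"
  shows "gen T - fscale (coef T) (gen T') \<in> fspan (normalized_rels Com n d)"
    and "T' \<in> level_trees Com n d"
proof -
  let ?G0 = "{T \<in> level_trees (commutative_operad :: ('k, 'k) operad) n d. arity_ge 1 T}"
  have T0: "T \<in> ?G0" using assms(1,2) by (simp add: full_def)
  then show "T' \<in> level_trees Com n d"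
    using level_trees_iso_closed[OF T0 assms(3)] by simp
  have "gen ((\<lambda>t. t) T) - fscale (coef T) (gen ((\<lambda>t. t) T')) \<in> fspan (tensor_rels commutative_operad ?G0)"
    by (rule iso_rels[OF level_trees_iso_closed assms(3,4) tree_contexts.hole T0])
  moreover have "fspan (tensor_rels commutative_operad ?G0) \<subseteq> fspan (normalized_rels Com n d)"
    using tensor_rels_mono[of ?G0 "level_trees commutative_operad n d" "commutative_operad :: ('k, 'k) operad"]
      fs.span_mono[of "tensor_rels commutative_operad (level_trees commutative_operad n d)" "normalized_rels Com n d"]
    by (auto simp: normalized_rels_def)
  ultimately show "gen T - fscale (coef T) (gen T') \<in> fspan (normalized_rels Com n d)"
    by auto
qed

lemma coef_ones:
  fixes T :: "('a, 'b::comm_ring_1) tree"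
  shows "ones T \<Longrightarrow> coef T = 1"
proof (induction T)
  case (Node a p ts)
  have "prod_list (map coef us) = 1" if "\<And>u. u \<in> set us \<Longrightarrow> coef u = 1" for us :: "('a, 'b) tree list"
    using that by (induction us) auto
  then show ?case using Node by simp
qed simp

lemma norm_class_rels:
  assumes "r \<in> normalized_rels (commutative_operad :: ('k, 'k::comm_ring_1) operad) n d"
  shows "lin_ext (norm_class d) r = 0"
  using assms unfolding normalized_rels_def
proof
  assume "r \<in> tensor_rels Com (level_trees commutative_operad n d)"
  then show ?thesis unfolding norm_class_def[abs_def]
  proof (rule kill_tensor_rels[rotated])
    fix C :: "'k level_tree \<Rightarrow> 'k level_tree" and a and p q :: 'k and ts us :: "'k level_tree list"
    assume C: "C \<in> tree_contexts" and m: "mset us = mset ts"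
    have s: "set us = set ts" using m by (rule mset_eq_setD)
    have "lev m (Node a p ts) = lev m (Node a q us)" for m by (cases m) (simp_all add: s)
    then have "lev m (C (Node a p ts)) = lev m (C (Node a q us))" for m by (rule context_lev[OF C])
    then show "norm_gen d (levset d (C (Node a p ts))) = (norm_gen d (levset d (C (Node a q us))) :: _ \<Rightarrow>\<^sub>0 'k)"
      by (simp add: levset_def)
  qed
next
  assume "r \<in> {gen (degeneracy Com j T) | j T. j < d \<and> T \<in> level_trees Com n (d - 1)}"
  then obtain j T where r: "r = gen (degeneracy Com j T)" "j < d"
    "T \<in> level_trees Com n (d - 1)" by blast
  have "card (levset d (degeneracy Com j T)) \<noteq> Suc d"
    using r(2) level_treesD(4)[OF r(3)] by (intro degenerate_card[OF lev_degeneracy[of "d - 1"]]) auto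
  then show ?thesis by (simp add: r(1) norm_class_def norm_gen_def)
qed

text \<open>If each partition refined the previous one strictly, the numbers of blocks would
  increase strictly and all members would be distinct.\<close>

lemma degenerate_level:
  assumes "full T" "card (levset d T) \<noteq> Suc d"
  shows "\<exists>j<d. lev (Suc j) T = lev j T"
proof (rule ccontr)
  assume n: "\<not> (\<exists>j<d. lev (Suc j) T = lev j T)"
  have step: "card (lev j T) < card (lev (Suc j) T)" if "j < d" for j
    using n that by (intro refines_card_less[OF _ lev_refines_Suc[OF assms(1)]]) auto
  have less: "card (lev m T) < card (lev m' T)" if "m < m'" "m' \<le> d" for m m'
    using that
  proof (induction rule: strict_inc_induct)
    case (base i)
    then show ?case using step[of i] by simp
  next
    case (step i)
    then show ?case using \<open>\<And>j. j < d \<Longrightarrow> card (lev j T) < card (lev (Suc j) T)\<close>[of i] by simp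
  qed
  have "inj_on (\<lambda>m. lev m T) {..d}"
  proof (rule inj_onI)
    fix m m' assume "m \<in> {..d}" "m' \<in> {..d}" "lev m T = lev m' T"
    then show "m = m'" using less[of m m'] less[of m' m] by (cases m m' rule: linorder_cases) auto
  qed
  then have "card (levset d T) = Suc d" unfolding levset_def by (simp add: card_image)
  then show False using assms(2) by simp
qed

lemma presents_norm:
  "presents (normalized_bar_complex (commutative_operad :: ('k, 'k::comm_ring_1) operad) n) d (lin_ext (norm_class d)) (norm_basis n d)"
proof -
  let ?P = "commutative_operad :: ('k, 'k) operad"
  let ?G = "level_trees ?P n d" and ?R = "normalized_rels ?P n d"
  define rep where "rep = (\<lambda>F. SOME T :: 'k level_tree. T \<in> ?G \<and> full T \<and> ones T \<and> levset d T = F)"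
  have rep: "rep F \<in> ?G" "full (rep F)" "ones (rep F)" "levset d (rep F) = F" if "F \<in> norm_basis n d" for F
  proof -
    have "\<exists>T. T \<in> ?G \<and> full T \<and> ones T \<and> levset d T = F" using norm_representative[OF that, where 'k='k] by blast
    from someI_ex[OF this] show "rep F \<in> ?G" "full (rep F)" "ones (rep F)" "levset d (rep F) = F"
      unfolding rep_def by blast+
  qed
  have tens: "fspan (tensor_rels ?P ?G) \<subseteq> fspan ?R" unfolding normalized_rels_def by (rule fs.span_mono) simp
  show ?thesis
  proof (rule presentsI[where G="?G" and R="?R" and s="\<lambda>F. gen (rep F)"])
    show "?R \<subseteq> fspan (gen ` ?G)"
    proof
      fix r assume "r \<in> ?R"
      then consider "r \<in> tensor_rels ?P ?G" | j T where "r = gen (degeneracy ?P j T)" "j < d" "T \<in> level_trees ?P n (d - 1)"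
        unfolding normalized_rels_def by blast
      then show "r \<in> fspan (gen ` ?G)"
      proof cases
        case 1
        then show ?thesis using tensor_rels_subset by blast
      next
        case 2
        note TD = level_treesD[OF 2(3)]
        have "has_levels (Suc (d - 1)) (degeneracy ?P j T)" using 2(2) TD(4) by (intro has_levels_degeneracy) auto
        then have "degeneracy ?P j T \<in> ?G"
          using 2(2) TD labelled_degeneracy[OF TD(3)] by (simp add: level_trees_def n_tree_def leaves_degeneracy)
        then show ?thesis unfolding 2(1) by (intro fs.span_base imageI)
      qed
    qed
    show "lin_ext (norm_class d) r = 0" if "r \<in> ?R" for r using norm_class_rels[OF that] .
    show "norm_class d T \<in> free_on (norm_basis n d)" if "T \<in> ?G" for T :: "'k level_tree" using norm_class_mem[OF that] .
    show "gen (rep F) \<in> fspan (gen ` ?G) \<and> lin_ext (norm_class d) (gen (rep F)) = gen F" if F: "F \<in> norm_basis n d" for F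
      using rep[OF F] F by (auto simp: norm_class_def norm_gen_def coef_ones norm_basis_def intro: fs.span_base)
    fix T :: "'k level_tree" assume T: "T \<in> ?G"
    note TD = level_treesD[OF T]
    show "gen T - lin_ext (\<lambda>F. gen (rep F)) (norm_class d T) \<in> fspan ?R"
      using coef_zero_or_full[OF T]
    proof
      assume z: "coef T = 0 \<and> gen T \<in> fspan (tensor_rels ?P ?G)"
      then have "norm_class d T = 0" by (simp add: norm_class_def)
      then show ?thesis using z tens by (auto simp: lin_zero[OF lin_lin_ext])
    next
      assume f: "full T"
      show ?thesis
      proof (cases "card (levset d T) = Suc d")
        case True
        define F where "F = levset d T"
        have F: "F \<in> norm_basis n d"
          using levset_part_chain[OF f TD(4)] TD(2) True by (simp add: norm_basis_def F_def)
        note S = rep[OF F] and SD = level_treesD[OF rep(1)[OF F]]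
        have "iso T (rep F)"
        proof (rule lev_eq_iso[OF f S(2) TD(4) SD(4)])
          show "lev m T = lev m (rep F)" if "m \<le> d" for m
            using levset_eq_lev[OF f S(2) True _ that] S(4) by (simp add: F_def)
        qed
        then have "gen T - fscale (coef T) (gen (rep F)) \<in> fspan ?R" by (rule level_trees_iso_rels(1)[OF T f _ S(3)])
        then show ?thesis using True by (simp add: norm_class_def norm_gen_def lin_scale[OF lin_lin_ext] F_def)
      next
        case False
        \<comment> \<open>A partition is repeated: T is a multiple of its relabelling by 1, and that
          tree is degenerate.\<close>
        obtain j where j: "j < d" "lev (Suc j) T = lev j T" using degenerate_level[OF f False] by blast
        obtain e where e: "d = Suc e" using j(1) by (cases d) auto
        define U where "U = (relabel T :: 'k level_tree)"
        have iso: "iso T U" and U1: "ones U" using iso_relabelled relabel_simps(3) by (simp_all add: U_def)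
        have fU: "full U" using f by (simp add: U_def full_def relabel_simps)
        have lU: "has_levels (Suc e) U" using TD(4) e by (simp add: U_def has_levels_relabel)
        have "lev (Suc j) U = lev j U" using j(2) by (simp add: U_def lev_relabel)
        then obtain V where V: "U = degeneracy ?P j V" "has_levels e V" "leaves V = leaves U" "arity_ge 1 V"
          using remove_degeneracy[OF fU U1 lU _ , of j] j(1) e by auto
        have UG: "U \<in> ?G" by (rule level_trees_iso_rels(2)[OF T f iso U1])
        have "V \<in> level_trees ?P n (d - 1)"
          using V(2-4) level_treesD[OF UG] e labelled_full[OF V(4)] by (simp add: level_trees_def n_tree_def)
        then have "gen U \<in> ?R" using V(1) j(1) unfolding normalized_rels_def by blast
        then have "fscale (coef T) (gen U) \<in> fspan ?R" by (intro fs.span_scale fs.span_base)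
        from fs.span_add[OF level_trees_iso_rels(1)[OF T f iso U1] this]
        have "gen T \<in> fspan ?R" by simp
        then show ?thesis using False by (simp add: norm_class_def norm_gen_def lin_zero[OF lin_lin_ext])
      qed
    qed
  qed (simp_all add: normalized_bar_complex_def)
qed


section \<open>The differential of the normalized complex\<close>

lemma augm_commutative: "augm (commutative_operad :: ('k, 'k::comm_ring_1) operad) r p = (if r = 1 then p else 0)"
  by (simp add: augm_def)

text \<open>Composing two consecutive levels erases the cut between them, at height i, and leaves
  the other cuts alone.\<close>

lemma merge_levels_props:
  assumes "has_levels (Suc e) T" "1 \<le> i" "i \<le> e"
  shows "has_levels e (merge_levels P i T)" "leaves (merge_levels P i T) = leaves T"
    "lev m (merge_levels P i T) = lev (if m < i then m else Suc m) T"
proof -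
  have "has_levels e (merge_levels P i T) \<and> leaves (merge_levels P i T) = leaves T \<and>
      (\<forall>m. lev m (merge_levels P i T) = lev (if m < i then m else Suc m) T)"
    using assms
  proof (induction T arbitrary: i e)
    case (Node a p ts)
    obtain e' where e: "e = Suc e'" using Node.prems(2,3) by (cases e) auto
    have lt: "has_levels (Suc e') t" if "t \<in> set ts" for t using Node.prems(1) that e by simp
    show ?case
    proof (cases "i \<le> 1")
      case True
      then have i: "i = 1" using Node.prems(2) by simp
      have t: "\<exists>q us. t = Node () q us" if "t \<in> set ts" for t using lt[OF that] by (cases t) auto
      have lc: "leaves t = concat (map leaves (children t))" "\<forall>u\<in>set (children t). has_levels e' u"
        "lev (Suc m) t = (\<Union>u\<in>set (children t). lev m u)" if "t \<in> set ts" for t m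
        using t[OF that] lt[OF that] by auto
      have cc: "concat (map leaves (concat (map children xs))) = concat (map (\<lambda>t. concat (map leaves (children t))) xs)"
        for xs :: "(unit, 'a) tree list" by (induction xs) auto
      have lv: "concat (map leaves (concat (map children ts))) = concat (map leaves ts)"
        unfolding cc using lc(1) by (simp cong: map_cong)
      have ls: "(\<Union>u\<in>set (concat (map children ts)). lset u) = (\<Union>t\<in>set ts. lset t)"
        using arg_cong[OF lv, of set] by simp
      have "lev m (merge_levels P i (Node a p ts)) = lev (if m < i then m else Suc m) (Node a p ts)" for m
      proof (cases m)
        case 0
        then show ?thesis using i ls by simp
      next
        case (Suc k)
        have "(\<Union>u\<in>set (concat (map children ts)). lev k u) = (\<Union>t\<in>set ts. \<Union>u\<in>set (children t). lev k u)" by auto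
        also have "\<dots> = (\<Union>t\<in>set ts. lev (Suc k) t)" using lc(3) by simp
        finally show ?thesis using i Suc by simp
      qed
      moreover have "has_levels e (merge_levels P i (Node a p ts))" using i e lc(2) by auto
      moreover have "leaves (merge_levels P i (Node a p ts)) = leaves (Node a p ts)" using i lv by simp
      ultimately show ?thesis by blast
    next
      case False
      have IH: "has_levels e' (merge_levels P (i - 1) t)" "leaves (merge_levels P (i - 1) t) = leaves t"
        "lev m (merge_levels P (i - 1) t) = lev (if m < i - 1 then m else Suc m) t" if "t \<in> set ts" for t m
        using Node.IH[OF that lt[OF that], of "i - 1"] False Node.prems(3) e by auto
      have lv: "map (\<lambda>t. leaves (merge_levels P (i - 1) t)) ts = map leaves ts" using IH(2) by simp
      have "lev m (merge_levels P i (Node a p ts)) = lev (if m < i then m else Suc m) (Node a p ts)" for m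
      proof (cases m)
        case 0
        then show ?thesis using False IH(2) by simp
      next
        case (Suc k)
        then show ?thesis using False IH(3) by auto
      qed
      moreover have "has_levels e (merge_levels P i (Node a p ts))" using False e IH(1) by auto
      moreover have "leaves (merge_levels P i (Node a p ts)) = leaves (Node a p ts)"
        using False lv by (simp add: comp_def cong: map_cong)
      ultimately show ?thesis by blast
    qed
  qed simp
  then show "has_levels e (merge_levels P i T)" "leaves (merge_levels P i T) = leaves T"
    "lev m (merge_levels P i T) = lev (if m < i then m else Suc m) T" by blast+
qed

lemma merge_levels_coef:
  fixes T :: "'k::comm_ring_1 level_tree"
  assumes "has_levels (Suc e) T" "1 \<le> i" "i \<le> e"
  shows "coef (merge_levels Com i T) = coef T"
  using assms
proof (induction T arbitrary: i e)
  case (Node a p ts)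
  obtain e' where e: "e = Suc e'" using Node.prems(2,3) by (cases e) auto
  have lt: "has_levels (Suc e') t" if "t \<in> set ts" for t using Node.prems(1) that e by simp
  show ?case
  proof (cases "i \<le> 1")
    case True
    have "coef t = label t * prod_list (map coef (children t))" if "t \<in> set ts" for t
      using lt[OF that] by (cases t) auto
    then have "map coef ts = map (\<lambda>t. label t * prod_list (map coef (children t))) ts" by simp
    moreover have "prod_list (map coef (concat (map children xs))) = prod_list (map (\<lambda>t. prod_list (map coef (children t))) xs)"
      for xs :: "'k level_tree list" by (induction xs) auto
    ultimately show ?thesis using True by (simp add: comp_def prod_list_mult ac_simps cong: map_cong)
  next
    case False
    have "coef (merge_levels Com (i - 1) t) = coef t" if "t \<in> set ts" for t
      using Node.IH[OF that lt[OF that], of "i - 1"] False Node.prems(3) e by auto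
    then show ?thesis using False by (simp add: comp_def cong: map_cong)
  qed
qed simp

lemma merge_levels_labelled:
  fixes T :: "'k::comm_ring_1 level_tree"
  assumes "has_levels (Suc e) T" "1 \<le> i" "i \<le> e" "labelled_in (ops Com) T"
  shows "labelled_in (ops Com) (merge_levels Com i T)"
  using assms
proof (induction T arbitrary: i e)
  case (Node a p ts)
  obtain e' where e: "e = Suc e'" using Node.prems(2,3) by (cases e) auto
  have lt: "has_levels (Suc e') t" if "t \<in> set ts" for t using Node.prems(1) that e by simp
  show ?case
  proof (cases "i \<le> 1")
    case True
    have ch: "u \<in> set (children t) \<Longrightarrow> labelled_in (ops Com) u"
      "children t = [] \<Longrightarrow> label t = 0" if mem: "t \<in> set ts" for t u
    proof -
      obtain q us where t: "t = Node () q us" using lt[OF mem] by (cases t) auto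
      have "labelled_in (ops Com) t" using Node.prems(4) mem unfolding labelled_in.simps by blast
      then show "u \<in> set (children t) \<Longrightarrow> labelled_in (ops Com) u"
        "children t = [] \<Longrightarrow> label t = 0" unfolding t by simp_all
    qed
    have "p * prod_list (map label ts) = 0" if "concat (map children ts) = []"
    proof (cases ts)
      case Nil
      then show ?thesis using Node.prems(4) by simp
    next
      case (Cons t us)
      then have "label t = 0" using that ch(2)[of t] by simp
      then show ?thesis using Cons by simp
    qed
    then have "p * prod_list (map label ts) \<in> ops Com (length (concat (map children ts)))"
      by simp
    moreover have "\<forall>u\<in>set (concat (map children ts)). labelled_in (ops Com) u"
      using ch(1) by (simp del: commutative_operad_simps(4))
    moreover have "merge_levels Com i (Node a p ts) = Node a (p * prod_list (map label ts)) (concat (map children ts))"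
      using True by (simp add: comp_def)
    ultimately show ?thesis by (simp only: labelled_in.simps)
  next
    case False
    have "labelled_in (ops Com) (merge_levels Com (i - 1) t)" if "t \<in> set ts" for t
    proof (rule Node.IH[OF that lt[OF that]])
      show "1 \<le> i - 1" "i - 1 \<le> e'" using False Node.prems(3) e by simp_all
      show "labelled_in (ops Com) t" using Node.prems(4) that unfolding labelled_in.simps by blast
    qed
    then show ?thesis using False Node.prems(4) by (simp del: commutative_operad_simps(4))
  qed
qed simp

lemma prod_list_nonzero: "prod_list xs \<noteq> (0 :: 'k::comm_ring_1) \<Longrightarrow> x \<in> set xs \<Longrightarrow> x \<noteq> 0"
proof -
  have "0 \<in> set ys \<Longrightarrow> prod_list ys = 0" for ys :: "'k list" by (induction ys) auto
  then show "prod_list xs \<noteq> 0 \<Longrightarrow> x \<in> set xs \<Longrightarrow> x \<noteq> 0" by metis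
qed

text \<open>A nonzero coefficient forces all vertices of the last level to be unary. Only then does
  \<open>cut_top\<close>, which keeps the first child alone, lose nothing.\<close>

lemma cut_top_props:
  fixes T :: "'k::comm_ring_1 level_tree"
  assumes "has_levels (Suc d) T" "top_coeff Com (Suc d) T \<noteq> 0"
  shows "leaves (cut_top (Suc d) T) = leaves T \<and> has_levels d (cut_top (Suc d) T) \<and>
    (labelled_in M T \<longrightarrow> labelled_in M (cut_top (Suc d) T)) \<and>
    (\<forall>m\<le>d. lev m (cut_top (Suc d) T) = lev m T) \<and> lev (Suc d) T = lev d T \<and>
    coef T = top_coeff Com (Suc d) T * coef (cut_top (Suc d) T)"
  using assms
proof (induction d arbitrary: T)
  case 0
  then obtain p ts where T: "T = Node () p ts" by (cases T) auto
  have "length ts = 1" using 0(2) unfolding T by (simp add: augm_commutative split: if_splits)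
  then obtain t where ts: "ts = [t]" by (cases ts) auto
  moreover obtain i where "t = Leaf i" using 0(1) unfolding T ts by (cases t) auto
  ultimately show ?case using T by (simp add: augm_commutative)
next
  case (Suc d)
  then obtain p ts where T: "T = Node () p ts" by (cases T) auto
  let ?top = "top_coeff (commutative_operad :: ('k, 'k) operad) (Suc d)"
  have top: "top_coeff Com (Suc (Suc d)) T = prod_list (map ?top ts)" by (simp add: T)
  have cut: "cut_top (Suc (Suc d)) T = Node () p (map (cut_top (Suc d)) ts)" by (simp add: T)
  have IH: "leaves (cut_top (Suc d) t) = leaves t" "has_levels d (cut_top (Suc d) t)"
    "labelled_in M t \<Longrightarrow> labelled_in M (cut_top (Suc d) t)" "\<And>m. m \<le> d \<Longrightarrow> lev m (cut_top (Suc d) t) = lev m t"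
    "lev (Suc d) t = lev d t" "coef t = ?top t * coef (cut_top (Suc d) t)" if t: "t \<in> set ts" for t
  proof -
    have "has_levels (Suc d) t" using Suc.prems(1) t T by simp
    moreover have "?top t \<noteq> 0" using prod_list_nonzero[of "map ?top ts" "?top t"] Suc.prems(2) t unfolding top by simp
    ultimately show "leaves (cut_top (Suc d) t) = leaves t" "has_levels d (cut_top (Suc d) t)"
      "labelled_in M t \<Longrightarrow> labelled_in M (cut_top (Suc d) t)" "\<And>m. m \<le> d \<Longrightarrow> lev m (cut_top (Suc d) t) = lev m t"
      "lev (Suc d) t = lev d t" "coef t = ?top t * coef (cut_top (Suc d) t)" using Suc.IH by blast+
  qed
  have "leaves (cut_top (Suc (Suc d)) T) = leaves T" unfolding cut T using IH(1) by (simp add: comp_def cong: map_cong)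
  moreover have "has_levels (Suc d) (cut_top (Suc (Suc d)) T)" unfolding cut using IH(2) by simp
  moreover have "labelled_in M T \<longrightarrow> labelled_in M (cut_top (Suc (Suc d)) T)" unfolding cut T using IH(3) by simp
  moreover have "lev m (cut_top (Suc (Suc d)) T) = lev m T" if m: "m \<le> Suc d" for m
  proof (cases m)
    case 0
    then show ?thesis unfolding cut T using IH(1) by simp
  next
    case (Suc k)
    then show ?thesis unfolding cut T using IH(4) m by simp
  qed
  moreover have "lev (Suc (Suc d)) T = lev (Suc d) T" unfolding T using IH(5) by simp
  moreover have "coef T = prod_list (map ?top ts) * coef (cut_top (Suc (Suc d)) T)"
  proof -
    have "prod_list (map coef ts) = prod_list (map (\<lambda>t. ?top t * coef (cut_top (Suc d) t)) ts)"
      by (intro arg_cong[where f=prod_list] map_cong refl IH(6))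
    then show ?thesis unfolding cut T by (simp add: comp_def prod_list_mult ac_simps)
  qed
  ultimately show ?case unfolding top by blast
qed

lemma prod_list_dvd:
  "(\<And>x. x \<in> set xs \<Longrightarrow> f x dvd g x) \<Longrightarrow> prod_list (map f xs) dvd prod_list (map g xs :: 'k::comm_ring_1 list)"
  by (induction xs) (auto intro: mult_dvd_mono)

text \<open>The coefficient may also be zero on unary vertices, through zero labels or zero
  divisors. By divisibility \<open>coef T\<close> then vanishes too, so no term is missed.\<close>

lemma top_coeff_dvd:
  fixes T :: "'k::comm_ring_1 level_tree"
  assumes "full T" "has_levels (Suc d) T" "lev (Suc d) T = lev d T"
  shows "top_coeff Com (Suc d) T dvd coef T"
  using assms
proof (induction d arbitrary: T)
  case 0
  then obtain p ts where T: "T = Node () p ts" by (cases T) auto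
  obtain t where ts: "ts = [t]" using one_child[of "()" p ts] 0(1,3) unfolding T by auto
  then show ?case by (simp add: T augm_commutative)
next
  case (Suc d)
  then obtain p ts where T: "T = Node () p ts" by (cases T) auto
  note f = Suc.prems(1)[unfolded T]
  have "top_coeff Com (Suc d) t dvd coef t" if t: "t \<in> set ts" for t
  proof (rule Suc.IH)
    show "full t" using full_child[OF f t] .
    show "has_levels (Suc d) t" using Suc.prems(2) t T by simp
    have "lev (Suc (Suc d)) (Node () p ts) = lev (Suc d) (Node () p ts)" using Suc.prems(3) unfolding T .
    then show "lev (Suc d) t = lev d t"
      unfolding lev_child[OF f t, of "Suc d"] lev_child[OF f t, of d] by (simp only:)
  qed
  then have "prod_list (map (top_coeff Com (Suc d)) ts) dvd prod_list (map coef ts)"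
    by (rule prod_list_dvd)
  then show ?case by (simp add: T)
qed

lemma levset_reindex:
  assumes "\<And>m. m \<le> d \<Longrightarrow> lev m U = lev (if m < i then m else Suc m) T" "i \<le> Suc d"
  shows "levset d U = (\<lambda>m. lev m T) ` ({..Suc d} - {i})"
proof -
  have "levset d U = (\<lambda>m. lev m T) ` ((\<lambda>m. if m < i then m else Suc m) ` {..d})"
    unfolding levset_def image_image using assms(1) by (intro image_cong) auto
  also have "(\<lambda>m. if m < i then m else Suc m) ` {..d} = {..Suc d} - {i}"
  proof (intro subset_antisym subsetI)
    fix k assume k: "k \<in> {..Suc d} - {i}"
    show "k \<in> (\<lambda>m. if m < i then m else Suc m) ` {..d}"
    proof (cases "k < i")
      case True
      then show ?thesis using assms(2) by (intro image_eqI[of _ _ k]) auto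
    next
      case False
      then show ?thesis using k by (intro image_eqI[of _ _ "k - 1"]) auto
    qed
  qed (auto split: if_splits)
  finally show ?thesis .
qed

text \<open>The outer faces apply the augmentation, which vanishes unless the first, respectively
  last, level is unary, that is, unless the two partitions at that end agree.\<close>

definition proper_face :: "nat \<Rightarrow> (nat \<Rightarrow> 'a) \<Rightarrow> nat \<Rightarrow> bool" where
  "proper_face d s i \<longleftrightarrow> (i = 0 \<longrightarrow> s (Suc 0) = s 0) \<and> (i = Suc d \<longrightarrow> s (Suc d) = s d)"

lemma face_commutative:
  fixes T :: "'k::comm_ring_1 level_tree"
  assumes T: "T \<in> level_trees Com n (Suc d)" and i: "i \<le> Suc d"
  shows "face Com (Suc d) i T \<in> fspan (gen ` level_trees Com n d)"
      (is ?mem)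
    and "lin_ext (norm_class d) (face Com (Suc d) i T) =
      fscale (coef T) (if proper_face d (\<lambda>m. lev m T) i then norm_gen d ((\<lambda>m. lev m T) ` ({..Suc d} - {i})) else 0)"
      (is ?class)
proof -
  let ?P = "commutative_operad :: ('k, 'k) operad"
  let ?s = "\<lambda>m. lev m T"
  note TD = level_treesD[OF T]
  obtain p ts where T': "T = Node () p ts" using TD(4) by (cases T) auto
  have full: "full T \<or> coef T = 0" using coef_zero_or_full[OF T] by blast
  consider "i = 0" | "0 < i" "i < Suc d" | "i = Suc d" using i by linarith
  then have "?mem \<and> ?class"
  proof cases
    case 1
    have f: "face ?P (Suc d) i T = fscale (if length ts = 1 then p else 0) (gen (hd ts))"
      using 1 by (simp add: face_def T' augm_commutative)
    show ?thesis
    proof (cases "length ts = 1")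
      case True
      then obtain t where ts: "ts = [t]" by (cases ts) auto
      have "t \<in> level_trees ?P n d" using T unfolding T' ts by (simp add: level_trees_def n_tree_def)
      moreover have "proper_face d ?s i" using 1 by (simp add: proper_face_def T' ts)
      moreover have "levset d t = ?s ` ({..Suc d} - {0})" by (rule levset_reindex) (simp_all add: T' ts)
      ultimately show ?thesis unfolding f using 1
        by (auto simp: ts T' norm_class_def lin_scale[OF lin_lin_ext] simp del: lev.simps intro: fs.span_scale fs.span_base)
    next
      case False
      have "\<not> proper_face d ?s i" if "full T"
      proof
        assume "proper_face d ?s i"
        then have "lev (Suc 0) (Node () p ts) = lev 0 (Node () p ts)" using 1 by (simp add: proper_face_def T' del: lev.simps)
        then show False using one_child[of "()" p ts] False that T' by fastforce
      qed
      then show ?thesis using False full unfolding f by (auto simp: fs.span_zero lin_zero[OF lin_lin_ext])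
    qed
  next
    case 2
    let ?U = "merge_levels ?P i T"
    have f: "face ?P (Suc d) i T = gen ?U" using 2 by (simp add: face_def)
    have id: "1 \<le> i" "i \<le> d" using 2 by simp_all
    note U = merge_levels_props[OF TD(4) id, where P="?P"] merge_levels_labelled[OF TD(4) id TD(3)] merge_levels_coef[OF TD(4) id]
    have "?U \<in> level_trees ?P n d" using U TD by (simp add: level_trees_def n_tree_def)
    moreover have "proper_face d ?s i" using 2 by (simp add: proper_face_def)
    moreover have "levset d ?U = ?s ` ({..Suc d} - {i})" using U(3) i by (intro levset_reindex) auto
    ultimately show ?thesis unfolding f by (auto simp: norm_class_def U(5) intro: fs.span_base)
  next
    case 3
    let ?U = "cut_top (Suc d) T" and ?c = "top_coeff ?P (Suc d) T"
    have f: "face ?P (Suc d) i T = fscale ?c (gen ?U)" using 3 by (simp add: face_def)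
    show ?thesis
    proof (cases "?c = 0")
      case True
      have "coef T = 0" if "proper_face d ?s i"
      proof (cases "coef T = 0")
        case False
        then have "full T" using full by blast
        moreover have "lev (Suc d) T = lev d T" using that 3 by (simp add: proper_face_def)
        ultimately have "?c dvd coef T" by (intro top_coeff_dvd TD(4))
        then show ?thesis using True by simp
      qed
      then show ?thesis unfolding f using True by (auto simp: fs.span_zero lin_zero[OF lin_lin_ext])
    next
      case False
      note U = cut_top_props[OF TD(4) False, of "ops ?P"]
      have "?U \<in> level_trees ?P n d" using U TD by (simp add: level_trees_def n_tree_def)
      moreover have "proper_face d ?s i" using 3 U by (simp add: proper_face_def)
      moreover have "levset d ?U = ?s ` ({..Suc d} - {i})" using U 3 by (intro levset_reindex) auto
      moreover have "coef T = ?c * coef ?U" using U by blast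
      ultimately show ?thesis unfolding f
        by (auto simp: norm_class_def lin_scale[OF lin_lin_ext] intro: fs.span_scale fs.span_base)
    qed
  qed
  then show ?mem ?class by blast+
qed

text \<open>Without repetitions the outer faces vanish, and an inner face deletes the partition at
  height i, which is preceded in \<open>prec\<close> by exactly i others; this explains the sign
  \<open>(-1) ^ i\<close>. With a repetition at heights j and j + 1 only the faces j and j + 1 can
  survive, and they agree up to opposite signs.\<close>

lemma norm_gen_bd:
  assumes "full T" "has_levels (Suc d) T"
  shows "(\<Sum>i\<le>Suc d. fscale ((-1) ^ i) (if proper_face d (\<lambda>m. lev m T) i then norm_gen d ((\<lambda>m. lev m T) ` ({..Suc d} - {i})) else 0)) =
    bd (- {singles (lset T), {lset T}}) (norm_gen (Suc d) (levset (Suc d) T) :: _ \<Rightarrow>\<^sub>0 'k::comm_ring_1)"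
proof -
  define s where "s = (\<lambda>m. lev m T)"
  define f where "f = (\<lambda>i. fscale ((-1) ^ i) (if proper_face d s i then norm_gen d (s ` ({..Suc d} - {i})) else 0) :: _ \<Rightarrow>\<^sub>0 'k)"
  let ?G = "levset (Suc d) T"
  have G: "?G = s ` {..Suc d}" by (simp add: levset_def s_def)
  have "(\<Sum>i\<le>Suc d. f i) = bd (- {singles (lset T), {lset T}}) (norm_gen (Suc d) ?G)"
  proof (cases "card ?G = Suc (Suc d)")
    case True
    have inj: "inj_on s {..Suc d}" using True unfolding G by (intro eq_card_imp_inj_on) simp_all
    have lt: "card (s m) < card (s m')" if "m < m'" "m' \<le> Suc d" for m m'
      using levset_strict[OF assms(1) True that] by (simp add: s_def)
    have f_eq: "f i = (if i = 0 \<or> i = Suc d then 0 else del (s i) (gen ?G))" if i: "i \<le> Suc d" for i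
    proof (cases "i = 0 \<or> i = Suc d")
      case True
      have "s (Suc 0) \<noteq> s 0" "s (Suc d) \<noteq> s d" using lt[of 0 "Suc 0"] lt[of d "Suc d"] by auto
      then show ?thesis using True by (auto simp: f_def proper_face_def)
    next
      case False
      have img: "s ` ({..Suc d} - {i}) = ?G - {s i}"
        unfolding G using inj i by (subst inj_on_image_set_diff[of s "{..Suc d}"]) auto
      have "card (s ` ({..Suc d} - {i})) = Suc d"
        using i by (subst card_image[OF inj_on_subset[OF inj]]) auto
      then have "norm_gen d (s ` ({..Suc d} - {i})) = (gen (?G - {s i}) :: _ \<Rightarrow>\<^sub>0 'k)"
        unfolding norm_gen_def img by simp
      moreover have "eps (s i) ?G = ((-1) ^ i :: 'k)"
      proof -
        have "prec (s m) (s i) \<longleftrightarrow> m < i" if "m \<le> Suc d" for m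
        proof (cases m i rule: linorder_cases)
          case less
          then show ?thesis using lt[of m i] i by (simp add: prec_def)
        next
          case greater
          then show ?thesis using lt[of i m] that by (simp add: prec_def)
        qed simp
        then have "{C \<in> ?G. prec C (s i)} = s ` {..<i}" unfolding G using i by auto
        moreover have "inj_on s {..<i}" using inj by (rule inj_on_subset) (use i in auto)
        ultimately show ?thesis by (simp add: eps_def card_image)
      qed
      moreover have "finite ?G" "s i \<in> ?G" using i by (auto simp: G)
      ultimately show ?thesis using False by (simp add: f_def proper_face_def del_gen)
    qed
    have ends: "s 0 = {lset T}" "s (Suc d) = singles (lset T)" using lev_top[OF assms(2)] by (simp_all add: s_def)
    have "(\<Sum>i\<le>Suc d. f i) = (\<Sum>i\<le>Suc d. if i = 0 \<or> i = Suc d then 0 else del (s i) (gen ?G))"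
      using f_eq by (intro sum.cong) auto
    also have "\<dots> = (\<Sum>i\<in>{..Suc d} - {0, Suc d}. del (s i) (gen ?G))"
      by (intro sum.mono_neutral_cong_right) auto
    also have "\<dots> = (\<Sum>D\<in>?G \<inter> - {singles (lset T), {lset T}}. del D (gen ?G))"
    proof (rule sum.reindex_cong[symmetric, OF _ _ refl])
      show "inj_on s ({..Suc d} - {0, Suc d})" using inj by (rule inj_on_subset) auto
      have "s ` ({..Suc d} - {0, Suc d}) = s ` {..Suc d} - s ` {0, Suc d}"
        by (rule inj_on_image_set_diff[OF inj]) auto
      then show "?G \<inter> - {singles (lset T), {lset T}} = s ` ({..Suc d} - {0, Suc d})" using ends unfolding G by auto
    qed
    also have "\<dots> = bd (- {singles (lset T), {lset T}}) (norm_gen (Suc d) ?G)" using True by (simp add: norm_gen_def bd_gen)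
    finally show ?thesis .
  next
    case False
    obtain j where j: "j < Suc d" "s (Suc j) = s j"
      using degenerate_level[OF assms(1) False] by (auto simp: s_def)
    \<comment> \<open>Removing another height keeps the repetition, so too few partitions are
      left.\<close>
    have zero: "f i = 0" if i: "i \<le> Suc d" "i \<noteq> j" "i \<noteq> Suc j" for i
    proof -
      have "s ` ({..Suc d} - {i}) = s ` ({..Suc d} - {i, j})"
      proof (intro subset_antisym subsetI)
        fix x assume "x \<in> s ` ({..Suc d} - {i})"
        then obtain m where m: "m \<le> Suc d" "m \<noteq> i" "x = s m" by auto
        show "x \<in> s ` ({..Suc d} - {i, j})"
        proof (cases "m = j")
          case True
          then show ?thesis using m(3) j i(3) by (intro image_eqI[of _ _ "Suc j"]) auto
        next
          case False
          then show ?thesis using m by (intro image_eqI[of _ _ m]) auto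
        qed
      qed auto
      moreover have "card (s ` ({..Suc d} - {i, j})) \<le> card ({..Suc d} - {i, j})" by (rule card_image_le) simp
      moreover have "card ({..Suc d} - {i, j}) = d" using i j by (simp add: card_Diff_subset)
      ultimately have "card (s ` ({..Suc d} - {i})) \<noteq> Suc d" by simp
      then show ?thesis by (simp add: f_def norm_gen_def)
    qed
    have same: "s ` ({..Suc d} - {j}) = s ` ({..Suc d} - {Suc j})"
    proof (intro subset_antisym subsetI)
      fix x assume "x \<in> s ` ({..Suc d} - {j})"
      then obtain m where m: "m \<le> Suc d" "m \<noteq> j" "x = s m" by auto
      then show "x \<in> s ` ({..Suc d} - {Suc j})" using j
        by (cases "m = Suc j") (auto intro: image_eqI[of _ _ j] image_eqI[of _ _ m])
    next
      fix x assume "x \<in> s ` ({..Suc d} - {Suc j})"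
      then obtain m where m: "m \<le> Suc d" "m \<noteq> Suc j" "x = s m" by auto
      then show "x \<in> s ` ({..Suc d} - {j})" using j
        by (cases "m = j") (auto intro: image_eqI[of _ _ "Suc j"] image_eqI[of _ _ m])
    qed
    have "proper_face d s j" "proper_face d s (Suc j)" using j by (auto simp: proper_face_def)
    then have "f j + f (Suc j) = 0" using same by (simp add: f_def)
    moreover have "(\<Sum>i\<le>Suc d. f i) = (\<Sum>i\<in>{j, Suc j}. f i)"
      by (rule sum.mono_neutral_right) (use zero j in auto)
    ultimately show ?thesis using False by (simp add: norm_gen_def lin_zero[OF lin_bd])
  qed
  then show ?thesis unfolding f_def s_def .
qed

lemma norm_bdry_commutative:
  fixes T :: "'k::comm_ring_1 level_tree"
  assumes T: "T \<in> level_trees Com n (Suc d)"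
  shows "(\<Sum>i\<le>Suc d. fscale ((-1) ^ i) (face Com (Suc d) i T)) \<in> fspan (gen ` level_trees Com n d)"
    and "lin_ext (norm_class d) (\<Sum>i\<le>Suc d. fscale ((-1) ^ i) (face Com (Suc d) i T)) =
      bd (- {singles {1..n}, {{1..n}}}) (norm_class (Suc d) T)"
proof -
  let ?P = "commutative_operad :: ('k, 'k) operad"
  show "(\<Sum>i\<le>Suc d. fscale ((-1) ^ i) (face ?P (Suc d) i T)) \<in> fspan (gen ` level_trees ?P n d)"
    using face_commutative(1)[OF T] by (intro fs.span_sum fs.span_scale) auto
  let ?g = "\<lambda>i. (if proper_face d (\<lambda>m. lev m T) i then norm_gen d ((\<lambda>m. lev m T) ` ({..Suc d} - {i})) else 0) :: _ \<Rightarrow>\<^sub>0 'k"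
  have "lin_ext (norm_class d) (\<Sum>i\<le>Suc d. fscale ((-1) ^ i) (face ?P (Suc d) i T)) =
      (\<Sum>i\<le>Suc d. fscale ((-1) ^ i) (fscale (coef T) (?g i)))"
    unfolding lin_sum[OF lin_lin_ext] lin_scale[OF lin_lin_ext]
    by (intro sum.cong refl arg_cong[where f="fscale _"] face_commutative(2)[OF T]) simp
  also have "\<dots> = fscale (coef T) (\<Sum>i\<le>Suc d. fscale ((-1) ^ i) (?g i))"
    unfolding fs.scale_sum_right by (intro sum.cong refl fs.scale_left_commute)
  also have "\<dots> = bd (- {singles {1..n}, {{1..n}}}) (norm_class (Suc d) T)"
  proof (cases "coef T = 0")
    case False
    then have f: "full T" using coef_zero_or_full[OF T] by blast
    show ?thesis
      unfolding norm_gen_bd[OF f level_treesD(4)[OF T]] level_treesD(2)[OF T]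
      by (simp add: norm_class_def lin_scale[OF lin_bd])
  qed (simp add: norm_class_def lin_zero[OF lin_bd])
  finally show "lin_ext (norm_class d) (\<Sum>i\<le>Suc d. fscale ((-1) ^ i) (face ?P (Suc d) i T)) =
      bd (- {singles {1..n}, {{1..n}}}) (norm_class (Suc d) T)" .
qed


section \<open>Levelization and subdivision\<close>

lemma unit_vertices_props:
  fixes t :: "'k::comm_ring_1 level_tree"
  defines "u \<equiv> \<lambda>r. (unit_vertex (commutative_operad :: ('k, 'k) operad) ^^ r) t"
  shows "leaves (u r) = leaves t" "coef (u r) = coef t" "has_levels e t \<Longrightarrow> has_levels (r + e) (u r)"
    "labelled_in (ops Com) t \<Longrightarrow> labelled_in (ops Com) (u r)"
    "lev j (u r) = (if j \<le> r then {lset t} else lev (j - r) t)"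
proof -
  show l: "leaves (u r) = leaves t" for r by (induction r) (simp_all add: u_def)
  show "coef (u r) = coef t" by (induction r) (simp_all add: u_def)
  show "has_levels e t \<Longrightarrow> has_levels (r + e) (u r)" by (induction r) (simp_all add: u_def)
  show "labelled_in (ops Com) t \<Longrightarrow> labelled_in (ops Com) (u r)"
    by (induction r) (simp_all add: u_def)
  show "lev j (u r) = (if j \<le> r then {lset t} else lev (j - r) t)"
  proof (induction r arbitrary: j)
    case 0
    then show ?case by (cases j) (simp_all add: u_def)
  next
    case (Suc r)
    have u: "u (Suc r) = Node () 1 [u r]" by (simp add: u_def)
    show ?case
    proof (cases j)
      case 0
      then show ?thesis unfolding u using l by simp
    next
      case (Suc k)
      then show ?thesis unfolding u using Suc.IH[of k] by simp
    qed
  qed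
qed

lemma mono_below:
  assumes "\<forall>v u. (v, u) \<in> edges (Node k p ts) \<longrightarrow> l u < (l v :: nat)" "t \<in> set ts" "v \<in> set (vertices t)"
  shows "l k < l v"
proof -
  have "\<forall>v\<in>set (vertices t). l k < l v"
    if "\<And>v u. (v, u) \<in> edges t \<Longrightarrow> l u < l v" "\<And>j q us. t = Node j q us \<Longrightarrow> l k < l j" for t :: "(nat, 'a) tree" and k
    using that
  proof (induction t arbitrary: k)
    case (Node j q us)
    have kj: "l k < l j" using Node.prems(2) by blast
    have "\<forall>v\<in>set (vertices u). l j < l v" if u: "u \<in> set us" for u
    proof (rule Node.IH[OF u])
      show "l a < l b" if "(b, a) \<in> edges u" for a b using Node.prems(1)[of b a] that u by auto
      show "l j < l i" if "u = Node i r vs" for i r vs using Node.prems(1)[of i j] that u by auto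
    qed
    then show ?case using kj by fastforce
  qed simp
  moreover have "l u < l v" if "(v, u) \<in> edges t" for v u using assms(1) assms(2) that by auto
  moreover have "l k < l j" if "t = Node j q us" for j q us using assms(1)[rule_format, of j k] assms(2) that by auto
  ultimately show ?thesis using assms(3) by metis
qed

text \<open>Of two nested clusters the larger belongs to a vertex nearer to the root; levels
  increase along each edge of the path between them.\<close>

lemma mono_clusters:
  assumes "reduced T" "\<And>v u. (v, u) \<in> edges T \<Longrightarrow> l u < (l v :: nat)"
    and "(v, c) \<in> vcs T" "(u, c') \<in> vcs T" "c \<subset> c'"
  shows "l u < l v"
  using assms
proof (induction T)
  case (Node k p ts)
  let ?L = "\<Union>t\<in>set ts. lset t"
  have ed: "\<forall>v u. (v, u) \<in> edges (Node k p ts) \<longrightarrow> l u < l v" using Node.prems(2) by blast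
  have cL: "c \<noteq> ?L" using vcs_subset[OF Node.prems(4)] Node.prems(5) by auto
  then have cV: "(v, c) \<in> (\<Union>t\<in>set ts. vcs t)" using Node.prems(3) by auto
  then obtain t where t: "t \<in> set ts" "(v, c) \<in> vcs t" by (rule UN_E)
  show ?case
  proof (cases "c' = ?L")
    case True
    then have "u = k" using vcs_inj[OF Node.prems(1,4), of k] by simp
    moreover have "v \<in> set (vertices t)" unfolding vcs_fst[symmetric] using t(2) by force
    ultimately show ?thesis using mono_below[where l=l, OF ed t(1)] by simp
  next
    case False
    then have "(u, c') \<in> (\<Union>t\<in>set ts. vcs t)" using Node.prems(4) by auto
    then obtain t' where t': "t' \<in> set ts" "(u, c') \<in> vcs t'" by (rule UN_E)
    have "c \<subseteq> lset t'" using vcs_subset[OF t'(2)] Node.prems(5) by blast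
    then have "(v, c) \<in> vcs t'" using vcs_child[OF Node.prems(1) t'(1)] cV by blast
    moreover have "l b < l a" if "(a, b) \<in> edges t'" for a b using Node.prems(2)[of a b] that t'(1) by auto
    ultimately show ?thesis using Node.IH[OF t'(1) reduced_child[OF Node.prems(1) t'(1)]] t'(2) Node.prems(5) by blast
  qed
qed simp

lemma edges_clusters:
  assumes "reduced T" "(v, u) \<in> edges T"
  shows "\<exists>c c'. (v, c) \<in> vcs T \<and> (u, c') \<in> vcs T \<and> c \<subset> c'"
  using assms
proof (induction T)
  case (Node k p ts)
  show ?case
  proof (cases "\<exists>t\<in>set ts. (v, u) \<in> edges t")
    case True
    then obtain t where t: "t \<in> set ts" "(v, u) \<in> edges t" by blast
    obtain c c' where "(v, c) \<in> vcs t" "(u, c') \<in> vcs t" "c \<subset> c'"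
      using Node.IH[OF t(1) reduced_child[OF Node.prems(1) t(1)] t(2)] by (elim exE conjE)
    moreover have "vcs t \<subseteq> vcs (Node k p ts)" using t(1) by auto
    ultimately show ?thesis by blast
  next
    case False
    then obtain q us where t: "Node v q us \<in> set ts" "u = k" using Node.prems(2) by auto
    have "(v, lset (Node v q us)) \<in> vcs (Node v q us)" by simp
    then have "(v, lset (Node v q us)) \<in> (\<Union>t\<in>set ts. vcs t)" using t(1) by (rule UN_I[rotated])
    then have "(v, lset (Node v q us)) \<in> vcs (Node k p ts)" unfolding vcs.simps by (rule insertI2)
    moreover have "(u, \<Union>t\<in>set ts. lset t) \<in> vcs (Node k p ts)" using t(2) by simp
    ultimately show ?thesis using child_psubset[OF Node.prems(1) t(1)] by blast
  qed
qed simp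

text \<open>Nonempty sets inside disjoint \<open>D t\<close> and \<open>D u\<close> are never
  comparable.\<close>

lemma maximals_UN:
  assumes "\<And>t c. t \<in> I \<Longrightarrow> c \<in> H t \<Longrightarrow> c \<subseteq> D t \<and> c \<noteq> {}"
    and "\<And>t u. t \<in> I \<Longrightarrow> u \<in> I \<Longrightarrow> t \<noteq> u \<Longrightarrow> D t \<inter> D u = {}"
  shows "maximals (\<Union>t\<in>I. H t) = (\<Union>t\<in>I. maximals (H t))"
proof (intro subset_antisym subsetI)
  fix c assume c: "c \<in> (\<Union>t\<in>I. maximals (H t))"
  then obtain t where t: "t \<in> I" "c \<in> H t" "\<forall>e\<in>H t. \<not> c \<subset> e" by (auto simp: maximals_def)
  have "\<not> c \<subset> e" if e: "u \<in> I" "e \<in> H u" for u e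
  proof (cases "t = u")
    case False
    then have "D t \<inter> D u = {}" using assms(2) t(1) e(1) by blast
    then show ?thesis using assms(1)[OF t(1,2)] assms(1)[OF e] by blast
  qed (use t(3) e in blast)
  then show "c \<in> maximals (\<Union>t\<in>I. H t)" using t unfolding maximals_def by blast
qed (auto simp: maximals_def)

context
  fixes l :: "nat \<Rightarrow> nat" and d :: nat
begin

abbreviation place :: "nat \<Rightarrow> (nat, 'k::comm_ring_1) tree \<Rightarrow> 'k level_tree" where
  "place \<equiv> place_levels Com l d"

lemma place_levels_basic:
  fixes T :: "(nat, 'k::comm_ring_1) tree"
  assumes "\<And>k. k \<in> set (vertices T) \<Longrightarrow> m \<le> l k \<and> l k < d" "\<And>v u. (v, u) \<in> edges T \<Longrightarrow> l u < l v" "m \<le> d"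
  shows "leaves (place m T) = leaves T \<and> coef (place m T) = coef T \<and> has_levels (d - m) (place m T) \<and>
    (labelled_in (reduced_ops Com) T \<longrightarrow> labelled_in (ops Com) (place m T))"
  using assms
proof (induction T arbitrary: m)
  case (Leaf i)
  have "has_levels (d - m + 0) ((unit_vertex Com ^^ (d - m)) (Leaf i))"
    by (rule unit_vertices_props(3)) simp
  moreover have "labelled_in (ops Com) ((unit_vertex Com ^^ (d - m)) (Leaf i))"
    by (rule unit_vertices_props(4)) simp
  ultimately show ?case
    unfolding place_levels.simps unit_vertices_props(1,2) by (simp del: commutative_operad_simps)
next
  case (Node k p ts)
  let ?t = "Node () p (map (place (Suc (l k))) ts)"
  have ed: "\<forall>v u. (v, u) \<in> edges (Node k p ts) \<longrightarrow> l u < l v" using Node.prems(2) by blast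
  have k: "m \<le> l k" "l k < d" using Node.prems(1) by auto
  have IH: "leaves (place (Suc (l k)) t) = leaves t" "coef (place (Suc (l k)) t) = coef t"
    "has_levels (d - Suc (l k)) (place (Suc (l k)) t)"
    "labelled_in (reduced_ops Com) t \<longrightarrow> labelled_in (ops Com) (place (Suc (l k)) t)"
    if t: "t \<in> set ts" for t
  proof -
    have v: "Suc (l k) \<le> l v \<and> l v < d" if "v \<in> set (vertices t)" for v
      using mono_below[where l=l, OF ed t that] Node.prems(1)[of v] t that by auto
    have e: "l u < l v" if "(v, u) \<in> edges t" for v u using Node.prems(2)[of v u] t that by auto
    have "Suc (l k) \<le> d" using k by simp
    note all = Node.IH[OF t v e this]
    show "leaves (place (Suc (l k)) t) = leaves t" "coef (place (Suc (l k)) t) = coef t"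
      "has_levels (d - Suc (l k)) (place (Suc (l k)) t)"
      "labelled_in (reduced_ops Com) t \<longrightarrow> labelled_in (ops Com) (place (Suc (l k)) t)"
      using all by blast+
  qed
  have "has_levels (d - l k) ?t" using IH(3) k by simp
  then have "has_levels ((l k - m) + (d - l k)) ((unit_vertex Com ^^ (l k - m)) ?t)"
    by (rule unit_vertices_props(3))
  moreover have "(l k - m) + (d - l k) = d - m" using k by simp
  moreover have "p \<in> ops Com (length ts)"
    if "p \<in> reduced_ops Com (length ts)"
    using that by (auto simp: reduced_ops_def split: if_splits)
  then have "labelled_in (reduced_ops Com) (Node k p ts) \<longrightarrow> labelled_in (ops Com) ?t"
    using IH(4) by auto
  then have "labelled_in (reduced_ops Com) (Node k p ts) \<longrightarrow>
      labelled_in (ops Com) ((unit_vertex Com ^^ (l k - m)) ?t)"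
    using unit_vertices_props(4) by blast
  moreover have "leaves ?t = leaves (Node k p ts)" using IH(1) by (simp add: comp_def cong: map_cong)
  moreover have "coef ?t = coef (Node k p ts)" using IH(2) by (simp add: comp_def cong: map_cong)
  ultimately show ?case unfolding place_levels.simps unit_vertices_props(1,2) by (simp only:)
qed

text \<open>This is the formula in \<open>flag\<close>: the vertices on levels from m + j on lie
  above the cut, and the edges through the cut carry the maximal sets among their clusters and the
  inputs. If the root vertex of T is above the cut, only its root edge is met.\<close>

lemma place_levels_lev:
  fixes T :: "(nat, 'k::comm_ring_1) tree"
  assumes "\<And>k. k \<in> set (vertices T) \<Longrightarrow> m \<le> l k \<and> l k < d" "\<And>v u. (v, u) \<in> edges T \<Longrightarrow> l u < l v" "m \<le> d"
    and "reduced T" "j \<le> d - m"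
  shows "lev j (place m T) = maximals (singles (lset T) \<union> {c. \<exists>k. (k, c) \<in> vcs T \<and> m + j \<le> l k})"
  using assms
proof (induction T arbitrary: m j)
  case (Leaf i)
  have "lev j (place m (Leaf i)) = {{i}}"
    unfolding place_levels.simps unit_vertices_props(5) using Leaf.prems(5) by simp
  moreover have "maximals {{i}} = {{i}}" by (auto simp: maximals_def)
  ultimately show ?case by (simp add: singles_def del: place_levels.simps)
next
  case (Node k p ts)
  let ?t = "Node () p (map (place (Suc (l k))) ts)"
  let ?L = "\<Union>t\<in>set ts. lset t"
  have ed: "\<forall>v u. (v, u) \<in> edges (Node k p ts) \<longrightarrow> l u < l v" using Node.prems(2) by blast
  have k: "m \<le> l k" "l k < d" using Node.prems(1) by auto
  have v: "Suc (l k) \<le> l v \<and> l v < d" if "t \<in> set ts" "v \<in> set (vertices t)" for t v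
    using mono_below[where l=l, OF ed that] Node.prems(1)[of v] that by auto
  have e: "l u < l v" if "t \<in> set ts" "(v, u) \<in> edges t" for t v u using Node.prems(2)[of v u] that by auto
  have Sk: "Suc (l k) \<le> d" using k by simp
  have "lset (place (Suc (l k)) t) = lset t" if t: "t \<in> set ts" for t
    using place_levels_basic[where T=t and m="Suc (l k)", OF v[OF t] e[OF t] Sk] by simp
  then have lt: "lset ?t = ?L" by simp
  have lv: "lev j (place m (Node k p ts)) = (if j \<le> l k - m then {?L} else lev (j - (l k - m)) ?t)"
    using unit_vertices_props(5)[of j "l k - m" ?t] lt by (simp del: leaves.simps lev.simps)
  have sub: "c \<subseteq> ?L" if "c \<in> singles ?L \<union> {c. \<exists>v. (v, c) \<in> vcs (Node k p ts) \<and> m + j \<le> l v}" for c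
    using that vcs_subset[of _ c "Node k p ts"] by (auto simp: singles_def)
  show ?case
  proof (cases "j \<le> l k - m")
    case True
    then have "m + j \<le> l k" using k by simp
    then have "?L \<in> singles ?L \<union> {c. \<exists>v. (v, c) \<in> vcs (Node k p ts) \<and> m + j \<le> l v}" by auto
    then have "maximals (singles ?L \<union> {c. \<exists>v. (v, c) \<in> vcs (Node k p ts) \<and> m + j \<le> l v}) = {?L}"
      using sub unfolding maximals_def by (intro subset_antisym subsetI) blast+
    then show ?thesis unfolding lv using True by simp
  next
    case False
    define i where "i = j - (l k - m) - 1"
    have i: "j - (l k - m) = Suc i" "Suc (l k) + i = m + j" "i \<le> d - Suc (l k)"
      using False k Node.prems(5) by (simp_all add: i_def)
    define H where "H = (\<lambda>t :: (nat, 'k) tree. singles (lset t) \<union> {c. \<exists>v. (v, c) \<in> vcs t \<and> m + j \<le> l v})"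
    have "lev j (place m (Node k p ts)) = (\<Union>t\<in>set ts. lev i (place (Suc (l k)) t))"
      unfolding lv using False i(1) by simp
    also have "\<dots> = (\<Union>t\<in>set ts. maximals (H t))"
      using Node.IH[OF _ v e Sk reduced_child[OF Node.prems(4)] i(3)] i(2) by (simp add: H_def)
    also have "\<dots> = maximals (\<Union>t\<in>set ts. H t)"
    proof (rule maximals_UN[symmetric])
      show "c \<subseteq> lset t \<and> c \<noteq> {}" if "t \<in> set ts" "c \<in> H t" for t c
        using that vcs_subset[of _ c t] reduced_cluster[OF reduced_child[OF Node.prems(4) that(1)], of _ c]
        by (auto simp: H_def singles_def)
      show "lset t \<inter> lset u = {}" if "t \<in> set ts" "u \<in> set ts" "t \<noteq> u" for t u
        using reduced_children_disjoint[OF Node.prems(4) that(1,2)] that(3) by metis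
    qed
    also have "(\<Union>t\<in>set ts. H t) = singles ?L \<union> {c. \<exists>v. (v, c) \<in> vcs (Node k p ts) \<and> m + j \<le> l v}"
      using False k by (auto simp: H_def singles_def)
    finally show ?thesis by simp
  qed
qed

end

text \<open>A level function l corresponds to the list \<open>X l\<close> of the clusters by level,
  and increase along edges to being a linear extension. As \<open>sign l\<close> is the product of
  the signs of \<open>X l\<close> and of the list by positions, the sum over l becomes the one
  defining \<open>subdivide\<close>.\<close>

lemma levelization_gen:
  fixes T :: "(nat, 'k::comm_ring_1) tree"
  assumes T: "T \<in> bar_trees Com n d"
  shows "levelization Com d (gen T) \<in> fspan (gen ` level_trees Com n d)"
    and "lin_ext (norm_class d) (levelization Com d (gen T)) =
      subdivide (singles {1..n}) (bar_class d T)"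
proof -
  let ?P = "commutative_operad :: ('k, 'k) operad"
  define Ls where "Ls = {l. l permutes {..<d} \<and> (\<forall>(v, u)\<in>edges T. l u < l v)}"
  define pl where "pl = (\<lambda>l. place_levels ?P l d 0 T)"
  note TD = bar_treesD[OF T]
  have L: "levelization ?P d (gen T) = (\<Sum>l\<in>Ls. fscale (of_int (sign l)) (gen (pl l)))"
    by (simp add: levelization_def Ls_def pl_def)
  have basic: "l permutes {..<d}" "\<And>k. k \<in> set (vertices T) \<Longrightarrow> 0 \<le> l k \<and> l k < d" "\<And>v u. (v, u) \<in> edges T \<Longrightarrow> l u < l v"
    if "l \<in> Ls" for l
    using that TD(4) permutes_in_image[of l "{..<d}"] by (auto simp: Ls_def)
  have pl: "leaves (pl l) = leaves T" "coef (pl l) = coef T" "has_levels d (pl l)" "labelled_in (ops ?P) (pl l)" if "l \<in> Ls" for l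
  proof -
    have "k \<in> set (vertices T) \<Longrightarrow> 0 \<le> l k \<and> l k < d" "(v, u) \<in> edges T \<Longrightarrow> l u < l v" for k v u
      using basic(2,3)[OF that] by blast+
    from place_levels_basic[where l=l and d=d and T=T and m=0, OF this le0] TD(5)
    show "leaves (pl l) = leaves T" "coef (pl l) = coef T" "has_levels d (pl l)" "labelled_in (ops ?P) (pl l)"
      unfolding pl_def diff_zero by blast+
  qed
  have pl_mem: "pl l \<in> level_trees ?P n d" if "l \<in> Ls" for l
    using pl[OF that] TD by (simp add: level_trees_def n_tree_def)
  then show "levelization ?P d (gen T) \<in> fspan (gen ` level_trees ?P n d)"
    unfolding L by (intro fs.span_sum fs.span_scale fs.span_base imageI)
  have sum: "lin_ext (norm_class d) (levelization ?P d (gen T)) = (\<Sum>l\<in>Ls. fscale (of_int (sign l)) (norm_class d (pl l)))"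
    unfolding L by (simp add: lin_sum[OF lin_lin_ext] lin_scale[OF lin_lin_ext])
  show "lin_ext (norm_class d) (levelization ?P d (gen T)) = subdivide (singles {1..n}) (bar_class d T)"
  proof (cases "coef T = 0")
    case True
    then show ?thesis unfolding sum by (simp add: norm_class_def pl(2) bar_class_def lin_zero[OF lin_subdivide])
  next
    case False
    then have red: "reduced T" using coef_zero_or_reduced[OF T] by blast
    define c where "c = cl (vcs T)"
    define ys where "ys = map c [0..<d]"
    define F where "F = snd ` vcs T"
    have P: "distinct ys" "set ys = F" "length ys = d" "card F = d"
      using reduced_positions[OF red TD(3,4)] by (simp_all add: c_def F_def ys_def)
    have mem: "(k, c k) \<in> vcs T" if "k < d" for k
      unfolding c_def using cl_mem[OF TD(3)] TD(4) that by simp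
    have FN: "F \<in> nested {1..n} (singles {1..n})" using vcs_nested[OF red] TD(2) by (simp add: F_def)
    \<comment> \<open>The inverse appears because entry i is the cluster of the vertex that l places
      on level i.\<close>
    define X where "X = (\<lambda>l. permute_list (inv l) ys)"
    have Xnth: "X l ! l k = c k" if "l \<in> Ls" "k < d" for l k
    proof -
      have "l k < d" using permutes_in_image[OF basic(1)[OF that(1)], of k] that(2) by simp
      moreover have "inv l permutes {..<length ys}" using permutes_inv[OF basic(1)[OF that(1)]] P(3) by simp
      ultimately show ?thesis using permutes_inverses(2)[OF basic(1)[OF that(1)]] that(2) P(3)
        by (simp add: X_def permute_list_nth) (simp add: ys_def)
    qed
    have Xprops: "distinct (X l)" "set (X l) = F" "length (X l) = d" if "l \<in> Ls" for l
      using permutes_inv[OF basic(1)[OF that]] P by (simp_all add: X_def)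
    have Xorder: "X l \<in> orders F" if l: "l \<in> Ls" for l
    proof -
      have "\<not> X l ! i \<subset> X l ! j" if ij: "i < j" "j < d" for i j
      proof
        assume a: "X l ! i \<subset> X l ! j"
        let ?v = "inv l i" and ?u = "inv l j"
        have lv: "l ?v = i" "l ?u = j" using permutes_inverses(1)[OF basic(1)[OF l]] by simp_all
        have vu: "?v < d" "?u < d" using permutes_in_image[OF permutes_inv[OF basic(1)[OF l]]] ij by auto
        have "c ?v \<subset> c ?u" using a Xnth[OF l vu(1)] Xnth[OF l vu(2)] lv by simp
        then have "l ?u < l ?v" using mono_clusters[OF red basic(3)[OF l] mem[OF vu(1)] mem[OF vu(2)]] by simp
        then show False using lv ij by simp
      qed
      then have "sorted_wrt (\<lambda>a b. \<not> a \<subset> b) (X l)" using Xprops(3)[OF l] by (simp add: sorted_wrt_iff_nth_less)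
      then show ?thesis using Xprops[OF l] by (simp add: orders_def)
    qed
    have bij: "bij_betw X Ls (orders F)"
    proof (rule bij_betw_imageI)
      show "inj_on X Ls"
      proof (rule inj_onI)
        fix l l' assume l: "l \<in> Ls" "l' \<in> Ls" "X l = X l'"
        have "l k = l' k" for k
        proof (cases "k < d")
          case True
          have "l k < d" "l' k < d" using permutes_in_image[OF basic(1)[OF l(1)], of k] permutes_in_image[OF basic(1)[OF l(2)], of k] True by auto
          moreover have "X l ! l k = X l ! l' k" using Xnth[OF l(1) True] Xnth[OF l(2) True] l(3) by simp
          ultimately show ?thesis using Xprops[OF l(1)] by (simp add: nth_eq_iff_index_eq)
        next
          case False
          then show ?thesis using basic(1)[OF l(1)] basic(1)[OF l(2)] by (simp add: permutes_def)
        qed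
        then show "l = l'" by blast
      qed
      have "xs \<in> X ` Ls" if xs: "xs \<in> orders F" for xs
      proof -
        have xsF: "distinct xs" "set xs = F" "sorted_wrt (\<lambda>a b. \<not> a \<subset> b) xs" using xs by (simp_all add: orders_def)
        then have "mset xs = mset ys" using P by (metis set_eq_iff_mset_eq_distinct)
        then obtain p where "p permutes {..<length ys}" and p2: "permute_list p ys = xs" by (rule mset_eq_permutation)
        then have p: "p permutes {..<d}" using P(3) by simp
        define l where "l = inv p"
        have l: "l permutes {..<d}" "inv l = p" using permutes_inv[OF p] inv_inv_eq[OF permutes_bij[OF p]] by (simp_all add: l_def)
        have nth: "xs ! l k = c k" "l k < d" if "k < d" for k
        proof -
          show lk: "l k < d" using permutes_in_image[OF l(1), of k] that by simp
          have "xs ! l k = ys ! p (l k)" unfolding p2[symmetric] using lk p P(3) by (simp add: permute_list_nth)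
          also have "p (l k) = k" unfolding l_def using permutes_inverses(1)[OF p] by simp
          finally show "xs ! l k = c k" using that by (simp add: ys_def)
        qed
        have "l u < l v" if vu: "(v, u) \<in> edges T" for v u
        proof -
          obtain C C' where C: "(v, C) \<in> vcs T" "(u, C') \<in> vcs T" "C \<subset> C'" using edges_clusters[OF red vu] by blast
          have vud: "v < d" "u < d" using vcs_fst[of T] TD(4) C(1,2) by force+
          have cv: "c v = C" "c u = C'" unfolding c_def using cl_eq[OF TD(3)] C by blast+
          have "length xs = d" using distinct_card[OF xsF(1)] xsF(2) P(4) by simp
          then have "\<not> l v < l u"
            using xsF(3) nth[OF vud(1)] nth[OF vud(2)] cv C(3) by (auto simp: sorted_wrt_iff_nth_less)
          moreover have "l u \<noteq> l v" using nth[OF vud(1)] nth[OF vud(2)] cv C(3) by auto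
          ultimately show ?thesis by simp
        qed
        then have "l \<in> Ls" using l(1) by (auto simp: Ls_def)
        moreover have "X l = xs" using l(2) p2 by (simp add: X_def)
        ultimately show ?thesis by blast
      qed
      then show "X ` Ls = orders F" using Xorder by blast
    qed
    have cls: "norm_class d (pl l) = fscale (coef T) (gen (flag (singles {1..n}) (X l)))" if l: "l \<in> Ls" for l
    proof -
      have "lev m (pl l) = maximals (singles {1..n} \<union> set (drop m (X l)))" if m: "m \<le> d" for m
      proof -
        have "lev m (pl l) = maximals (singles (lset T) \<union> {C. \<exists>k. (k, C) \<in> vcs T \<and> 0 + m \<le> l k})"
          unfolding pl_def by (rule place_levels_lev[OF basic(2,3)[OF l] _ red]) (use m in simp_all)
        also have "{C. \<exists>k. (k, C) \<in> vcs T \<and> 0 + m \<le> l k} = set (drop m (X l))"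
        proof (intro subset_antisym subsetI)
          fix C assume "C \<in> {C. \<exists>k. (k, C) \<in> vcs T \<and> 0 + m \<le> l k}"
          then obtain k where k: "(k, C) \<in> vcs T" "m \<le> l k" by auto
          have kd: "k < d" using vcs_fst[of T] TD(4) k(1) by force
          have "c k = C" unfolding c_def by (rule cl_eq[OF TD(3) k(1)])
          then have "X l ! l k = C" using Xnth[OF l kd] by simp
          moreover have "l k < d" using permutes_in_image[OF basic(1)[OF l], of k] kd by simp
          ultimately have "drop m (X l) ! (l k - m) = C" "l k - m < length (drop m (X l))"
            using k(2) Xprops(3)[OF l] by simp_all
          then show "C \<in> set (drop m (X l))" by (metis nth_mem)
        next
          fix C assume "C \<in> set (drop m (X l))"
          then obtain i where i: "i < d - m" "C = X l ! (m + i)"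
            using Xprops(3)[OF l] m by (auto simp: in_set_conv_nth)
          let ?k = "inv l (m + i)"
          have lk: "l ?k = m + i" using permutes_inverses(1)[OF basic(1)[OF l]] by simp
          have "?k < d" using permutes_in_image[OF permutes_inv[OF basic(1)[OF l]], of "m + i"] i(1) by auto
          then have "C = c ?k" "(?k, c ?k) \<in> vcs T" using Xnth[OF l, of ?k] lk i(2) mem by simp_all
          then show "C \<in> {C. \<exists>k. (k, C) \<in> vcs T \<and> 0 + m \<le> l k}" using lk by auto
        qed
        finally show ?thesis using TD(2) by simp
      qed
      then have "levset d (pl l) = flag (singles {1..n}) (X l)"
        unfolding levset_def flag_def Xprops(3)[OF l] by (intro image_cong) auto
      moreover have "card (flag (singles {1..n}) (X l)) = Suc d"
        using flag_mem[OF _ partition_on_singles FN Xorder[OF l]] Xprops(3)[OF l] by simp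
      ultimately show ?thesis by (simp add: norm_class_def pl(2)[OF l] norm_gen_def)
    qed
    have sgn: "order_sign (X l) * order_sign ys = (of_int (sign l) :: 'k)" if l: "l \<in> Ls" for l
    proof -
      have "order_sign (X l) = of_int (sign (inv l)) * (order_sign ys :: 'k)"
        unfolding X_def using permutes_inv[OF basic(1)[OF l]] P(1,3) by (intro order_sign_permute) simp_all
      moreover have "sign (inv l) = sign l"
        using basic(1)[OF l] by (intro sign_inverse permutes_imp_permutation[OF finite_lessThan])
      moreover have "order_sign ys * order_sign ys = (1 :: 'k)"
        using orient_square[OF red TD(3,4), where 'k='k] by (simp add: orient_def ys_def c_def)
      ultimately show ?thesis by (simp add: mult.assoc)
    qed
    have "subdivide (singles {1..n}) (bar_class d T) =
        fscale (coef T * order_sign ys) (\<Sum>xs\<in>orders F. fscale (order_sign xs) (gen (flag (singles {1..n}) xs)))"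
      by (simp add: bar_class_def F_def[symmetric] lin_scale[OF lin_subdivide] orient_def ys_def c_def) (simp add: subdivide_def)
    also have "(\<Sum>xs\<in>orders F. fscale (order_sign xs) (gen (flag (singles {1..n}) xs))) =
        (\<Sum>l\<in>Ls. fscale (order_sign (X l)) (gen (flag (singles {1..n}) (X l)) :: _ \<Rightarrow>\<^sub>0 'k))"
      by (rule sum.reindex_bij_betw[OF bij, symmetric])
    also have "fscale (coef T * order_sign ys) \<dots> = (\<Sum>l\<in>Ls. fscale (of_int (sign l)) (norm_class d (pl l)))"
      unfolding fs.scale_sum_right
    proof (intro sum.cong refl)
      fix l assume l: "l \<in> Ls"
      have "coef T * order_sign ys * order_sign (X l) = of_int (sign l) * coef T"
        unfolding sgn[OF l, symmetric] by (simp only: ac_simps)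
      then show "fscale (coef T * order_sign ys) (fscale (order_sign (X l)) (gen (flag (singles {1..n}) (X l)))) =
          fscale (of_int (sign l)) (norm_class d (pl l))"
        by (simp add: cls[OF l])
    qed
    finally show ?thesis unfolding sum by (rule sym)
  qed
qed


section \<open>Quasi-isomorphisms\<close>

definition linear_complex :: "('b, 'k::comm_ring_1) fcomplex \<Rightarrow> bool" where
  "linear_complex C \<longleftrightarrow> chain_complex C \<and> (\<forall>d. lin (bdry C d))"

definition linear_map :: "('b, 'k::comm_ring_1) fcomplex \<Rightarrow> ('c, 'k) fcomplex \<Rightarrow> (nat \<Rightarrow> ('b \<Rightarrow>\<^sub>0 'k) \<Rightarrow> ('c \<Rightarrow>\<^sub>0 'k)) \<Rightarrow> bool" where
  "linear_map C D f \<longleftrightarrow> linear_complex C \<and> linear_complex D \<and> chain_map C D f \<and> (\<forall>d. lin (f d))"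

text \<open>Injectivity and surjectivity on homology in terms of representatives, so that cosets
  appear only in \<open>quasi_isoI\<close>.\<close>

definition homology_iso :: "('b, 'k::comm_ring_1) fcomplex \<Rightarrow> ('c, 'k) fcomplex \<Rightarrow> (nat \<Rightarrow> ('b \<Rightarrow>\<^sub>0 'k) \<Rightarrow> ('c \<Rightarrow>\<^sub>0 'k)) \<Rightarrow> bool" where
  "homology_iso C D f \<longleftrightarrow> (\<forall>d. (\<forall>x\<in>cycles C d. f d x \<in> boundaries D d \<longrightarrow> x \<in> boundaries C d) \<and>
     (\<forall>y\<in>cycles D d. \<exists>x\<in>cycles C d. y - f d x \<in> boundaries D d))"

lemma linear_complexD:
  assumes "linear_complex C"
  shows "fs.subspace (chains C d)" "fs.subspace (zeros C d)" "zeros C d \<subseteq> chains C d" "lin (bdry C d)"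
    "x \<in> chains C (Suc d) \<Longrightarrow> bdry C d x \<in> chains C d" "x \<in> zeros C (Suc d) \<Longrightarrow> bdry C d x \<in> zeros C d"
    "x \<in> chains C (Suc (Suc d)) \<Longrightarrow> bdry C d (bdry C (Suc d) x) \<in> zeros C d"
  using assms unfolding linear_complex_def chain_complex_def image_subset_iff by blast+

lemma linear_mapD:
  assumes "linear_map C D f"
  shows "linear_complex C" "linear_complex D" "lin (f d)" "x \<in> chains C d \<Longrightarrow> f d x \<in> chains D d"
    "x \<in> zeros C d \<Longrightarrow> f d x \<in> zeros D d"
    "x \<in> chains C (Suc d) \<Longrightarrow> f d (bdry C d x) - bdry D d (f (Suc d) x) \<in> zeros D d"
  using assms unfolding linear_map_def chain_map_def image_subset_iff by blast+

lemma subspace_boundaries: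
  assumes "linear_complex C"
  shows "fs.subspace (boundaries C d)"
proof -
  note C = linear_complexD[OF assms]
  show ?thesis
  proof (rule fs.subspaceI)
    show "0 \<in> boundaries C d"
      using fs.subspace_0[OF C(1)[of "Suc d"]] fs.subspace_0[OF C(2)[of d]] lin_zero[OF C(4)[of d]]
      unfolding boundaries_def by force
  next
    fix x y assume "x \<in> boundaries C d" "y \<in> boundaries C d"
    then obtain u z v w where uv: "x = bdry C d u + z" "y = bdry C d v + w" "u \<in> chains C (Suc d)" "v \<in> chains C (Suc d)"
      "z \<in> zeros C d" "w \<in> zeros C d" unfolding boundaries_def by blast
    have "x + y = bdry C d (u + v) + (z + w)" using uv(1,2) lin_add[OF C(4)] by simp
    then show "x + y \<in> boundaries C d"
      using fs.subspace_add[OF C(1) uv(3,4)] fs.subspace_add[OF C(2) uv(5,6)] unfolding boundaries_def by blast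
  next
    fix c x assume "x \<in> boundaries C d"
    then obtain u z where u: "x = bdry C d u + z" "u \<in> chains C (Suc d)" "z \<in> zeros C d" unfolding boundaries_def by blast
    have "fscale c x = bdry C d (fscale c u) + fscale c z" using u(1) lin_scale[OF C(4)] fs.scale_right_distrib by simp
    then show "fscale c x \<in> boundaries C d"
      using fs.subspace_scale[OF C(1) u(2)] fs.subspace_scale[OF C(2) u(3)] unfolding boundaries_def by blast
  qed
qed

lemma subspace_cycles:
  assumes "linear_complex C"
  shows "fs.subspace (cycles C d)"
proof -
  note C = linear_complexD[OF assms]
  show ?thesis
  proof (cases d)
    case (Suc e)
    show ?thesis unfolding Suc cycles.simps
    proof (rule fs.subspaceI)
      show "0 \<in> {x \<in> chains C (Suc e). bdry C e x \<in> zeros C e}"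
        using fs.subspace_0[OF C(1)[of "Suc e"]] fs.subspace_0[OF C(2)[of e]] lin_zero[OF C(4)[of e]] by simp
    qed (auto simp: lin_add[OF C(4)] lin_scale[OF C(4)] intro: fs.subspace_add[OF C(1)] fs.subspace_add[OF C(2)]
        fs.subspace_scale[OF C(1)] fs.subspace_scale[OF C(2)])
  qed (use C(1) in simp)
qed

lemma cycles_subset: "cycles C d \<subseteq> chains C d"
  by (cases d) auto

lemma linear_map_cycles:
  assumes "linear_map C D f" "x \<in> cycles C d"
  shows "f d x \<in> cycles D d"
proof (cases d)
  case 0
  then show ?thesis using assms linear_mapD(4)[OF assms(1)] by simp
next
  case (Suc e)
  note f = linear_mapD[OF assms(1)]
  have x: "x \<in> chains C (Suc e)" "bdry C e x \<in> zeros C e" using assms(2) Suc by simp_all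
  have "f e (bdry C e x) - (f e (bdry C e x) - bdry D e (f (Suc e) x)) \<in> zeros D e"
    by (intro fs.subspace_diff[OF linear_complexD(2)[OF f(2)]] f(5,6) x)
  then show ?thesis using Suc f(4)[OF x(1)] by simp
qed

lemma linear_map_boundaries:
  assumes "linear_map C D f" "x \<in> boundaries C d"
  shows "f d x \<in> boundaries D d"
proof -
  note f = linear_mapD[OF assms(1)]
  obtain y z where y: "x = bdry C d y + z" "y \<in> chains C (Suc d)" "z \<in> zeros C d"
    using assms(2) unfolding boundaries_def by blast
  have "f d x = bdry D d (f (Suc d) y) + (f d (bdry C d y) - bdry D d (f (Suc d) y) + f d z)"
    using y(1) lin_add[OF f(3)] by simp
  moreover have "f d (bdry C d y) - bdry D d (f (Suc d) y) + f d z \<in> zeros D d"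
    by (intro fs.subspace_add[OF linear_complexD(2)[OF f(2)]] f(5,6) y)
  ultimately show ?thesis using f(4)[OF y(2)] unfolding boundaries_def by blast
qed

lemma coset_eq:
  assumes "fs.subspace B"
  shows "coset B x = coset B y \<longleftrightarrow> x - y \<in> B"
proof
  assume "coset B x = coset B y"
  moreover have "x \<in> coset B x" unfolding coset_def using fs.subspace_0[OF assms] by (metis add.right_neutral imageI)
  ultimately obtain b where "b \<in> B" "x = y + b" unfolding coset_def by auto
  then show "x - y \<in> B" by simp
next
  have sub: "coset B x \<subseteq> coset B y" if "x - y \<in> B" for x y
  proof
    fix u assume "u \<in> coset B x"
    then obtain b where b: "b \<in> B" "u = x + b" unfolding coset_def by auto
    then have "u = y + (x - y + b)" by simp
    then show "u \<in> coset B y" unfolding coset_def using fs.subspace_add[OF assms that b(1)] by blast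
  qed
  assume xy: "x - y \<in> B"
  then have "y - x \<in> B" using fs.subspace_neg[OF assms xy] by simp
  then show "coset B x = coset B y" using sub xy by blast
qed

text \<open>The union in \<open>homology_map\<close> runs over cosets that all coincide.\<close>

lemma homology_map_coset:
  assumes "linear_map C D f" "x \<in> cycles C d"
  shows "homology_map D d (f d) (coset (boundaries C d) x) = coset (boundaries D d) (f d x)"
proof -
  note f = linear_mapD[OF assms(1)]
  have "coset (boundaries D d) (f d (x + b)) = coset (boundaries D d) (f d x)" if "b \<in> boundaries C d" for b
    using linear_map_boundaries[OF assms(1) that] lin_add[OF f(3)] by (subst coset_eq[OF subspace_boundaries[OF f(2)]]) simp
  moreover have "0 \<in> boundaries C d" by (rule fs.subspace_0[OF subspace_boundaries[OF f(1)]])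
  ultimately show ?thesis unfolding homology_map_def coset_def[of "boundaries C d"] by auto
qed

lemma quasi_isoI:
  assumes f: "linear_map C D f" and iso: "homology_iso C D f"
  shows "quasi_iso C D f"
proof -
  note fD = linear_mapD[OF f]
  have "bij_betw (homology_map D d (f d)) (homology C d) (homology D d)" for d
  proof (rule bij_betw_imageI)
    show "inj_on (homology_map D d (f d)) (homology C d)"
    proof (rule inj_onI)
      fix X Y assume XY: "X \<in> homology C d" "Y \<in> homology C d" "homology_map D d (f d) X = homology_map D d (f d) Y"
      obtain x y where x: "x \<in> cycles C d" "X = coset (boundaries C d) x" and y: "y \<in> cycles C d" "Y = coset (boundaries C d) y"
        using XY(1,2) unfolding homology_def by blast
      have "f d x - f d y \<in> boundaries D d"
        using XY(3) unfolding x(2) y(2) homology_map_coset[OF f x(1)] homology_map_coset[OF f y(1)]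
          coset_eq[OF subspace_boundaries[OF fD(2)]] .
      then have "f d (x - y) \<in> boundaries D d" using lin_diff[OF fD(3)] by simp
      moreover have "x - y \<in> cycles C d" by (rule fs.subspace_diff[OF subspace_cycles[OF fD(1)] x(1) y(1)])
      ultimately have "x - y \<in> boundaries C d" using iso unfolding homology_iso_def by blast
      then show "X = Y" unfolding x(2) y(2) coset_eq[OF subspace_boundaries[OF fD(1)]] .
    qed
    show "homology_map D d (f d) ` homology C d = homology D d"
    proof (intro subset_antisym subsetI)
      fix Y assume "Y \<in> homology_map D d (f d) ` homology C d"
      then show "Y \<in> homology D d"
        unfolding homology_def using homology_map_coset[OF f] linear_map_cycles[OF f] by auto
    next
      fix Y assume "Y \<in> homology D d"
      then obtain y where y: "y \<in> cycles D d" "Y = coset (boundaries D d) y" unfolding homology_def by blast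
      obtain x where x: "x \<in> cycles C d" "y - f d x \<in> boundaries D d" using iso y(1) unfolding homology_iso_def by blast
      have "Y = homology_map D d (f d) (coset (boundaries C d) x)"
        unfolding y(2) homology_map_coset[OF f x(1)] coset_eq[OF subspace_boundaries[OF fD(2)]] by (rule x(2))
      then show "Y \<in> homology_map D d (f d) ` homology C d" unfolding homology_def using x(1) by blast
    qed
  qed
  then show ?thesis using f unfolding quasi_iso_def linear_map_def linear_complex_def by blast
qed

lemma linear_map_comp:
  assumes f: "linear_map C D f" and g: "linear_map D E g"
  shows "linear_map C E (\<lambda>d x. g d (f d x))"
proof -
  note fD = linear_mapD[OF f] and gD = linear_mapD[OF g]
  have l: "lin (\<lambda>x. g d (f d x))" for d by (rule lin_comp[OF gD(3) fD(3)])
  have "g d (f d (bdry C d x)) - bdry E d (g (Suc d) (f (Suc d) x)) \<in> zeros E d" if x: "x \<in> chains C (Suc d)" for d x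
  proof -
    have "g d (f d (bdry C d x) - bdry D d (f (Suc d) x)) + (g d (bdry D d (f (Suc d) x)) - bdry E d (g (Suc d) (f (Suc d) x))) \<in> zeros E d"
      by (intro fs.subspace_add[OF linear_complexD(2)[OF gD(2)]] gD(5,6) fD(4,6) x)
    then show ?thesis using lin_diff[OF gD(3)] by simp
  qed
  then have "chain_map C E (\<lambda>d x. g d (f d x))"
    unfolding chain_map_def using fD(4,5) gD(4,5) by (simp add: lin_linear_on[OF l] image_subset_iff)
  then show ?thesis unfolding linear_map_def using fD(1) gD(2) l by blast
qed

lemma homology_iso_comp:
  assumes f: "linear_map C D f" "homology_iso C D f" and g: "linear_map D E g" "homology_iso D E g"
  shows "homology_iso C E (\<lambda>d x. g d (f d x))"
  unfolding homology_iso_def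
proof (intro allI conjI ballI impI)
  note gD = linear_mapD[OF g(1)]
  fix d x assume "x \<in> cycles C d" "g d (f d x) \<in> boundaries E d"
  then show "x \<in> boundaries C d" using f(2) g(2) linear_map_cycles[OF f(1)] unfolding homology_iso_def by blast
next
  note gD = linear_mapD[OF g(1)]
  fix d e assume "e \<in> cycles E d"
  then obtain y where y: "y \<in> cycles D d" "e - g d y \<in> boundaries E d" using g(2) unfolding homology_iso_def by blast
  then obtain x where x: "x \<in> cycles C d" "y - f d x \<in> boundaries D d" using f(2) unfolding homology_iso_def by blast
  have "(e - g d y) + g d (y - f d x) \<in> boundaries E d"
    by (intro fs.subspace_add[OF subspace_boundaries[OF gD(2)]] y(2) linear_map_boundaries[OF g(1)] x(2))
  then have "e - g d (f d x) \<in> boundaries E d" using lin_diff[OF gD(3)] by simp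
  then show "\<exists>x\<in>cycles C d. e - g d (f d x) \<in> boundaries E d" using x(1) by blast
qed


section \<open>Complexes presented by based complexes\<close>

text \<open>Besides a presentation in each degree, the differential has to correspond to
  \<open>bd\<close>. The condition in degree 0 is there because \<open>cycles C 0\<close> contains
  all chains, whereas \<open>bd\<close> is one operator for all degrees.\<close>

definition presented ::
  "('b, 'k::comm_ring_1) fcomplex \<Rightarrow> (nat \<Rightarrow> ('b \<Rightarrow>\<^sub>0 'k) \<Rightarrow> ('w set set \<Rightarrow>\<^sub>0 'k)) \<Rightarrow> (nat \<Rightarrow> 'w set set set) \<Rightarrow> 'w set set \<Rightarrow> bool" where
  "presented C \<Phi> S \<Omega> \<longleftrightarrow> (\<forall>d. presents C d (\<Phi> d) (S d) \<and> lin (bdry C d) \<and>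
     (\<forall>x\<in>chains C (Suc d). bdry C d x \<in> chains C d \<and> \<Phi> d (bdry C d x) = bd \<Omega> (\<Phi> (Suc d) x))) \<and>
     (\<forall>x\<in>free_on (S 0). bd \<Omega> x = (0 :: 'w set set \<Rightarrow>\<^sub>0 'k))"

context
  fixes C :: "('b, 'k::comm_ring_1) fcomplex" and \<Phi> :: "nat \<Rightarrow> ('b \<Rightarrow>\<^sub>0 'k) \<Rightarrow> ('w set set \<Rightarrow>\<^sub>0 'k)" and S \<Omega>
  assumes presented: "presented C \<Phi> S \<Omega>"
begin

lemma presentedD:
  shows "fs.subspace (chains C d)" "fs.subspace (zeros C d)" "zeros C d \<subseteq> chains C d" "lin (\<Phi> d)" "lin (bdry C d)"
    "x \<in> chains C d \<Longrightarrow> \<Phi> d x \<in> free_on (S d)" "x \<in> chains C d \<Longrightarrow> \<Phi> d x = 0 \<longleftrightarrow> x \<in> zeros C d"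
    "x \<in> chains C (Suc d) \<Longrightarrow> bdry C d x \<in> chains C d"
    "x \<in> chains C (Suc d) \<Longrightarrow> \<Phi> d (bdry C d x) = bd \<Omega> (\<Phi> (Suc d) x)"
    "b \<in> S d \<Longrightarrow> \<exists>x\<in>chains C d. \<Phi> d x = gen b"
    "y \<in> free_on (S 0) \<Longrightarrow> bd \<Omega> y = (0 :: 'w set set \<Rightarrow>\<^sub>0 'k)"
  using presented unfolding presented_def presents_def by blast+

lemma presented_section:
  "\<exists>s. \<forall>b\<in>S d. s b \<in> chains C d \<and> \<Phi> d (s b) = gen b"
proof (rule bchoice, rule ballI)
  show "\<exists>x. x \<in> chains C d \<and> \<Phi> d x = gen b" if "b \<in> S d" for b using presentedD(10)[OF that] by blast
qed

lemma presented_lift_section: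
  assumes s: "\<forall>b\<in>S d. s b \<in> chains C d \<and> \<Phi> d (s b) = gen b" and y: "y \<in> free_on (S d)"
  shows "lin_ext s y \<in> chains C d" "\<Phi> d (lin_ext s y) = y"
proof -
  show "lin_ext s y \<in> chains C d" by (rule lin_ext_mem[OF y presentedD(1)]) (use s in blast)
  show "\<Phi> d (lin_ext s y) = y"
    by (rule lin_eq_on_free[where f="\<lambda>y. \<Phi> d (lin_ext s y)", OF lin_comp[OF presentedD(4) lin_lin_ext] lin_id y])
      (use s in simp)
qed

lemma presented_lift: "y \<in> free_on (S d) \<Longrightarrow> \<exists>x\<in>chains C d. \<Phi> d x = y"
  using presented_section presented_lift_section by metis

lemma presented_linear_complex: "linear_complex C"
proof -
  have "bdry C d x \<in> zeros C d" if x: "x \<in> zeros C (Suc d)" for d x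
  proof -
    have c: "x \<in> chains C (Suc d)" using x presentedD(3) by blast
    then have "\<Phi> d (bdry C d x) = 0" using presentedD(7,9) x lin_zero[OF lin_bd] by metis
    then show ?thesis using presentedD(7)[OF presentedD(8)[OF c]] by blast
  qed
  moreover have "bdry C d (bdry C (Suc d) x) \<in> zeros C d" if x: "x \<in> chains C (Suc (Suc d))" for d x
  proof -
    have c: "bdry C (Suc d) x \<in> chains C (Suc d)" by (rule presentedD(8)[OF x])
    have "\<Phi> d (bdry C d (bdry C (Suc d) x)) = 0" using presentedD(9)[OF c] presentedD(9)[OF x] by simp
    then show ?thesis using presentedD(7)[OF presentedD(8)[OF c]] by blast
  qed
  ultimately show ?thesis unfolding linear_complex_def chain_complex_def
    using presentedD(1-3,5,8) lin_linear_on[OF presentedD(5)] by blast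
qed

lemma presented_cycles: "x \<in> cycles C d \<longleftrightarrow> x \<in> chains C d \<and> bd \<Omega> (\<Phi> d x) = 0"
proof (cases d)
  case 0
  then show ?thesis using presentedD(6,11) by auto
next
  case (Suc e)
  then show ?thesis using presentedD(7)[OF presentedD(8)] presentedD(9) by auto
qed

lemma presented_boundaries:
  assumes "x \<in> chains C d"
  shows "x \<in> boundaries C d \<longleftrightarrow> (\<exists>y\<in>free_on (S (Suc d)). \<Phi> d x = bd \<Omega> y)"
proof
  assume "x \<in> boundaries C d"
  then obtain u z where u: "x = bdry C d u + z" "u \<in> chains C (Suc d)" "z \<in> zeros C d" unfolding boundaries_def by blast
  have "\<Phi> d z = 0" using presentedD(7)[of z d] presentedD(3) u(3) by blast
  then have "\<Phi> d x = bd \<Omega> (\<Phi> (Suc d) u)" using u(1) presentedD(9)[OF u(2)] lin_add[OF presentedD(4)] by simp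
  then show "\<exists>y\<in>free_on (S (Suc d)). \<Phi> d x = bd \<Omega> y" using presentedD(6)[OF u(2)] by blast
next
  assume "\<exists>y\<in>free_on (S (Suc d)). \<Phi> d x = bd \<Omega> y"
  then obtain u where u: "u \<in> chains C (Suc d)" "\<Phi> d x = bd \<Omega> (\<Phi> (Suc d) u)" using presented_lift by metis
  have "x - bdry C d u \<in> chains C d" by (intro fs.subspace_diff[OF presentedD(1)] assms presentedD(8) u(1))
  moreover have "\<Phi> d (x - bdry C d u) = 0" using u presentedD(9) lin_diff[OF presentedD(4)] by simp
  ultimately have "x - bdry C d u \<in> zeros C d" using presentedD(7) by blast
  moreover have "x = bdry C d u + (x - bdry C d u)" by simp
  ultimately show "x \<in> boundaries C d" using u(1) unfolding boundaries_def by blast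
qed

end

text \<open>\<open>inj\<close> and \<open>surj\<close> are the two consequences of an acyclic cone
  in a fixed degree; they are transported by lifting elements of the free modules to chains.\<close>

lemma presented_homology_iso:
  fixes \<Phi> :: "nat \<Rightarrow> ('b \<Rightarrow>\<^sub>0 'k::comm_ring_1) \<Rightarrow> ('v set set \<Rightarrow>\<^sub>0 'k)" and \<Psi> :: "nat \<Rightarrow> ('c \<Rightarrow>\<^sub>0 'k) \<Rightarrow> ('w set set \<Rightarrow>\<^sub>0 'k)"
  assumes C: "presented C \<Phi> S \<Omega>" and D: "presented D \<Psi> S' \<Omega>'"
    and f: "\<And>d. lin (f d)" "\<And>d x. x \<in> chains C d \<Longrightarrow> f d x \<in> chains D d"
      "\<And>d x. x \<in> chains C d \<Longrightarrow> \<Psi> d (f d x) = \<sigma> (\<Phi> d x)"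
    and \<sigma>: "lin \<sigma>" "\<And>d x. x \<in> free_on (S d) \<Longrightarrow> bd \<Omega>' (\<sigma> x) = \<sigma> (bd \<Omega> x)"
    and inj: "\<And>d x y. x \<in> free_on (S d) \<Longrightarrow> bd \<Omega> x = 0 \<Longrightarrow> y \<in> free_on (S' (Suc d)) \<Longrightarrow> \<sigma> x = bd \<Omega>' y \<Longrightarrow>
      \<exists>x'\<in>free_on (S (Suc d)). x = bd \<Omega> x'"
    and surj: "\<And>d y. y \<in> free_on (S' d) \<Longrightarrow> bd \<Omega>' y = 0 \<Longrightarrow>
      \<exists>x\<in>free_on (S d). bd \<Omega> x = 0 \<and> (\<exists>y'\<in>free_on (S' (Suc d)). y = \<sigma> x + bd \<Omega>' y')"
  shows "linear_map C D f \<and> homology_iso C D f"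
proof
  note CD = presentedD[OF C] and DD = presentedD[OF D]
  have "f d x \<in> zeros D d" if x: "x \<in> zeros C d" for d x
  proof -
    have c: "x \<in> chains C d" using x CD(3) by blast
    then have "\<Psi> d (f d x) = 0" using f(3)[OF c] CD(7)[OF c] x lin_zero[OF \<sigma>(1)] by simp
    then show ?thesis using DD(7)[OF f(2)[OF c]] by blast
  qed
  moreover have "f d (bdry C d x) - bdry D d (f (Suc d) x) \<in> zeros D d" if x: "x \<in> chains C (Suc d)" for d x
  proof -
    have "\<Psi> d (f d (bdry C d x) - bdry D d (f (Suc d) x)) = 0"
      using f(3)[OF CD(8)[OF x]] DD(9)[OF f(2)[OF x]] f(3)[OF x] CD(9)[OF x] \<sigma>(2)[OF CD(6)[OF x]] lin_diff[OF DD(4)] by simp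
    moreover have "f d (bdry C d x) - bdry D d (f (Suc d) x) \<in> chains D d"
      by (intro fs.subspace_diff[OF DD(1)] f(2) CD(8) DD(8) x)
    ultimately show ?thesis using DD(7) by blast
  qed
  ultimately have "chain_map C D f"
    unfolding chain_map_def using f(2) by (simp add: lin_linear_on[OF f(1)] image_subset_iff)
  then show "linear_map C D f"
    unfolding linear_map_def using presented_linear_complex[OF C] presented_linear_complex[OF D] f(1) by blast
  show "homology_iso C D f"
    unfolding homology_iso_def
  proof (intro allI conjI ballI impI)
    fix d x assume x: "x \<in> cycles C d" "f d x \<in> boundaries D d"
    have c: "x \<in> chains C d" "bd \<Omega> (\<Phi> d x) = 0" using x(1) unfolding presented_cycles[OF C] by blast+
    obtain y where y: "y \<in> free_on (S' (Suc d))" "\<Psi> d (f d x) = bd \<Omega>' y"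
      using x(2) unfolding presented_boundaries[OF D f(2)[OF c(1)]] by blast
    have "\<exists>x'\<in>free_on (S (Suc d)). \<Phi> d x = bd \<Omega> x'"
      by (rule inj[OF CD(6)[OF c(1)] c(2) y(1)]) (use y(2) f(3)[OF c(1)] in simp)
    then show "x \<in> boundaries C d" unfolding presented_boundaries[OF C c(1)] .
  next
    fix d y assume "y \<in> cycles D d"
    then have y: "y \<in> chains D d" "bd \<Omega>' (\<Psi> d y) = 0" unfolding presented_cycles[OF D] by blast+
    obtain x y' where x: "x \<in> free_on (S d)" "bd \<Omega> x = 0" "y' \<in> free_on (S' (Suc d))" "\<Psi> d y = \<sigma> x + bd \<Omega>' y'"
      using surj[OF DD(6)[OF y(1)] y(2)] by blast
    obtain u where u: "u \<in> chains C d" "\<Phi> d u = x" using presented_lift[OF C x(1)] by blast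
    have "u \<in> cycles C d" unfolding presented_cycles[OF C] using u x(2) by blast
    moreover have "y - f d u \<in> boundaries D d"
    proof (subst presented_boundaries[OF D])
      show "y - f d u \<in> chains D d" by (intro fs.subspace_diff[OF DD(1)] y(1) f(2) u(1))
      show "\<exists>y'\<in>free_on (S' (Suc d)). \<Psi> d (y - f d u) = bd \<Omega>' y'"
        using x(3,4) f(3)[OF u(1)] u(2) lin_diff[OF DD(4)] by (intro bexI[of _ y']) simp_all
    qed
    ultimately show "\<exists>x\<in>cycles C d. y - f d x \<in> boundaries D d" by blast
  qed
qed


section \<open>Comparison of the bar constructions\<close>

lemma bar_presented:
  "presented (bar_complex (commutative_operad :: ('k, 'k::comm_ring_1) operad) n) (\<lambda>d. lin_ext (bar_class d))
    (bar_basis n) (- {{1..n}})"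
  unfolding presented_def
proof (intro conjI allI ballI presents_bar)
  let ?P = "commutative_operad :: ('k, 'k) operad"
  fix d
  show "lin (bdry (bar_complex ?P n) d)" unfolding bar_complex_def by (simp add: lin_lin_ext)
  fix x assume "x \<in> chains (bar_complex ?P n) (Suc d)"
  then have x: "x \<in> free_on (bar_trees ?P n (Suc d))" by (simp add: bar_complex_def span_gen)
  show "bdry (bar_complex ?P n) d x \<in> chains (bar_complex ?P n) d"
    unfolding bar_complex_def quotient_complex.simps by (rule lin_ext_mem[OF x fs.subspace_span bar_diff_commutative(1)])
  show "lin_ext (bar_class d) (bdry (bar_complex ?P n) d x) = bd (- {{1..n}}) (lin_ext (bar_class (Suc d)) x)"
    unfolding bar_complex_def quotient_complex.simps
    by (rule lin_eq_on_free[OF lin_comp[OF lin_lin_ext lin_lin_ext] lin_comp[OF lin_bd lin_lin_ext] x])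
      (simp add: bar_diff_commutative(2))
next
  fix x :: "nat set set \<Rightarrow>\<^sub>0 'k" assume x: "x \<in> free_on (bar_basis n 0)"
  show "bd (- {{1..n}}) x = 0"
  proof (rule lin_eq_on_free[OF lin_bd lin_0 x])
    fix F assume "F \<in> bar_basis n 0"
    then have "F = {}" using nested_finite[of "{1..n}" F] by (auto simp: bar_basis_def)
    then show "bd (- {{1..n}}) (gen F) = (0 :: nat set set \<Rightarrow>\<^sub>0 'k)" by (simp add: bd_gen)
  qed
qed

lemma norm_presented:
  "presented (normalized_bar_complex (commutative_operad :: ('k, 'k::comm_ring_1) operad) n) (\<lambda>d. lin_ext (norm_class d))
    (norm_basis n) (- {singles {1..n}, {{1..n}}})"
  unfolding presented_def
proof (intro conjI allI ballI presents_norm)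
  let ?P = "commutative_operad :: ('k, 'k) operad"
  fix d
  show "lin (bdry (normalized_bar_complex ?P n) d)" unfolding normalized_bar_complex_def by (simp add: lin_lin_ext)
  fix x assume "x \<in> chains (normalized_bar_complex ?P n) (Suc d)"
  then have x: "x \<in> free_on (level_trees ?P n (Suc d))" by (simp add: normalized_bar_complex_def span_gen)
  show "bdry (normalized_bar_complex ?P n) d x \<in> chains (normalized_bar_complex ?P n) d"
    unfolding normalized_bar_complex_def quotient_complex.simps
    by (rule lin_ext_mem[OF x fs.subspace_span norm_bdry_commutative(1)])
  show "lin_ext (norm_class d) (bdry (normalized_bar_complex ?P n) d x) =
      bd (- {singles {1..n}, {{1..n}}}) (lin_ext (norm_class (Suc d)) x)"
    unfolding normalized_bar_complex_def quotient_complex.simps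
    by (rule lin_eq_on_free[OF lin_comp[OF lin_lin_ext lin_lin_ext] lin_comp[OF lin_bd lin_lin_ext] x])
      (simp only: lin_ext_gen norm_bdry_commutative(2))
next
  fix x :: "nat set set set \<Rightarrow>\<^sub>0 'k" assume x: "x \<in> free_on (norm_basis n 0)"
  show "bd (- {singles {1..n}, {{1..n}}}) x = 0"
  proof (rule lin_eq_on_free[OF lin_bd lin_0 x])
    fix G assume G: "G \<in> norm_basis n 0"
    then obtain \<pi> where "G = {\<pi>}" unfolding norm_basis_def by (auto simp: card_1_singleton_iff)
    moreover have "singles {1..n} \<in> G" using G part_chainsD(2) unfolding norm_basis_def by blast
    ultimately show "bd (- {singles {1..n}, {{1..n}}}) (gen G) = (0 :: nat set set set \<Rightarrow>\<^sub>0 'k)" by (simp add: bd_gen)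
  qed
qed

text \<open>The boundary lowers the cardinality by one, so it respects homogeneous components. This
  recovers degrees from the ungraded exactness statements.\<close>

lemma bd_restrict_card:
  fixes x :: "'w set set \<Rightarrow>\<^sub>0 'k::comm_ring_1"
  assumes "x \<in> free_on {F. finite F}"
  shows "bd \<Omega> (restrict {F. card F = Suc d} x) = restrict {F. card F = d} (bd \<Omega> x)"
proof (rule lin_eq_on_free[OF lin_comp[OF lin_bd lin_restrict] lin_comp[OF lin_restrict lin_bd] assms])
  fix F :: "'w set set" assume "F \<in> {F. finite F}"
  then have F: "finite F" by simp
  have "restrict {F. card F = d} (del D (gen F)) = (if card F = Suc d then del D (gen F) else 0 :: _ \<Rightarrow>\<^sub>0 'k)"
    if D: "D \<in> F" for D
    using F D card_gt_0_iff[of F] by (auto simp: del_gen lin_scale[OF lin_restrict] restrict_gen)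
  then show "bd \<Omega> (restrict {F. card F = Suc d} (gen F)) = restrict {F. card F = d} (bd \<Omega> (gen F) :: _ \<Rightarrow>\<^sub>0 'k)"
    by (simp add: restrict_gen lin_zero[OF lin_bd] bd_gen lin_sum[OF lin_restrict])
qed

lemma subdivide_restrict_card:
  fixes x :: "'a set set \<Rightarrow>\<^sub>0 'k::comm_ring_1"
  assumes "finite A" "partition_on A \<rho>" "x \<in> free_on (nested A \<rho>)"
  shows "restrict {G. card G = Suc d} (subdivide \<rho> x) = subdivide \<rho> (restrict {F. card F = d} x)"
proof (rule lin_eq_on_free[OF lin_comp[OF lin_restrict lin_subdivide] lin_comp[OF lin_subdivide lin_restrict] assms(3)])
  fix F assume F: "F \<in> nested A \<rho>"
  have "restrict {G. card G = Suc d} (gen (flag \<rho> xs)) = (if card F = d then gen (flag \<rho> xs) else 0 :: _ \<Rightarrow>\<^sub>0 'k)"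
    if xs: "xs \<in> orders F" for xs
  proof -
    have "card F = length xs" using xs distinct_card[of xs] by (simp add: orders_def)
    then show ?thesis using flag_mem[OF assms(1,2) F xs] by (simp add: restrict_gen)
  qed
  then have "(\<Sum>xs\<in>orders F. fscale (order_sign xs) (restrict {G. card G = Suc d} (gen (flag \<rho> xs)))) =
      (\<Sum>xs\<in>orders F. fscale (order_sign xs) (if card F = d then gen (flag \<rho> xs) else 0 :: _ \<Rightarrow>\<^sub>0 'k))"
    by (intro sum.cong refl) (simp only:)
  then show "restrict {G. card G = Suc d} (subdivide \<rho> (gen F)) = subdivide \<rho> (restrict {F. card F = d} (gen F) :: _ \<Rightarrow>\<^sub>0 'k)"
    by (simp add: subdivide_def lin_sum[OF lin_restrict] lin_scale[OF lin_restrict] restrict_gen[of _ F] lin_zero[OF lin_lin_ext])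
qed

lemma restrict_bar_basis: "x \<in> free_on (nested {1..n} (singles {1..n})) \<Longrightarrow> restrict {F. card F = d} x \<in> free_on (bar_basis n d)"
  using restrict_free_on[of x "nested {1..n} (singles {1..n})" "{F. card F = d}"]
  by (rule free_on_mono) (auto simp: bar_basis_def)

lemma restrict_norm_basis:
  "x \<in> free_on (part_chains {1..n} (singles {1..n})) \<Longrightarrow> restrict {G. card G = Suc d} x \<in> free_on (norm_basis n d)"
  using restrict_free_on[of x "part_chains {1..n} (singles {1..n})" "{G. card G = Suc d}"]
  by (rule free_on_mono) (auto simp: norm_basis_def)

lemma bar_basis_nested: "x \<in> free_on (bar_basis n d) \<Longrightarrow> x \<in> free_on (nested {1..n} (singles {1..n}))"
  by (erule free_on_mono) (auto simp: bar_basis_def)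

lemma norm_basis_part_chains: "x \<in> free_on (norm_basis n d) \<Longrightarrow> x \<in> free_on (part_chains {1..n} (singles {1..n}))"
  by (erule free_on_mono) (auto simp: norm_basis_def)

lemma bd_bar_basis:
  assumes "x \<in> free_on (bar_basis n (Suc d))"
  shows "bd (- {{1..n}}) x \<in> free_on (bar_basis n d)"
proof (rule bd_mem[OF assms])
  fix F D assume F: "F \<in> bar_basis n (Suc d)" "D \<in> F" "D \<in> - {{1..n}}"
  have "F - {D} \<in> nested {1..n} (singles {1..n})" using F by (auto simp: bar_basis_def intro: nested_delete)
  then show "F - {D} \<in> bar_basis n d" using F by (simp add: bar_basis_def)
qed

lemma levelization_iso:
  defines "P \<equiv> commutative_operad :: ('k, 'k::comm_ring_1) operad"
  shows "linear_map (bar_complex P n) (normalized_bar_complex P n) (levelization P) \<and>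
    homology_iso (bar_complex P n) (normalized_bar_complex P n) (levelization P)"
proof (rule presented_homology_iso[OF bar_presented[where 'k='k, folded P_def] norm_presented[where 'k='k, folded P_def]])
  let ?A = "{1..n}"
  let ?\<rho> = "singles ?A"
  note part = partition_on_singles[of ?A]
  show "lin (levelization P d)" for d unfolding levelization_def by (rule lin_lin_ext)
  show "levelization P d x \<in> chains (normalized_bar_complex P n) d"
    "lin_ext (norm_class d) (levelization P d x) = subdivide ?\<rho> (lin_ext (bar_class d) x)"
    if "x \<in> chains (bar_complex P n) d" for d x
  proof -
    have x: "x \<in> free_on (bar_trees P n d)" using that by (simp add: bar_complex_def span_gen)
    have l: "lin (levelization P d)" unfolding levelization_def by (rule lin_lin_ext)
    show "levelization P d x \<in> chains (normalized_bar_complex P n) d"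
      unfolding normalized_bar_complex_def quotient_complex.simps
      by (rule lin_free_on_mem[OF l x fs.subspace_span]) (unfold P_def, rule levelization_gen(1))
    show "lin_ext (norm_class d) (levelization P d x) = subdivide ?\<rho> (lin_ext (bar_class d) x)"
      by (rule lin_eq_on_free[OF lin_comp[OF lin_lin_ext l] lin_comp[OF lin_subdivide lin_lin_ext] x])
        (simp add: P_def levelization_gen(2))
  qed
  show "lin (subdivide ?\<rho>)" by (rule lin_subdivide)
  show "bd (- {?\<rho>, {?A}}) (subdivide ?\<rho> x) = subdivide ?\<rho> (bd (- {?A}) x)"
    if "x \<in> free_on (bar_basis n d)" for d and x :: "_ \<Rightarrow>\<^sub>0 'k"
    by (rule subdivide_bd[OF _ part bar_basis_nested[OF that]]) simp
  show "\<exists>x'\<in>free_on (bar_basis n (Suc d)). x = bd (- {?A}) x'"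
    if x: "x \<in> free_on (bar_basis n d)" "bd (- {?A}) x = 0"
      and y: "y \<in> free_on (norm_basis n (Suc d))" "subdivide ?\<rho> x = bd (- {?\<rho>, {?A}}) y"
    for d and x :: "_ \<Rightarrow>\<^sub>0 'k" and y
  proof -
    obtain x' where x': "x' \<in> free_on (nested ?A ?\<rho>)" "x = bd (- {?A}) x'"
      using subdivide_cone_acyclic[OF _ part bar_basis_nested[OF x(1)] norm_basis_part_chains[OF y(1)] x(2) y(2)] by auto
    have "x = restrict {F. card F = d} x" using x(1) by (intro restrict_id[symmetric]) (auto simp: bar_basis_def elim: free_on_mono)
    also have "\<dots> = bd (- {?A}) (restrict {F. card F = Suc d} x')"
      unfolding x'(2) using bd_restrict_card[OF nested_free_finite[OF _ x'(1)]] by simp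
    finally show ?thesis using restrict_bar_basis[OF x'(1)] by blast
  qed
  show "\<exists>x\<in>free_on (bar_basis n d). bd (- {?A}) x = 0 \<and>
      (\<exists>y'\<in>free_on (norm_basis n (Suc d)). y = subdivide ?\<rho> x + bd (- {?\<rho>, {?A}}) y')"
    if y: "y \<in> free_on (norm_basis n d)" "bd (- {?\<rho>, {?A}}) y = 0" for d and y :: "_ \<Rightarrow>\<^sub>0 'k"
  proof -
    \<comment> \<open>The acyclicity of the cone is applied with first component 0.\<close>
    obtain x' y' where x': "x' \<in> free_on (nested ?A ?\<rho>)" "bd (- {?A}) x' = 0"
      and y': "y' \<in> free_on (part_chains ?A ?\<rho>)" "y = subdivide ?\<rho> x' + bd (- {?\<rho>, {?A}}) y'"
      using subdivide_cone_acyclic[OF _ part zero_free_on norm_basis_part_chains[OF y(1)]] y(2)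
      by (auto simp: lin_zero[OF lin_bd] lin_zero[OF lin_subdivide])
    have "y = restrict {G. card G = Suc d} y" using y(1) by (intro restrict_id[symmetric]) (auto simp: norm_basis_def elim: free_on_mono)
    also have "\<dots> = subdivide ?\<rho> (restrict {F. card F = d} x') + bd (- {?\<rho>, {?A}}) (restrict {G. card G = Suc (Suc d)} y')"
      unfolding y'(2) lin_add[OF lin_restrict]
      using subdivide_restrict_card[OF _ part x'(1)] bd_restrict_card[OF part_chains_free_finite[OF _ y'(1)]] by simp
    finally have "y = subdivide ?\<rho> (restrict {F. card F = d} x') + bd (- {?\<rho>, {?A}}) (restrict {G. card G = Suc (Suc d)} y')" .
    \<comment> \<open>In degree 0 there is no lower component to compare with; there every element
      is a cycle.\<close>
    moreover have "bd (- {?A}) (restrict {F. card F = d} x') = 0"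
    proof (cases d)
      case 0
      then show ?thesis using presentedD(11)[OF bar_presented] restrict_bar_basis[OF x'(1), of 0] by blast
    next
      case (Suc e)
      then show ?thesis using bd_restrict_card[OF nested_free_finite[OF _ x'(1)], of "- {?A}" e] x'(2) by (simp add: lin_zero[OF lin_restrict])
    qed
    ultimately show ?thesis using restrict_bar_basis[OF x'(1)] restrict_norm_basis[OF y'(1)] by blast
  qed
qed


section \<open>The Koszul construction\<close>

lemma leaves_weight: "arity_ge 1 T \<Longrightarrow> length (leaves T) = Suc (tree_weight T)"
proof (induction T)
  case (Node a p ts)
  have "(\<And>t. t \<in> set us \<Longrightarrow> length (leaves t) = Suc (tree_weight t)) \<Longrightarrow>
      length (concat (map leaves us)) = length us + sum_list (map tree_weight us)" for us
    by (induction us) auto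
  from this[of ts] have "length (concat (map leaves ts)) = length ts + sum_list (map tree_weight ts)" using Node by simp
  then show ?case using Node.prems by (auto simp: canonical_weight_def)
qed simp

text \<open>A vertex with at least two inputs adds at least one leaf, starting from the single leaf
  of the trivial tree.\<close>

lemma leaves_vertices: "arity_ge 2 T \<Longrightarrow> length (vertices T) < length (leaves T)"
proof (induction T)
  case (Node a p ts)
  have "(\<And>t. t \<in> set us \<Longrightarrow> length (vertices t) < length (leaves t)) \<Longrightarrow>
      length (concat (map vertices us)) + length us \<le> length (concat (map leaves us))" for us
    by (induction us) (auto, fastforce)
  from this[of ts] show ?case using Node by auto
qed simp

lemma reduced_bar_tree:
  assumes "T \<in> bar_trees P n d" "reduced T"
  shows "n = Suc (tree_weight T)" "d < n"
proof -
  note T = bar_treesD[OF assms(1)]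
  have n: "length (leaves T) = n" using distinct_card[OF T(1)] T(2) by simp
  have a: "arity_ge 2 T" using assms(2) by (simp add: reduced_def)
  then show "n = Suc (tree_weight T)" using leaves_weight[OF arity_ge_mono[OF a]] n by simp
  show "d < n" using leaves_vertices[OF a] n distinct_card[OF T(3)] T(4) by simp
qed

lemma bar_basis_empty:
  assumes "n \<le> d"
  shows "bar_basis n d = {}"
proof -
  have "F \<notin> bar_basis n d" for F
  proof
    assume "F \<in> bar_basis n d"
    \<comment> \<open>\<open>bar_basis\<close> does not depend on the ring, so the representing tree
      may be taken with integer labels.\<close>
    then obtain T :: "(nat, int) tree" where "T \<in> bar_trees (commutative_operad :: (int, int) operad) n d" "reduced T"
      using bar_representative[where 'k=int] by blast
    then show False using reduced_bar_tree(2) assms by fastforce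
  qed
  then show ?thesis by blast
qed

lemma bar_exact:
  fixes x :: "_ \<Rightarrow>\<^sub>0 'k::comm_ring_1"
  assumes x: "x \<in> free_on (bar_basis n d)" "bd (- {{1..n}}) x = 0" and n: "n \<noteq> Suc d"
  shows "\<exists>y\<in>free_on (bar_basis n (Suc d)). bd (- {{1..n}}) y = x"
proof (cases "n \<le> d")
  case True
  then have "x = 0" using x(1) bar_basis_empty[OF True] by (auto simp: free_on_def)
  then show ?thesis using lin_zero[OF lin_bd] by (intro bexI[of _ 0]) auto
next
  case False
  have "card (singles {1..n}) = n" by (simp add: singles_def card_image)
  then have "x \<in> free_on {F \<in> nested {1..n} (singles {1..n}). Suc (card F) < card (singles {1..n})}"
    using x(1) False n by (auto simp: bar_basis_def elim!: free_on_mono)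
  then obtain y where y: "y \<in> free_on (nested {1..n} (singles {1..n}))" "bd (- {{1..n}}) y = x"
    using nested_acyclic[OF _ partition_on_singles _ x(2)] by auto
  have "x = restrict {F. card F = d} x" using x(1) by (intro restrict_id[symmetric]) (auto simp: bar_basis_def elim: free_on_mono)
  also have "\<dots> = bd (- {{1..n}}) (restrict {F. card F = Suc d} y)"
    unfolding y(2)[symmetric] using bd_restrict_card[OF nested_free_finite[OF _ y(1)]] by simp
  finally show ?thesis using restrict_bar_basis[OF y(1)] by metis
qed

text \<open>
  Acyclicity below the top degree gives preimages of basis elements, hence linear splittings
  degree by degree; this makes the module of top cycles a direct summand of a free module over any ring.
\<close>

lemma bar_splitting:
  assumes "Suc d < n"
  shows "\<exists>h :: _ \<Rightarrow> (_ \<Rightarrow>\<^sub>0 'k::comm_ring_1). lin h \<and> (\<forall>y\<in>free_on (bar_basis n d). h y \<in> free_on (bar_basis n (Suc d)) \<and>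
    (bd (- {{1..n}}) y = 0 \<longrightarrow> bd (- {{1..n}}) (h y) = y))"
  using assms
proof (induction d)
  case 0
  have "\<exists>w. w \<in> free_on (bar_basis n (Suc 0)) \<and> bd (- {{1..n}}) w = (gen F :: _ \<Rightarrow>\<^sub>0 'k)" if F: "F \<in> bar_basis n 0" for F
    using bar_exact[of "gen F" n 0] presentedD(11)[OF bar_presented, of "gen F" n] F 0 by auto
  then obtain w where w: "\<And>F. F \<in> bar_basis n 0 \<Longrightarrow> w F \<in> free_on (bar_basis n (Suc 0)) \<and> bd (- {{1..n}}) (w F) = (gen F :: _ \<Rightarrow>\<^sub>0 'k)"
    by metis
  have "lin_ext w y \<in> free_on (bar_basis n (Suc 0)) \<and> bd (- {{1..n}}) (lin_ext w y) = y" if y: "y \<in> free_on (bar_basis n 0)" for y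
  proof
    show "lin_ext w y \<in> free_on (bar_basis n (Suc 0))" by (rule lin_ext_mem[OF y subspace_free_on]) (use w in blast)
    show "bd (- {{1..n}}) (lin_ext w y) = y"
      by (rule lin_eq_on_free[OF lin_comp[OF lin_bd lin_lin_ext] lin_id y]) (use w in simp)
  qed
  then show ?case using lin_lin_ext by blast
next
  case (Suc d)
  then obtain h :: "_ \<Rightarrow> (_ \<Rightarrow>\<^sub>0 'k)" where h: "lin h" "\<And>y. y \<in> free_on (bar_basis n d) \<Longrightarrow> h y \<in> free_on (bar_basis n (Suc d))"
    "\<And>y. y \<in> free_on (bar_basis n d) \<Longrightarrow> bd (- {{1..n}}) y = 0 \<Longrightarrow> bd (- {{1..n}}) (h y) = y" by auto
  have bdm: "bd (- {{1..n}}) y \<in> free_on (bar_basis n d)" if "y \<in> free_on (bar_basis n (Suc d))" for y :: "_ \<Rightarrow>\<^sub>0 'k"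
    using bd_bar_basis[OF that] .
  \<comment> \<open>Subtracting \<open>h (bd y)\<close> projects onto the cycles, because h splits
    the boundary one degree lower; exactness is then used only on the images of basis
    elements.\<close>
  let ?z = "\<lambda>y. y - h (bd (- {{1..n}}) y)"
  have z: "?z y \<in> free_on (bar_basis n (Suc d))" "bd (- {{1..n}}) (?z y) = 0" if y: "y \<in> free_on (bar_basis n (Suc d))" for y
    using diff_free_on[OF y h(2)[OF bdm[OF y]]] h(3)[OF bdm[OF y]] by (simp_all add: lin_diff[OF lin_bd])
  have "\<exists>w. w \<in> free_on (bar_basis n (Suc (Suc d))) \<and> bd (- {{1..n}}) w = ?z (gen F)" if F: "F \<in> bar_basis n (Suc d)" for F
    using bar_exact[OF z] F Suc.prems by (metis gen_mem_free_on nat_neq_iff)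
  then obtain w where w: "\<And>F. F \<in> bar_basis n (Suc d) \<Longrightarrow> w F \<in> free_on (bar_basis n (Suc (Suc d))) \<and> bd (- {{1..n}}) (w F) = ?z (gen F)"
    by metis
  have lz: "lin ?z" by (intro lin_minus lin_id lin_comp[OF h(1) lin_bd])
  have "lin_ext w y \<in> free_on (bar_basis n (Suc (Suc d))) \<and> bd (- {{1..n}}) (lin_ext w y) = ?z y" if y: "y \<in> free_on (bar_basis n (Suc d))" for y
  proof
    show "lin_ext w y \<in> free_on (bar_basis n (Suc (Suc d)))" by (rule lin_ext_mem[OF y subspace_free_on]) (use w in blast)
    show "bd (- {{1..n}}) (lin_ext w y) = ?z y"
      by (rule lin_eq_on_free[OF lin_comp[OF lin_bd lin_lin_ext] lz y]) (use w in simp)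
  qed
  then show ?case using lin_lin_ext[of w] lin_zero[OF h(1)] by (intro exI[of _ "lin_ext w"]) auto
qed

text \<open>In positive degree the retraction is \<open>y - h (bd y)\<close> with h the splitting
  one degree lower; in degree 0 all elements are cycles and the identity serves.\<close>

lemma bar_retraction:
  "\<exists>r :: _ \<Rightarrow> (_ \<Rightarrow>\<^sub>0 'k::comm_ring_1). lin r \<and> (\<forall>y\<in>free_on (bar_basis (Suc s) s). r y \<in> free_on (bar_basis (Suc s) s) \<and>
    bd (- {{1..Suc s}}) (r y) = 0 \<and> (bd (- {{1..Suc s}}) y = 0 \<longrightarrow> r y = y))"
proof (cases s)
  case 0
  have "bd (- {{1..Suc s}}) y = 0" if "y \<in> free_on (bar_basis (Suc s) s)" for y :: "_ \<Rightarrow>\<^sub>0 'k"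
    using presentedD(11)[OF bar_presented, of y "Suc s"] that unfolding 0 by blast
  then show ?thesis by (intro exI[of _ "\<lambda>x. x"] conjI ballI lin_id) simp_all
next
  case (Suc d)
  obtain h :: "_ \<Rightarrow> (_ \<Rightarrow>\<^sub>0 'k)" where h: "lin h" "\<And>y. y \<in> free_on (bar_basis (Suc s) d) \<Longrightarrow> h y \<in> free_on (bar_basis (Suc s) (Suc d))"
    "\<And>y. y \<in> free_on (bar_basis (Suc s) d) \<Longrightarrow> bd (- {{1..Suc s}}) y = 0 \<Longrightarrow> bd (- {{1..Suc s}}) (h y) = y"
    using bar_splitting[of d "Suc s"] Suc by auto
  have "y - h (bd (- {{1..Suc s}}) y) \<in> free_on (bar_basis (Suc s) s) \<and> bd (- {{1..Suc s}}) (y - h (bd (- {{1..Suc s}}) y)) = 0"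
    if y: "y \<in> free_on (bar_basis (Suc s) s)" for y
  proof -
    have y': "y \<in> free_on (bar_basis (Suc s) (Suc d))" using y Suc by simp
    note b = bd_bar_basis[OF y']
    show ?thesis using diff_free_on[OF y' h(2)[OF b]] h(3)[OF b bd_bd] Suc by (simp add: lin_diff[OF lin_bd])
  qed
  moreover have "lin (\<lambda>y. y - h (bd (- {{1..Suc s}}) y))" by (intro lin_minus lin_id lin_comp[OF h(1) lin_bd])
  ultimately show ?thesis using lin_zero[OF h(1)] by (intro exI[of _ "\<lambda>y. y - h (bd (- {{1..Suc s}}) y)"]) auto
qed

context
  fixes P :: "('k, 'k::comm_ring_1) operad"
  defines "P \<equiv> commutative_operad"
begin

lemmas bar = bar_presented[where 'k='k, folded P_def]

text \<open>The representatives of nested sets are reduced trees, whose weight n - 1 is the s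
  required.\<close>

lemma bar_lift_reduced:
  assumes y: "y \<in> free_on (bar_basis n s)" and n: "n = Suc s"
  shows "\<exists>x\<in>fspan (gen ` {T \<in> bar_trees P n s. tree_weight T = s}). lin_ext (bar_class s) x = y"
proof -
  let ?W = "{T \<in> bar_trees P n s. tree_weight T = s}"
  have "\<exists>x. x \<in> fspan (gen ` ?W) \<and> lin_ext (bar_class s) x = (gen F :: _ \<Rightarrow>\<^sub>0 'k)" if F: "F \<in> bar_basis n s" for F
  proof -
    obtain T where T: "T \<in> bar_trees P n s" "reduced T" "ones T" "snd ` vcs T = F"
      using bar_representative[OF F, where 'k='k] unfolding P_def by blast
    let ?x = "fscale (orient s (vcs T)) (gen T) :: _ \<Rightarrow>\<^sub>0 'k"
    have "T \<in> ?W" using reduced_bar_tree[OF T(1,2)] T(1) n by simp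
    then have "?x \<in> fspan (gen ` ?W)" by (intro fs.span_scale fs.span_base imageI)
    moreover have "lin_ext (bar_class s) ?x = gen F"
      using orient_square[OF T(2) bar_treesD(3,4)[OF T(1)], where 'k='k] coef_ones[OF T(3)] T(4)
      by (simp add: lin_scale[OF lin_lin_ext] bar_class_def)
    ultimately show ?thesis by blast
  qed
  then have "\<exists>w. \<forall>F\<in>bar_basis n s. w F \<in> fspan (gen ` ?W) \<and> lin_ext (bar_class s) (w F) = (gen F :: _ \<Rightarrow>\<^sub>0 'k)"
    by (intro bchoice ballI)
  then obtain w where w: "\<forall>F\<in>bar_basis n s. w F \<in> fspan (gen ` ?W) \<and> lin_ext (bar_class s) (w F) = (gen F :: _ \<Rightarrow>\<^sub>0 'k)" ..
  have "lin_ext w y \<in> fspan (gen ` ?W)" by (rule lin_ext_mem[OF y fs.subspace_span]) (use w in blast)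
  moreover have "lin_ext (bar_class s) (lin_ext w y) = y"
    by (rule lin_eq_on_free[OF lin_comp[OF lin_lin_ext lin_lin_ext] lin_id y]) (use w in simp)
  ultimately show ?thesis by blast
qed

lemma zeros_cycles: "zeros (bar_complex P n) s \<subseteq> cycles (bar_complex P n) s"
proof
  fix z assume z: "z \<in> zeros (bar_complex P n) s"
  then have c: "z \<in> chains (bar_complex P n) s" using presentedD(3)[OF bar] by blast
  then have "lin_ext (bar_class s) z = 0" using presentedD(7)[OF bar c] z by blast
  then show "z \<in> cycles (bar_complex P n) s" unfolding presented_cycles[OF bar] using c lin_zero[OF lin_bd] by simp
qed

text \<open>A reduced tree with n inputs has weight n - 1, and trees with a vertex of low arity are
  zero in the quotient. The weight condition thus holds for all relevant trees or for none.\<close>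

lemma koszul_chains:
  "chains (koszul_complex P n) s = (if n = Suc s then cycles (bar_complex P n) s else zeros (bar_complex P n) s)"
proof -
  let ?B = "bar_complex P n" and ?W = "{T \<in> bar_trees P n s. tree_weight T = s}"
  have K: "chains (koszul_complex P n) s = {x + z | x z. x \<in> fspan (gen ` ?W) \<and> x \<in> cycles ?B s \<and> z \<in> zeros ?B s}"
    by (simp add: koszul_complex_def)
  note zs = presentedD(2)[OF bar, of n s]
  have cs: "fs.subspace (cycles ?B s)" by (rule subspace_cycles[OF presented_linear_complex[OF bar]])
  show ?thesis
  proof (cases "n = Suc s")
    case True
    have "x \<in> chains (koszul_complex P n) s" if x: "x \<in> cycles ?B s" for x
    proof -
      have xc: "x \<in> chains ?B s" "bd (- {{1..n}}) (lin_ext (bar_class s) x) = 0"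
        using x unfolding presented_cycles[OF bar] by blast+
      obtain u where u: "u \<in> fspan (gen ` ?W)" "lin_ext (bar_class s) u = lin_ext (bar_class s) x"
        using bar_lift_reduced[OF presentedD(6)[OF bar xc(1)] True] by blast
      have uc: "u \<in> chains ?B s" using u(1) fs.span_mono[of "gen ` ?W" "gen ` bar_trees P n s"] by (auto simp: bar_complex_def)
      then have "u \<in> cycles ?B s" unfolding presented_cycles[OF bar] using u(2) xc(2) by simp
      moreover have "x - u \<in> chains ?B s" by (intro fs.subspace_diff[OF presentedD(1)[OF bar]] xc(1) uc)
      then have "x - u \<in> zeros ?B s" using presentedD(7)[OF bar, of "x - u"] u(2) lin_diff[OF lin_lin_ext] by (metis right_minus_eq)
      moreover have "x = u + (x - u)" by simp
      ultimately show ?thesis unfolding K using u(1) by blast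
    qed
    moreover have "x \<in> cycles ?B s" if "x \<in> chains (koszul_complex P n) s" for x
      using that fs.subspace_add[OF cs] zeros_cycles unfolding K by blast
    ultimately show ?thesis using True by auto
  next
    case False
    have "x \<in> zeros ?B s" if x: "x \<in> fspan (gen ` ?W)" for x
    proof -
      have xc: "x \<in> chains ?B s" using x fs.span_mono[of "gen ` ?W" "gen ` bar_trees P n s"] by (auto simp: bar_complex_def)
      have xW: "x \<in> free_on ?W" using x span_gen by blast
      have "lin_ext (bar_class s) x = 0"
      proof (rule lin_eq_on_free[OF lin_lin_ext lin_0 xW])
        fix T assume T: "T \<in> ?W"
        then have "\<not> reduced T" using reduced_bar_tree(1)[of T P n s] False by auto
        then have "coef T = 0" using coef_zero_or_reduced[of T n s] T unfolding P_def by blast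
        then show "lin_ext (bar_class s) (gen T) = (0 :: _ \<Rightarrow>\<^sub>0 'k)" by (simp add: bar_class_def)
      qed
      then show ?thesis using presentedD(7)[OF bar xc] by blast
    qed
    then have "chains (koszul_complex P n) s \<subseteq> zeros ?B s" unfolding K using fs.subspace_add[OF zs] by blast
    moreover have "z \<in> chains (koszul_complex P n) s" if z: "z \<in> zeros ?B s" for z
    proof -
      have "z = 0 + z" "0 \<in> fspan (gen ` ?W)" "0 \<in> cycles ?B s" by (simp_all add: fs.span_zero fs.subspace_0[OF cs])
      then show ?thesis unfolding K using z by blast
    qed
    ultimately show ?thesis using False by auto
  qed
qed

lemma koszul_simps [simp]:
  "zeros (koszul_complex P n) = zeros (bar_complex P n)" "bdry (koszul_complex P n) = bdry (bar_complex P n)"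
  by (simp_all add: koszul_complex_def)

lemma koszul_chains_cycles: "chains (koszul_complex P n) s \<subseteq> cycles (bar_complex P n) s"
  and zeros_koszul_chains: "zeros (bar_complex P n) s \<subseteq> chains (koszul_complex P n) s"
  unfolding koszul_chains using zeros_cycles by auto

lemma koszul_bdry:
  assumes "x \<in> chains (koszul_complex P n) (Suc s)"
  shows "bdry (bar_complex P n) s x \<in> zeros (bar_complex P n) s"
  using assms koszul_chains_cycles[of n "Suc s"] by auto

text \<open>The differential of the Koszul complex is zero modulo the relations. In degree n - 1
  there are no nonzero boundaries, as no nested set has n members; in every other degree the bar
  complex is exact and the Koszul complex is zero.\<close>

lemma koszul_iso:
  "linear_map (koszul_complex P n) (bar_complex P n) koszul_inclusion \<and>
   homology_iso (koszul_complex P n) (bar_complex P n) koszul_inclusion"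
proof
  let ?B = "bar_complex P n" and ?K = "koszul_complex P n"
  note B = presented_linear_complex[OF bar]
  note BD = linear_complexD[OF B]
  have sub: "fs.subspace (chains ?K d)" for d
    unfolding koszul_chains using subspace_cycles[OF B] BD(2) by simp
  have "chain_complex ?K"
    unfolding chain_complex_def koszul_simps
    using sub BD(2) zeros_koszul_chains lin_linear_on[OF BD(4)] koszul_bdry BD(6)
    by (intro allI conjI) blast+
  then have "linear_complex ?K" unfolding linear_complex_def using BD(4) by simp
  moreover have "chains ?K d \<subseteq> chains ?B d" for d using koszul_chains_cycles cycles_subset by blast
  then have "chain_map ?K ?B koszul_inclusion"
    unfolding chain_map_def koszul_simps using fs.subspace_0[OF BD(2)] lin_linear_on[OF lin_id] by auto
  ultimately show "linear_map ?K ?B koszul_inclusion" unfolding linear_map_def using B lin_id by blast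
  show "homology_iso ?K ?B koszul_inclusion"
    unfolding homology_iso_def
  proof (intro allI conjI ballI impI)
    fix d x assume x: "x \<in> cycles ?K d" "x \<in> boundaries ?B d"
    have xK: "x \<in> chains ?K d" using x(1) cycles_subset by blast
    have "x \<in> zeros ?B d"
    proof (cases "n = Suc d")
      case True
      have c: "x \<in> chains ?B d" using xK koszul_chains_cycles cycles_subset by blast
      then obtain y where y: "y \<in> free_on (bar_basis n (Suc d))" "lin_ext (bar_class d) x = bd (- {{1..n}}) y"
        using x(2) presented_boundaries[OF bar c] by blast
      have "y = 0" using y(1) bar_basis_empty[of n "Suc d"] True by (auto simp: free_on_def)
      then have "lin_ext (bar_class d) x = 0" using y(2) lin_zero[OF lin_bd] by simp
      then show ?thesis using presentedD(7)[OF bar c] by blast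
    qed (use xK koszul_chains in simp)
    moreover have "x = bdry ?K d 0 + x" using lin_zero[OF BD(4)] by simp
    ultimately show "x \<in> boundaries ?K d" unfolding boundaries_def koszul_simps using fs.subspace_0[OF sub] by blast
  next
    fix d y assume y: "y \<in> cycles ?B d"
    have Kc: "cycles ?K d = chains ?K d" using koszul_bdry by (cases d) auto
    show "\<exists>x\<in>cycles ?K d. y - x \<in> boundaries ?B d"
    proof (cases "n = Suc d")
      case True
      then show ?thesis unfolding Kc koszul_chains using y fs.subspace_0[OF subspace_boundaries[OF B]] by (intro bexI[of _ y]) simp_all
    next
      case False
      have yc: "y \<in> chains ?B d" "bd (- {{1..n}}) (lin_ext (bar_class d) y) = 0" using y unfolding presented_cycles[OF bar] by blast+
      obtain u where "u \<in> free_on (bar_basis n (Suc d))" "bd (- {{1..n}}) u = lin_ext (bar_class d) y"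
        using bar_exact[OF presentedD(6)[OF bar yc(1)] yc(2) False] by blast
      then have "y \<in> boundaries ?B d" unfolding presented_boundaries[OF bar yc(1)] by metis
      then show ?thesis unfolding Kc using fs.subspace_0[OF sub] by (intro bexI[of _ 0]) simp_all
    qed
  qed
qed

text \<open>The top cycles are a retract of the free module on the nested sets. As
  \<open>projective_quotient\<close> wants a free module indexed by chains, a nested set F is
  represented by the basis element of its lift \<open>\<sigma> F\<close>.\<close>

lemma koszul_projective: "projective_quotient fscale (chains (koszul_complex P n) s) (zeros (koszul_complex P n) s)"
proof (cases "n = Suc s")
  case False
  have z: "fs.subspace (zeros (bar_complex P n) s)" by (rule presentedD(2)[OF bar])
  show ?thesis
    unfolding projective_quotient_def koszul_simps koszul_chains using False fs.subspace_0[OF z] fs.subspace_neg[OF z]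
    by (intro exI[of _ "\<lambda>x. 0"] conjI lin_linear_on[OF lin_0]) simp_all
next
  case n: True
  let ?B = "bar_complex P n" and ?\<Phi> = "lin_ext (bar_class s) :: ((nat, 'k) tree \<Rightarrow>\<^sub>0 'k) \<Rightarrow> _" and ?S = "bar_basis n s"
  obtain \<sigma> where \<sigma>: "\<forall>F\<in>?S. \<sigma> F \<in> chains ?B s \<and> ?\<Phi> (\<sigma> F) = gen F" using presented_section[OF bar] by blast
  note lift = presented_lift_section[OF bar \<sigma>]
  obtain r :: "_ \<Rightarrow> (_ \<Rightarrow>\<^sub>0 'k)" where r: "lin r" "\<And>y. y \<in> free_on ?S \<Longrightarrow> r y \<in> free_on ?S"
    "\<And>y. y \<in> free_on ?S \<Longrightarrow> bd (- {{1..n}}) (r y) = 0" "\<And>y. y \<in> free_on ?S \<Longrightarrow> bd (- {{1..n}}) y = 0 \<Longrightarrow> r y = y"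
    using bar_retraction[of s, where 'k='k] unfolding n[symmetric] by blast
  define i where "i = (\<lambda>x. lin_ext (\<lambda>F. gen (\<sigma> F)) (?\<Phi> x) :: _ \<Rightarrow>\<^sub>0 'k)"
  \<comment> \<open>The restriction gives q a value in the cycles also on basis elements that are
    not lifts.\<close>
  define q where "q = (\<lambda>y. lin_ext \<sigma> (r (restrict ?S (?\<Phi> y))))"
  have restrict: "restrict ?S y \<in> free_on ?S" for y :: "_ \<Rightarrow>\<^sub>0 'k"
    using restrict_free_on[of y UNIV ?S] by (simp add: free_on_def)
  have q: "q y \<in> cycles ?B s" for y
    unfolding q_def presented_cycles[OF bar] using lift[OF r(2)[OF restrict]] r(3)[OF restrict] by simp
  have pi: "lin_ext q (i x) - x \<in> zeros ?B s" if x: "x \<in> cycles ?B s" for x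
  proof -
    have xc: "x \<in> chains ?B s" "bd (- {{1..n}}) (?\<Phi> x) = 0" using x unfolding presented_cycles[OF bar] by blast+
    note \<Phi>x = presentedD(6)[OF bar xc(1)]
    have "lin_ext q (i x) = lin_ext \<sigma> (r (?\<Phi> x))"
      unfolding i_def
    proof (rule lin_eq_on_free[where f="\<lambda>y. lin_ext q (lin_ext (\<lambda>F. gen (\<sigma> F)) y)" and g="\<lambda>y. lin_ext \<sigma> (r y)",
          OF lin_comp[OF lin_lin_ext lin_lin_ext] lin_comp[OF lin_lin_ext r(1)] \<Phi>x])
      fix F assume F: "F \<in> ?S"
      then have "restrict ?S (?\<Phi> (\<sigma> F)) = gen F" using \<sigma> by (simp add: restrict_gen)
      then show "lin_ext q (lin_ext (\<lambda>F. gen (\<sigma> F)) (gen F)) = lin_ext \<sigma> (r (gen F))" by (simp add: q_def)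
    qed
    then have e: "lin_ext q (i x) = lin_ext \<sigma> (?\<Phi> x)" using r(4)[OF \<Phi>x xc(2)] by simp
    have "lin_ext \<sigma> (?\<Phi> x) - x \<in> chains ?B s" by (intro fs.subspace_diff[OF presentedD(1)[OF bar]] lift(1) \<Phi>x xc(1))
    moreover have "?\<Phi> (lin_ext \<sigma> (?\<Phi> x) - x) = 0" using lift(2)[OF \<Phi>x] lin_diff[OF lin_lin_ext] by (metis right_minus_eq)
    ultimately show ?thesis unfolding e using presentedD(7)[OF bar] by blast
  qed
  have zero: "i x = 0" if x: "x \<in> zeros ?B s" for x
  proof -
    have "x \<in> chains ?B s" using x presentedD(3)[OF bar] by blast
    then have "?\<Phi> x = 0" using presentedD(7)[OF bar] x by blast
    then show ?thesis unfolding i_def by (simp add: lin_zero[OF lin_lin_ext])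
  qed
  have mem: "lin_ext q y \<in> cycles ?B s" for y
    by (rule lin_ext_mem[of y UNIV, OF _ subspace_cycles[OF presented_linear_complex[OF bar]] q]) (simp add: free_on_def)
  have "lin i" unfolding i_def by (rule lin_comp[OF lin_lin_ext lin_lin_ext])
  then show ?thesis
    unfolding projective_quotient_def koszul_simps koszul_chains if_P[OF n]
    using pi zero mem by (intro exI[of _ i] exI[of _ "lin_ext q"] conjI lin_linear_on lin_lin_ext ballI allI) blast+
qed

lemma fscale_single: "fscale c (Poly_Mapping.single b a) = Poly_Mapping.single b (c * a)"
  by (rule poly_mapping_eqI) (simp add: lookup_fscale lookup_single when_def)

text \<open>In positive arity the module is the ring itself, a retract of the free module through
  the basis element indexed by 1.\<close>

lemma ops_projective: "projective_quotient (smul P) (ops P r) {0}"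
proof (cases "r = 0")
  case True
  then show ?thesis
    unfolding projective_quotient_def
    by (intro exI[of _ "\<lambda>x. 0"]) (simp add: P_def linear_on_def)
next
  case False
  show ?thesis
    unfolding projective_quotient_def
    by (intro exI[of _ "Poly_Mapping.single 1"] exI[of _ "\<lambda>y. Poly_Mapping.lookup y 1"])
      (use False in \<open>simp add: P_def linear_on_def single_add lookup_add lookup_fscale fscale_single\<close>)
qed

end

theorem theorem6p8:
  "koszul (commutative_operad :: ('k, 'k::comm_ring_1) operad) \<and>
   (\<forall>n.
      quasi_iso (koszul_complex (commutative_operad :: ('k, 'k) operad) n)
        (bar_complex commutative_operad n) koszul_inclusion \<and>
      quasi_iso (bar_complex (commutative_operad :: ('k, 'k) operad) n)
        (normalized_bar_complex commutative_operad n) (levelization commutative_operad) \<and>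
      quasi_iso (koszul_complex (commutative_operad :: ('k, 'k) operad) n)
        (normalized_bar_complex commutative_operad n)
        (\<lambda>d x. levelization commutative_operad d (koszul_inclusion d x)))"
proof (intro conjI allI)
  let ?P = "commutative_operad :: ('k, 'k) operad"
  fix n
  note K = koszul_iso[where 'k='k and n=n] and L = levelization_iso[where 'k='k and n=n]
  show q: "quasi_iso (koszul_complex ?P n) (bar_complex ?P n) koszul_inclusion" for n
    by (rule quasi_isoI) (use koszul_iso[where 'k='k and n=n] in blast)+
  show "quasi_iso (bar_complex ?P n) (normalized_bar_complex ?P n) (levelization ?P)"
    by (rule quasi_isoI) (use L in blast)+
  show "quasi_iso (koszul_complex ?P n) (normalized_bar_complex ?P n) (\<lambda>d x. levelization ?P d (koszul_inclusion d x))"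
    using linear_map_comp homology_iso_comp K L by (intro quasi_isoI) blast+
  show "koszul ?P"
    unfolding koszul_def using connected_commutative_operad q koszul_projective ops_projective by blast
qed

end
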